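(* Let $\Delta\subset\mathbb R$ be an interval with right endpoint $\beta\in\mathbb R\cup\{\infty\}$ and let $T$ be an operator function on $\Delta$ satisfying (A1)–(A3), continuous in the norm resolvent sense on $\Delta$, with $T(\lambda)$ bounded from below for each $\lambda\in\Delta$. Let $p$ be a generalised Rayleigh functional for $T$ on $\Delta$, let $\gamma\in\rho(T)\cap\Delta$ with $\gamma<\beta$, and let $\lambda_e:=\inf(\sigma_{ess}(T)\cap(\gamma,\beta))$ if this set is nonempty, $\lambda_e:=\beta$ otherwise. Assume $\sigma(T)\cap[\gamma,\lambda_e)$ has no accumulation point in $[\gamma,\lambda_e)$, i.e. it is empty or consists of a finite or infinite non-decreasing sequence of eigenvalues $(\lambda_n)_{n=1}^N$, $N\in\mathbb N\cup\{\infty\}$, counted with multiplicities ($\dim\ker T(\lambda)$), accumulating at most at $\lambda_e$. If $\sigma(T)\cap(\gamma,\lambda_e)\ne\varnothing$, then $$\lambda_n=\sup_{\mathcal M\in\mathbb M^+_\gamma}\ \sup_{\substack{\mathcal L\subset\mathcal M\\ \dim\mathcal L=n-1}}\ \inf_{\substack{x\in\mathcal M\setminus\{0\}\\ x\perp\mathcal L}}p(x),\qquad n\in\mathbb N,\ n\le N.$$ Moreover, if in addition $T$ satisfies (VM), $N$ is finite and $\sigma_{ess}(T)\cap(\gamma,\beta)\ne\varnothing$, then for every $n>N$ the same triple variation equals $\lambda_e$.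
   Context: "Subspace" means linear manifold, not necessarily closed. For a self-adjoint operator $A$ with spectral measure $E$, its form is $\mathfrak a[x,y]=\int\mu\,d\langle E(\mu)x,y\rangle$ on $\mathrm{dom}(|A|^{1/2})$, $\mathfrak a[x]:=\mathfrak a[x,x]$. A subspace $\mathcal L\subset\mathrm{dom}\,\mathfrak a$ is $\mathfrak a$-non-negative if $\mathfrak a[x]\ge0$ on $\mathcal L$; maximal if not properly contained in another such subspace of $\mathrm{dom}\,\mathfrak a$. For an operator function $T$: $\sigma(T)=\{\lambda:0\in\sigma(T(\lambda))\}$, $\rho(T)=\{\lambda:0\in\rho(T(\lambda))\}$, $\sigma_{ess}(T)=\{\lambda: T(\lambda)\text{ not Fredholm}\}$. (A1) $T(\lambda)$ self-adjoint for $\lambda\in\Delta$, with form $\mathfrak t(\lambda)$; (A2) $\mathrm{dom}\,\mathfrak t(\lambda)=:\mathcal D$ independent of $\lambda$; (A3) for each $x\in\mathcal D\setminus\{0\}$, $\lambda\mapsto\mathfrak t(\lambda)[x]$ is continuous, and if $\mathfrak t(\lambda_0)[x]=0$ then $\mathfrak t(\lambda)[x]>0$ for $\lambda<\lambda_0$ and $<0$ for $\lambda>\lambda_0$ ($\lambda\in\Delta$). (VM): for every $u\in\mathcal D$, $\mathfrak t(\cdot)[u]$ is differentiable on $\Delta$, and for every compact subinterval $I\subset\Delta$ there are $\varepsilon,\delta>0$ with: $x\in\mathcal D$, $\|x\|=1$, $\lambda\in I$, $|\mathfrak t(\lambda)[x]|\le\varepsilon$ imply $\mathfrak t'(\lambda)[x]\le-\delta$.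 A generalised Rayleigh functional for $T$ on $\Delta$ is a map $p:\mathcal D\setminus\{0\}\to\mathbb R\cup\{\pm\infty\}$ such that for every $x\in\mathcal D\setminus\{0\}$: $p(x)=\lambda_0$ if $\mathfrak t(\lambda_0)[x]=0$; $p(x)<\lambda$ for all $\lambda\in\Delta$ if $\mathfrak t(\mu)[x]<0$ for all $\mu\in\Delta$; $p(x)>\lambda$ for all $\lambda\in\Delta$ if $\mathfrak t(\mu)[x]>0$ for all $\mu\in\Delta$. $\mathbb M^+_\gamma$ is the set of maximal $\mathfrak t(\gamma)$-non-negative subspaces of $\mathcal D$. *)

theory Defs
  imports "HOL-Analysis.Analysis"
begin

text \<open>
Setting. A complex Hilbert space is modelled as a real Hilbert space 'h
(class real_inner + complete_space) together with a complex structure J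
(multiplication by the imaginary unit): J is real-linear, J (J x) = - x and
J is orthogonal. The real inner product is the real part of the complex one;
complex subspaces are the J-invariant real subspaces; the complex dimension
is half the real dimension.
A (possibly unbounded) linear operator is a pair (domain, map).
\<close>

type_synonym 'h lop = "'h set \<times> ('h \<Rightarrow> 'h)"

definition cplx_struct :: "('h::real_inner \<Rightarrow> 'h) \<Rightarrow> bool" where
  "cplx_struct J \<longleftrightarrow> linear J \<and> (\<forall>x. J (J x) = - x) \<and> (\<forall>x y. J x \<bullet> J y = x \<bullet> y)"

definition csubspace :: "('h::real_vector \<Rightarrow> 'h) \<Rightarrow> 'h set \<Rightarrow> bool" where
  "csubspace J S \<longleftrightarrow> subspace S \<and> (\<forall>x\<in>S. J x \<in> S)"

definition fin_dim :: "'h::real_vector set \<Rightarrow> bool" where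
  "fin_dim S \<longleftrightarrow> (\<exists>B. finite B \<and> S \<subseteq> span B)"

definition cdim :: "'h::real_vector set \<Rightarrow> enat" where
  "cdim S = (if fin_dim S then enat (dim S div 2) else \<infinity>)"

definition ker :: "'h::real_vector lop \<Rightarrow> 'h set" where
  "ker A = {x \<in> fst A. snd A x = 0}"

definition ran :: "'h lop \<Rightarrow> 'h set" where
  "ran A = snd A ` fst A"

definition self_adjoint :: "('h::{real_inner,complete_space} \<Rightarrow> 'h) \<Rightarrow> 'h lop \<Rightarrow> bool" where
  "self_adjoint J A \<longleftrightarrow>
     csubspace J (fst A) \<and> closure (fst A) = UNIV \<and>
     (\<forall>x\<in>fst A. \<forall>y\<in>fst A. \<forall>c::real.
         snd A (x + y) = snd A x + snd A y \<and> snd A (c *\<^sub>R x) = c *\<^sub>R snd A x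
         \<and> snd A (J x) = J (snd A x)) \<and>
     (\<forall>y. y \<in> fst A \<longleftrightarrow> (\<exists>z. \<forall>x\<in>fst A. snd A x \<bullet> y = x \<bullet> z)) \<and>
     (\<forall>x\<in>fst A. \<forall>y\<in>fst A. snd A x \<bullet> y = x \<bullet> snd A y)"

definition bounded_below :: "'h::real_inner lop \<Rightarrow> bool" where
  "bounded_below A \<longleftrightarrow> (\<exists>c. \<forall>x\<in>fst A. snd A x \<bullet> x \<ge> c * (norm x)\<^sup>2)"

definition in_rho :: "'h::real_normed_vector lop \<Rightarrow> bool" where
  "in_rho A \<longleftrightarrow> (\<forall>y. \<exists>!x. x \<in> fst A \<and> snd A x = y) \<and>
                (\<exists>K. \<forall>x\<in>fst A. norm x \<le> K * norm (snd A x))"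

definition fredholm :: "'h::real_inner lop \<Rightarrow> bool" where
  "fredholm A \<longleftrightarrow> fin_dim (ker A) \<and> closed (ran A) \<and>
                   fin_dim {y. \<forall>z\<in>ran A. z \<bullet> y = 0}"

definition spec :: "real set \<Rightarrow> (real \<Rightarrow> 'h::real_normed_vector lop) \<Rightarrow> real set" where
  "spec \<Delta> T = {l\<in>\<Delta>. \<not> in_rho (T l)}"

definition spec_ess :: "real set \<Rightarrow> (real \<Rightarrow> 'h::real_inner lop) \<Rightarrow> real set" where
  "spec_ess \<Delta> T = {l\<in>\<Delta>. \<not> fredholm (T l)}"

text \<open>Resolvent (A - i)^{-1} at the non-real point i (i acts as J).\<close>
definition res_i :: "('h::real_vector \<Rightarrow> 'h) \<Rightarrow> 'h lop \<Rightarrow> 'h \<Rightarrow> 'h" where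
  "res_i J A y = (THE x. x \<in> fst A \<and> snd A x - J x = y)"

definition norm_resolvent_continuous_on ::
    "('h::{real_inner,complete_space} \<Rightarrow> 'h) \<Rightarrow> real set \<Rightarrow> (real \<Rightarrow> 'h lop) \<Rightarrow> bool" where
  "norm_resolvent_continuous_on J \<Delta> T \<longleftrightarrow>
     (\<forall>l0\<in>\<Delta>. ((\<lambda>l. onorm (\<lambda>y. res_i J (T l) y - res_i J (T l0) y)) \<longlongrightarrow> 0) (at l0 within \<Delta>))"

text \<open>Closed quadratic form of a semibounded self-adjoint operator: its domain
  (= dom |A|^(1/2)) is the completion of dom A w.r.t. the form norm.\<close>
definition form_seq :: "'h::real_inner lop \<Rightarrow> 'h \<Rightarrow> (nat \<Rightarrow> 'h) \<Rightarrow> bool" where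
  "form_seq A x s \<longleftrightarrow> (\<forall>n. s n \<in> fst A) \<and> s \<longlonglongrightarrow> x \<and>
     (\<forall>e>0. \<exists>M. \<forall>m\<ge>M. \<forall>n\<ge>M. \<bar>snd A (s m - s n) \<bullet> (s m - s n)\<bar> < e)"

definition form_dom :: "'h::real_inner lop \<Rightarrow> 'h set" where
  "form_dom A = {x. \<exists>s. form_seq A x s}"

definition form_val :: "'h::real_inner lop \<Rightarrow> 'h \<Rightarrow> real" where
  "form_val A x = (THE a. \<forall>s. form_seq A x s \<longrightarrow> (\<lambda>n. snd A (s n) \<bullet> s n) \<longlonglongrightarrow> a)"

definition gen_rayleigh ::
    "real set \<Rightarrow> (real \<Rightarrow> 'h::real_inner lop) \<Rightarrow> 'h set \<Rightarrow> ('h \<Rightarrow> ereal) \<Rightarrow> bool" where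
  "gen_rayleigh \<Delta> T D p \<longleftrightarrow>
     (\<forall>x\<in>D - {0}.
        (\<forall>l0\<in>\<Delta>. form_val (T l0) x = 0 \<longrightarrow> p x = ereal l0) \<and>
        ((\<forall>\<mu>\<in>\<Delta>. form_val (T \<mu>) x < 0) \<longrightarrow> (\<forall>l\<in>\<Delta>. p x < ereal l)) \<and>
        ((\<forall>\<mu>\<in>\<Delta>. form_val (T \<mu>) x > 0) \<longrightarrow> (\<forall>l\<in>\<Delta>. p x > ereal l)))"

definition nonneg_sub :: "('h::real_inner \<Rightarrow> 'h) \<Rightarrow> 'h lop \<Rightarrow> 'h set \<Rightarrow> 'h set \<Rightarrow> bool" where
  "nonneg_sub J A D L \<longleftrightarrow> csubspace J L \<and> L \<subseteq> D \<and> (\<forall>x\<in>L. form_val A x \<ge> 0)"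

definition Mplus :: "('h::real_inner \<Rightarrow> 'h) \<Rightarrow> 'h lop \<Rightarrow> 'h set \<Rightarrow> 'h set set" where
  "Mplus J A D = {M. nonneg_sub J A D M \<and> (\<forall>M'. nonneg_sub J A D M' \<and> M \<subseteq> M' \<longrightarrow> M' = M)}"

definition triple_var ::
    "('h::real_inner \<Rightarrow> 'h) \<Rightarrow> 'h lop \<Rightarrow> 'h set \<Rightarrow> ('h \<Rightarrow> ereal) \<Rightarrow> nat \<Rightarrow> ereal" where
  "triple_var J A D p n =
     (SUP M\<in>Mplus J A D.
        SUP L\<in>{L. csubspace J L \<and> L \<subseteq> M \<and> cdim L = enat (n - 1)}.
          INF x\<in>{x\<in>M. x \<noteq> 0 \<and> (\<forall>y\<in>L. x \<bullet> y = 0)}. p x)"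

definition cond_A :: "('h::{real_inner,complete_space} \<Rightarrow> 'h) \<Rightarrow> real set \<Rightarrow> (real \<Rightarrow> 'h lop) \<Rightarrow> 'h set \<Rightarrow> bool" where
  "cond_A J \<Delta> T D \<longleftrightarrow>
     (\<forall>l\<in>\<Delta>. self_adjoint J (T l)) \<and>
     (\<forall>l\<in>\<Delta>. form_dom (T l) = D) \<and>
     (\<forall>x\<in>D - {0}. continuous_on \<Delta> (\<lambda>l. form_val (T l) x) \<and>
        (\<forall>l0\<in>\<Delta>. form_val (T l0) x = 0 \<longrightarrow>
           (\<forall>l\<in>\<Delta>. l < l0 \<longrightarrow> form_val (T l) x > 0) \<and>
           (\<forall>l\<in>\<Delta>. l > l0 \<longrightarrow> form_val (T l) x < 0)))"

definition cond_VM :: "real set \<Rightarrow> (real \<Rightarrow> 'h::real_inner lop) \<Rightarrow> 'h set \<Rightarrow> bool" where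
  "cond_VM \<Delta> T D \<longleftrightarrow>
     (\<forall>u\<in>D. \<forall>l\<in>\<Delta>. (\<lambda>\<mu>. form_val (T \<mu>) u) differentiable (at l within \<Delta>)) \<and>
     (\<forall>a b. a \<le> b \<and> {a..b} \<subseteq> \<Delta> \<longrightarrow>
        (\<exists>\<epsilon>>0. \<exists>\<delta>>0. \<forall>x\<in>D. \<forall>l\<in>{a..b}. \<forall>d.
            norm x = 1 \<and> \<bar>form_val (T l) x\<bar> \<le> \<epsilon> \<and>
            ((\<lambda>\<mu>. form_val (T \<mu>) x) has_real_derivative d) (at l within \<Delta>)
            \<longrightarrow> d \<le> - \<delta>))"

end

theory Submission
  imports Defs
begin

text \<open>
  Write \<open>t(\<nu>)\<close> for the form of \<open>T(\<nu>)\<close> and split the space into the spectral subspaces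
  \<open>H\<^sub>-(\<nu>)\<close>, \<open>ker T(\<nu>)\<close> and \<open>H\<^sub>+(\<nu>)\<close> of \<open>T(\<nu>)\<close>. Sign changes from plus to minus only mean: if
  \<open>t(\<nu>)[x] \<le> 0\<close> and \<open>\<nu> < \<nu>'\<close>, then \<open>t(\<nu>')[x] < 0\<close>; by the S-lemma this gives an
  inequality \<open>t(\<nu>') \<le> c t(\<nu>)\<close>, which makes negativity uniform.

  Upper bound. Every maximal non-negative \<open>M\<close> is a complement of \<open>H\<^sub>-(\<gamma>)\<close>. Adding the eigenspaces one
  after the other shows that \<open>t(\<lambda>\<^sub>n)\<close> is non-positive on the direct sum of \<open>H\<^sub>-(\<gamma>)\<close> and the eigenspaces
  up to \<open>\<lambda>\<^sub>n\<close>; this sum meets \<open>M\<close> in dimension at least \<open>n\<close>. Above a point of the essential spectrum the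
  eigenspaces are replaced by spaces of approximate null vectors.

  Lower bound. Let \<open>M\<close> be the sum of the non-negative part of the form domain at \<open>\<lambda>\<close> and the eigenspaces
  in \<open>[\<gamma>, \<lambda>)\<close>. It is \<open>t(\<gamma>)\<close>-non-negative, and it is maximal: the operators
  \<open>1 - s (T(\<nu>) + s)\<^sup>-\<^sup>1\<close> depend continuously on \<open>\<nu>\<close>, so the spectral subspaces at close parameters
  are complementary, and a Neumann series transports the complement \<open>H\<^sub>-(\<lambda>)\<close> in small steps to
  \<open>H\<^sub>-(\<gamma>)\<close>. The orthogonal complement in \<open>M\<close> of its intersection with \<open>H\<^sub>-(\<lambda>)\<close> is \<open>t(\<lambda>)\<close>-non-negative.
\<close>

section \<open>Symmetric bilinear forms on a subspace\<close>

text \<open>The operators \<open>T \<nu>\<close> are unbounded and their domains may move with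
  \<nu>; only the form domain stays. Parameters are therefore compared through forms on
  \<open>D\<close> and through the bounded operator 1 - s (T \<nu> + s)^(-1), whose sign structure
  is that of \<open>T \<nu>\<close>. This needs one shift \<open>s\<close> for all of [\<gamma>, l],
  whereas the hypotheses bound each \<open>T \<nu>\<close> from below separately; the common bound
  is extracted from the one-directional sign change. The obstacle on the way from \<open>l\<close>
  to \<gamma> is that kernels appear and disappear, so the negative and positive parts are not
  continuous in \<nu>. What survives a small change is that the non-positive part at one parameter
  and the non-negative part at the other have the whole space as their sum. Each step then hands the
  kernel at its left end over to \<open>M\<close>. For approximate null vectors a mere sign is not
  enough; (VM) supplies the margin that absorbs their error. The complex structure is carried as the
  real operator \<open>J\<close>, and all counting is done in real dimensions, so eigenspaces enter
  with twice their multiplicity.\<close>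

locale bform =
  fixes D :: "'a::real_vector set" and b :: "'a \<Rightarrow> 'a \<Rightarrow> real"
  assumes subD: "subspace D"
    and sym: "\<lbrakk>x \<in> D; y \<in> D\<rbrakk> \<Longrightarrow> b x y = b y x"
    and add_l: "\<lbrakk>x \<in> D; y \<in> D; z \<in> D\<rbrakk> \<Longrightarrow> b (x + y) z = b x z + b y z"
    and scale_l: "\<lbrakk>x \<in> D; z \<in> D\<rbrakk> \<Longrightarrow> b (c *\<^sub>R x) z = c * b x z"
begin

lemma zero_mem: "0 \<in> D"
  using subD by (simp add: subspace_0)

lemma mem: "\<lbrakk>x \<in> D; y \<in> D\<rbrakk> \<Longrightarrow> x + y \<in> D" "\<lbrakk>x \<in> D; y \<in> D\<rbrakk> \<Longrightarrow> x - y \<in> D"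
  "x \<in> D \<Longrightarrow> c *\<^sub>R x \<in> D" "x \<in> D \<Longrightarrow> - x \<in> D"
  using subD by (auto simp: subspace_add subspace_diff subspace_scale subspace_neg)

lemma neg_l: "\<lbrakk>x \<in> D; z \<in> D\<rbrakk> \<Longrightarrow> b (- x) z = - b x z"
  using scale_l[of x z "-1"] by simp

lemma diff_l: "\<lbrakk>x \<in> D; y \<in> D; z \<in> D\<rbrakk> \<Longrightarrow> b (x - y) z = b x z - b y z"
  using add_l[of x "- y" z] neg_l[of y z] mem(4)[of y] by simp

lemma zero_l: "z \<in> D \<Longrightarrow> b 0 z = 0"
  using scale_l[of z z 0] by simp

lemma add_r: "\<lbrakk>x \<in> D; y \<in> D; z \<in> D\<rbrakk> \<Longrightarrow> b z (x + y) = b z x + b z y"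
  using sym[of z "x + y"] sym[of z x] sym[of z y] add_l[of x y z] mem(1)[of x y] by simp

lemma scale_r: "\<lbrakk>x \<in> D; z \<in> D\<rbrakk> \<Longrightarrow> b z (c *\<^sub>R x) = c * b z x"
  using sym[of z "c *\<^sub>R x"] sym[of z x] scale_l[of x z c] mem(3)[of x c] by simp

lemma neg_r: "\<lbrakk>x \<in> D; z \<in> D\<rbrakk> \<Longrightarrow> b z (- x) = - b z x"
  using scale_r[of x z "-1"] by simp

lemma diff_r: "\<lbrakk>x \<in> D; y \<in> D; z \<in> D\<rbrakk> \<Longrightarrow> b z (x - y) = b z x - b z y"
  using sym[of z "x - y"] sym[of z x] sym[of z y] diff_l[of x y z] mem(2)[of x y] by simp

lemma zero_r: "z \<in> D \<Longrightarrow> b z 0 = 0"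
  using scale_r[of z z 0] by simp

lemma sq_add: "\<lbrakk>x \<in> D; y \<in> D\<rbrakk> \<Longrightarrow> b (x + y) (x + y) = b x x + 2 * b x y + b y y"
  using sym[of y x] by (simp add: add_l add_r mem)

lemma sq_diff: "\<lbrakk>x \<in> D; y \<in> D\<rbrakk> \<Longrightarrow> b (x - y) (x - y) = b x x - 2 * b x y + b y y"
  using sym[of y x] by (simp add: diff_l diff_r mem)

lemma sq_scale: "x \<in> D \<Longrightarrow> b (c *\<^sub>R x) (c *\<^sub>R x) = c\<^sup>2 * b x x"
  by (simp add: scale_l scale_r mem power2_eq_square)

lemma sq_add_scale:
  "\<lbrakk>x \<in> D; y \<in> D\<rbrakk> \<Longrightarrow> b (x + c *\<^sub>R y) (x + c *\<^sub>R y) = b x x + 2 * c * b x y + c\<^sup>2 * b y y"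
  by (simp add: sq_add mem scale_l scale_r power2_eq_square)

text \<open>Evaluation at the vertex \<open>c = - q / r\<close>. The coefficients are free numbers
  rather than form values, so that an error term may be added to one of them, as the projection
  argument does.\<close>

lemma quadratic_discr:
  assumes "\<And>c::real. 0 \<le> p + 2 * c * q + c\<^sup>2 * r" "0 \<le> r"
  shows "q\<^sup>2 \<le> p * r"
proof (cases "r = 0")
  case True
  have "q = 0"
  proof (rule ccontr)
    assume "q \<noteq> 0"
    then show False
      \<comment> \<open>At this \<open>c\<close> the polynomial, now linear, has the value
        -1.\<close>
      using assms(1)[of "- (p + 1) / (2 * q)"] True by (simp add: field_simps)
  qed
  then show ?thesis using True by simp
next
  case False
  have "0 \<le> p + 2 * (- q / r) * q + (- q / r)\<^sup>2 * r" by (rule assms(1))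
  also have "\<dots> = p - q\<^sup>2 / r"
    using False by (simp add: power2_eq_square field_simps)
  finally show ?thesis
    using False assms(2) by (simp add: field_simps)
qed

lemma cauchy_schwarz:
  assumes "subspace V" "V \<subseteq> D" "\<And>v. v \<in> V \<Longrightarrow> 0 \<le> b v v" "x \<in> V" "y \<in> V"
  shows "(b x y)\<^sup>2 \<le> b x x * b y y"
proof (rule quadratic_discr)
  show "0 \<le> b x x + 2 * c * b x y + c\<^sup>2 * b y y" for c
    using assms sq_add_scale[of x y c]
    by (metis subsetD subspace_add subspace_scale)
  show "0 \<le> b y y" using assms by blast
qed

text \<open>A minimising sequence and the parallelogram law, but for a form that is only
  semidefinite. Completeness of \<open>V\<close> is asked for in the seminorm of \<open>b\<close>,
  so that the lemma serves the inner product, a form on its positive part, and the negative of a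
  form on a negative subspace. Orthogonality is passed to the limit directly, without first showing
  that \<open>v\<close> is a minimiser.\<close>

lemma projection:
  assumes nn: "\<And>v. v \<in> D \<Longrightarrow> 0 \<le> b v v"
    and V: "subspace V" "V \<subseteq> D"
    and complete: "\<And>f. \<lbrakk>\<And>n. f n \<in> V; \<And>e. e > 0 \<Longrightarrow> \<exists>N::nat. \<forall>m\<ge>N. \<forall>n\<ge>N. b (f m - f n) (f m - f n) < e\<rbrakk>
        \<Longrightarrow> \<exists>v\<in>V. (\<lambda>n. b (f n - v) (f n - v)) \<longlonglongrightarrow> 0"
    and x: "x \<in> D"
  shows "\<exists>v\<in>V. \<forall>w\<in>V. b (x - v) w = 0"
proof -
  define g where "g v = b (x - v) (x - v)" for v
  define d where "d = (INF v\<in>V. g v)"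
  have V0: "0 \<in> V" using V subspace_0 by blast
  have gnn: "0 \<le> g v" if "v \<in> V" for v
    unfolding g_def using that V x nn mem by blast
  have bdd: "bdd_below (g ` V)" using gnn by (auto intro!: bdd_belowI[of _ 0])
  have dle: "d \<le> g v" if "v \<in> V" for v
    unfolding d_def using bdd that by (rule cINF_lower)
  have "\<exists>v\<in>V. g v < d + 1 / real (Suc n)" for n
  proof -
    have "Inf (g ` V) < d + 1 / real (Suc n)" by (simp add: d_def)
    then show ?thesis
      using cInf_lessD[of "g ` V" "d + 1 / real (Suc n)"] V0 by blast
  qed
  then obtain f where fV: "\<And>n. f n \<in> V" and fd: "\<And>n. g (f n) < d + 1 / real (Suc n)" by metis
  have fD: "f n \<in> D" for n using fV V by blast
  have cau: "\<exists>N::nat. \<forall>m\<ge>N. \<forall>n\<ge>N. b (f m - f n) (f m - f n) < e" if "e > 0" for e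
  proof -
    obtain N where N: "1 / real (Suc N) < e / 4" using \<open>e > 0\<close> nat_approx_posE[of "e/4"] by auto
    have "b (f m - f n) (f m - f n) < e" if "m \<ge> N" "n \<ge> N" for m n
    proof -
      let ?u = "(1/2::real) *\<^sub>R (f m + f n)"
      have u: "?u \<in> V" using fV V by (simp add: subspace_add subspace_scale)
      \<comment> \<open>Parallelogram law; the midpoint \<open>?u\<close> lies in \<open>V\<close>,
        so its value is at least \<open>d\<close>.\<close>
      have eq: "b (f m - f n) (f m - f n) = 2 * g (f m) + 2 * g (f n) - 4 * g ?u"
        unfolding g_def using x fD[of m] fD[of n] sym[of "f n" "f m"]
        by (simp add: sq_diff mem scale_l scale_r add_l add_r field_simps)
      have "g (f m) < d + 1 / real (Suc N)" "g (f n) < d + 1 / real (Suc N)"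
        using fd[of m] fd[of n] that
        by (smt (verit) frac_le Suc_le_mono of_nat_0_less_iff of_nat_le_iff zero_less_Suc)+
      then show ?thesis using eq dle[OF u] N by linarith
    qed
    then show ?thesis by blast
  qed
  obtain v where v: "v \<in> V" and lim: "(\<lambda>n. b (f n - v) (f n - v)) \<longlonglongrightarrow> 0"
    using complete[OF fV cau] by blast
  have vD: "v \<in> D" using v V by blast
  have "b (x - v) w = 0" if w: "w \<in> V" for w
  proof -
    have wD: "w \<in> D" using w V by blast
    \<comment> \<open>Along the line through \<open>f n\<close> in direction \<open>w\<close> the
      value of \<open>g\<close> stays above \<open>d\<close>. Replacing \<open>g (f n)\<close> by
      1/(n+1), which bounds its excess over \<open>d\<close>, therefore keeps the quadratic
      polynomial non-negative.\<close>
    have 1: "(b (x - f n) w)\<^sup>2 \<le> (1 / real (Suc n)) * b w w" for n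
    proof (rule quadratic_discr)
      fix c
      have m: "f n - c *\<^sub>R w \<in> V" using fV w V by (simp add: subspace_diff subspace_scale)
      have "g (f n - c *\<^sub>R w) = g (f n) + 2 * c * b (x - f n) w + c\<^sup>2 * b w w"
        unfolding g_def using sq_add_scale[of "x - f n" w c] x fD wD mem
        by (simp add: algebra_simps)
      then show "0 \<le> 1 / real (Suc n) + 2 * c * b (x - f n) w + c\<^sup>2 * b w w"
        using dle[OF m] fd[of n] by linarith
    qed (use nn wD in auto)
    have 2: "(b (f n - v) w)\<^sup>2 \<le> b (f n - v) (f n - v) * b w w" for n
      using cauchy_schwarz[of V "f n - v" w] V fV v w nn by (meson subsetD subspace_diff)
    have l1: "(\<lambda>n. (b (x - f n) w)\<^sup>2) \<longlonglongrightarrow> 0"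
    proof (rule tendsto_sandwich[OF _ _ tendsto_const])
      show "(\<lambda>n. (1 / real (Suc n)) * b w w) \<longlonglongrightarrow> 0"
        using tendsto_mult_left_zero[OF LIMSEQ_inverse_real_of_nat] by (simp add: inverse_eq_divide)
    qed (use 1 in auto)
    have l2: "(\<lambda>n. (b (f n - v) w)\<^sup>2) \<longlonglongrightarrow> 0"
    proof (rule tendsto_sandwich[OF _ _ tendsto_const])
      show "(\<lambda>n. b (f n - v) (f n - v) * b w w) \<longlonglongrightarrow> 0"
        using tendsto_mult_left_zero[OF lim] .
    qed (use 2 in auto)
    have "(\<lambda>n. b (x - f n) w + b (f n - v) w) \<longlonglongrightarrow> 0 + 0"
      using l1 l2 by (intro tendsto_add) (simp_all add: power_tendsto_0_iff)
    moreover have "b (x - f n) w + b (f n - v) w = b (x - v) w" for n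
      using x fD[of n] vD wD by (simp add: diff_l)
    ultimately show ?thesis by (simp add: LIMSEQ_const_iff)
  qed
  then show ?thesis using v by blast
qed

end

lemma bform_inner: "bform UNIV ((\<bullet>) :: 'a::real_inner \<Rightarrow> 'a \<Rightarrow> real)"
  by unfold_locales (auto simp: inner_add_left inner_commute[of _ "_ + _"] intro: inner_commute)

lemma bform_uminus: "bform D b \<Longrightarrow> bform D (\<lambda>x y. - b x y)"
  unfolding bform_def by (simp add: algebra_simps)

lemma bform_subset: "bform D b \<Longrightarrow> subspace V \<Longrightarrow> V \<subseteq> D \<Longrightarrow> bform V b"
  unfolding bform_def by (meson subsetD)

lemma bform_plus_inner:
  fixes D :: "'a::real_inner set"
  assumes "bform D b"
  shows "bform D (\<lambda>x y. b x y + s * (x \<bullet> y))"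
  using assms unfolding bform_def by (auto simp: inner_add_left algebra_simps intro: inner_commute)

text \<open>The S-lemma. For \<open>u\<close> negative and \<open>v\<close> positive, the two neutral vectors of the line
  \<open>v + \<real> u\<close> have parameters with product \<open>-1\<close> (after normalisation); a suitable combination of
  \<open>b'\<close> at these two vectors eliminates the mixed term.\<close>

lemma S_lemma_pair:
  assumes "bform D b" "bform D b'"
    and imp: "\<And>x. x \<in> D \<Longrightarrow> b x x \<le> 0 \<Longrightarrow> b' x x \<le> 0"
    and u: "u \<in> D" "b u u < 0" and v: "v \<in> D" "b v v > 0"
  shows "b' v v / b v v \<le> b' u u / b u u"
proof -
  interpret b: bform D b by fact
  interpret b': bform D b' by fact
  define \<alpha> where "\<alpha> = - b u u"
  define \<beta> where "\<beta> = b v v"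
  define \<mu> where "\<mu> = b v u"
  have pos: "\<alpha> > 0" "\<beta> > 0" using u v by (auto simp: \<alpha>_def \<beta>_def)
  define r where "r = sqrt (\<mu>\<^sup>2 + \<alpha> * \<beta>)"
  have r2: "r\<^sup>2 = \<mu>\<^sup>2 + \<alpha> * \<beta>" unfolding r_def using pos by simp
  have r_gt: "r > \<bar>\<mu>\<bar>"
  proof -
    have "sqrt (\<mu>\<^sup>2) < r" unfolding r_def using pos by (intro real_sqrt_less_mono) simp
    then show ?thesis by simp
  qed
  define s1 where "s1 = (\<mu> + r) / \<alpha>"
  define s2 where "s2 = (r - \<mu>) / \<alpha>"
  have s: "s1 > 0" "s2 > 0" using r_gt pos unfolding s1_def s2_def by auto
  have prod: "s1 * s2 = \<beta> / \<alpha>"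
  proof -
    have "s1 * s2 = (r\<^sup>2 - \<mu>\<^sup>2) / (\<alpha> * \<alpha>)"
      unfolding s1_def s2_def by (simp add: power2_eq_square algebra_simps)
    then show ?thesis using r2 pos by simp
  qed
  have root1: "b (v + s1 *\<^sub>R u) (v + s1 *\<^sub>R u) = 0"
  proof -
    have "\<alpha> * (\<beta> + 2 * s1 * \<mu> - s1\<^sup>2 * \<alpha>) = \<alpha> * \<beta> + \<mu>\<^sup>2 - r\<^sup>2"
      unfolding s1_def using pos by (simp add: power2_eq_square field_simps)
    then have "\<beta> + 2 * s1 * \<mu> - s1\<^sup>2 * \<alpha> = 0" using r2 pos by simp
    then show ?thesis using u v by (simp add: b.sq_add_scale \<alpha>_def \<beta>_def \<mu>_def)
  qed
  have root2: "b (v + (- s2) *\<^sub>R u) (v + (- s2) *\<^sub>R u) = 0"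
  proof -
    have "\<alpha> * (\<beta> - 2 * s2 * \<mu> - s2\<^sup>2 * \<alpha>) = \<alpha> * \<beta> + \<mu>\<^sup>2 - r\<^sup>2"
      unfolding s2_def using pos by (simp add: power2_eq_square field_simps)
    then have "\<beta> - 2 * s2 * \<mu> - s2\<^sup>2 * \<alpha> = 0" using r2 pos by simp
    then show ?thesis using u v b.sq_add_scale[of v u "- s2"] by (simp add: \<alpha>_def \<beta>_def \<mu>_def)
  qed
  have i1: "b' v v + 2 * s1 * b' v u + s1\<^sup>2 * b' u u \<le> 0"
    using imp[of "v + s1 *\<^sub>R u"] root1 u v b.mem b'.sq_add_scale[of v u s1] by simp
  have i2: "b' v v - 2 * s2 * b' v u + s2\<^sup>2 * b' u u \<le> 0"
    using imp[of "v + (- s2) *\<^sub>R u"] root2 u v b.mem b'.sq_add_scale[of v u "- s2"]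
    by (simp del: scaleR_minus_left)
  have "s2 * (b' v v + 2 * s1 * b' v u + s1\<^sup>2 * b' u u) + s1 * (b' v v - 2 * s2 * b' v u + s2\<^sup>2 * b' u u) \<le> 0"
    using i1 i2 s by (smt (verit) mult_nonneg_nonpos)
  then have "(s1 + s2) * (b' v v + (s1 * s2) * b' u u) \<le> 0"
    by (simp add: power2_eq_square algebra_simps)
  then have "b' v v + (\<beta> / \<alpha>) * b' u u \<le> 0"
    using s prod by (simp add: mult_le_0_iff)
  then show ?thesis using pos by (simp add: \<alpha>_def \<beta>_def field_simps)
qed

text \<open>The quotient b'/b at a positive vector never exceeds that at a negative one, so the
  infimum \<open>c\<close> of the negative quotients separates the two families; neutral vectors are
  covered by the hypothesis. One negative \<open>u\<close> makes the infimum meaningful, one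
  \<open>v\<close> with \<open>b' v v > 0\<close> makes it positive. The explicit lower bound for
  \<open>c\<close> later yields uniform constants.\<close>

lemma S_lemma:
  assumes "bform D b" "bform D b'"
    and imp: "\<And>x. x \<in> D \<Longrightarrow> b x x \<le> 0 \<Longrightarrow> b' x x \<le> 0"
    and u: "u \<in> D" "b u u < 0" and v: "v \<in> D" "b' v v > 0"
  shows "\<exists>c. c \<ge> b' v v / b v v \<and> b v v > 0 \<and> c > 0 \<and> (\<forall>x\<in>D. b' x x \<le> c * b x x)"
proof -
  define S where "S = {b' u u / b u u | u. u \<in> D \<and> b u u < 0}"
  define c where "c = Inf S"
  have v': "b v v > 0" using imp v by fastforce
  have S: "S \<noteq> {}" using u unfolding S_def by blast
  have low: "b' w w / b w w \<le> y" if "y \<in> S" "w \<in> D" "b w w > 0" for y w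
    using that S_lemma_pair[OF assms(1-3)] unfolding S_def by blast
  have bdd: "bdd_below S" using low v v' by (meson bdd_belowI)
  have cS: "c \<le> y" if "y \<in> S" for y unfolding c_def using that bdd by (rule cInf_lower)
  have cw: "b' w w / b w w \<le> c" if "w \<in> D" "b w w > 0" for w
    unfolding c_def using S low that by (intro cInf_greatest) auto
  have "c > 0" using cw[OF v(1) v'] v v' by (smt (verit) divide_pos_pos)
  moreover have "b' x x \<le> c * b x x" if x: "x \<in> D" for x
  proof -
    consider "b x x < 0" | "b x x = 0" | "b x x > 0" by linarith
    then show ?thesis
    proof cases
      case 1
      then have "c \<le> b' x x / b x x" using cS x unfolding S_def by blast
      then show ?thesis using 1 by (simp add: field_simps)
    next
      case 2 then show ?thesis using imp x by simp
    next
      case 3 then show ?thesis using cw[OF x 3] by (simp add: field_simps)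
    qed
  qed
  ultimately show ?thesis using cw[OF v(1) v'] v' by blast
qed

section \<open>Bounded self-adjoint operators\<close>

lemma Cauchy_geometric:
  fixes u :: "nat \<Rightarrow> 'a::real_normed_vector"
  assumes "\<And>n. norm (u (Suc n) - u n) \<le> K * q ^ n" "0 \<le> q" "q < 1"
  shows "Cauchy u"
proof -
  have K: "K \<ge> 0" using order_trans[OF norm_ge_zero assms(1)[of 0]] by simp
  have d: "norm (u (n + k) - u n) \<le> K * q ^ n / (1 - q)" for n k
  proof -
    have "norm (u (n + k) - u n) \<le> K * q ^ n * (1 - q ^ k) / (1 - q)"
    proof (induction k)
      case (Suc k)
      have "norm (u (n + Suc k) - u n) \<le> norm (u (Suc (n + k)) - u (n + k)) + norm (u (n + k) - u n)"
        using norm_triangle_ineq[of "u (Suc (n + k)) - u (n + k)" "u (n + k) - u n"] by simp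
      also have "\<dots> \<le> K * q ^ (n + k) + K * q ^ n * (1 - q ^ k) / (1 - q)"
        using Suc assms(1)[of "n + k"] by linarith
      also have "\<dots> = K * q ^ n * (1 - q ^ Suc k) / (1 - q)"
        using assms(3) by (simp add: field_simps power_add)
      finally show ?case .
    qed simp
    also have "\<dots> \<le> K * q ^ n / (1 - q)"
      using K assms(2,3) by (intro divide_right_mono) (auto intro!: mult_right_le_one_le simp: power_le_one)
    finally show ?thesis .
  qed
  have lim: "(\<lambda>n. K * q ^ n / (1 - q)) \<longlonglongrightarrow> 0"
    using tendsto_mult[OF tendsto_const[of "K / (1 - q)"] LIMSEQ_power_zero[of q]] assms(2,3) by simp
  show ?thesis
  proof (rule metric_CauchyI)
    fix e :: real assume "e > 0"
    then obtain M where M: "\<And>n. n \<ge> M \<Longrightarrow> K * q ^ n / (1 - q) < e / 2"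
      using order_tendstoD(2)[OF lim, of "e/2"] by (auto simp: eventually_sequentially)
    have n1: "norm (u m - u M) < e / 2" if "m \<ge> M" for m
      using le_less_trans[OF d[of M "m - M"] M[of M]] that by simp
    have "dist (u m) (u n) < e" if "m \<ge> M" "n \<ge> M" for m n
      using n1[OF that(1)] n1[OF that(2)] norm_triangle_ineq4[of "u m - u M" "u n - u M"]
      by (simp add: dist_norm)
    then show "\<exists>M. \<forall>m\<ge>M. \<forall>n\<ge>M. dist (u m) (u n) < e" by blast
  qed
qed

text \<open>The iterates of u = h + f u from 0 are the partial sums of the Neumann series.
  Contraction is measured by a function \<open>b\<close> known only to be comparable to the squared
  norm, hence the ratio sqrt q in norm. Of linearity only compatibility with differences in
  \<open>V\<close> is asked, because some of the maps to which this applies are assembled from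
  chosen decompositions.\<close>

lemma neumann:
  fixes V :: "'a::{real_inner,complete_space} set"
  assumes V: "subspace V" "closed V"
    and map: "\<And>x. x \<in> V \<Longrightarrow> f x \<in> V"
    and diff: "\<And>x y. x \<in> V \<Longrightarrow> y \<in> V \<Longrightarrow> f x - f y = f (x - y)"
    and b: "\<And>x. x \<in> V \<Longrightarrow> c * (norm x)\<^sup>2 \<le> b x" "\<And>x. x \<in> V \<Longrightarrow> b x \<le> C * (norm x)\<^sup>2" "c > 0"
    and contr: "\<And>x. x \<in> V \<Longrightarrow> b (f x) \<le> q * b x" "0 \<le> q" "q < 1"
    and h: "h \<in> V"
  shows "\<exists>u\<in>V. u = h + f u"
proof -
  define w where "w = rec_nat 0 (\<lambda>_ x. h + f x)"
  have w0: "w 0 = 0" and wS: "w (Suc n) = h + f (w n)" for n by (auto simp: w_def)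
  have wV: "w n \<in> V" for n
    by (induction n) (use w0 wS V h map in \<open>auto simp: subspace_0 subspace_add\<close>)
  have dV: "w (Suc n) - w n \<in> V" for n using wV V subspace_diff by blast
  have bd: "b (w (Suc n) - w n) \<le> q ^ n * b (w (Suc 0) - w 0)" for n
  proof (induction n)
    case (Suc n)
    have "w (Suc (Suc n)) - w (Suc n) = f (w (Suc n) - w n)"
      using diff[OF wV[of "Suc n"] wV[of n]] wS[of "Suc n"] wS[of n] by (metis add_diff_cancel_left)
    then have "b (w (Suc (Suc n)) - w (Suc n)) \<le> q * b (w (Suc n) - w n)"
      using contr(1)[OF dV] by simp
    also have "\<dots> \<le> q * (q ^ n * b (w (Suc 0) - w 0))"
      using Suc contr(2) by (rule mult_left_mono)
    finally show ?case by (simp add: mult.assoc)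
  qed simp
  have b0: "b x \<ge> 0" if "x \<in> V" for x using b(1)[OF that] b(3) by (smt (verit) mult_nonneg_nonneg zero_le_power2)
  define K where "K = sqrt (b (w (Suc 0) - w 0) / c)"
  have "norm (w (Suc n) - w n) \<le> K * (sqrt q) ^ n" for n
  proof -
    have "(norm (w (Suc n) - w n))\<^sup>2 \<le> q ^ n * b (w (Suc 0) - w 0) / c"
      using b(1)[OF dV[of n]] bd[of n] b(3) by (simp add: field_simps)
    then have "norm (w (Suc n) - w n) \<le> sqrt (q ^ n * b (w (Suc 0) - w 0) / c)"
      by (simp add: real_le_rsqrt)
    also have "\<dots> = K * (sqrt q) ^ n"
      by (simp add: K_def real_sqrt_mult real_sqrt_power real_sqrt_divide)
    finally show ?thesis .
  qed
  then have "Cauchy w" using contr(2,3) by (intro Cauchy_geometric[of w K "sqrt q"]) auto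
  then obtain u where u: "w \<longlonglongrightarrow> u" using Cauchy_convergent convergent_def by blast
  have uV: "u \<in> V" using closed_sequentially[OF V(2)] wV u by blast
  have nf: "norm (f x) \<le> sqrt (q * C / c) * norm x" if "x \<in> V" for x
  proof -
    have "c * (norm (f x))\<^sup>2 \<le> q * (C * (norm x)\<^sup>2)"
      using b(1)[OF map[OF that]] contr(1)[OF that] b(2)[OF that] contr(2) by (smt (verit) mult_left_mono)
    then have "(norm (f x))\<^sup>2 \<le> (q * C / c) * (norm x)\<^sup>2" using b(3) by (simp add: field_simps)
    then have "norm (f x) \<le> sqrt ((q * C / c) * (norm x)\<^sup>2)" by (simp add: real_le_rsqrt)
    also have "\<dots> = sqrt (q * C / c) * norm x" by (subst real_sqrt_mult) simp
    finally show ?thesis .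
  qed
  have "(\<lambda>n. f (w n)) \<longlonglongrightarrow> f u"
  proof (rule LIM_zero_cancel, rule tendsto_norm_zero_cancel, rule tendsto_sandwich[OF _ _ tendsto_const])
    show "(\<lambda>n. sqrt (q * C / c) * norm (w n - u)) \<longlonglongrightarrow> 0"
      using u by (intro tendsto_mult_right_zero tendsto_norm_zero LIM_zero)
    show "\<forall>\<^sub>F n in sequentially. norm (f (w n) - f u) \<le> sqrt (q * C / c) * norm (w n - u)"
      using diff[OF wV uV] nf[OF subspace_diff[OF V(1) wV uV]] by simp
  qed auto
  then have "(\<lambda>n. w (Suc n)) \<longlonglongrightarrow> h + f u" unfolding wS by (intro tendsto_intros)
  moreover have "(\<lambda>n. w (Suc n)) \<longlonglongrightarrow> u" using u by (simp add: LIMSEQ_Suc)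
  ultimately show ?thesis using uV LIMSEQ_unique by blast
qed

section \<open>Bounded self-adjoint operators: numerical range, square root and sign\<close>

definition sadj :: "('a::real_inner \<Rightarrow> 'a) \<Rightarrow> bool" where
  "sadj f \<longleftrightarrow> bounded_linear f \<and> (\<forall>x y. f x \<bullet> y = x \<bullet> f y)"

lemma sadjD: "sadj f \<Longrightarrow> bounded_linear f" "sadj f \<Longrightarrow> f x \<bullet> y = x \<bullet> f y"
  unfolding sadj_def by auto

lemma sadj_lin:
  assumes "sadj f"
  shows "f (x + y) = f x + f y" "f (x - y) = f x - f y" "f (c *\<^sub>R x) = c *\<^sub>R f x" "f 0 = 0" "f (- x) = - f x"
  using linear_simps[OF sadjD(1)[OF assms]] by auto

lemma sadj_id: "sadj (\<lambda>x. x)"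
  by (simp add: sadj_def bounded_linear_ident)

lemma sadj_add: "sadj f \<Longrightarrow> sadj g \<Longrightarrow> sadj (\<lambda>x. f x + g x)"
  by (auto simp: sadj_def inner_add_left inner_add_right intro: bounded_linear_add)

lemma sadj_diff: "sadj f \<Longrightarrow> sadj g \<Longrightarrow> sadj (\<lambda>x. f x - g x)"
  by (auto simp: sadj_def inner_diff_left inner_diff_right intro: bounded_linear_sub)

lemma sadj_scale: "sadj f \<Longrightarrow> sadj (\<lambda>x. c *\<^sub>R f x)"
  by (auto simp: sadj_def intro: bounded_linear_compose[OF bounded_linear_scaleR_right])

lemma sadj_comp: "sadj f \<Longrightarrow> sadj g \<Longrightarrow> (\<And>x. f (g x) = g (f x)) \<Longrightarrow> sadj (\<lambda>x. f (g x))"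
  unfolding sadj_def using bounded_linear_compose by metis

lemma sadj_bound:
  assumes "sadj f"
  obtains m where "m > 0" "\<And>x. norm (f x) \<le> m * norm x"
  using bounded_linear.pos_bounded[OF sadjD(1)[OF assms]] by (metis mult.commute)

lemma linear_bound_bounded_linear:
  assumes "\<And>x y. f (x + y) = f x + f y" "\<And>c x. f (c *\<^sub>R x) = c *\<^sub>R f x" "\<And>x. norm (f x) \<le> K * norm x"
  shows "bounded_linear f"
  using assms by (intro bounded_linear_intro[where K = K]) (auto simp: mult.commute)

text \<open>For a symmetric operator the numerical radius is the norm: polarise
  \<open>f x \<bullet> y\<close>, where \<open>y\<close> is the multiple of \<open>f x\<close> that
  has the norm of \<open>x\<close>, and apply the parallelogram law.\<close>

lemma sadj_norm_le:
  assumes f: "sadj f" and k: "\<And>x. \<bar>f x \<bullet> x\<bar> \<le> k * (norm x)\<^sup>2"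
  shows "norm (f x) \<le> k * norm x"
proof (cases "f x = 0 \<or> x = 0")
  case True
  have "0 \<le> k * norm x"
  proof (cases "x = 0")
    case False
    have "0 \<le> k * (norm x)\<^sup>2" using k[of x] by linarith
    then show ?thesis using False by (simp add: zero_le_mult_iff)
  qed simp
  then show ?thesis using True sadj_lin(4)[OF f] by auto
next
  case False
  define y where "y = (norm x / norm (f x)) *\<^sub>R f x"
  have ny: "norm y = norm x" using False by (simp add: y_def)
  have fxy: "f x \<bullet> y = norm x * norm (f x)"
    using False by (simp add: y_def dot_square_norm power2_eq_square)
  have "4 * (f x \<bullet> y) = f (x + y) \<bullet> (x + y) - f (x - y) \<bullet> (x - y)"
    using sadjD(2)[OF f, of y x] by (simp add: sadj_lin[OF f] inner_add_left inner_add_right inner_diff_left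
        inner_diff_right inner_commute)
  also have "\<dots> \<le> k * (norm (x + y))\<^sup>2 + k * (norm (x - y))\<^sup>2"
    using k[of "x + y"] k[of "x - y"] by linarith
  also have "\<dots> = k * (2 * (norm x)\<^sup>2 + 2 * (norm y)\<^sup>2)"
    by (simp add: power2_norm_eq_inner inner_add_left inner_add_right inner_diff_left inner_diff_right algebra_simps)
  finally have "norm x * norm (f x) \<le> k * norm x * norm x" using ny fxy by (simp add: power2_eq_square)
  then show ?thesis using False by (simp add: mult.commute mult.left_commute)
qed

text \<open>With S = 1 - Z the equation S^2 = 1 - X becomes Z = (X + Z^2)/2, solved by iteration
  from 0. As the norm of \<open>X\<close> is at most \<open>q < 1\<close>, the iterates keep that
  bound, because (q + q^2)/2 <= q, and their increments shrink by the factor \<open>q\<close>. Each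
  iterate is a polynomial in \<open>X\<close>, whence the commutation property.\<close>

lemma sadj_sqrt:
  fixes X :: "'a::{real_inner,complete_space} \<Rightarrow> 'a"
  assumes X: "sadj X" and q: "\<And>x. norm (X x) \<le> q * norm x" "0 \<le> q" "q < 1"
  obtains S where "sadj S" "\<And>x. S (S x) = x - X x" "\<And>x. (1 - q) * (norm x)\<^sup>2 \<le> S x \<bullet> x"
    "\<And>C x. bounded_linear C \<Longrightarrow> (\<And>x. C (X x) = X (C x)) \<Longrightarrow> C (S x) = S (C x)"
proof -
  define Y where "Y = rec_nat (\<lambda>x. 0) (\<lambda>_ f x. (1/2::real) *\<^sub>R (X x + f (f x)))"
  have Y0: "Y 0 = (\<lambda>x. 0)" and YS: "Y (Suc n) = (\<lambda>x. (1/2::real) *\<^sub>R (X x + Y n (Y n x)))" for n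
    by (auto simp: Y_def)
  have sY: "sadj (Y n)" for n
  proof (induction n)
    case 0 show ?case by (simp add: Y0 sadj_def)
  next
    case (Suc n)
    have "sadj (\<lambda>x. Y n (Y n x))" by (rule sadj_comp[OF Suc Suc]) simp
    then show ?case unfolding YS by (intro sadj_scale sadj_add X)
  qed
  note lin = sadj_lin[OF sY]
  have nY: "norm (Y n x) \<le> q * norm x" for n x
  proof (induction n arbitrary: x)
    case 0 then show ?case using q by (simp add: Y0)
  next
    case (Suc n)
    have "norm (Y n (Y n x)) \<le> q * (q * norm x)"
      using Suc[of "Y n x"] Suc[of x] q by (smt (verit) mult_left_mono)
    also have "\<dots> \<le> q * norm x" using q by (simp add: mult_left_le_one_le mult_left_mono mult_nonneg_nonneg)
    finally have "norm (X x + Y n (Y n x)) \<le> 2 * (q * norm x)"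
      using q(1)[of x] norm_triangle_ineq[of "X x" "Y n (Y n x)"] by linarith
    then show ?case by (simp add: YS)
  qed
  have dY: "norm (Y (Suc n) x - Y n x) \<le> (q * norm x) * q ^ n" for n x
  proof (induction n arbitrary: x)
    case 0 then show ?case using q(1)[of x] order_trans[OF norm_ge_zero q(1)[of x]] by (simp add: YS Y0)
  next
    case (Suc n)
    \<comment> \<open>Difference of two squares, arranged so that \<open>Y (Suc n)\<close> and
      \<open>Y n\<close> are never interchanged.\<close>
    have "Y (Suc (Suc n)) x - Y (Suc n) x
        = (1/2::real) *\<^sub>R (Y (Suc n) (Y (Suc n) x - Y n x) + (Y (Suc n) (Y n x) - Y n (Y n x)))"
      unfolding lin(2) YS[of "Suc n"] by (subst (2) YS) (simp add: algebra_simps)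
    moreover have "norm (Y (Suc n) (Y (Suc n) x - Y n x)) \<le> (q * norm x) * q ^ Suc n"
      using nY[of "Suc n" "Y (Suc n) x - Y n x"] mult_left_mono[OF Suc[of x] q(2)]
      by (simp add: mult_ac)
    moreover have "norm (Y (Suc n) (Y n x) - Y n (Y n x)) \<le> (q * norm x) * q ^ Suc n"
    proof -
      have "norm (Y (Suc n) (Y n x) - Y n (Y n x)) \<le> (q * norm (Y n x)) * q ^ n" by (rule Suc)
      also have "\<dots> \<le> (q * (q * norm x)) * q ^ n"
        using nY[of n x] q by (intro mult_right_mono mult_left_mono) auto
      finally show ?thesis by (simp add: mult_ac)
    qed
    ultimately show ?case
      using norm_triangle_ineq[of "Y (Suc n) (Y (Suc n) x - Y n x)" "Y (Suc n) (Y n x) - Y n (Y n x)"]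
      by simp
  qed
  have "Cauchy (\<lambda>n. Y n x)" for x
    using dY q(2,3) by (intro Cauchy_geometric[where K = "q * norm x" and q = q]) auto
  then have "\<exists>l. (\<lambda>n. Y n x) \<longlonglongrightarrow> l" for x
    using Cauchy_convergent convergent_def by blast
  then obtain Z where Z: "\<And>x. (\<lambda>n. Y n x) \<longlonglongrightarrow> Z x" by metis
  have nZ: "norm (Z x) \<le> q * norm x" for x
    using nY by (intro LIMSEQ_le_const2[OF tendsto_norm[OF Z]]) auto
  have Zadd: "Z (x + y) = Z x + Z y" for x y
    using tendsto_add[OF Z Z, of x y] Z[of "x + y"] by (simp add: lin LIMSEQ_unique)
  have Zsc: "Z (c *\<^sub>R x) = c *\<^sub>R Z x" for c x
    using tendsto_scaleR[OF tendsto_const Z, of c x] Z[of "c *\<^sub>R x"] by (simp add: lin LIMSEQ_unique)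
  have sZ: "sadj Z"
    unfolding sadj_def
  proof (intro conjI allI)
    show "bounded_linear Z" using Zadd Zsc nZ by (rule linear_bound_bounded_linear)
    show "Z x \<bullet> y = x \<bullet> Z y" for x y
      using tendsto_inner[OF Z[of x] tendsto_const[of y]] tendsto_inner[OF tendsto_const[of x] Z[of y]]
      by (simp add: sadjD(2)[OF sY] LIMSEQ_unique)
  qed
  have ZZ: "(\<lambda>n. Y n (Y n x)) \<longlonglongrightarrow> Z (Z x)" for x
  proof -
    have "(\<lambda>n. Y n (Y n x - Z x)) \<longlonglongrightarrow> 0"
    proof (rule tendsto_norm_zero_cancel, rule tendsto_sandwich[OF _ _ tendsto_const])
      show "(\<lambda>n. q * norm (Y n x - Z x)) \<longlonglongrightarrow> 0"
        by (intro tendsto_mult_right_zero tendsto_norm_zero LIM_zero Z)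
    qed (use nY in auto)
    from tendsto_add[OF this Z[of "Z x"]] show ?thesis by (simp add: lin)
  qed
  have fixp: "Z x = (1/2::real) *\<^sub>R (X x + Z (Z x))" for x
  proof (rule LIMSEQ_unique)
    show "(\<lambda>n. Y (Suc n) x) \<longlonglongrightarrow> Z x" by (rule LIMSEQ_Suc[OF Z])
    show "(\<lambda>n. Y (Suc n) x) \<longlonglongrightarrow> (1/2::real) *\<^sub>R (X x + Z (Z x))"
      unfolding YS by (intro tendsto_intros ZZ)
  qed
  define S where "S x = x - Z x" for x
  show thesis
  proof
    show "sadj S" unfolding S_def using sadj_diff[OF sadj_id sZ] .
    show "S (S x) = x - X x" for x
    proof -
      have "S (S x) = x - 2 *\<^sub>R Z x + Z (Z x)"
        unfolding S_def by (simp add: sadj_lin[OF sZ] scaleR_2)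
      also have "2 *\<^sub>R Z x = X x + Z (Z x)" by (subst fixp) simp
      finally show ?thesis by simp
    qed
    show "(1 - q) * (norm x)\<^sup>2 \<le> S x \<bullet> x" for x
    proof -
      have "Z x \<bullet> x \<le> norm (Z x) * norm x" by (rule norm_cauchy_schwarz)
      also have "\<dots> \<le> (q * norm x) * norm x" by (intro mult_right_mono nZ) auto
      finally have "Z x \<bullet> x \<le> q * (norm x)\<^sup>2" by (simp add: power2_eq_square mult.assoc)
      then show ?thesis unfolding S_def by (simp add: inner_diff_left dot_square_norm algebra_simps)
    qed
    fix C x assume C: "bounded_linear C" and com: "\<And>x. C (X x) = X (C x)"
    have CY: "C (Y n x) = Y n (C x)" for n x
    proof (induction n arbitrary: x)
      case 0 then show ?case using linear_simps(3)[OF C] by (simp add: Y0)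
    next
      case (Suc n) then show ?case by (simp add: YS linear_simps[OF C] com)
    qed
    have "(\<lambda>n. C (Y n x)) \<longlonglongrightarrow> C (Z x)" by (rule bounded_linear.tendsto[OF C Z])
    then have "C (Z x) = Z (C x)" using Z[of "C x"] by (simp add: CY LIMSEQ_unique)
    then show "C (S x) = S (C x)" unfolding S_def by (simp add: linear_simps[OF C])
  qed
qed

text \<open>If a <= F <= m, then 1 - F/m has its numerical range in [0, 1 - a/m] and is a strict
  contraction. This feeds both the Neumann inverse and the square root of \<open>F\<close>; taking
  \<open>m\<close> at least \<open>a\<close> keeps \<open>q\<close> non-negative.\<close>

lemma sadj_pos_normalise:
  assumes F: "sadj F" and a: "a > 0" "\<And>x. a * (norm x)\<^sup>2 \<le> F x \<bullet> x"
  obtains m q where "m > 0" "0 \<le> q" "q < 1" "sadj (\<lambda>x. x - (1/m) *\<^sub>R F x)"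
    "\<And>x. norm (x - (1/m) *\<^sub>R F x) \<le> q * norm x"
proof -
  obtain m0 where m0: "m0 > 0" "\<And>x. norm (F x) \<le> m0 * norm x" using sadj_bound[OF F] by blast
  define m where "m = max m0 a"
  have m: "m > 0" "a \<le> m" "\<And>x. norm (F x) \<le> m * norm x"
    using m0 unfolding m_def by (auto intro!: order_trans[OF m0(2)] mult_right_mono)
  have s: "sadj (\<lambda>x. x - (1/m) *\<^sub>R F x)" by (intro sadj_diff sadj_id sadj_scale F)
  have "\<bar>(x - (1/m) *\<^sub>R F x) \<bullet> x\<bar> \<le> (1 - a/m) * (norm x)\<^sup>2" for x
  proof -
    have "F x \<bullet> x \<le> norm (F x) * norm x" by (rule norm_cauchy_schwarz)
    also have "\<dots> \<le> m * norm x * norm x" by (intro mult_right_mono m) auto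
    finally have "(F x \<bullet> x) / m \<le> (norm x)\<^sup>2" using m by (simp add: field_simps power2_eq_square)
    moreover have "(a / m) * (norm x)\<^sup>2 \<le> (F x \<bullet> x) / m" using a(2)[of x] m by (simp add: field_simps)
    ultimately show ?thesis by (simp add: inner_diff_left dot_square_norm algebra_simps)
  qed
  then have "norm (x - (1/m) *\<^sub>R F x) \<le> (1 - a/m) * norm x" for x using sadj_norm_le[OF s] by blast
  then show thesis using that[of m "1 - a/m"] m a s by simp
qed

text \<open>Solving F x = y amounts to the fixed point equation u = y/m + (1 - F/m) u.\<close>

lemma sadj_pos_surj:
  fixes F :: "'a::{real_inner,complete_space} \<Rightarrow> 'a"
  assumes F: "sadj F" and a: "a > 0" "\<And>x. a * (norm x)\<^sup>2 \<le> F x \<bullet> x"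
  shows "\<exists>x. F x = y"
proof -
  obtain m q where m: "m > 0" "0 \<le> q" "q < 1" "sadj (\<lambda>x. x - (1/m) *\<^sub>R F x)"
    "\<And>x. norm (x - (1/m) *\<^sub>R F x) \<le> q * norm x"
    using sadj_pos_normalise[OF assms] by blast
  have "\<exists>u\<in>UNIV. u = (1/m) *\<^sub>R y + (u - (1/m) *\<^sub>R F u)"
  proof (rule neumann[where b = "\<lambda>x. (norm x)\<^sup>2" and c = 1 and C = 1 and q = "q\<^sup>2"])
    show "(norm (x - (1/m) *\<^sub>R F x))\<^sup>2 \<le> q\<^sup>2 * (norm x)\<^sup>2" for x
      using power_mono[OF m(5)[of x], of 2] by (simp add: power_mult_distrib)
    show "q\<^sup>2 < 1" using m by (simp add: power_less_one_iff)
  qed (auto simp: sadj_lin[OF F] algebra_simps)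
  then obtain u where "u = (1/m) *\<^sub>R y + (u - (1/m) *\<^sub>R F u)" by blast
  then have "(1/m) *\<^sub>R F u = (1/m) *\<^sub>R y" by (simp add: algebra_simps)
  then show ?thesis using m(1) by auto
qed

text \<open>Write F = m S^2 with a square root \<open>S\<close> that commutes with \<open>B\<close>;
  the product then becomes m times the form of \<open>B\<close> at \<open>S y\<close>.\<close>

lemma commuting_pos:
  fixes F :: "'a::{real_inner,complete_space} \<Rightarrow> 'a"
  assumes F: "sadj F" and a: "a > 0" "\<And>x. a * (norm x)\<^sup>2 \<le> F x \<bullet> x"
    and B: "sadj B" "\<And>x. 0 \<le> B x \<bullet> x" and com: "\<And>x. F (B x) = B (F x)"
  shows "0 \<le> F y \<bullet> B y"
proof -
  obtain m q where m: "m > 0" "0 \<le> q" "q < 1" "sadj (\<lambda>x. x - (1/m) *\<^sub>R F x)"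
    "\<And>x. norm (x - (1/m) *\<^sub>R F x) \<le> q * norm x"
    using sadj_pos_normalise[OF F a] by blast
  obtain S where S: "sadj S" "\<And>x. S (S x) = x - (x - (1/m) *\<^sub>R F x)"
    "\<And>C x. bounded_linear C \<Longrightarrow> (\<And>x. C (x - (1/m) *\<^sub>R F x) = C x - (1/m) *\<^sub>R F (C x)) \<Longrightarrow> C (S x) = S (C x)"
    using sadj_sqrt[OF m(4) m(5) m(2,3)] by metis
  have BS: "B (S x) = S (B x)" for x
    using sadjD(1)[OF B(1)] by (rule S(3)) (simp add: sadj_lin[OF B(1)] com)
  have "F y = m *\<^sub>R S (S y)" using m(1) S(2)[of y] by simp
  then have "F y \<bullet> B y = m * (S y \<bullet> B (S y))" using sadjD(2)[OF S(1)] by (simp add: BS)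
  also have "\<dots> \<ge> 0" using B(2)[of "S y"] m(1) by (simp add: inner_commute)
  finally show ?thesis .
qed

text \<open>\<open>U = F \<bar>F\<bar>\<^sup>-\<^sup>1\<close>, where \<open>\<bar>F\<bar> = m S\<close> in the proof.\<close>

lemma sadj_sign:
  fixes F :: "'a::{real_inner,complete_space} \<Rightarrow> 'a"
  assumes F: "sadj F" and a: "a > 0" "\<And>x. a * norm x \<le> norm (F x)"
  obtains U c where "sadj U" "\<And>x. U (U x) = x" "c > 0" "\<And>x. c * (norm x)\<^sup>2 \<le> F (U x) \<bullet> x"
    "\<And>C x. bounded_linear C \<Longrightarrow> (\<And>x. C (F x) = F (C x)) \<Longrightarrow> C (U x) = U (C x)"
proof -
  obtain m0 where m0: "m0 > 0" "\<And>x. norm (F x) \<le> m0 * norm x" using sadj_bound[OF F] by blast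
  define m where "m = max m0 a"
  have m: "m > 0" "a \<le> m" "\<And>x. norm (F x) \<le> m * norm x"
    using m0 unfolding m_def by (auto intro!: order_trans[OF m0(2)] mult_right_mono)
  \<comment> \<open>The two bounds on \<open>F\<close> give \<open>X\<close> a norm of at most 1 -
    a^2/m^2, so the square root of 1 - X = F^2/m^2 is available.\<close>
  define X where "X x = x - (1/m\<^sup>2) *\<^sub>R F (F x)" for x
  define q where "q = 1 - a\<^sup>2/m\<^sup>2"
  have "sadj (\<lambda>x. F (F x))" by (rule sadj_comp[OF F F]) simp
  then have sX: "sadj X" unfolding X_def by (intro sadj_diff sadj_id sadj_scale)
  have q: "0 \<le> q" "q < 1" using m a by (auto simp: q_def power_mono)
  have "\<bar>X x \<bullet> x\<bar> \<le> q * (norm x)\<^sup>2" for x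
  proof -
    have e: "X x \<bullet> x = (norm x)\<^sup>2 - (norm (F x))\<^sup>2 / m\<^sup>2"
      unfolding X_def using sadjD(2)[OF F, of "F x" x] by (simp add: inner_diff_left dot_square_norm)
    have "(norm (F x))\<^sup>2 \<le> m\<^sup>2 * (norm x)\<^sup>2" using power_mono[OF m(3)[of x], of 2] by (simp add: power_mult_distrib)
    moreover have "a\<^sup>2 * (norm x)\<^sup>2 \<le> (norm (F x))\<^sup>2"
      using power_mono[OF a(2)[of x], of 2] a(1) by (simp add: power_mult_distrib)
    ultimately have "(norm (F x))\<^sup>2 / m\<^sup>2 \<le> (norm x)\<^sup>2" "a\<^sup>2 / m\<^sup>2 * (norm x)\<^sup>2 \<le> (norm (F x))\<^sup>2 / m\<^sup>2"
      using m(1) by (auto simp: field_simps)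
    then show ?thesis unfolding e q_def by (simp add: algebra_simps)
  qed
  then have nX: "norm (X x) \<le> q * norm x" for x using sadj_norm_le[OF sX] by blast
  obtain S where S: "sadj S" "\<And>x. S (S x) = x - X x" "\<And>x. (1 - q) * (norm x)\<^sup>2 \<le> S x \<bullet> x"
    and comS: "\<And>C x. bounded_linear C \<Longrightarrow> (\<And>x. C (X x) = X (C x)) \<Longrightarrow> C (S x) = S (C x)"
    using sadj_sqrt[OF sX nX q] by blast
  have SS: "S (S x) = (1/m\<^sup>2) *\<^sub>R F (F x)" for x unfolding S(2) X_def by simp
  have inj: "S x = S y \<Longrightarrow> x = y" for x y
    using S(3)[of "x - y"] q by (simp add: sadj_lin[OF S(1)] mult_le_0_iff)
  have surj: "\<exists>x. S x = y" for y using q(2) by (intro sadj_pos_surj[OF S(1) _ S(3)]) simp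
  obtain Z where Z: "\<And>y. S (Z y) = y" using surj by metis
  have ZS: "Z (S x) = x" for x using inj Z by blast
  have Zadd: "Z (x + y) = Z x + Z y" for x y by (rule inj) (simp add: Z sadj_lin[OF S(1)])
  have Zsc: "Z (c *\<^sub>R x) = c *\<^sub>R Z x" for c x by (rule inj) (simp add: Z sadj_lin[OF S(1)])
  have nZ: "norm (Z x) \<le> (1 / (1 - q)) * norm x" for x
  proof (cases "Z x = 0")
    case False
    have "(1 - q) * (norm (Z x))\<^sup>2 \<le> norm x * norm (Z x)"
      using S(3)[of "Z x"] norm_cauchy_schwarz[of x "Z x"] by (simp add: Z)
    then have "((1 - q) * norm (Z x)) * norm (Z x) \<le> norm x * norm (Z x)"
      by (simp add: power2_eq_square mult.assoc)
    then have "(1 - q) * norm (Z x) \<le> norm x" using False by simp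
    then show ?thesis using q by (simp add: field_simps)
  qed (use q in simp)
  have sZ: "sadj Z" unfolding sadj_def
  proof (intro conjI allI)
    show "bounded_linear Z" using Zadd Zsc nZ by (rule linear_bound_bounded_linear)
    show "Z x \<bullet> y = x \<bullet> Z y" for x y using sadjD(2)[OF S(1), of "Z x" "Z y"] by (simp add: Z)
  qed
  have comZ: "C (Z x) = Z (C x)" if "bounded_linear C" "\<And>x. C (F x) = F (C x)" for C x
  proof (rule inj)
    have "C (X x) = X (C x)" for x
      unfolding X_def by (simp add: linear_simps[OF that(1)] that(2))
    then show "S (C (Z x)) = S (Z (C x))" using comS[OF that(1), of "Z x"] by (simp add: Z)
  qed
  have FZ: "F (Z x) = Z (F x)" for x using comZ[OF sadjD(1)[OF F]] by simp
  define U where "U x = (1/m) *\<^sub>R F (Z x)" for x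
  have FU: "F (U x) = m *\<^sub>R S x" for x
  proof -
    have "F (U x) = (1/m) *\<^sub>R F (F (Z x))" unfolding U_def by (simp add: sadj_lin[OF F])
    also have "F (F (Z x)) = m\<^sup>2 *\<^sub>R S (S (Z x))" using m(1) by (simp add: SS)
    finally show ?thesis using m(1) by (simp add: Z power2_eq_square)
  qed
  show thesis
  proof
    show "sadj U" unfolding U_def by (rule sadj_scale[OF sadj_comp[OF F sZ FZ]])
    show "U (U x) = x" for x
    proof -
      have "U (U x) = (1/m) *\<^sub>R Z (F (U x))" by (simp add: U_def[of "U x"] FZ)
      then show ?thesis using m(1) by (simp add: FU ZS Zsc)
    qed
    show "m * (1 - q) > 0" using m q by simp
    show "m * (1 - q) * (norm x)\<^sup>2 \<le> F (U x) \<bullet> x" for x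
      using S(3)[of x] m(1) by (simp add: FU mult.assoc)
    show "C (U x) = U (C x)" if "bounded_linear C" "\<And>x. C (F x) = F (C x)" for C x
      unfolding U_def using comZ[OF that] by (simp add: linear_simps[OF that(1)] that(2))
  qed
qed

text \<open>Hellinger--Toeplitz: the inverse is symmetric and defined everywhere, so its sublevel sets are
  closed and Baire's theorem applies.\<close>

lemma sadj_bij_bounded_below:
  fixes F :: "'a::{real_inner,complete_space} \<Rightarrow> 'a"
  assumes F: "sadj F" and inj: "\<And>x. F x = 0 \<Longrightarrow> x = 0" and surj: "\<And>y. \<exists>x. F x = y"
  obtains a where "a > 0" "\<And>x. a * norm x \<le> norm (F x)"
proof -
  obtain S where S: "\<And>y. F (S y) = y" using surj by metis
  have inj': "F x = F y \<Longrightarrow> x = y" for x y using inj[of "x - y"] by (simp add: sadj_lin[OF F])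
  have SF: "S (F x) = x" for x using inj' S by blast
  have Sdiff: "S (x - y) = S x - S y" for x y by (rule inj') (simp add: S sadj_lin[OF F])
  have Ssc: "S (c *\<^sub>R x) = c *\<^sub>R S x" for c x by (rule inj') (simp add: S sadj_lin[OF F])
  have sym: "S x \<bullet> y = x \<bullet> S y" for x y using sadjD(2)[OF F, of "S x" "S y"] by (simp add: S)
  define E where "E n = {x. norm (S x) \<le> real n}" for n
  have E_eq: "E n = (\<Inter>y\<in>cball 0 1. {x. x \<bullet> S y \<le> real n})" for n
  proof (intro set_eqI iffI)
    fix x assume x: "x \<in> E n"
    have "x \<bullet> S y \<le> real n" if "norm y \<le> 1" for y
    proof -
      have "x \<bullet> S y \<le> norm (S x) * norm y" using norm_cauchy_schwarz[of "S x" y] by (simp add: sym)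
      also have "\<dots> \<le> norm (S x)" using that by (simp add: mult_left_le)
      finally show ?thesis using x by (simp add: E_def)
    qed
    then show "x \<in> (\<Inter>y\<in>cball 0 1. {x. x \<bullet> S y \<le> real n})" by simp
  next
    fix x assume x: "x \<in> (\<Inter>y\<in>cball 0 1. {x. x \<bullet> S y \<le> real n})"
    have "norm (S x) \<le> real n"
    proof (cases "S x = 0")
      case False
      have "S x \<bullet> ((1 / norm (S x)) *\<^sub>R S x) = norm (S x)"
        using False by (simp add: dot_square_norm power2_eq_square)
      moreover have "S x \<bullet> ((1 / norm (S x)) *\<^sub>R S x) \<le> real n"
        using x False unfolding sym by simp
      ultimately show ?thesis by simp
    qed simp
    then show "x \<in> E n" by (simp add: E_def)
  qed
  have clE: "closed (E n)" for n
    unfolding E_eq by (intro closed_INT ballI closed_Collect_le continuous_intros)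
  have "\<exists>n. interior (E n) \<noteq> {}"
  proof (rule ccontr)
    assume "\<nexists>n. interior (E n) \<noteq> {}"
    then have "(euclidean :: 'a topology) interior_of \<Union>(range E) = {}"
      using clE by (intro Baire_category_alt) (auto simp: completely_metrizable_space_euclidean closed_closedin[symmetric])
    moreover have "\<Union>(range E) = UNIV" using real_arch_simple by (auto simp: E_def)
    ultimately show False by simp
  qed
  then obtain n x0 e where e: "e > 0" "cball x0 e \<subseteq> E n"
    by (metis ex_in_conv mem_interior_cball)
  have bnd: "norm (S x) \<le> (2 * real n / e) * norm x" for x
  proof (cases "x = 0")
    case True then show ?thesis using Ssc[of 0 0] by simp
  next
    case False
    define y where "y = (e / norm x) *\<^sub>R x"
    have "x0 + y \<in> E n" "x0 \<in> E n" using e False by (auto simp: y_def dist_norm intro!: subsetD[OF e(2)])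
    then have "norm (S y) \<le> 2 * real n"
      using Sdiff[of "x0 + y" x0] norm_triangle_ineq4[of "S (x0 + y)" "S x0"] by (simp add: E_def)
    then show ?thesis using False e(1) by (simp add: y_def Ssc field_simps)
  qed
  define K where "K = 2 * real n / e + 1"
  have K: "K > 0" using e(1) by (simp add: K_def add_nonneg_pos)
  have "(1 / K) * norm x \<le> norm (F x)" for x
  proof -
    have "norm x \<le> (2 * real n / e) * norm (F x)" using bnd[of "F x"] by (simp add: SF)
    also have "\<dots> \<le> K * norm (F x)" unfolding K_def by (intro mult_right_mono) auto
    finally show ?thesis using K by (simp add: field_simps)
  qed
  then show thesis using that[of "1 / K"] K by simp
qed

lemma closed_subspace_projector:
  fixes V :: "'a::{real_inner,complete_space} set"
  assumes V: "subspace V" "closed V"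
  obtains P where "sadj P" "\<And>x. P x \<in> V" "\<And>x. x \<in> V \<Longrightarrow> P x = x" "\<And>x v. v \<in> V \<Longrightarrow> (x - P x) \<bullet> v = 0"
proof -
  interpret I: bform UNIV "(\<bullet>) :: 'a \<Rightarrow> 'a \<Rightarrow> real" by (rule bform_inner)
  have "\<exists>v\<in>V. \<forall>w\<in>V. (x - v) \<bullet> w = 0" for x
  proof (rule I.projection[OF _ V(1)])
    fix f :: "nat \<Rightarrow> 'a" assume fV: "\<And>n. f n \<in> V"
      and c: "\<And>e. e > 0 \<Longrightarrow> \<exists>N::nat. \<forall>m\<ge>N. \<forall>n\<ge>N. (f m - f n) \<bullet> (f m - f n) < e"
    have "Cauchy f"
    proof (rule metric_CauchyI)
      fix e :: real assume "e > 0"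
      then obtain N where N: "\<forall>m\<ge>N. \<forall>n\<ge>N. (f m - f n) \<bullet> (f m - f n) < e\<^sup>2" using c[of "e\<^sup>2"] by auto
      then have "\<forall>m\<ge>N. \<forall>n\<ge>N. dist (f m) (f n) < e"
        using \<open>e > 0\<close> by (auto simp: dot_square_norm dist_norm intro: power2_less_imp_less)
      then show "\<exists>M. \<forall>m\<ge>M. \<forall>n\<ge>M. dist (f m) (f n) < e" by blast
    qed
    then obtain v where v: "f \<longlonglongrightarrow> v" using Cauchy_convergent convergent_def by blast
    have "v \<in> V" using closed_sequentially[OF V(2)] fV v by blast
    moreover have "(\<lambda>n. (f n - v) \<bullet> (f n - v)) \<longlonglongrightarrow> (v - v) \<bullet> (v - v)" by (intro tendsto_intros v)
    ultimately show "\<exists>v\<in>V. (\<lambda>n. (f n - v) \<bullet> (f n - v)) \<longlonglongrightarrow> 0" by auto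
  qed auto
  then obtain P where P: "\<And>x. P x \<in> V" "\<And>x w. w \<in> V \<Longrightarrow> (x - P x) \<bullet> w = 0" by metis
  have uniq: "P x = v" if "v \<in> V" "\<And>w. w \<in> V \<Longrightarrow> (x - v) \<bullet> w = 0" for x v
  proof -
    have d: "P x - v \<in> V" using P that V subspace_diff by blast
    have "(P x - v) \<bullet> (P x - v) = (x - v) \<bullet> (P x - v) - (x - P x) \<bullet> (P x - v)"
      by (simp add: inner_diff_left)
    then show ?thesis using P(2)[OF d] that(2)[OF d] by simp
  qed
  have add: "P (x + y) = P x + P y" for x y
    using P V by (intro uniq) (auto simp: subspace_add add_diff_add inner_add_left)
  have sc: "P (c *\<^sub>R x) = c *\<^sub>R P x" for c x
    using P V by (intro uniq) (auto simp: subspace_scale scaleR_diff_right[symmetric])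
  have PP: "P x \<bullet> y = P x \<bullet> P y" for x y using P(2)[OF P(1), of y x] by (simp add: inner_diff_left inner_diff_right inner_commute)
  have nP: "norm (P x) \<le> 1 * norm x" for x
  proof (cases "P x = 0")
    case False
    have "(norm (P x))\<^sup>2 = P x \<bullet> x" using PP[of x x] by (simp add: dot_square_norm)
    also have "\<dots> \<le> norm (P x) * norm x" by (rule norm_cauchy_schwarz)
    finally show ?thesis using False by (simp add: power2_eq_square)
  qed simp
  show thesis
  proof
    show "sadj P" unfolding sadj_def
    proof (intro conjI allI)
      show "bounded_linear P" using add sc nP by (rule linear_bound_bounded_linear)
      show "P x \<bullet> y = x \<bullet> P y" for x y using PP[of x y] PP[of y x] by (simp add: inner_commute)
    qed
    show "P x = x" if "x \<in> V" for x using that by (intro uniq) auto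
  qed (use P in auto)
qed

text \<open>By the bounds on \<open>A\<close> the ranges of \<open>P\<close> and \<open>Q\<close> have a positive angle.\<close>

lemma sum_of_kernels:
  fixes A :: "'a::{real_inner,complete_space} \<Rightarrow> 'a"
  assumes P: "sadj P" "\<And>x. P (P x) = P x" and Q: "sadj Q" "\<And>x. Q (Q x) = Q x"
    and A: "sadj A" "\<And>x. A (Q x) = Q (A x)" "\<And>x. norm (A x) \<le> K * norm x"
    and AQ: "\<And>x. a * (norm (Q x))\<^sup>2 \<le> A (Q x) \<bullet> Q x"
    and AP: "\<And>x. A (P x) \<bullet> P x \<le> e * (norm (P x))\<^sup>2" and e: "e < a" "0 < a"
  shows "\<exists>u v. P u = 0 \<and> Q v = 0 \<and> h = u + v"
proof -
  have pyth: "(norm (x - R x))\<^sup>2 = (norm x)\<^sup>2 - (norm (R x))\<^sup>2" if "sadj R" "\<And>x. R (R x) = R x" for R and x :: 'a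
    using sadjD(2)[OF that(1), of x "R x"] sadjD(2)[OF that(1), of "R x" x]
    by (simp add: that(2) power2_norm_eq_inner inner_diff_left inner_diff_right inner_commute)
  have nP: "norm (P x) \<le> norm x" for x
    using pyth[OF P, of x] by (smt (verit) norm_ge_zero power2_le_imp_le zero_le_power2)
  have K: "K \<ge> 0 \<or> (\<forall>x::'a. x = 0)"
    using A(3) by (meson norm_ge_zero order_trans zero_le_mult_iff norm_le_zero_iff mult_nonneg_nonpos2 linorder_le_cases zero_less_norm_iff)
  show ?thesis
  proof (cases "\<forall>x::'a. x = 0")
    case True then show ?thesis by metis
  next
    case False
    then have K: "K \<ge> 0" using K by blast
    \<comment> \<open>On y in the range of \<open>P\<close>, split off \<open>Q y\<close>:
      \<open>A\<close> is at least \<open>a\<close> on the range of \<open>Q\<close> and at least -K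
      on its kernel, while it is at most \<open>e\<close> at y. This bounds the squared norm of
      \<open>Q y\<close> by \<open>q\<close> times that of y. The maximum with 0 covers negative
      \<open>e\<close>.\<close>
    define q where "q = (max 0 e + K) / (a + K)"
    have q: "0 \<le> q" "q < 1" using K e by (auto simp: q_def field_simps)
    have QP: "(norm (Q (P x)))\<^sup>2 \<le> q * (norm (P x))\<^sup>2" for x
    proof -
      define y where "y = P x"
      define z where "z = y - Q y"
      have Qz: "Q z = 0" by (simp add: z_def sadj_lin[OF Q(1)] Q(2))
      have "A z \<bullet> Q y = 0" using sadjD(2)[OF Q(1), of "A z" y] A(2)[of z] Qz sadj_lin(4)[OF A(1)] by simp
      then have "A y \<bullet> y = A (Q y) \<bullet> Q y + A z \<bullet> z"
        using sadjD(2)[OF A(1), of "Q y" z]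
        by (simp add: z_def sadj_lin[OF A(1)] inner_diff_left inner_diff_right inner_commute)
      moreover have "A z \<bullet> z \<ge> - K * (norm z)\<^sup>2"
      proof -
        have "\<bar>A z \<bullet> z\<bar> \<le> norm (A z) * norm z" by (rule Cauchy_Schwarz_ineq2)
        also have "\<dots> \<le> K * norm z * norm z" by (intro mult_right_mono A) auto
        finally show ?thesis by (simp add: power2_eq_square mult.assoc)
      qed
      moreover have "A y \<bullet> y \<le> max 0 e * (norm y)\<^sup>2"
        using AP[of x] mult_right_mono[of e "max 0 e" "(norm y)\<^sup>2"] by (simp add: y_def)
      ultimately have "a * (norm (Q y))\<^sup>2 - K * ((norm y)\<^sup>2 - (norm (Q y))\<^sup>2) \<le> max 0 e * (norm y)\<^sup>2"
        using AQ[of y] pyth[OF Q, of y] by (simp add: z_def)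
      then have "(a + K) * (norm (Q y))\<^sup>2 \<le> (max 0 e + K) * (norm y)\<^sup>2" by (simp add: algebra_simps)
      then show ?thesis using K e by (simp add: q_def y_def field_simps)
    qed
    define V where "V = {x. P x = x}"
    have V: "subspace V" "closed V"
      unfolding V_def subspace_def using sadjD(1)[OF P(1)]
      by (auto simp: sadj_lin[OF P(1)] intro!: closed_Collect_eq continuous_intros
          intro: bounded_linear.continuous_on)
    \<comment> \<open>A fixed point \<open>w\<close> satisfies P (w - Q w) = P h, so v = w - Q w
      lies in the kernel of \<open>Q\<close> and h - v in that of \<open>P\<close>.\<close>
    have "\<exists>u\<in>V. u = P h + P (Q u)"
    proof (rule neumann[OF V, where b = "\<lambda>x. (norm x)\<^sup>2" and c = 1 and C = 1 and q = q])
      show "(norm (P (Q x)))\<^sup>2 \<le> q * (norm x)\<^sup>2" if "x \<in> V" for x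
      proof -
        have "(norm (P (Q x)))\<^sup>2 \<le> (norm (Q x))\<^sup>2" by (intro power_mono nP) auto
        also have "\<dots> \<le> q * (norm x)\<^sup>2" using QP[of x] that by (simp add: V_def)
        finally show ?thesis .
      qed
    qed (use q in \<open>auto simp: V_def P(2) sadj_lin[OF P(1)] sadj_lin[OF Q(1)]\<close>)
    then obtain w where w: "P w = w" "w = P h + P (Q w)" unfolding V_def by blast
    define v where "v = w - Q w"
    have "Q v = 0" by (simp add: v_def sadj_lin[OF Q(1)] Q(2))
    moreover have "P v = P h" using w by (simp add: v_def sadj_lin[OF P(1)] algebra_simps)
    then have "P (h - v) = 0" by (simp add: sadj_lin[OF P(1)])
    ultimately show ?thesis by (intro exI[of _ "h - v"] exI[of _ v]) simp
  qed
qed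

context bform
begin

lemma sqrt_triangle:
  assumes nn: "\<And>v. v \<in> D \<Longrightarrow> 0 \<le> b v v" and xy: "x \<in> D" "y \<in> D"
  shows "sqrt (b (x + y) (x + y)) \<le> sqrt (b x x) + sqrt (b y y)"
proof -
  have "(b x y)\<^sup>2 \<le> b x x * b y y" using cauchy_schwarz[OF subD order_refl nn xy] .
  then have "b x y \<le> sqrt (b x x) * sqrt (b y y)"
    by (metis real_le_rsqrt real_sqrt_mult)
  then have "b (x + y) (x + y) \<le> (sqrt (b x x) + sqrt (b y y))\<^sup>2"
    using sq_add[OF xy] nn xy by (simp add: power2_sum)
  then show ?thesis using nn xy by (intro real_le_lsqrt) auto
qed

lemma sqrt_triangle_diff:
  assumes nn: "\<And>v. v \<in> D \<Longrightarrow> 0 \<le> b v v" and xy: "x \<in> D" "y \<in> D" "z \<in> D"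
  shows "sqrt (b (x - z) (x - z)) \<le> sqrt (b (x - y) (x - y)) + sqrt (b (y - z) (y - z))"
  using sqrt_triangle[OF nn, of "x - y" "y - z"] xy mem by simp

lemma sqrt_abs_diff:
  assumes nn: "\<And>v. v \<in> D \<Longrightarrow> 0 \<le> b v v" and xy: "x \<in> D" "y \<in> D"
  shows "\<bar>sqrt (b x x) - sqrt (b y y)\<bar> \<le> sqrt (b (x - y) (x - y))"
proof -
  have "sqrt (b x x) \<le> sqrt (b (x - y) (x - y)) + sqrt (b y y)"
    using sqrt_triangle[OF nn, of "x - y" y] xy mem by simp
  moreover have "sqrt (b y y) \<le> sqrt (b (y - x) (y - x)) + sqrt (b x x)"
    using sqrt_triangle[OF nn, of "y - x" x] xy mem by simp
  moreover have "b (y - x) (y - x) = b (x - y) (x - y)"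
    using neg_l[of "x - y" "y - x"] neg_r[of "x - y" "x - y"] xy mem by simp
  ultimately show ?thesis by simp
qed

end

section \<open>Self-adjoint operators\<close>

locale sa_op =
  fixes J :: "'h::{real_inner,complete_space} \<Rightarrow> 'h" and A :: "'h lop"
  assumes J: "cplx_struct J" and sa: "self_adjoint J A"
begin

abbreviation "dm \<equiv> fst A"
abbreviation "T \<equiv> snd A"

lemma J_lin: "J (x + y) = J x + J y" "J (x - y) = J x - J y" "J (c *\<^sub>R x) = c *\<^sub>R J x" "J 0 = 0" "J (- x) = - J x"
proof -
  have "linear J" using J by (simp add: cplx_struct_def)
  then show "J (x + y) = J x + J y" "J (x - y) = J x - J y" "J (c *\<^sub>R x) = c *\<^sub>R J x" "J 0 = 0" "J (- x) = - J x"
    by (auto simp: linear_add linear_diff linear_scale linear_0 linear_neg)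
qed

lemma JJ: "J (J x) = - x"
  using J by (simp add: cplx_struct_def)

lemma J_inner: "J x \<bullet> J y = x \<bullet> y"
  using J by (simp add: cplx_struct_def)

lemma J_skew: "J x \<bullet> y = - (x \<bullet> J y)"
  using J_inner[of x "J y"] by (simp add: JJ)

lemma J_self: "J x \<bullet> x = 0"
  using J_skew[of x x] by (simp add: inner_commute)

lemma J_norm: "norm (J x) = norm x"
  using J_inner[of x x] by (simp add: norm_eq_sqrt_inner)

lemma J_bounded_linear: "bounded_linear J"
  by (rule linear_bound_bounded_linear[where K = 1]) (auto simp: J_lin J_norm)

lemma dom_subspace: "subspace dm"
  using sa by (simp add: self_adjoint_def csubspace_def)

lemma dom_closed: "x \<in> dm \<Longrightarrow> y \<in> dm \<Longrightarrow> x + y \<in> dm" "x \<in> dm \<Longrightarrow> y \<in> dm \<Longrightarrow> x - y \<in> dm"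
  "x \<in> dm \<Longrightarrow> c *\<^sub>R x \<in> dm" "x \<in> dm \<Longrightarrow> - x \<in> dm" "0 \<in> dm" "x \<in> dm \<Longrightarrow> J x \<in> dm"
proof -
  show "x \<in> dm \<Longrightarrow> J x \<in> dm" using sa unfolding self_adjoint_def csubspace_def by blast
qed (use dom_subspace in \<open>auto simp: subspace_add subspace_diff subspace_scale subspace_neg subspace_0\<close>)

lemma T_lin:
  shows T_add: "x \<in> dm \<Longrightarrow> y \<in> dm \<Longrightarrow> T (x + y) = T x + T y"
    and T_scale: "x \<in> dm \<Longrightarrow> T (c *\<^sub>R x) = c *\<^sub>R T x"
    and T_J: "x \<in> dm \<Longrightarrow> T (J x) = J (T x)"
  using sa unfolding self_adjoint_def by blast+

lemma T_neg: "x \<in> dm \<Longrightarrow> T (- x) = - T x"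
  using T_scale[of x "-1"] by simp

lemma T_diff: "x \<in> dm \<Longrightarrow> y \<in> dm \<Longrightarrow> T (x - y) = T x - T y"
  using T_add[of x "- y"] T_neg[of y] dom_closed by simp

lemma T_zero: "T 0 = 0"
  using T_scale[of 0 0] dom_closed by simp

lemma T_sym: "x \<in> dm \<Longrightarrow> y \<in> dm \<Longrightarrow> T x \<bullet> y = x \<bullet> T y"
  using sa unfolding self_adjoint_def by blast

lemma ker_subspace: "subspace (ker A)"
  by (rule subspaceI) (auto simp: ker_def dom_closed T_zero T_add T_scale)

lemma dense_zero:
  assumes "\<And>x. x \<in> dm \<Longrightarrow> x \<bullet> z = 0"
  shows "z = 0"
proof -
  have "z \<in> closure dm" using sa by (simp add: self_adjoint_def)
  then obtain f where f: "\<And>n. f n \<in> dm" "f \<longlonglongrightarrow> z" unfolding closure_sequential by blast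
  have "(\<lambda>n. f n \<bullet> z) \<longlonglongrightarrow> z \<bullet> z" by (intro tendsto_intros f)
  then show ?thesis using assms f(1) by (simp add: LIMSEQ_const_iff)
qed

text \<open>Self-adjointness is encoded as equality of the domain with that of the adjoint; the
  value follows because the domain is dense.\<close>

lemma adjointI:
  assumes "\<And>x. x \<in> dm \<Longrightarrow> T x \<bullet> y = x \<bullet> z"
  shows "y \<in> dm" "T y = z"
proof -
  show y: "y \<in> dm" using assms sa unfolding self_adjoint_def by blast
  have "x \<bullet> (T y - z) = 0" if "x \<in> dm" for x
    using assms[OF that] T_sym[OF that y] by (simp add: inner_diff_right)
  then show "T y = z" using dense_zero[of "T y - z"] by simp
qed

lemma T_closed:
  assumes "\<And>n. f n \<in> dm" "f \<longlonglongrightarrow> x" "(\<lambda>n. T (f n)) \<longlonglongrightarrow> y"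
  shows "x \<in> dm" "T x = y"
proof -
  have "T z \<bullet> x = z \<bullet> y" if z: "z \<in> dm" for z
  proof (rule LIMSEQ_unique)
    show "(\<lambda>n. T z \<bullet> f n) \<longlonglongrightarrow> T z \<bullet> x" by (intro tendsto_intros assms)
    have "(\<lambda>n. z \<bullet> T (f n)) \<longlonglongrightarrow> z \<bullet> y" by (intro tendsto_intros assms)
    then show "(\<lambda>n. T z \<bullet> f n) \<longlonglongrightarrow> z \<bullet> y" using T_sym[OF z assms(1)] by simp
  qed
  then show "x \<in> dm" "T x = y" using adjointI by blast+
qed

text \<open>The lower bound on \<open>V\<close> makes the preimages of a convergent sequence Cauchy,
  and \<open>T\<close> is closed. With \<open>V\<close> the whole space this serves resolvents, with
  \<open>V\<close> of finite codimension the essential spectrum.\<close>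

lemma perturbed_range_closed:
  assumes C: "bounded_linear C" and a: "a > 0" and V: "subspace V" "closed V"
    and low: "\<And>x. x \<in> dm \<Longrightarrow> x \<in> V \<Longrightarrow> a * norm x \<le> norm (T x + C x)"
  shows "closed ((\<lambda>x. T x + C x) ` (dm \<inter> V))"
  unfolding closed_sequential_limits
proof (intro allI impI, elim conjE)
  fix g y assume g: "\<forall>n. g n \<in> (\<lambda>x. T x + C x) ` (dm \<inter> V)" and lim: "g \<longlonglongrightarrow> y"
  then have "\<forall>n. \<exists>x. x \<in> dm \<inter> V \<and> g n = T x + C x" by blast
  then obtain f where f: "\<And>n. f n \<in> dm" "\<And>n. f n \<in> V" "\<And>n. g n = T (f n) + C (f n)" by (metis IntE)
  have d: "a * norm (f m - f n) \<le> norm (g m - g n)" for m n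
    using low[of "f m - f n"] f V dom_closed subspace_diff[of V]
    by (simp add: T_diff linear_simps[OF C] algebra_simps)
  have "Cauchy g" using lim convergent_Cauchy convergentI by blast
  have "Cauchy f"
  proof (rule metric_CauchyI)
    fix e :: real assume "e > 0"
    then obtain M where M: "\<forall>m\<ge>M. \<forall>n\<ge>M. dist (g m) (g n) < a * e"
      using metric_CauchyD[OF \<open>Cauchy g\<close>, of "a * e"] a by auto
    have "dist (f m) (f n) < e" if "m \<ge> M" "n \<ge> M" for m n
    proof -
      have "a * norm (f m - f n) < a * e" using d[of m n] M that by (simp add: dist_norm) (meson le_less_trans)
      then show ?thesis using a by (simp add: dist_norm)
    qed
    then show "\<exists>M. \<forall>m\<ge>M. \<forall>n\<ge>M. dist (f m) (f n) < e" by blast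
  qed
  then obtain x where x: "f \<longlonglongrightarrow> x" using Cauchy_convergent convergent_def by blast
  have "(\<lambda>n. g n - C (f n)) \<longlonglongrightarrow> y - C x"
    by (intro tendsto_intros lim bounded_linear.tendsto[OF C x])
  then have "(\<lambda>n. T (f n)) \<longlonglongrightarrow> y - C x" by (simp add: f(3))
  then have "x \<in> dm" "T x = y - C x" using T_closed[OF f(1) x] by auto
  moreover have "x \<in> V" using closed_sequentially[OF V(2)] f(2) x by blast
  ultimately show "y \<in> (\<lambda>x. T x + C x) ` (dm \<inter> V)" by (intro image_eqI[of _ _ x]) auto
qed

lemma perturbed_range_subspace:
  assumes C: "bounded_linear C" and V: "subspace V"
  shows "subspace ((\<lambda>x. T x + C x) ` (dm \<inter> V))"
proof (rule subspaceI)
  have "(\<lambda>x. T x + C x) 0 = 0" using T_zero linear_simps(3)[OF C] by simp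
  then show "0 \<in> (\<lambda>x. T x + C x) ` (dm \<inter> V)"
    using V by (intro image_eqI[of _ _ 0]) (auto simp: dom_closed subspace_0)
next
  fix x y assume "x \<in> (\<lambda>x. T x + C x) ` (dm \<inter> V)" "y \<in> (\<lambda>x. T x + C x) ` (dm \<inter> V)"
  then obtain u v where uv: "u \<in> dm" "u \<in> V" "v \<in> dm" "v \<in> V" "x = T u + C u" "y = T v + C v" by blast
  then show "x + y \<in> (\<lambda>x. T x + C x) ` (dm \<inter> V)"
    using V by (intro image_eqI[of _ _ "u + v"]) (auto simp: T_add linear_simps[OF C] dom_closed subspace_add)
next
  fix c x assume "x \<in> (\<lambda>x. T x + C x) ` (dm \<inter> V)"
  then obtain u where uv: "u \<in> dm" "u \<in> V" "x = T u + C u" by blast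
  then show "c *\<^sub>R x \<in> (\<lambda>x. T x + C x) ` (dm \<inter> V)"
    using V by (intro image_eqI[of _ _ "c *\<^sub>R u"]) (auto simp: T_scale linear_simps[OF C] dom_closed subspace_scale algebra_simps)
qed

text \<open>The range is closed, and a vector orthogonal to it is annihilated by the adjoint T + C',
  which is bounded below as well. The pair C, C' is -J, J for the resolvent at the imaginary unit
  and s, s for the one at -s.\<close>

lemma perturbed_surj:
  assumes C: "bounded_linear C" "\<And>x y. C x \<bullet> y = x \<bullet> C' y" and a: "a > 0"
    and low: "\<And>x. x \<in> dm \<Longrightarrow> a * norm x \<le> norm (T x + C x)"
    and low': "\<And>x. x \<in> dm \<Longrightarrow> a * norm x \<le> norm (T x + C' x)"
  shows "\<exists>x\<in>dm. T x + C x = y"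
proof -
  let ?R = "(\<lambda>x. T x + C x) ` (dm \<inter> UNIV)"
  have R: "subspace ?R" "closed ?R"
    using perturbed_range_subspace[OF C(1), of UNIV] perturbed_range_closed[OF C(1) a, of UNIV] low by auto
  obtain P where P: "\<And>x. P x \<in> ?R" "\<And>x v. v \<in> ?R \<Longrightarrow> (x - P x) \<bullet> v = 0"
    using closed_subspace_projector[OF R] by metis
  define w where "w = y - P y"
  have "T x \<bullet> w = x \<bullet> (- C' w)" if "x \<in> dm" for x
  proof -
    have "T x + C x \<in> ?R" using that by blast
    then have "w \<bullet> (T x + C x) = 0" using P(2) unfolding w_def by blast
    then show ?thesis using C(2)[of x w] by (simp add: inner_add_right inner_commute)
  qed
  then have "w \<in> dm" "T w = - C' w" using adjointI by blast+
  then have "w = 0" using low'[of w] a by (simp add: mult_le_0_iff)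
  then show ?thesis using P(1)[of y] unfolding w_def by auto
qed

text \<open>\<open>J x\<close> is orthogonal to \<open>T x\<close>, because \<open>T\<close> is
  symmetric and commutes with the skew operator \<open>J\<close>; so Pythagoras applies.\<close>

lemma res_low: "x \<in> dm \<Longrightarrow> norm x \<le> norm (T x - J x)" "x \<in> dm \<Longrightarrow> norm x \<le> norm (T x + J x)"
proof -
  assume x: "x \<in> dm"
  have "T x \<bullet> J x = 0"
    using T_sym[OF x dom_closed(6)[OF x]] T_J[OF x] J_skew[of x "T x"] by (simp add: inner_commute)
  then have "(norm (T x - J x))\<^sup>2 = (norm (T x))\<^sup>2 + (norm x)\<^sup>2" "(norm (T x + J x))\<^sup>2 = (norm (T x))\<^sup>2 + (norm x)\<^sup>2"
    by (simp_all add: power2_norm_eq_inner inner_diff_left inner_diff_right inner_add_left inner_add_right J_inner inner_commute)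
  then show "norm x \<le> norm (T x - J x)" "norm x \<le> norm (T x + J x)"
    using power2_le_imp_le[of "norm x" "norm (T x - J x)"] power2_le_imp_le[of "norm x" "norm (T x + J x)"] by simp_all
qed

abbreviation "R \<equiv> res_i J A"

lemma res_i: "R y \<in> dm" "T (R y) - J (R y) = y"
proof -
  have "\<exists>x\<in>dm. T x + - J x = y"
  proof (rule perturbed_surj[where C' = J and a = 1])
    show "bounded_linear (\<lambda>x. - J x)" using J_bounded_linear by (rule bounded_linear_minus)
  qed (auto simp: J_skew res_low)
  then obtain x where x: "x \<in> dm" "T x - J x = y" by auto
  have "R y \<in> dm \<and> T (R y) - J (R y) = y"
    unfolding res_i_def
  proof (rule theI)
    show "x \<in> dm \<and> T x - J x = y" using x by simp
    fix x' assume x': "x' \<in> dm \<and> T x' - J x' = y"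
    then have "norm (x' - x) \<le> norm ((T x' - J x') - (T x - J x))"
      using res_low(1)[of "x' - x"] x dom_closed by (simp add: T_diff J_lin algebra_simps)
    then show "x' = x" using x x' by simp
  qed
  then show "R y \<in> dm" "T (R y) - J (R y) = y" by auto
qed

lemma res_i_eq: "x \<in> dm \<Longrightarrow> R (T x - J x) = x"
proof -
  assume x: "x \<in> dm"
  let ?z = "R (T x - J x)"
  have "norm (?z - x) \<le> norm ((T ?z - J ?z) - (T x - J x))"
    using res_low(1)[of "?z - x"] x res_i(1)[of "T x - J x"] dom_closed by (simp add: T_diff J_lin algebra_simps)
  then show ?thesis using res_i(2)[of "T x - J x"] by simp
qed

lemma res_i_bounded_linear: "bounded_linear R"
proof (rule linear_bound_bounded_linear[where K = 1])
  fix x y c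
  show "R (x + y) = R x + R y"
    using res_i_eq[of "R x + R y"] res_i[of x] res_i[of y] by (simp add: dom_closed T_add J_lin) (metis add_diff_add)
  show "R (c *\<^sub>R x) = c *\<^sub>R R x"
    using res_i_eq[of "c *\<^sub>R R x"] res_i[of x] by (simp add: dom_closed T_scale J_lin) (metis scaleR_diff_right)
  show "norm (R x) \<le> 1 * norm x" using res_low(1)[OF res_i(1)[of x]] res_i(2)[of x] by simp
qed

end

section \<open>The form of a semibounded self-adjoint operator\<close>

text \<open>Polarisation of the quadratic form; on the complex side this is the real part of the
  sesquilinear form.\<close>

definition fb :: "'h::real_inner lop \<Rightarrow> 'h \<Rightarrow> 'h \<Rightarrow> real" where
  "fb A x y = (form_val A (x + y) - form_val A (x - y)) / 4"

text \<open>The normalisation is T + s >= 1 with s >= 1: the shifted form then dominates both the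
  squared norm and the form itself, and (T + s)^(-1) is a contraction.\<close>

locale sb_op = sa_op J A for J :: "'h::{real_inner,complete_space} \<Rightarrow> 'h" and A +
  fixes s :: real
  assumes s1: "1 \<le> s" and low: "x \<in> fst A \<Longrightarrow> (1 - s) * (norm x)\<^sup>2 \<le> snd A x \<bullet> x"
begin

definition q0 :: "'h \<Rightarrow> 'h \<Rightarrow> real" where "q0 x y = T x \<bullet> y + s * (x \<bullet> y)"

lemma bform_T: "bform dm (\<lambda>x y. T x \<bullet> y)"
proof
  show "T x \<bullet> y = T y \<bullet> x" if "x \<in> dm" "y \<in> dm" for x y
    using T_sym[OF that] by (simp add: inner_commute)
qed (auto simp: dom_subspace T_add T_scale inner_add_left)

lemma bform_q0: "bform dm q0"
  using bform_plus_inner[OF bform_T, of s] unfolding q0_def[abs_def] .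

sublocale Q0: bform dm q0 by (rule bform_q0)

lemma q0_ge: "x \<in> dm \<Longrightarrow> (norm x)\<^sup>2 \<le> q0 x x"
  using low[of x] by (simp add: q0_def dot_square_norm algebra_simps)

lemma q0_nn: "x \<in> dm \<Longrightarrow> 0 \<le> q0 x x"
  using q0_ge[of x] by (smt (verit) zero_le_power2)

abbreviation "n0 x \<equiv> sqrt (q0 x x)"

text \<open>The definition of \<open>form_seq\<close> tests the unshifted, possibly indefinite form.
  Along a norm-convergent sequence \<open>s\<close> times the squared norm of the differences
  vanishes, so this is the Cauchy property in the form norm.\<close>

lemma form_seq_iff:
  "form_seq A x f \<longleftrightarrow> (\<forall>n. f n \<in> dm) \<and> f \<longlonglongrightarrow> x \<and> (\<forall>e>0. \<exists>M. \<forall>m\<ge>M. \<forall>n\<ge>M. n0 (f m - f n) < e)"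
proof (cases "(\<forall>n. f n \<in> dm) \<and> f \<longlonglongrightarrow> x")
  case True
  then have fd: "f m - f n \<in> dm" for m n by (simp add: dom_closed(2))
  have cau: "Cauchy f" using True convergent_Cauchy convergentI by blast
  have "(\<forall>e>0. \<exists>M. \<forall>m\<ge>M. \<forall>n\<ge>M. \<bar>T (f m - f n) \<bullet> (f m - f n)\<bar> < e)
      \<longleftrightarrow> (\<forall>e>0. \<exists>M. \<forall>m\<ge>M. \<forall>n\<ge>M. n0 (f m - f n) < e)" (is "?L \<longleftrightarrow> ?R")
  proof
    assume L: ?L
    show ?R
    proof (intro allI impI)
      fix e :: real assume e: "e > 0"
      obtain M1 where M1: "\<forall>m\<ge>M1. \<forall>n\<ge>M1. \<bar>T (f m - f n) \<bullet> (f m - f n)\<bar> < e\<^sup>2 / 2" using L e by (metis half_gt_zero zero_less_power)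
      have "e / sqrt (2 * s) > 0" using e s1 by simp
      then obtain M2 where M2: "\<forall>m\<ge>M2. \<forall>n\<ge>M2. dist (f m) (f n) < e / sqrt (2 * s)"
        using metric_CauchyD[OF cau] by blast
      have "n0 (f m - f n) < e" if "m \<ge> max M1 M2" "n \<ge> max M1 M2" for m n
      proof -
        have "norm (f m - f n) < e / sqrt (2 * s)" using M2 that by (simp add: dist_norm)
        then have "(norm (f m - f n))\<^sup>2 < (e / sqrt (2 * s))\<^sup>2" by (intro power_strict_mono) auto
        also have "\<dots> = e\<^sup>2 / (2 * s)" using s1 by (simp add: power_divide)
        finally have "s * (norm (f m - f n))\<^sup>2 < e\<^sup>2 / 2" using s1 by (simp add: field_simps)
        moreover have "T (f m - f n) \<bullet> (f m - f n) < e\<^sup>2 / 2" using M1 that by (meson abs_ge_self le_less_trans max.boundedE)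
        ultimately have "q0 (f m - f n) (f m - f n) < e\<^sup>2" by (simp add: q0_def dot_square_norm)
        then show ?thesis using e by (intro real_less_lsqrt) auto
      qed
      then show "\<exists>M. \<forall>m\<ge>M. \<forall>n\<ge>M. n0 (f m - f n) < e" by blast
    qed
  next
    assume R: ?R
    show ?L
    proof (intro allI impI)
      fix e :: real assume e: "e > 0"
      \<comment> \<open>With this bound both \<open>q0\<close> and \<open>s\<close> times the
        squared norm of the difference lie in [0, e), and the unshifted form is the difference of
        these two numbers.\<close>
      then have "sqrt (e / s) > 0" using s1 by simp
      then obtain M where M: "\<forall>m\<ge>M. \<forall>n\<ge>M. n0 (f m - f n) < sqrt (e / s)" using R by blast
      have "\<bar>T (f m - f n) \<bullet> (f m - f n)\<bar> < e" if mn: "m \<ge> M" "n \<ge> M" for m n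
      proof -
        have "q0 (f m - f n) (f m - f n) < e / s" using M mn by simp
        then have *: "s * q0 (f m - f n) (f m - f n) < e" using s1 by (simp add: field_simps)
        have q: "q0 (f m - f n) (f m - f n) \<le> s * q0 (f m - f n) (f m - f n)"
          using s1 q0_nn[OF fd[of m n]] by (simp add: mult_le_cancel_right1)
        have "s * (norm (f m - f n))\<^sup>2 \<le> s * q0 (f m - f n) (f m - f n)"
          using q0_ge[OF fd[of m n]] s1 by (intro mult_left_mono) auto
        moreover have "0 \<le> s * (norm (f m - f n))\<^sup>2" using s1 by simp
        ultimately show ?thesis using * q q0_nn[OF fd[of m n]] by (simp add: q0_def dot_square_norm)
      qed
      then show "\<exists>M. \<forall>m\<ge>M. \<forall>n\<ge>M. \<bar>T (f m - f n) \<bullet> (f m - f n)\<bar> < e" by blast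
    qed
  qed
  then show ?thesis using True by (simp add: form_seq_def)
qed (auto simp: form_seq_def)

lemma form_seqD: "form_seq A x f \<Longrightarrow> f n \<in> dm" "form_seq A x f \<Longrightarrow> f \<longlonglongrightarrow> x"
  by (auto simp: form_seq_def)

lemma form_seq_add:
  assumes f: "form_seq A x f" and g: "form_seq A y g"
  shows "form_seq A (x + y) (\<lambda>n. f n + g n)"
  unfolding form_seq_iff
proof (intro conjI allI impI)
  show "f n + g n \<in> dm" for n using f g dom_closed by (simp add: form_seqD)
  show "(\<lambda>n. f n + g n) \<longlonglongrightarrow> x + y" using f g by (intro tendsto_add) (auto simp: form_seqD)
  fix e :: real assume "e > 0"
  then obtain M N where M: "\<forall>m\<ge>M. \<forall>n\<ge>M. n0 (f m - f n) < e/2" and N: "\<forall>m\<ge>N. \<forall>n\<ge>N. n0 (g m - g n) < e/2"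
    using f g unfolding form_seq_iff by (meson half_gt_zero)
  have "n0 (f m + g m - (f n + g n)) < e" if "m \<ge> max M N" "n \<ge> max M N" for m n
  proof -
    have d: "f m - f n \<in> dm" "g m - g n \<in> dm" using f g dom_closed by (auto simp: form_seqD)
    have "n0 ((f m - f n) + (g m - g n)) \<le> n0 (f m - f n) + n0 (g m - g n)"
      using Q0.sqrt_triangle[OF q0_nn d] .
    moreover have "n0 (f m - f n) < e/2" "n0 (g m - g n) < e/2" using M N that by auto
    ultimately show ?thesis by (simp add: add_diff_add)
  qed
  then show "\<exists>M. \<forall>m\<ge>M. \<forall>n\<ge>M. n0 (f m + g m - (f n + g n)) < e" by blast
qed

lemma form_seq_scale:
  assumes f: "form_seq A x f"
  shows "form_seq A (c *\<^sub>R x) (\<lambda>n. c *\<^sub>R f n)"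
  unfolding form_seq_iff
proof (intro conjI allI impI)
  show "c *\<^sub>R f n \<in> dm" for n using f dom_closed by (simp add: form_seqD)
  show "(\<lambda>n. c *\<^sub>R f n) \<longlonglongrightarrow> c *\<^sub>R x" using f by (intro tendsto_intros) (auto simp: form_seqD)
  fix e :: real assume "e > 0"
  then have "e / (\<bar>c\<bar> + 1) > 0" by simp
  then obtain M where M: "\<forall>m\<ge>M. \<forall>n\<ge>M. n0 (f m - f n) < e / (\<bar>c\<bar> + 1)"
    using f unfolding form_seq_iff by meson
  have "n0 (c *\<^sub>R f m - c *\<^sub>R f n) < e" if "m \<ge> M" "n \<ge> M" for m n
  proof -
    have d: "f m - f n \<in> dm" using f dom_closed by (auto simp: form_seqD)
    have "n0 (c *\<^sub>R f m - c *\<^sub>R f n) = \<bar>c\<bar> * n0 (f m - f n)"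
      using Q0.sq_scale[OF d, of c] by (simp add: scaleR_diff_right[symmetric] real_sqrt_mult)
    also have "\<dots> \<le> (\<bar>c\<bar> + 1) * n0 (f m - f n)" using q0_nn[OF d] by (intro mult_right_mono) auto
    also have "\<dots> < e" using M that by (simp add: field_simps)
    finally show ?thesis .
  qed
  then show "\<exists>M. \<forall>m\<ge>M. \<forall>n\<ge>M. n0 (c *\<^sub>R f m - c *\<^sub>R f n) < e" by blast
qed

lemma form_seq_diff:
  assumes "form_seq A x f" "form_seq A y g"
  shows "form_seq A (x - y) (\<lambda>n. f n - g n)"
  using form_seq_add[OF assms(1) form_seq_scale[OF assms(2), of "-1"]] by simp

lemma form_seq_const: "x \<in> dm \<Longrightarrow> form_seq A x (\<lambda>_. x)"
  by (auto simp: form_seq_def T_zero)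

lemma form_seq_J:
  assumes f: "form_seq A x f"
  shows "form_seq A (J x) (\<lambda>n. J (f n))"
proof -
  have fd: "f m - f n \<in> dm" for m n using f dom_closed by (auto simp: form_seqD)
  have "T (J (f m) - J (f n)) \<bullet> (J (f m) - J (f n)) = T (f m - f n) \<bullet> (f m - f n)" for m n
    using T_J[OF fd[of m n]] J_inner by (simp add: J_lin(2)[symmetric])
  then show ?thesis
    using f bounded_linear.tendsto[OF J_bounded_linear, of f x] by (auto simp: form_seq_def dom_closed)
qed

text \<open>This is closability. The value at \<open>f n\<close> splits as q0 (f n) (f n - f m) + q0
  (f n) (f m): the first term is at most n0 (f n) times e/2 by Cauchy-Schwarz, the second tends to 0
  as m grows, since \<open>f n\<close> is in the operator domain and \<open>f m\<close> tends to 0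
  in norm.\<close>

lemma form_seq_null:
  assumes f: "form_seq A 0 f"
  shows "(\<lambda>n. n0 (f n)) \<longlonglongrightarrow> 0"
proof (rule LIMSEQ_I)
  fix e :: real assume e: "e > 0"
  then obtain M where M: "\<forall>m\<ge>M. \<forall>n\<ge>M. n0 (f m - f n) < e/2"
    using f unfolding form_seq_iff by (meson half_gt_zero)
  have "n0 (f n) < e" if n: "n \<ge> M" for n
  proof -
    have d: "f m \<in> dm" for m using f by (simp add: form_seqD)
    have "(\<lambda>m. q0 (f n) (f m)) \<longlonglongrightarrow> T (f n) \<bullet> 0 + s * (f n \<bullet> 0)"
      unfolding q0_def by (intro tendsto_intros form_seqD(2)[OF f])
    then have l: "(\<lambda>m. q0 (f n) (f m)) \<longlonglongrightarrow> 0" by simp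
    have "q0 (f n) (f n) \<le> n0 (f n) * (e/2) + q0 (f n) (f m)" if m: "m \<ge> M" for m
    proof -
      have dd: "f n - f m \<in> dm" using d by (simp add: dom_closed(2))
      have "(q0 (f n) (f n - f m))\<^sup>2 \<le> q0 (f n) (f n) * q0 (f n - f m) (f n - f m)"
        using Q0.cauchy_schwarz[OF dom_subspace order_refl q0_nn d dd] .
      then have "q0 (f n) (f n - f m) \<le> n0 (f n) * n0 (f n - f m)" by (metis real_le_rsqrt real_sqrt_mult)
      also have "\<dots> \<le> n0 (f n) * (e/2)"
        using M m n q0_nn[OF d] by (intro mult_left_mono) (auto intro: less_imp_le)
      finally show ?thesis using Q0.diff_r[OF d[of n] d[of m] d[of n]] by simp
    qed
    then have "q0 (f n) (f n) \<le> n0 (f n) * (e/2) + 0"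
      by (intro LIMSEQ_le_const[OF tendsto_add[OF tendsto_const l]]) auto
    then have "n0 (f n) * n0 (f n) \<le> n0 (f n) * (e/2)" using q0_nn[OF d[of n]] by simp
    then have "n0 (f n) \<le> e/2 \<or> n0 (f n) = 0" using q0_nn[OF d[of n]] by (metis mult_le_cancel_left_pos less_le real_sqrt_ge_zero)
    then show ?thesis using e by auto
  qed
  then show "\<exists>no. \<forall>n\<ge>no. norm (n0 (f n) - 0) < e" using q0_nn f by (auto simp: form_seqD)
qed

lemma form_seq_convergent:
  assumes f: "form_seq A x f"
  shows "\<exists>l. (\<lambda>n. T (f n) \<bullet> f n) \<longlonglongrightarrow> l"
proof -
  have d: "f m \<in> dm" for m using f by (simp add: form_seqD)
  have "Cauchy (\<lambda>n. n0 (f n))"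
  proof (rule metric_CauchyI)
    fix e :: real assume e: "e > 0"
    then obtain M where "\<forall>m\<ge>M. \<forall>n\<ge>M. n0 (f m - f n) < e" using f unfolding form_seq_iff by meson
    then have "\<forall>m\<ge>M. \<forall>n\<ge>M. dist (n0 (f m)) (n0 (f n)) < e"
      using Q0.sqrt_abs_diff[OF q0_nn d d] unfolding dist_real_def by (meson le_less_trans)
    then show "\<exists>M. \<forall>m\<ge>M. \<forall>n\<ge>M. dist (n0 (f m)) (n0 (f n)) < e" by blast
  qed
  then obtain l where l: "(\<lambda>n. n0 (f n)) \<longlonglongrightarrow> l" using Cauchy_convergent convergent_def by blast
  have "(\<lambda>n. (n0 (f n))\<^sup>2 - s * (f n \<bullet> f n)) \<longlonglongrightarrow> l\<^sup>2 - s * (x \<bullet> x)"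
    by (intro tendsto_intros l form_seqD(2)[OF f])
  moreover have "(n0 (f n))\<^sup>2 - s * (f n \<bullet> f n) = T (f n) \<bullet> f n" for n
    using q0_nn[OF d] by (simp add: q0_def)
  ultimately show ?thesis by auto
qed

text \<open>Two approximating sequences of \<open>x\<close> differ by one tending to 0, so
  closability identifies the limits. This makes the description in \<open>form_val\<close> well
  defined.\<close>

lemma form_seq_unique:
  assumes f: "form_seq A x f" and g: "form_seq A x g" and l: "(\<lambda>n. T (f n) \<bullet> f n) \<longlonglongrightarrow> l"
  shows "(\<lambda>n. T (g n) \<bullet> g n) \<longlonglongrightarrow> l"
proof -
  have d: "f m \<in> dm" "g m \<in> dm" for m using f g by (auto simp: form_seqD)
  have "form_seq A 0 (\<lambda>n. f n - g n)" using form_seq_diff[OF f g] by simp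
  then have z: "(\<lambda>n. n0 (f n - g n)) \<longlonglongrightarrow> 0" by (rule form_seq_null)
  have "(\<lambda>n. n0 (f n) - n0 (g n)) \<longlonglongrightarrow> 0"
    using Q0.sqrt_abs_diff[OF q0_nn d(1) d(2)] by (intro tendsto_rabs_zero_cancel[OF tendsto_sandwich[OF _ _ tendsto_const z]]) auto
  moreover have "(\<lambda>n. n0 (f n)) \<longlonglongrightarrow> sqrt (l + s * (x \<bullet> x))"
    unfolding q0_def by (intro tendsto_intros l form_seqD(2)[OF f])
  ultimately have "(\<lambda>n. n0 (g n)) \<longlonglongrightarrow> sqrt (l + s * (x \<bullet> x))"
    using tendsto_diff[of "\<lambda>n. n0 (f n)" "sqrt (l + s * (x \<bullet> x))" sequentially "\<lambda>n. n0 (f n) - n0 (g n)" 0] by simp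
  then have "(\<lambda>n. (n0 (g n))\<^sup>2 - s * (g n \<bullet> g n)) \<longlonglongrightarrow> (sqrt (l + s * (x \<bullet> x)))\<^sup>2 - s * (x \<bullet> x)"
    by (rule tendsto_diff[OF tendsto_power tendsto_mult[OF tendsto_const tendsto_inner[OF form_seqD(2)[OF g] form_seqD(2)[OF g]]]])
  moreover have "(n0 (g n))\<^sup>2 - s * (g n \<bullet> g n) = T (g n) \<bullet> g n" for n
    using q0_nn[OF d(2)] by (simp add: q0_def)
  moreover have "l + s * (x \<bullet> x) \<ge> 0"
  proof (rule LIMSEQ_le_const)
    show "(\<lambda>n. q0 (f n) (f n)) \<longlonglongrightarrow> l + s * (x \<bullet> x)"
      unfolding q0_def by (intro tendsto_intros l form_seqD(2)[OF f])
  qed (use q0_nn d in auto)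
  ultimately show ?thesis by simp
qed

abbreviation "D \<equiv> form_dom A"
abbreviation "t \<equiv> fb A"

lemma form_val_lim:
  assumes f: "form_seq A x f"
  shows "(\<lambda>n. T (f n) \<bullet> f n) \<longlonglongrightarrow> form_val A x"
proof -
  obtain l where l: "(\<lambda>n. T (f n) \<bullet> f n) \<longlonglongrightarrow> l" using form_seq_convergent[OF f] by blast
  have "form_val A x = l" unfolding form_val_def
  proof (rule the_equality)
    show "\<forall>g. form_seq A x g \<longrightarrow> (\<lambda>n. T (g n) \<bullet> g n) \<longlonglongrightarrow> l" using form_seq_unique[OF f _ l] by blast
    show "a = l" if "\<forall>g. form_seq A x g \<longrightarrow> (\<lambda>n. T (g n) \<bullet> g n) \<longlonglongrightarrow> a" for a
      using that f l LIMSEQ_unique by blast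
  qed
  then show ?thesis using l by simp
qed

lemma D_seq: "x \<in> D \<Longrightarrow> \<exists>f. form_seq A x f" "form_seq A x f \<Longrightarrow> x \<in> D"
  by (auto simp: form_dom_def)

lemma fb_lim:
  assumes f: "form_seq A x f" and g: "form_seq A y g"
  shows "(\<lambda>n. T (f n) \<bullet> g n) \<longlonglongrightarrow> t x y"
proof -
  have "(\<lambda>n. (T (f n + g n) \<bullet> (f n + g n) - T (f n - g n) \<bullet> (f n - g n)) / 4) \<longlonglongrightarrow> t x y"
    unfolding fb_def by (intro tendsto_intros form_val_lim form_seq_add form_seq_diff f g) auto
  moreover have "(T (f n + g n) \<bullet> (f n + g n) - T (f n - g n) \<bullet> (f n - g n)) / 4 = T (f n) \<bullet> g n" for n
    using T_sym[of "f n" "g n"] form_seqD(1)[OF f, of n] form_seqD(1)[OF g, of n]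
    by (simp add: T_add T_diff inner_add_left inner_add_right inner_diff_left inner_diff_right inner_commute)
  ultimately show ?thesis by simp
qed

lemma fb_self: "x \<in> D \<Longrightarrow> t x x = form_val A x"
  using D_seq(1) fb_lim form_val_lim LIMSEQ_unique by metis

lemma bform_t: "bform D t"
proof
  show "subspace D"
    by (rule subspaceI)
      (use D_seq form_seq_const[OF dom_closed(5)] form_seq_add form_seq_scale in metis)+
  show "t x y = t y x" if xy: "x \<in> D" "y \<in> D" for x y
    unfolding fb_def
  proof -
    obtain f0 g0 where "form_seq A x f0" "form_seq A y g0" using xy D_seq(1) by metis
    then obtain f where f: "form_seq A (x - y) f" using form_seq_diff by blast
    have "form_seq A (y - x) (\<lambda>n. - f n)" using form_seq_scale[OF f, of "-1"] by simp
    from form_val_lim[OF this] have "(\<lambda>n. T (f n) \<bullet> f n) \<longlonglongrightarrow> form_val A (y - x)"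
      using form_seqD(1)[OF f] by (simp add: T_neg)
    then have "form_val A (x - y) = form_val A (y - x)" using form_val_lim[OF f] LIMSEQ_unique by blast
    then show "(form_val A (x + y) - form_val A (x - y)) / 4 = (form_val A (y + x) - form_val A (y - x)) / 4"
      by (simp add: add.commute)
  qed
  fix x y z :: 'h and c assume x: "x \<in> D" and z: "z \<in> D"
  obtain f h where f: "form_seq A x f" and h: "form_seq A z h" using x z D_seq by metis
  note fd = form_seqD(1)[OF f]
  show "t (c *\<^sub>R x) z = c * t x z"
  proof (rule LIMSEQ_unique)
    show "(\<lambda>n. T (c *\<^sub>R f n) \<bullet> h n) \<longlonglongrightarrow> t (c *\<^sub>R x) z" by (intro fb_lim form_seq_scale f h)
    show "(\<lambda>n. T (c *\<^sub>R f n) \<bullet> h n) \<longlonglongrightarrow> c * t x z"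
      using tendsto_mult_left[OF fb_lim[OF f h], of c] by (simp add: T_scale fd)
  qed
  assume y: "y \<in> D"
  obtain g where g: "form_seq A y g" using y D_seq by metis
  show "t (x + y) z = t x z + t y z"
  proof (rule LIMSEQ_unique)
    show "(\<lambda>n. T (f n + g n) \<bullet> h n) \<longlonglongrightarrow> t (x + y) z" by (intro fb_lim form_seq_add f g h)
    show "(\<lambda>n. T (f n + g n) \<bullet> h n) \<longlonglongrightarrow> t x z + t y z"
      using tendsto_add[OF fb_lim[OF f h] fb_lim[OF g h]] by (simp add: T_add fd form_seqD(1)[OF g] inner_add_left)
  qed
qed

sublocale F: bform D t by (rule bform_t)

lemma D_J: "x \<in> D \<Longrightarrow> J x \<in> D"
  using D_seq form_seq_J by metis

lemma t_J: "x \<in> D \<Longrightarrow> y \<in> D \<Longrightarrow> t (J x) (J y) = t x y"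
proof -
  assume "x \<in> D" "y \<in> D"
  then obtain f g where f: "form_seq A x f" "form_seq A y g" using D_seq by metis
  have "(\<lambda>n. T (J (f n)) \<bullet> J (g n)) \<longlonglongrightarrow> t (J x) (J y)" by (intro fb_lim form_seq_J f)
  then have "(\<lambda>n. T (f n) \<bullet> g n) \<longlonglongrightarrow> t (J x) (J y)" using form_seqD(1)[OF f(1)] by (simp add: T_J J_inner)
  then show "t (J x) (J y) = t x y" using fb_lim[OF f] LIMSEQ_unique by blast
qed

lemma t_J_skew: "x \<in> D \<Longrightarrow> y \<in> D \<Longrightarrow> t (J x) y = - t x (J y)"
  using t_J[of x "J y"] F.neg_r[of y "J x"] by (simp add: JJ D_J)

lemma dom_D: "x \<in> dm \<Longrightarrow> x \<in> D"
  using form_seq_const D_seq(2) by blast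

lemma t_dom: "x \<in> dm \<Longrightarrow> y \<in> D \<Longrightarrow> t x y = T x \<bullet> y"
proof -
  assume x: "x \<in> dm" and "y \<in> D"
  then obtain g where g: "form_seq A y g" using D_seq by metis
  have "(\<lambda>n. T x \<bullet> g n) \<longlonglongrightarrow> T x \<bullet> y" by (intro tendsto_intros form_seqD(2)[OF g])
  then show ?thesis using fb_lim[OF form_seq_const[OF x] g] LIMSEQ_unique by blast
qed

lemma t_low: "x \<in> D \<Longrightarrow> (1 - s) * (norm x)\<^sup>2 \<le> t x x"
proof -
  assume "x \<in> D"
  then obtain f where f: "form_seq A x f" using D_seq by metis
  show ?thesis
  proof (rule LIMSEQ_le)
    show "(\<lambda>n. T (f n) \<bullet> f n) \<longlonglongrightarrow> t x x" by (rule fb_lim[OF f f])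
    show "(\<lambda>n. (1 - s) * (norm (f n))\<^sup>2) \<longlonglongrightarrow> (1 - s) * (norm x)\<^sup>2"
      by (intro tendsto_intros form_seqD(2)[OF f])
  qed (use low form_seqD(1)[OF f] in auto)
qed

definition Q :: "'h \<Rightarrow> 'h \<Rightarrow> real" where "Q x y = t x y + s * (x \<bullet> y)"

sublocale Q: bform D Q
  using bform_plus_inner[OF bform_t, of s] unfolding Q_def[abs_def] .

lemma Q_ge: "x \<in> D \<Longrightarrow> (norm x)\<^sup>2 \<le> Q x x"
  using t_low[of x] by (simp add: Q_def dot_square_norm algebra_simps)

lemma Q_nn: "x \<in> D \<Longrightarrow> 0 \<le> Q x x"
  using Q_ge[of x] by (smt (verit) zero_le_power2)

lemma t_le_Q: "x \<in> D \<Longrightarrow> t x x \<le> Q x x"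
  using s1 by (simp add: Q_def)

lemma Q_dom: "x \<in> dm \<Longrightarrow> y \<in> dm \<Longrightarrow> Q x y = q0 x y"
  by (simp add: Q_def q0_def t_dom dom_D)

abbreviation "nQ x \<equiv> sqrt (Q x x)"

lemma norm_le_nQ: "x \<in> D \<Longrightarrow> norm x \<le> nQ x"
  using Q_ge by (simp add: real_le_rsqrt)

lemma nQ_triangle: "x \<in> D \<Longrightarrow> y \<in> D \<Longrightarrow> z \<in> D \<Longrightarrow> nQ (x - z) \<le> nQ (x - y) + nQ (y - z)"
  by (rule Q.sqrt_triangle_diff[OF Q_nn])

lemma form_seq_nQ:
  assumes f: "form_seq A x f"
  shows "(\<lambda>n. nQ (f n - x)) \<longlonglongrightarrow> 0"
proof (rule LIMSEQ_I)
  fix e :: real assume e: "e > 0"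
  then obtain M where M: "\<forall>m\<ge>M. \<forall>n\<ge>M. n0 (f m - f n) < e/2"
    using f unfolding form_seq_iff by (meson half_gt_zero)
  have x: "x \<in> D" using f D_seq by blast
  have "nQ (f n - x) < e" if n: "n \<ge> M" for n
  proof -
    have g: "form_seq A (f n - x) (\<lambda>m. f n - f m)"
      by (intro form_seq_diff form_seq_const f form_seqD(1)[OF f])
    have "(\<lambda>m. n0 (f n - f m)) \<longlonglongrightarrow> nQ (f n - x)"
      unfolding q0_def Q_def by (intro tendsto_intros fb_lim g form_seqD(2)[OF f])
    moreover have "\<forall>m\<ge>M. n0 (f n - f m) \<le> e/2" using M n by (auto intro: less_imp_le)
    ultimately have "nQ (f n - x) \<le> e/2" using LIMSEQ_le_const2 by blast
    then show ?thesis using e by simp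
  qed
  moreover have "0 \<le> nQ (f n - x)" for n
    using Q_nn F.mem(2)[OF dom_D[OF form_seqD(1)[OF f]] x] by simp
  ultimately show "\<exists>no. \<forall>n\<ge>no. norm (nQ (f n - x) - 0) < e" by auto
qed

lemma D_approx: "x \<in> D \<Longrightarrow> \<exists>f. (\<forall>n. f n \<in> dm) \<and> (\<lambda>n. nQ (f n - x)) \<longlonglongrightarrow> 0"
  using D_seq(1) form_seq_nQ form_seqD(1) by metis

text \<open>Each \<open>f n\<close> is replaced by an element of the operator domain at form
  distance below 1/(n+1); the replacements form an admissible sequence for their limit.\<close>

lemma form_complete:
  assumes f: "\<And>n. f n \<in> D" and cau: "\<And>e. e > 0 \<Longrightarrow> \<exists>M. \<forall>m\<ge>M. \<forall>n\<ge>M. nQ (f m - f n) < e"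
  shows "\<exists>x\<in>D. (\<lambda>n. nQ (f n - x)) \<longlonglongrightarrow> 0"
proof -
  have "\<exists>y\<in>dm. nQ (f n - y) < 1 / real (Suc n)" for n
  proof -
    obtain g where g: "\<forall>k. g k \<in> dm" "(\<lambda>k. nQ (g k - f n)) \<longlonglongrightarrow> 0" using D_approx[OF f] by blast
    then obtain k where "nQ (g k - f n) < 1 / real (Suc n)"
      using order_tendstoD(2)[OF g(2), of "1 / real (Suc n)"] by (auto simp: eventually_sequentially)
    moreover have "Q (g k - f n) (g k - f n) = Q (f n - g k) (f n - g k)"
      using Q.sq_diff[of "g k" "f n"] Q.sq_diff[of "f n" "g k"] Q.sym[of "g k" "f n"] g(1) f dom_D by simp
    ultimately show ?thesis using g(1) by auto
  qed
  then obtain g where g: "\<And>n. g n \<in> dm" "\<And>n. nQ (f n - g n) < 1 / real (Suc n)" by metis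
  have gD: "g n \<in> D" for n using g dom_D by blast
  have sw: "nQ (x - y) = nQ (y - x)" if "x \<in> D" "y \<in> D" for x y
    using Q.sq_diff[of x y] Q.sq_diff[of y x] Q.sym[of x y] that by simp
  have gc: "\<exists>M. \<forall>m\<ge>M. \<forall>n\<ge>M. n0 (g m - g n) < e" if e: "e > 0" for e
  proof -
    obtain M where M: "\<forall>m\<ge>M. \<forall>n\<ge>M. nQ (f m - f n) < e/3" using cau[of "e/3"] e by auto
    obtain N where N: "1 / real (Suc N) < e/3" using nat_approx_posE[of "e/3"] e by auto
    have "n0 (g m - g n) < e" if mn: "m \<ge> max M N" "n \<ge> max M N" for m n
    proof -
      have i: "nQ (f k - g k) < e/3" if "k \<ge> N" for k
      proof -
        have "1 / real (Suc k) \<le> 1 / real (Suc N)" using that by (intro divide_left_mono) auto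
        then show ?thesis using g(2)[of k] N by linarith
      qed
      have "nQ (g m - g n) \<le> nQ (g m - f m) + (nQ (f m - f n) + nQ (f n - g n))"
        using nQ_triangle[OF gD[of m] f[of m] gD[of n]] nQ_triangle[OF f[of m] f[of n] gD[of n]] by linarith
      then have "nQ (g m - g n) < e" using i[of m] i[of n] M mn sw[OF f[of m] gD[of m]] by fastforce
      then show ?thesis using Q_dom[of "g m - g n" "g m - g n"] g dom_closed by simp
    qed
    then show ?thesis by blast
  qed
  have "Cauchy g"
  proof (rule metric_CauchyI)
    fix e :: real assume "e > 0"
    then obtain M where M: "\<forall>m\<ge>M. \<forall>n\<ge>M. n0 (g m - g n) < e" using gc by blast
    have "dist (g m) (g n) \<le> n0 (g m - g n)" for m n
      using q0_ge[of "g m - g n"] g dom_closed by (simp add: dist_norm real_le_rsqrt)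
    then show "\<exists>M. \<forall>m\<ge>M. \<forall>n\<ge>M. dist (g m) (g n) < e" using M by (meson le_less_trans)
  qed
  then obtain x where x: "g \<longlonglongrightarrow> x" using Cauchy_convergent convergent_def by blast
  have fs: "form_seq A x g" unfolding form_seq_iff using g x gc by blast
  then have xD: "x \<in> D" using D_seq by blast
  have "(\<lambda>n. nQ (f n - x)) \<longlonglongrightarrow> 0"
  proof (rule tendsto_sandwich[OF _ _ tendsto_const])
    show "(\<lambda>n. 1 / real (Suc n) + nQ (g n - x)) \<longlonglongrightarrow> 0"
      using tendsto_add[OF LIMSEQ_inverse_real_of_nat form_seq_nQ[OF fs]] by (simp add: inverse_eq_divide)
    show "\<forall>\<^sub>F n in sequentially. nQ (f n - x) \<le> 1 / real (Suc n) + nQ (g n - x)"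
    proof (rule always_eventually, rule allI)
      fix n
      show "nQ (f n - x) \<le> 1 / real (Suc n) + nQ (g n - x)"
        using nQ_triangle[OF f[of n] gD[of n] xD] g(2)[of n] by linarith
    qed
  qed (use Q_nn f xD F.mem in auto)
  then show ?thesis using xD by blast
qed

end

section \<open>Spectral splitting of a semibounded Fredholm operator\<close>

context sb_op
begin

definition B :: "'h \<Rightarrow> 'h" where "B y = (SOME x. x \<in> dm \<and> T x + s *\<^sub>R x = y)"

lemma shift_low: "x \<in> dm \<Longrightarrow> norm x \<le> norm (T x + s *\<^sub>R x)"
proof (cases "x = 0")
  case False
  assume x: "x \<in> dm"
  have "(norm x)\<^sup>2 \<le> (T x + s *\<^sub>R x) \<bullet> x" using q0_ge[OF x] by (simp add: q0_def inner_add_left)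
  also have "\<dots> \<le> norm (T x + s *\<^sub>R x) * norm x" by (rule norm_cauchy_schwarz)
  finally show ?thesis using False by (simp add: power2_eq_square)
qed simp

lemma B: "B y \<in> dm" "T (B y) + s *\<^sub>R B y = y"
proof -
  have "\<exists>x\<in>dm. T x + s *\<^sub>R x = y"
    by (rule perturbed_surj[where C' = "\<lambda>x. s *\<^sub>R x" and a = 1]) (auto simp: shift_low bounded_linear_scaleR_right)
  then have "\<exists>x. x \<in> dm \<and> T x + s *\<^sub>R x = y" by blast
  then have "B y \<in> dm \<and> T (B y) + s *\<^sub>R B y = y" unfolding B_def by (rule someI_ex)
  then show "B y \<in> dm" "T (B y) + s *\<^sub>R B y = y" by auto
qed

lemma B_eq: "x \<in> dm \<Longrightarrow> B (T x + s *\<^sub>R x) = x"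
proof -
  assume x: "x \<in> dm"
  let ?z = "B (T x + s *\<^sub>R x)"
  have "norm (?z - x) \<le> norm ((T ?z + s *\<^sub>R ?z) - (T x + s *\<^sub>R x))"
    using shift_low[of "?z - x"] x B(1)[of "T x + s *\<^sub>R x"] dom_closed(2)[of ?z x]
    by (simp add: T_diff algebra_simps)
  then show ?thesis using B(2)[of "T x + s *\<^sub>R x"] by simp
qed

lemma T_B: "T (B y) = y - s *\<^sub>R B y"
  using B(2)[of y] by (metis add_diff_cancel_right')

lemma B_norm: "norm (B y) \<le> norm y"
  using shift_low[OF B(1)[of y]] B(2)[of y] by simp

lemma B_sadj: "sadj B"
  unfolding sadj_def
proof (intro conjI allI)
  show "bounded_linear B"
  proof (rule linear_bound_bounded_linear[where K = 1])
    fix x y c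
    have "T (B x + B y) + s *\<^sub>R (B x + B y) = x + y"
      using B(2)[of x] B(2)[of y] by (simp add: T_add B(1) algebra_simps)
    then show "B (x + y) = B x + B y" using B_eq[of "B x + B y"] dom_closed(1)[OF B(1) B(1), of x y] by simp
    have "T (c *\<^sub>R B x) + s *\<^sub>R (c *\<^sub>R B x) = c *\<^sub>R (T (B x) + s *\<^sub>R B x)"
      by (simp add: T_scale B(1) algebra_simps)
    then show "B (c *\<^sub>R x) = c *\<^sub>R B x" using B_eq[of "c *\<^sub>R B x"] dom_closed(3)[OF B(1)] B(2)[of x] by simp
    show "norm (B x) \<le> 1 * norm x" using B_norm by simp
  qed
  fix x y
  have "B x \<bullet> y = B x \<bullet> (T (B y) + s *\<^sub>R B y)" by (simp add: B(2))
  also have "\<dots> = (T (B x) + s *\<^sub>R B x) \<bullet> B y"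
    using T_sym[OF B(1)[of x] B(1)[of y]] by (simp add: inner_add_left inner_add_right)
  finally show "B x \<bullet> y = x \<bullet> B y" by (simp add: B(2))
qed

lemma B_inner: "(norm (B y))\<^sup>2 \<le> B y \<bullet> y"
  using q0_ge[OF B(1)[of y]] B(2)[of y] by (metis inner_add_left inner_commute inner_scaleR_left q0_def)

lemma B_pos: "0 \<le> B y \<bullet> y"
  using B_inner[of y] by (smt (verit) zero_le_power2)

lemma B_J: "B (J y) = J (B y)"
proof -
  have "T (J (B y)) + s *\<^sub>R J (B y) = J y"
    using B(2)[of y] by (simp add: T_J B(1) J_lin[symmetric])
  then show ?thesis using B_eq[OF dom_closed(6)[OF B(1)], of y] by simp
qed

text \<open>Equal to T (T + s)^(-1): a bounded self-adjoint operator with the kernel and the sign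
  structure of \<open>T\<close>. It stands in for the spectral calculus of the unbounded
  operator.\<close>

definition A0 :: "'h \<Rightarrow> 'h" where "A0 x = x - s *\<^sub>R B x"

lemma A0_T: "A0 x = T (B x)"
  by (simp add: A0_def T_B)

lemma A0_sadj: "sadj A0"
  unfolding A0_def by (intro sadj_diff sadj_id sadj_scale B_sadj)

lemma A0_norm: "norm (A0 x) \<le> (1 + s) * norm x"
proof -
  have "norm (A0 x) \<le> norm x + norm (s *\<^sub>R B x)" unfolding A0_def by (rule norm_triangle_ineq4)
  also have "\<dots> \<le> norm x + s * norm x" using B_norm[of x] s1 by (simp add: mult_left_mono)
  finally show ?thesis by (simp add: algebra_simps)
qed

lemma A0_B: "A0 (B x) = B (A0 x)"
  by (simp add: A0_def sadj_lin[OF B_sadj])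

lemma kerD: "x \<in> ker A \<Longrightarrow> x \<in> dm" "x \<in> ker A \<Longrightarrow> T x = 0"
  by (auto simp: ker_def)

lemma ker_J: "x \<in> ker A \<Longrightarrow> J x \<in> ker A"
  by (auto simp: ker_def dom_closed T_J J_lin)

lemma ker_closed: "closed (ker A)"
  unfolding closed_sequential_limits
proof (intro allI impI, elim conjE)
  fix f l assume "\<forall>n. f n \<in> ker A" "f \<longlonglongrightarrow> l"
  then show "l \<in> ker A" using T_closed[of f l 0] by (simp add: ker_def)
qed

lemma A0_ker: "A0 x = 0 \<longleftrightarrow> x \<in> ker A"
proof
  assume a: "A0 x = 0"
  then have "x = s *\<^sub>R B x" by (simp add: A0_def)
  moreover have "B x \<in> ker A" using a B(1)[of x] by (simp add: A0_T ker_def)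
  ultimately show "x \<in> ker A" using ker_subspace subspace_scale by metis
next
  assume x: "x \<in> ker A"
  then have "B (s *\<^sub>R x) = x" using B_eq[of x] by (simp add: ker_def)
  then show "A0 x = 0" by (simp add: A0_def sadj_lin[OF B_sadj])
qed

lemma t_B: "t (B y) (B y) = A0 y \<bullet> B y" "Q (B y) (B y) = y \<bullet> B y"
proof -
  show "t (B y) (B y) = A0 y \<bullet> B y" by (simp add: t_dom B(1) dom_D A0_T)
  show "Q (B y) (B y) = y \<bullet> B y"
    using B(2)[of y] by (simp add: Q_def t_dom B(1) dom_D) (metis inner_add_left inner_scaleR_left)
qed

lemma t_ker: "x \<in> ker A \<Longrightarrow> y \<in> D \<Longrightarrow> t x y = 0"
  by (simp add: t_dom kerD)

lemma ran_orth: "w \<in> ker A" if "\<And>z. z \<in> ran A \<Longrightarrow> z \<bullet> w = 0"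
proof -
  have "T x \<bullet> w = x \<bullet> 0" if "x \<in> dm" for x using \<open>\<And>z. z \<in> ran A \<Longrightarrow> z \<bullet> w = 0\<close> that by (simp add: ran_def)
  then show ?thesis using adjointI[of w 0] by (simp add: ker_def)
qed

end

text \<open>The negative, null and positive spectral projections, recorded through their properties
  only. One constant \<open>a\<close> bounds the gap at 0 both for the form and for
  \<open>A0\<close>: the form bounds compare subspaces of the form domain, the \<open>A0\<close>
  bounds survive a perturbation of the resolvent. On the positive part the form dominates the full
  form norm.\<close>

locale ssplit = sb_op J A s for J :: "'h::{real_inner,complete_space} \<Rightarrow> 'h" and A s +
  fixes Pm Pz Pp :: "'h \<Rightarrow> 'h" and a :: real
  assumes a_pos: "0 < a"
    and Pm_sadj: "sadj Pm" and Pz_sadj: "sadj Pz" and Pp_sadj: "sadj Pp"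
    and P_sum: "Pm x + Pz x + Pp x = x"
    and P_idem: "Pm (Pm x) = Pm x" "Pz (Pz x) = Pz x" "Pp (Pp x) = Pp x"
    and P_orth: "Pm (Pz x) = 0" "Pm (Pp x) = 0" "Pz (Pm x) = 0" "Pz (Pp x) = 0" "Pp (Pm x) = 0" "Pp (Pz x) = 0"
    and P_J: "Pm (J x) = J (Pm x)" "Pz (J x) = J (Pz x)" "Pp (J x) = J (Pp x)"
    and Pz_ker: "Pz x \<in> ker A" "x \<in> ker A \<Longrightarrow> Pz x = x"
    and Pm_dom: "Pm x \<in> fst A"
    and t_mp: "y \<in> form_dom A \<Longrightarrow> fb A (Pm x) (Pp y) = 0"
    and t_neg: "fb A (Pm x) (Pm x) \<le> - a * (norm (Pm x))\<^sup>2"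
    and t_pos: "x \<in> form_dom A \<Longrightarrow> a * Q (Pp x) (Pp x) \<le> fb A (Pp x) (Pp x)"
    and A0_com: "A0 (Pm x) = Pm (A0 x)" "A0 (Pp x) = Pp (A0 x)"
    and A0_neg: "A0 (Pm x) \<bullet> Pm x \<le> - a * (norm (Pm x))\<^sup>2"
    and A0_pos: "a * (norm (Pp x))\<^sup>2 \<le> A0 (Pp x) \<bullet> Pp x"

context sb_op
begin

text \<open>Fredholmness isolates 0: adding the projection onto the kernel makes \<open>A0\<close>
  bijective, and the eigenspaces of the sign \<open>U\<close> of the sum give the splitting. As
  \<open>U\<close> commutes with everything that commutes with the sum, the projections inherit
  commutation with \<open>B\<close>, \<open>J\<close> and \<open>Pz\<close>.\<close>

lemma ex_ssplit:
  assumes fred: "fredholm A"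
  shows "\<exists>Pm Pz Pp a. ssplit J A s Pm Pz Pp a"
proof -
  obtain Pz where Pz: "sadj Pz" "\<And>x. Pz x \<in> ker A" "\<And>x. x \<in> ker A \<Longrightarrow> Pz x = x"
    "\<And>x v. v \<in> ker A \<Longrightarrow> (x - Pz x) \<bullet> v = 0"
    using closed_subspace_projector[OF ker_subspace ker_closed] by metis
  have PzPz: "Pz (Pz x) = Pz x" for x using Pz by blast
  have A0z: "A0 (Pz x) = 0" for x using Pz(2) A0_ker by blast
  have zA0: "Pz (A0 x) = 0" for x
  proof -
    have "Pz (A0 x) \<bullet> Pz (A0 x) = A0 x \<bullet> Pz (A0 x)"
      using sadjD(2)[OF Pz(1), of "A0 x" "Pz (A0 x)"] by (simp add: PzPz)
    also have "\<dots> = 0" using sadjD(2)[OF A0_sadj, of x "Pz (A0 x)"] by (simp add: A0z)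
    finally show ?thesis by simp
  qed
  define F where "F x = A0 x + Pz x" for x
  have sF: "sadj F" unfolding F_def by (intro sadj_add A0_sadj Pz)
  have injF: "x = 0" if "F x = 0" for x
  proof -
    have "Pz (F x) = Pz x" unfolding F_def by (simp add: sadj_lin[OF Pz(1)] zA0 PzPz)
    then have "Pz x = 0" using that sadj_lin(4)[OF Pz(1)] by simp
    moreover have "A0 x = 0" using that \<open>Pz x = 0\<close> by (simp add: F_def)
    ultimately show ?thesis using Pz(3) A0_ker by metis
  qed
  have ran_sub: "subspace (ran A)"
    using perturbed_range_subspace[of "\<lambda>x. 0" UNIV] by (simp add: ran_def)
  have surjF: "\<exists>x. F x = y" for y
  proof -
    have "closed (ran A)" using fred by (simp add: fredholm_def)
    then obtain R where R: "\<And>x. R x \<in> ran A" "\<And>x v. v \<in> ran A \<Longrightarrow> (x - R x) \<bullet> v = 0"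
      using closed_subspace_projector[OF ran_sub] by metis
    \<comment> \<open>The part of \<open>y - Pz y\<close> outside the closed range is orthogonal to
      the range, so it lies in the kernel; it is also orthogonal to itself, because
      \<open>y - Pz y\<close> and the range are orthogonal to the kernel.\<close>
    define w where "w = (y - Pz y) - R (y - Pz y)"
    have "w \<in> ker A" using R(2) by (intro ran_orth) (simp add: w_def inner_commute)
    obtain d where d: "d \<in> dm" "R (y - Pz y) = T d" using R(1)[of "y - Pz y"] by (auto simp: ran_def)
    have "T d \<bullet> w = 0" using T_sym[OF d(1) kerD(1)[OF \<open>w \<in> ker A\<close>]] kerD(2)[OF \<open>w \<in> ker A\<close>] by simp
    then have "w \<bullet> w = 0" using Pz(4)[OF \<open>w \<in> ker A\<close>, of y] d(2) by (simp add: w_def inner_diff_left)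
    then have yd: "y - Pz y = T d" using d(2) by (simp add: w_def)
    define z where "z = T d + s *\<^sub>R d"
    have "A0 z = T d" by (simp add: A0_T z_def B_eq d(1))
    then have "F (z - Pz z + Pz y) = y"
      unfolding F_def using yd
      by (simp add: sadj_lin[OF A0_sadj] sadj_lin[OF Pz(1)] A0z PzPz algebra_simps)
    then show ?thesis by blast
  qed
  obtain g where g: "g > 0" "\<And>x. g * norm x \<le> norm (F x)"
    using sadj_bij_bounded_below[OF sF injF surjF] by blast
  obtain U c where U: "sadj U" "\<And>x. U (U x) = x" "c > 0" "\<And>x. c * (norm x)\<^sup>2 \<le> F (U x) \<bullet> x"
    and comU: "\<And>C x. bounded_linear C \<Longrightarrow> (\<And>x. C (F x) = F (C x)) \<Longrightarrow> C (U x) = U (C x)"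
    using sadj_sign[OF sF g] by blast
  note Ul = sadj_lin[OF U(1)] and Fl = sadj_lin[OF sF] and Pzl = sadj_lin[OF Pz(1)]
    and Bl = sadj_lin[OF B_sadj] and A0l = sadj_lin[OF A0_sadj]
  have UF: "F (U x) = U (F x)" for x using comU[OF sadjD(1)[OF sF]] by simp
  have zF: "Pz (F x) = F (Pz x)" for x
    unfolding F_def by (simp add: Pzl zA0 PzPz A0z)
  have Uz: "Pz (U x) = U (Pz x)" for x by (rule comU[OF sadjD(1)[OF Pz(1)] zF])
  have BPz: "B (Pz x) = (1/s) *\<^sub>R Pz x" for x
  proof -
    have "Pz x = s *\<^sub>R B (Pz x)" using A0z[of x] by (simp add: A0_def)
    then have "(1/s) *\<^sub>R Pz x = (1/s) *\<^sub>R (s *\<^sub>R B (Pz x))" by simp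
    then show ?thesis using s1 by simp
  qed
  have PzB: "Pz (B x) = (1/s) *\<^sub>R Pz x" for x
  proof -
    have "Pz x = s *\<^sub>R Pz (B x)" using zA0[of x] by (simp add: A0_def Pzl)
    then have "(1/s) *\<^sub>R Pz x = (1/s) *\<^sub>R (s *\<^sub>R Pz (B x))" by simp
    then show ?thesis using s1 by simp
  qed
  have BF: "B (F x) = F (B x)" for x
    unfolding F_def by (simp add: Bl A0_B BPz PzB)
  have UB: "B (U x) = U (B x)" for x by (rule comU[OF sadjD(1)[OF B_sadj] BF])
  have JPz: "J (Pz x) = Pz (J x)" for x
  proof -
    have 1: "J (Pz x) \<in> ker A" using Pz(2) ker_J by blast
    define w where "w = Pz (J x) - J (Pz x)"
    have wk: "w \<in> ker A" unfolding w_def using 1 Pz(2) ker_subspace subspace_diff by blast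
    have "w \<bullet> w = (J x - J (Pz x)) \<bullet> w - (J x - Pz (J x)) \<bullet> w" by (simp add: w_def inner_diff_left)
    also have "(J x - Pz (J x)) \<bullet> w = 0" using Pz(4)[OF wk] .
    also have "(J x - J (Pz x)) \<bullet> w = - ((x - Pz x) \<bullet> J w)" by (simp add: J_lin[symmetric] J_skew)
    also have "(x - Pz x) \<bullet> J w = 0" using Pz(4)[OF ker_J[OF wk]] .
    finally show ?thesis by (simp add: w_def)
  qed
  have JF: "J (F x) = F (J x)" for x
    unfolding F_def A0_def by (simp add: J_lin JPz B_J)
  have UJ: "J (U x) = U (J x)" for x by (rule comU[OF J_bounded_linear JF])
  define Pm where "Pm x = (1/2::real) *\<^sub>R (x - U x)" for x
  \<comment> \<open>\<open>Pq\<close> projects onto the part where \<open>U\<close> is 1. It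
    contains the kernel, on which the sum \<open>F\<close> acts as the identity; \<open>Pp\<close>
    removes the kernel again.\<close>
  define Pq where "Pq x = (1/2::real) *\<^sub>R (x + U x)" for x
  define Pp where "Pp x = Pq x - Pz x" for x
  have sPm: "sadj Pm" unfolding Pm_def by (intro sadj_scale sadj_diff sadj_id U)
  have sPq: "sadj Pq" unfolding Pq_def by (intro sadj_scale sadj_add sadj_id U)
  have sPp: "sadj Pp" unfolding Pp_def by (intro sadj_diff sPq Pz)
  note Pml = sadj_lin[OF sPm] and Pql = sadj_lin[OF sPq]
  have half: "(1/2::real) *\<^sub>R (x + x) = x" for x :: 'h by (simp add: scaleR_2[symmetric])
  have mq: "Pm x + Pq x = x" for x
    unfolding Pm_def Pq_def by (simp add: scaleR_add_right[symmetric] half)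
  have Um: "U (Pm x) = - Pm x" and Uq: "U (Pq x) = Pq x" for x
    unfolding Pm_def Pq_def by (simp_all add: Ul U(2) algebra_simps)
  have mm: "Pm (Pm x) = Pm x" and qm: "Pq (Pm x) = 0" for x
    using Um[of x] by (simp_all add: Pm_def[of "Pm x"] Pq_def[of "Pm x"] half)
  have qq: "Pq (Pq x) = Pq x" and mqz: "Pm (Pq x) = 0" for x
    using Uq[of x] by (simp_all add: Pm_def[of "Pq x"] Pq_def[of "Pq x"] half)
  have Fneg: "F (Pm x) \<bullet> Pm x \<le> - c * (norm (Pm x))\<^sup>2" for x
    using U(4)[of "Pm x"] by (simp add: Um Fl)
  have Fpos: "c * (norm (Pq x))\<^sup>2 \<le> F (Pq x) \<bullet> Pq x" for x
    using U(4)[of "Pq x"] by (simp add: Uq)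
  have zm: "Pz (Pm x) = Pm (Pz x)" and zq: "Pz (Pq x) = Pq (Pz x)" for x
    unfolding Pm_def Pq_def by (simp_all add: Pzl Uz)
  have Fm: "F (Pm x) = Pm (F x)" and Fq: "F (Pq x) = Pq (F x)" for x
    unfolding Pm_def Pq_def by (simp_all add: Fl UF)
  have Bm: "B (Pm x) = Pm (B x)" and Bq: "B (Pq x) = Pq (B x)" for x
    unfolding Pm_def Pq_def by (simp_all add: Bl UB)
  have mz: "Pm (Pz x) = 0" for x
  proof -
    have "F (Pm (Pz x)) = Pm (Pz x)" unfolding Fm by (simp add: F_def A0z PzPz)
    then have "(norm (Pm (Pz x)))\<^sup>2 \<le> - c * (norm (Pm (Pz x)))\<^sup>2" using Fneg[of "Pz x"] by (simp add: dot_square_norm)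
    then show ?thesis using U(3) by (smt (verit) mult_minus_left mult_nonneg_nonneg norm_le_zero_iff power2_less_eq_zero_iff zero_le_power2)
  qed
  have qz: "Pq (Pz x) = Pz x" for x using mq[of "Pz x"] mz by simp
  have zq': "Pz (Pq x) = Pz x" for x using zq qz by simp
  have pq: "Pp x = Pq (x - Pz x)" for x by (simp add: Pp_def Pql qz)
  have Pzp: "Pz (Pp x) = 0" for x by (simp add: Pp_def Pzl zq' PzPz)
  have A0m: "A0 (Pm x) = F (Pm x)" for x by (simp add: F_def zm mz)
  have A0p: "A0 (Pp x) = F (Pp x)" for x by (simp add: F_def Pzp)
  have A0_m: "A0 (Pm x) = Pm (A0 x)" and A0_q: "A0 (Pq x) = Pq (A0 x)" for x
    unfolding A0_def by (simp_all add: Pml Pql Bm Bq)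
  have A0_p: "A0 (Pp x) = Pp (A0 x)" for x
    unfolding Pp_def by (simp add: A0l A0_q A0z zA0)
  have BPp: "B (Pp x) = Pp (B x)" for x
    unfolding Pp_def by (simp add: Bl Bq BPz PzB)
  have A0neg: "A0 (Pm x) \<bullet> Pm x \<le> - c * (norm (Pm x))\<^sup>2" for x using Fneg by (simp add: A0m)
  have A0pos: "c * (norm (Pp x))\<^sup>2 \<le> A0 (Pp x) \<bullet> Pp x" for x
    using Fpos[of "x - Pz x"] by (simp add: A0p) (simp add: pq)
  \<comment> \<open>Where \<open>A0\<close> is negative, s B >= 1, so \<open>B\<close> is bounded
    below on the negative part. Completed by the identity on the rest it is invertible; hence the
    negative part is its own image under \<open>B\<close> and consists of domain vectors.\<close>
  have inv_m: "\<exists>z. Pm x = B (Pm z)" for x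
  proof -
    define G where "G x = B (Pm x) + Pq x" for x
    have sG: "sadj G" unfolding G_def by (intro sadj_add sPq) (rule sadj_comp[OF B_sadj sPm Bm])
    have "(min 1 (1/s)) * (norm y)\<^sup>2 \<le> G y \<bullet> y" for y
    proof -
      have orth: "Pm y \<bullet> Pq z = 0" for y z using sadjD(2)[OF sPm, of y "Pq z"] by (simp add: mqz)
      have y: "y = Pm y + Pq y" by (simp add: mq)
      have n: "(norm y)\<^sup>2 = (norm (Pm y))\<^sup>2 + (norm (Pq y))\<^sup>2"
        by (subst y) (use orth[of y y] in \<open>simp add: power2_norm_eq_inner inner_add_left inner_add_right inner_commute\<close>)
      have "G y \<bullet> y = B (Pm y) \<bullet> Pm y + (norm (Pq y))\<^sup>2"
      proof -
        have "B (Pm y) \<bullet> Pq y = 0" using orth[of "B y" y] by (simp add: Bm)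
        moreover have "Pq y \<bullet> Pm y = 0" using orth[of y y] by (simp add: inner_commute)
        ultimately have "(B (Pm y) + Pq y) \<bullet> (Pm y + Pq y) = B (Pm y) \<bullet> Pm y + (norm (Pq y))\<^sup>2"
          by (simp add: inner_add_left inner_add_right dot_square_norm)
        then show ?thesis by (simp add: G_def mq)
      qed
      moreover have "s * (B (Pm y) \<bullet> Pm y) \<ge> (norm (Pm y))\<^sup>2"
      proof -
        have "A0 (Pm y) \<bullet> Pm y \<le> 0" using A0neg[of y] U(3) by (smt (verit) mult_minus_left mult_nonneg_nonneg zero_le_power2)
        then show ?thesis by (simp add: A0_def inner_diff_left dot_square_norm)
      qed
      then have "(1/s) * (norm (Pm y))\<^sup>2 \<le> B (Pm y) \<bullet> Pm y" using s1 by (simp add: field_simps)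
      moreover have "min 1 (1/s) * (norm (Pm y))\<^sup>2 \<le> (1/s) * (norm (Pm y))\<^sup>2" by (intro mult_right_mono) auto
      moreover have "min 1 (1/s) * (norm (Pq y))\<^sup>2 \<le> 1 * (norm (Pq y))\<^sup>2" by (intro mult_right_mono) auto
      ultimately show ?thesis by (simp add: n distrib_left)
    qed
    then obtain z where z: "G z = Pm x" using sadj_pos_surj[OF sG, of "min 1 (1/s)"] s1 by auto
    have "Pm (G z) = B (Pm z)" by (simp add: G_def Pml Bm mm mqz)
    then show ?thesis using z mm by metis
  qed
  have Pm_dm: "Pm x \<in> dm" for x using inv_m[of x] B(1) by metis
  have tmp: "t (Pm x) (Pp y) = 0" if "y \<in> D" for x y
  proof -
    obtain z where z: "Pm x = B (Pm z)" using inv_m by blast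
    have yD: "Pp y \<in> D"
      using that F.mem(2)[of "y - Pm y" "Pz y"] F.mem(2)[of y "Pm y"] dom_D[OF Pm_dm] dom_D[OF kerD(1)[OF Pz(2)]] mq[of y]
      unfolding Pp_def by (metis add_diff_cancel_left')
    have "t (Pm x) (Pp y) = A0 (Pm z) \<bullet> Pp y"
      using t_dom[OF Pm_dm[of x] yD] unfolding A0_T z[symmetric] .
    also have "\<dots> = A0 z \<bullet> Pm (Pp y)" by (simp add: A0_m sadjD(2)[OF sPm])
    also have "Pm (Pp y) = 0" by (simp add: pq mqz)
    finally show ?thesis by simp
  qed
  \<comment> \<open>With v = Pm z and Pm x = B v, the relation s B v = v - A0 v turns the form into
    (A0 v . v - norm(A0 v)^2)/s. The first term is non-positive, and c norm(v) <= norm(A0 v) gives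
    the constant c^2/s.\<close>
  have tneg: "\<exists>d>0. \<forall>x. t (Pm x) (Pm x) \<le> - d * (norm (Pm x))\<^sup>2"
  proof (intro exI conjI allI)
    show "c\<^sup>2 / s > 0" using U(3) s1 by simp
    fix x
    obtain z where z: "Pm x = B (Pm z)" using inv_m by blast
    have "t (Pm x) (Pm x) = A0 (Pm z) \<bullet> B (Pm z)" unfolding z by (rule t_B)
    also have "B (Pm z) = (1/s) *\<^sub>R (Pm z - A0 (Pm z))" using s1 by (simp add: A0_def)
    also have "A0 (Pm z) \<bullet> ((1/s) *\<^sub>R (Pm z - A0 (Pm z))) = (1/s) * (A0 (Pm z) \<bullet> Pm z - (norm (A0 (Pm z)))\<^sup>2)"
      by (simp add: inner_diff_right dot_square_norm)
    also have "\<dots> \<le> (1/s) * (- (norm (A0 (Pm z)))\<^sup>2)"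
    proof (intro mult_left_mono)
      have "- c * (norm (Pm z))\<^sup>2 \<le> 0" using U(3) by simp
      then show "A0 (Pm z) \<bullet> Pm z - (norm (A0 (Pm z)))\<^sup>2 \<le> - (norm (A0 (Pm z)))\<^sup>2" using A0neg[of z] by linarith
    qed (use s1 in auto)
    also have "\<dots> \<le> (1/s) * (- (c\<^sup>2 * (norm (Pm x))\<^sup>2))"
    proof (intro mult_left_mono)
      have "c * (norm (Pm z))\<^sup>2 \<le> norm (A0 (Pm z)) * norm (Pm z)"
        using A0neg[of z] Cauchy_Schwarz_ineq2[of "A0 (Pm z)" "Pm z"] by linarith
      then have "(c * norm (Pm z)) * norm (Pm z) \<le> norm (A0 (Pm z)) * norm (Pm z)"
        by (simp add: power2_eq_square mult.assoc)
      then have "c * norm (Pm z) \<le> norm (A0 (Pm z)) \<or> Pm z = 0"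
        by (metis mult_le_cancel_right_pos zero_less_norm_iff)
      then have "c * norm (Pm z) \<le> norm (A0 (Pm z))" by auto
      moreover have "c * norm (Pm x) \<le> c * norm (Pm z)" using B_norm[of "Pm z"] U(3) by (simp add: z)
      ultimately have "c * norm (Pm x) \<le> norm (A0 (Pm z))" by linarith
      then have "(c * norm (Pm x))\<^sup>2 \<le> (norm (A0 (Pm z)))\<^sup>2" using U(3) by (intro power_mono) auto
      then show "- (norm (A0 (Pm z)))\<^sup>2 \<le> - (c\<^sup>2 * (norm (Pm x))\<^sup>2)" by (simp add: power_mult_distrib)
    qed (use s1 in auto)
    finally show "t (Pm x) (Pm x) \<le> - (c\<^sup>2 / s) * (norm (Pm x))\<^sup>2" by simp
  qed
  then obtain d where d: "d > 0" "\<And>x. t (Pm x) (Pm x) \<le> - d * (norm (Pm x))\<^sup>2" by blast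
  have PmD: "Pm x \<in> D" and PzD: "Pz x \<in> D" for x using dom_D Pm_dm kerD(1)[OF Pz(2)] by auto
  have PpD: "Pp x \<in> D" if "x \<in> D" for x
  proof -
    have "Pp x = x - Pm x - Pz x" unfolding Pp_def using mq[of x] by (metis add_diff_cancel_left')
    then show ?thesis using that F.mem(2)[OF F.mem(2)[OF that PmD] PzD] by simp
  qed
  \<comment> \<open>Half of the gap is kept in reserve: A0 - k is still at least k on the positive
    part. With the identity added on the rest it is a positive operator commuting with
    \<open>B\<close>, so its product with \<open>B\<close> is positive; on the positive part this
    product is the form minus k times \<open>Q\<close>.\<close>
  define k where "k = c / 2"
  have k: "k > 0" using U(3) by (simp add: k_def)
  have tpos0: "k * Q (Pp (B y)) (Pp (B y)) \<le> t (Pp (B y)) (Pp (B y))" for y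
  proof -
    define G where "G x = (A0 (Pp x) - k *\<^sub>R Pp x) + (x - Pp x)" for x
    have ApS: "sadj (\<lambda>x. A0 (Pp x))" by (rule sadj_comp[OF A0_sadj sPp A0_p])
    have sG: "sadj G" unfolding G_def by (intro sadj_add sadj_diff sadj_scale sadj_id sPp ApS)
    have pp: "Pp (Pp x) = Pp x" for x by (simp add: Pp_def[of "Pp x"] Pzp) (simp add: pq qq)
    have Gl: "min k 1 * (norm x)\<^sup>2 \<le> G x \<bullet> x" for x
    proof -
      define z where "z = x - Pp x"
      have o: "Pp y \<bullet> z = 0" for y using sadjD(2)[OF sPp, of y z] by (simp add: z_def sadj_lin[OF sPp] pp)
      have xz: "x = Pp x + z" by (simp add: z_def)
      have n: "(norm x)\<^sup>2 = (norm (Pp x))\<^sup>2 + (norm z)\<^sup>2"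
        by (subst xz) (use o[of x] in \<open>simp add: power2_norm_eq_inner inner_add_left inner_add_right inner_commute\<close>)
      have "G x \<bullet> x = A0 (Pp x) \<bullet> Pp x - k * (norm (Pp x))\<^sup>2 + (norm z)\<^sup>2"
      proof -
        have "A0 (Pp x) \<bullet> z = 0" using o[of "A0 x"] by (simp add: A0_p)
        then have "(A0 (Pp x) - k *\<^sub>R Pp x + z) \<bullet> (Pp x + z) = A0 (Pp x) \<bullet> Pp x - k * (norm (Pp x))\<^sup>2 + (norm z)\<^sup>2"
          using o[of x] by (simp add: inner_add_left inner_add_right inner_diff_left inner_diff_right inner_commute dot_square_norm)
        then show ?thesis by (simp add: G_def z_def)
      qed
      moreover have "2 * k * (norm (Pp x))\<^sup>2 \<le> A0 (Pp x) \<bullet> Pp x" using A0pos[of x] by (simp add: k_def)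
      moreover have "min k 1 * (norm (Pp x))\<^sup>2 \<le> k * (norm (Pp x))\<^sup>2" by (intro mult_right_mono) auto
      moreover have "min k 1 * (norm z)\<^sup>2 \<le> 1 * (norm z)\<^sup>2" by (intro mult_right_mono) auto
      ultimately show ?thesis by (simp add: n distrib_left)
    qed
    have GB: "G (B x) = B (G x)" for x
      by (simp add: G_def Bl A0_B BPp[symmetric])
    have "0 \<le> G (Pp y) \<bullet> B (Pp y)"
      by (rule commuting_pos[OF sG _ Gl B_sadj B_pos GB]) (use k in simp)
    moreover have "G (Pp y) = A0 (Pp y) - k *\<^sub>R Pp y" by (simp add: G_def pp)
    ultimately have "k * (Pp y \<bullet> B (Pp y)) \<le> A0 (Pp y) \<bullet> B (Pp y)" by (simp add: inner_diff_left)
    then show ?thesis by (simp add: BPp[symmetric] t_B)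
  qed
  have tpos: "k * Q (Pp x) (Pp x) \<le> t (Pp x) (Pp x)" if x: "x \<in> D" for x
  proof -
    obtain f where f: "\<And>n. f n \<in> dm" "(\<lambda>n. nQ (f n - x)) \<longlonglongrightarrow> 0" using D_approx[OF x] by blast
    have fB: "f n = B (T (f n) + s *\<^sub>R f n)" for n using B_eq[OF f(1)] by simp
    have fD: "f n \<in> D" for n using f dom_D by blast
    \<comment> \<open>The negative and null components have form norm at most sqrt s times their
      norm, which makes \<open>Pp\<close> continuous in the form norm. The bound known on the range
      of \<open>B\<close> then extends to the form domain by density.\<close>
    have bnd: "nQ (Pp w) \<le> (1 + 2 * sqrt s) * nQ w" if w: "w \<in> D" for w
    proof -
      have e: "Pp w = w - Pm w - Pz w" unfolding Pp_def using mq[of w] by (metis add_diff_cancel_left')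
      have contr: "norm (R w) \<le> norm w" if "sadj R" "\<And>x. R (R x) = R x" for R
      proof (cases "R w = 0")
        case False
        have "(norm (R w))\<^sup>2 = R w \<bullet> w" using sadjD(2)[OF that(1), of "R w" w] by (simp add: that(2) dot_square_norm)
        also have "\<dots> \<le> norm (R w) * norm w" by (rule norm_cauchy_schwarz)
        finally show ?thesis using False by (simp add: power2_eq_square)
      qed simp
      have s': "sqrt (s * (norm y)\<^sup>2) = sqrt s * norm y" for y :: 'h by (simp add: real_sqrt_mult)
      have "t (Pm w) (Pm w) \<le> 0" using d by (smt (verit) mult_minus_left mult_nonneg_nonneg zero_le_power2)
      then have "Q (Pm w) (Pm w) \<le> s * (norm (Pm w))\<^sup>2" by (simp add: Q_def dot_square_norm)
      then have 1: "nQ (Pm w) \<le> sqrt s * norm (Pm w)" using s'[of "Pm w"] by (metis real_sqrt_le_iff)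
      have 2: "nQ (Pz w) = sqrt s * norm (Pz w)"
        by (simp add: Q_def t_ker Pz(2) PzD dot_square_norm s')
      have "nQ (Pp w) \<le> nQ w + nQ (Pm w) + nQ (Pz w)"
      proof -
        have neg: "nQ (- y) = nQ y" if "y \<in> D" for y using that by (simp add: Q.neg_l Q.neg_r F.mem)
        have "nQ (w + - Pm w) \<le> nQ w + nQ (- Pm w)" by (rule Q.sqrt_triangle[OF Q_nn w F.mem(4)[OF PmD]])
        moreover have "nQ ((w + - Pm w) + - Pz w) \<le> nQ (w + - Pm w) + nQ (- Pz w)"
          by (rule Q.sqrt_triangle[OF Q_nn F.mem(1)[OF w F.mem(4)[OF PmD]] F.mem(4)[OF PzD]])
        ultimately show ?thesis using neg[OF PmD] neg[OF PzD] by (simp add: e)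
      qed
      moreover have "sqrt s * norm (Pm w) \<le> sqrt s * nQ w"
        using order_trans[OF contr[OF sPm mm] norm_le_nQ[OF w]] s1 by (intro mult_left_mono) auto
      moreover have "sqrt s * norm (Pz w) \<le> sqrt s * nQ w"
        using order_trans[OF contr[OF Pz(1) PzPz] norm_le_nQ[OF w]] s1 by (intro mult_left_mono) auto
      ultimately show ?thesis using 1 2 by (simp add: algebra_simps)
    qed
    have lim: "(\<lambda>n. nQ (Pp (f n)) - nQ (Pp x)) \<longlonglongrightarrow> 0"
    proof (rule tendsto_rabs_zero_cancel, rule tendsto_sandwich[OF _ _ tendsto_const])
      show "(\<lambda>n. (1 + 2 * sqrt s) * nQ (f n - x)) \<longlonglongrightarrow> 0" by (rule tendsto_mult_right_zero[OF f(2)])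
      show "\<forall>\<^sub>F n in sequentially. \<bar>nQ (Pp (f n)) - nQ (Pp x)\<bar> \<le> (1 + 2 * sqrt s) * nQ (f n - x)"
      proof (rule always_eventually, rule allI)
        fix n
        have "\<bar>nQ (Pp (f n)) - nQ (Pp x)\<bar> \<le> nQ (Pp (f n) - Pp x)"
          by (rule Q.sqrt_abs_diff[OF Q_nn PpD[OF fD] PpD[OF x]])
        also have "\<dots> \<le> (1 + 2 * sqrt s) * nQ (f n - x)"
          using bnd[OF F.mem(2)[OF fD x], of n] by (simp add: sadj_lin[OF sPp])
        finally show "\<bar>nQ (Pp (f n)) - nQ (Pp x)\<bar> \<le> (1 + 2 * sqrt s) * nQ (f n - x)" .
      qed
    qed auto
    then have l1: "(\<lambda>n. nQ (Pp (f n))) \<longlonglongrightarrow> nQ (Pp x)" by (rule LIM_zero_cancel)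
    have "(\<lambda>n. (nQ (Pp (f n)))\<^sup>2) \<longlonglongrightarrow> (nQ (Pp x))\<^sup>2" by (rule tendsto_power[OF l1])
    then have l2: "(\<lambda>n. Q (Pp (f n)) (Pp (f n))) \<longlonglongrightarrow> Q (Pp x) (Pp x)"
      using Q_nn[OF PpD[OF fD]] Q_nn[OF PpD[OF x]] by simp
    have fx: "f \<longlonglongrightarrow> x"
    proof (rule LIM_zero_cancel, rule tendsto_norm_zero_cancel, rule tendsto_sandwich[OF _ _ tendsto_const f(2)])
      show "\<forall>\<^sub>F n in sequentially. norm (f n - x) \<le> nQ (f n - x)" using norm_le_nQ F.mem(2)[OF fD x] by simp
    qed auto
    have l3: "(\<lambda>n. s * (norm (Pp (f n)))\<^sup>2) \<longlonglongrightarrow> s * (norm (Pp x))\<^sup>2"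
      by (intro tendsto_intros bounded_linear.tendsto[OF sadjD(1)[OF sPp] fx])
    \<comment> \<open>The claim k Q <= t rewritten by means of Q = t + s norm^2, so that both sides
      are known to converge along \<open>f\<close>.\<close>
    have "(1 - k) * Q (Pp x) (Pp x) \<ge> s * (norm (Pp x))\<^sup>2"
    proof (rule LIMSEQ_le[OF l3 tendsto_mult_left[OF l2]], intro exI allI impI)
      fix n
      show "s * (norm (Pp (f n)))\<^sup>2 \<le> (1 - k) * Q (Pp (f n)) (Pp (f n))"
        using tpos0[of "T (f n) + s *\<^sub>R f n"] fB[of n] by (simp add: Q_def dot_square_norm algebra_simps)
    qed
    then show ?thesis by (simp add: Q_def dot_square_norm algebra_simps)
  qed
  define a where "a = min d (min c k)"
  have a: "0 < a" "a \<le> d" "a \<le> c" "a \<le> k" using d U(3) k by (auto simp: a_def)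
  have "ssplit J A s Pm Pz Pp a"
  proof
    fix x y
    show "Pm x + Pz x + Pp x = x" by (simp add: Pp_def mq)
    show "Pp (Pp x) = Pp x" by (simp add: Pp_def[of "Pp x"] Pzp) (simp add: pq qq)
    show "Pm (Pp x) = 0" by (simp add: pq mqz)
    show "Pz (Pm x) = 0" by (simp add: zm mz)
    show "Pp (Pm x) = 0" by (simp add: Pp_def qm zm mz)
    show "Pp (Pz x) = 0" by (simp add: Pp_def qz PzPz)
    show "Pm (J x) = J (Pm x)" by (simp add: Pm_def J_lin UJ)
    show "Pp (J x) = J (Pp x)" by (simp add: Pp_def Pq_def J_lin UJ JPz)
    show "t (Pm x) (Pm x) \<le> - a * (norm (Pm x))\<^sup>2"
      using d(2)[of x] mult_right_mono[OF a(2), of "(norm (Pm x))\<^sup>2"] by simp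
    show "A0 (Pm x) \<bullet> Pm x \<le> - a * (norm (Pm x))\<^sup>2"
      using A0neg[of x] mult_right_mono[OF a(3), of "(norm (Pm x))\<^sup>2"] by simp
    show "a * (norm (Pp x))\<^sup>2 \<le> A0 (Pp x) \<bullet> Pp x"
      using A0pos[of x] mult_right_mono[OF a(3), of "(norm (Pp x))\<^sup>2"] by simp
    show "a * Q (Pp x) (Pp x) \<le> t (Pp x) (Pp x)" if "x \<in> D"
      using tpos[OF that] mult_right_mono[OF a(4) Q_nn[OF PpD[OF that]]] by simp
  qed (use a Pz sPm sPp mm PzPz mz Pzp JPz Pm_dm tmp A0_m A0_p in auto)
  then show ?thesis by blast
qed

end

section \<open>Non-negative subspaces and their negative complements\<close>

context ssplit
begin

lemma PmD: "Pm x \<in> D" and PzD: "Pz x \<in> D"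
  using dom_D Pm_dom kerD(1)[OF Pz_ker(1)] by auto

lemma PpD: "x \<in> D \<Longrightarrow> Pp x \<in> D"
proof -
  assume x: "x \<in> D"
  have "Pp x = x - Pm x - Pz x" using P_sum[of x] by (simp add: algebra_simps)
  then show ?thesis using F.mem(2)[OF F.mem(2)[OF x PmD] PzD] by simp
qed

lemma t_Pm: "y \<in> D \<Longrightarrow> t (Pm x) y = t (Pm x) (Pm y)"
proof -
  assume y: "y \<in> D"
  have "t (Pm x) y = t (Pm x) (Pm y + Pz y + Pp y)" by (simp add: P_sum)
  also have "\<dots> = t (Pm x) (Pm y) + t (Pm x) (Pz y) + t (Pm x) (Pp y)"
    by (simp add: F.add_r F.mem PmD PzD PpD y)
  also have "t (Pm x) (Pz y) = 0" using t_ker[OF Pz_ker(1) PmD, of y x] F.sym[OF PmD PzD] by simp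
  finally show ?thesis using t_mp[OF y] by simp
qed

lemma t_Pp: "x \<in> D \<Longrightarrow> y \<in> D \<Longrightarrow> t (Pp x) y = t (Pp x) (Pp y)"
proof -
  assume x: "x \<in> D" and y: "y \<in> D"
  have "t (Pp x) y = t (Pp x) (Pm y + Pz y + Pp y)" by (simp add: P_sum)
  also have "\<dots> = t (Pp x) (Pm y) + t (Pp x) (Pz y) + t (Pp x) (Pp y)"
    by (simp add: F.add_r F.mem PmD PzD PpD x y)
  also have "t (Pp x) (Pz y) = 0" using t_ker[OF Pz_ker(1) PpD[OF x], of y] F.sym[OF PpD[OF x] PzD] by simp
  also have "t (Pp x) (Pm y) = 0" using t_mp[OF x, of y] F.sym[OF PpD[OF x] PmD] by simp
  finally show ?thesis by simp
qed

lemma t_split: "x \<in> D \<Longrightarrow> t x x = t (Pm x) (Pm x) + t (Pp x) (Pp x)"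
proof -
  assume x: "x \<in> D"
  have "t x x = t (Pm x + Pz x + Pp x) x" by (simp add: P_sum)
  also have "\<dots> = t (Pm x) x + t (Pz x) x + t (Pp x) x" by (simp add: F.add_l F.mem PmD PzD PpD x)
  finally show ?thesis by (simp add: t_Pm t_Pp x t_ker Pz_ker)
qed

lemma P_inner: "Pm x \<bullet> y = Pm x \<bullet> Pm y" "Pp x \<bullet> y = Pp x \<bullet> Pp y"
  using sadjD(2)[OF Pm_sadj, of "Pm x" y] sadjD(2)[OF Pp_sadj, of "Pp x" y] by (simp_all add: P_idem)

lemma t_pos_nn: "x \<in> D \<Longrightarrow> 0 \<le> t (Pp x) (Pp x)"
  using t_pos[of x] Q_nn[OF PpD[of x]] a_pos by (meson less_imp_le mult_nonneg_nonneg order_trans)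

lemma t_neg_nn: "t (Pm x) (Pm x) \<le> 0"
  using t_neg[of x] a_pos by (smt (verit) mult_minus_left mult_nonneg_nonneg zero_le_power2)

lemma t_nonneg: "x \<in> D \<Longrightarrow> Pm x = 0 \<Longrightarrow> 0 \<le> t x x"
  using t_split[of x] t_pos_nn[of x] F.zero_l[OF F.zero_mem] by simp

lemma t_nonpos: "x \<in> D \<Longrightarrow> Pp x = 0 \<Longrightarrow> t x x \<le> 0"
  using t_split[of x] t_neg_nn[of x] F.zero_l[OF F.zero_mem] by simp

lemma t_neg_zero: "Pm x = x \<Longrightarrow> 0 \<le> t x x \<Longrightarrow> x = 0"
  using t_neg[of x] a_pos by (smt (verit) mult_minus_left mult_pos_pos norm_eq_zero zero_less_power2)

lemma norm_split: "(norm x)\<^sup>2 = (norm (Pm x))\<^sup>2 + (norm (x - Pm x))\<^sup>2"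
proof -
  have "Pm x \<bullet> (x - Pm x) = 0" using P_inner(1)[of x "x - Pm x"] by (simp add: sadj_lin[OF Pm_sadj] P_idem)
  then show ?thesis
    by (simp add: power2_norm_eq_inner inner_diff_left inner_diff_right inner_commute algebra_simps)
qed

lemma nonpos_dom: "Pp x = 0 \<Longrightarrow> x \<in> dm"
  using P_sum[of x] dom_closed(1)[OF Pm_dom kerD(1)[OF Pz_ker(1)], of x x] by simp

text \<open>For a vector of non-negative form value the positive component controls the negative
  one, since a norm(Pm w)^2 <= - t(Pm w) <= t(Pp w). So a non-negative subspace without null
  components is a graph over its positive part, with bounds in the form norm.\<close>

lemma Q_sum_le:
  assumes w: "w \<in> D" "Pz w = 0" "0 \<le> t w w"
  shows "Q w w \<le> ((1 + s) / a) * t (Pp w) (Pp w)" "t (Pp w) (Pp w) \<le> Q (Pp w) (Pp w)"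
    "Q (Pp w) (Pp w) \<le> Q w w"
proof -
  have o: "Pm w \<bullet> Pp w = 0" using P_inner(1)[of w "Pp w"] by (simp add: P_orth)
  have w': "w = Pm w + Pp w" using P_sum[of w] w(2) by simp
  have "Q (Pm w + Pp w) (Pm w + Pp w) = Q (Pm w) (Pm w) + 2 * Q (Pm w) (Pp w) + Q (Pp w) (Pp w)"
    by (rule Q.sq_add[OF PmD PpD[OF w(1)]])
  moreover have "Q (Pm w) (Pp w) = 0" using t_mp[OF w(1), of w] o by (simp add: Q_def)
  ultimately have Qs: "Q w w = Q (Pm w) (Pm w) + Q (Pp w) (Pp w)" using w' by simp
  have "a * (norm (Pm w))\<^sup>2 \<le> t (Pp w) (Pp w)" using t_neg[of w] t_split[OF w(1)] w(3) by simp
  then have "(norm (Pm w))\<^sup>2 \<le> t (Pp w) (Pp w) / a" using a_pos by (simp add: field_simps)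
  then have "s * (norm (Pm w))\<^sup>2 \<le> s * (t (Pp w) (Pp w) / a)" using s1 by (intro mult_left_mono) auto
  moreover have "Q (Pm w) (Pm w) \<le> s * (norm (Pm w))\<^sup>2" using t_neg_nn[of w] by (simp add: Q_def dot_square_norm)
  moreover have "Q (Pp w) (Pp w) \<le> t (Pp w) (Pp w) / a" using t_pos[OF w(1)] a_pos by (simp add: field_simps)
  ultimately show "Q w w \<le> ((1 + s) / a) * t (Pp w) (Pp w)" using Qs by (simp add: algebra_simps add_divide_distrib)
  show "t (Pp w) (Pp w) \<le> Q (Pp w) (Pp w)" by (rule t_le_Q[OF PpD[OF w(1)]])
  show "Q (Pp w) (Pp w) \<le> Q w w" using Qs Q_nn[OF PmD, of w] by simp
qed

end

context sb_op
begin

text \<open>The closure of \<open>M\<close> in the form norm is again a non-negative complex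
  subspace, so maximality forces equality.\<close>

lemma form_closure_nonneg:
  assumes M: "M \<in> Mplus J A D" and f: "\<And>n. f n \<in> M" "(\<lambda>n. nQ (f n - x)) \<longlonglongrightarrow> 0" and x: "x \<in> D"
  shows "x \<in> M"
proof -
  have nn: "csubspace J M" "M \<subseteq> D" "\<And>x. x \<in> M \<Longrightarrow> 0 \<le> t x x"
    and max: "\<And>M'. nonneg_sub J A D M' \<Longrightarrow> M \<subseteq> M' \<Longrightarrow> M' = M"
    using M fb_self unfolding Mplus_def nonneg_sub_def by auto
  have sub: "subspace M" and MJ: "\<And>x. x \<in> M \<Longrightarrow> J x \<in> M" using nn(1) by (auto simp: csubspace_def)
  define M' where "M' = {x \<in> D. \<exists>f. (\<forall>n. f n \<in> M) \<and> (\<lambda>n. nQ (f n - x)) \<longlonglongrightarrow> 0}"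
  have "M \<subseteq> M'"
  proof
    fix y assume y: "y \<in> M"
    then have "(\<lambda>n::nat. nQ (y - y)) \<longlonglongrightarrow> 0" using Q.zero_l[OF F.zero_mem] by simp
    then show "y \<in> M'" unfolding M'_def using y nn(2) by (intro CollectI conjI exI[of _ "\<lambda>_. y"]) auto
  qed
  moreover have "nonneg_sub J A D M'"
    unfolding nonneg_sub_def csubspace_def
  proof (intro conjI ballI)
    show "M' \<subseteq> D" by (auto simp: M'_def)
    show "subspace M'"
    proof (rule subspaceI)
      show "0 \<in> M'" using subsetD[OF \<open>M \<subseteq> M'\<close> subspace_0[OF sub]] .
    next
      fix u v assume "u \<in> M'" "v \<in> M'"
      then obtain g h where g: "\<And>n. g n \<in> M" "(\<lambda>n. nQ (g n - u)) \<longlonglongrightarrow> 0" "u \<in> D"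
        and h: "\<And>n. h n \<in> M" "(\<lambda>n. nQ (h n - v)) \<longlonglongrightarrow> 0" "v \<in> D" unfolding M'_def by blast
      have "(\<lambda>n. nQ (g n + h n - (u + v))) \<longlonglongrightarrow> 0"
      proof (rule tendsto_sandwich[OF _ _ tendsto_const])
        show "(\<lambda>n. nQ (g n - u) + nQ (h n - v)) \<longlonglongrightarrow> 0" using tendsto_add[OF g(2) h(2)] by simp
        show "\<forall>\<^sub>F n in sequentially. nQ (g n + h n - (u + v)) \<le> nQ (g n - u) + nQ (h n - v)"
        proof (rule always_eventually, rule allI)
          fix n
          have "g n - u \<in> D" "h n - v \<in> D" using g h nn(2) F.mem by blast+
          then show "nQ (g n + h n - (u + v)) \<le> nQ (g n - u) + nQ (h n - v)"
            using Q.sqrt_triangle[OF Q_nn, of "g n - u" "h n - v"] by (simp add: add_diff_add)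
        qed
        show "\<forall>\<^sub>F n in sequentially. 0 \<le> nQ (g n + h n - (u + v))"
        proof (rule always_eventually, rule allI)
          fix n
          have "g n + h n - (u + v) \<in> D"
            by (rule F.mem(2)[OF F.mem(1) F.mem(1)]) (use g h nn(2) in auto)
          then show "0 \<le> nQ (g n + h n - (u + v))" using Q_nn by simp
        qed
      qed
      moreover have "\<forall>n. g n + h n \<in> M" using g h sub subspace_add by blast
      ultimately show "u + v \<in> M'" unfolding M'_def using F.mem(1)[OF g(3) h(3)]
        by (intro CollectI conjI exI[of _ "\<lambda>n. g n + h n"])
    next
      fix c u assume "u \<in> M'"
      then obtain g where g: "\<And>n. g n \<in> M" "(\<lambda>n. nQ (g n - u)) \<longlonglongrightarrow> 0" "u \<in> D" unfolding M'_def by blast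
      have "nQ (c *\<^sub>R g n - c *\<^sub>R u) = \<bar>c\<bar> * nQ (g n - u)" for n
      proof -
        have "g n - u \<in> D" using g nn(2) F.mem by blast
        then show ?thesis using Q.sq_scale[of "g n - u" c] by (simp add: scaleR_diff_right[symmetric] real_sqrt_mult)
      qed
      then have "(\<lambda>n. nQ (c *\<^sub>R g n - c *\<^sub>R u)) \<longlonglongrightarrow> 0" using tendsto_mult_right_zero[OF g(2), of "\<bar>c\<bar>"] by simp
      moreover have "\<forall>n. c *\<^sub>R g n \<in> M" using g sub subspace_scale by blast
      ultimately show "c *\<^sub>R u \<in> M'" unfolding M'_def using F.mem(3)[OF g(3)]
        by (intro CollectI conjI exI[of _ "\<lambda>n. c *\<^sub>R g n"])
    qed
    fix u assume "u \<in> M'"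
    then obtain g where g: "\<And>n. g n \<in> M" "(\<lambda>n. nQ (g n - u)) \<longlonglongrightarrow> 0" "u \<in> D" unfolding M'_def by blast
    have gD: "g n \<in> D" for n using g nn(2) by blast
    have d: "g n - u \<in> D" for n using F.mem(2)[OF gD g(3)] .
    have "nQ (J (g n) - J u) = nQ (g n - u)" for n
      using t_J[OF d[of n] d[of n]] by (simp add: Q_def J_lin[symmetric] J_inner)
    then show "J u \<in> M'" unfolding M'_def using g MJ D_J[OF g(3)]
      by (intro CollectI conjI exI[of _ "\<lambda>n. J (g n)"]) auto
    have "(\<lambda>n. nQ (g n) - nQ u) \<longlonglongrightarrow> 0"
    proof (rule tendsto_rabs_zero_cancel, rule tendsto_sandwich[OF _ _ tendsto_const g(2)])
      show "\<forall>\<^sub>F n in sequentially. \<bar>nQ (g n) - nQ u\<bar> \<le> nQ (g n - u)"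
        by (rule always_eventually) (rule allI, rule Q.sqrt_abs_diff[OF Q_nn gD g(3)])
    qed auto
    then have "(\<lambda>n. nQ (g n)) \<longlonglongrightarrow> nQ u" by (rule LIM_zero_cancel)
    moreover have "g \<longlonglongrightarrow> u"
    proof (rule LIM_zero_cancel, rule tendsto_norm_zero_cancel, rule tendsto_sandwich[OF _ _ tendsto_const g(2)])
      show "\<forall>\<^sub>F n in sequentially. norm (g n - u) \<le> nQ (g n - u)" using norm_le_nQ d by simp
    qed auto
    ultimately have "(\<lambda>n. (nQ (g n))\<^sup>2 - s * (g n \<bullet> g n)) \<longlonglongrightarrow> (nQ u)\<^sup>2 - s * (u \<bullet> u)"
      by (intro tendsto_diff tendsto_power tendsto_mult tendsto_const tendsto_inner)
    moreover have "(nQ v)\<^sup>2 - s * (v \<bullet> v) = t v v" if "v \<in> D" for v using Q_nn[OF that] by (simp add: Q_def)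
    ultimately have "(\<lambda>n. t (g n) (g n)) \<longlonglongrightarrow> t u u" using gD g(3) by simp
    then have "0 \<le> t u u" using nn(3)[OF g(1)] by (intro LIMSEQ_le_const[of "\<lambda>n. t (g n) (g n)"]) auto
    then show "0 \<le> form_val A u" using fb_self[OF g(3)] by simp
  qed
  ultimately have "M' = M" using max by blast
  moreover have "x \<in> M'" unfolding M'_def using f x by blast
  ultimately show ?thesis by simp
qed

end

lemma csubspace_sum:
  assumes "csubspace J U" "csubspace J V" "linear J"
  shows "csubspace J {u + v | u v. u \<in> U \<and> v \<in> V}"
  unfolding csubspace_def
proof
  show "subspace {u + v | u v. u \<in> U \<and> v \<in> V}"
    using subspace_sums assms unfolding csubspace_def by blast
  show "\<forall>x\<in>{u + v | u v. u \<in> U \<and> v \<in> V}. J x \<in> {u + v | u v. u \<in> U \<and> v \<in> V}"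
    using assms linear_add[of J] unfolding csubspace_def by blast
qed

context ssplit
begin

text \<open>Project \<open>Pp x\<close> onto \<open>Pp M\<close> orthogonally in the form. The
  residual \<open>w\<close> is positive and orthogonal to \<open>M\<close>, so enlarging
  \<open>M\<close> by the complex line through \<open>w\<close> keeps it non-negative. Maximality
  puts \<open>w\<close> in \<open>M\<close>, hence t(w, w) = 0 and w = 0. Completeness of
  \<open>Pp M\<close> comes from the graph estimate and the form closedness of
  \<open>M\<close>.\<close>

lemma Mplus_complement:
  assumes inj: "\<And>x. x \<in> ker A \<Longrightarrow> x = 0" and M: "M \<in> Mplus J A D" and x: "x \<in> D"
  shows "\<exists>m\<in>M. Pm (x - m) = x - m"
proof -
  have nn: "csubspace J M" "M \<subseteq> D" "\<And>x. x \<in> M \<Longrightarrow> 0 \<le> t x x"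
    and max: "\<And>M'. nonneg_sub J A D M' \<Longrightarrow> M \<subseteq> M' \<Longrightarrow> M' = M"
    using M fb_self unfolding Mplus_def nonneg_sub_def by auto
  have sub: "subspace M" and MJ: "\<And>x. x \<in> M \<Longrightarrow> J x \<in> M" using nn(1) by (auto simp: csubspace_def)
  note Ppl = sadj_lin[OF Pp_sadj] and Pml = sadj_lin[OF Pm_sadj]
  have Pz0: "Pz y = 0" for y using inj Pz_ker(1) by blast
  define D' where "D' = {y \<in> D. Pp y = y}"
  have D': "subspace D'"
    by (rule subspaceI) (auto simp: D'_def F.mem F.zero_mem Ppl)
  define V where "V = Pp ` M"
  have V: "subspace V"
    unfolding V_def using sub sadjD(1)[OF Pp_sadj] bounded_linear.linear linear_subspace_image by blast
  have VD: "V \<subseteq> D'" unfolding V_def D'_def using nn(2) PpD P_idem by auto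
  interpret G: bform D' t
    by (rule bform_subset[OF bform_t D']) (auto simp: D'_def)
  have "\<exists>v\<in>V. \<forall>w\<in>V. t (Pp x - v) w = 0"
  proof (rule G.projection[OF _ V VD])
    show "0 \<le> t v v" if "v \<in> D'" for v using that t_pos_nn[of v] by (simp add: D'_def)
    show "Pp x \<in> D'" using x PpD P_idem by (simp add: D'_def)
    fix f :: "nat \<Rightarrow> 'h" assume fV: "\<And>n. f n \<in> V"
      and cau: "\<And>e. e > 0 \<Longrightarrow> \<exists>N::nat. \<forall>m\<ge>N. \<forall>n\<ge>N. t (f m - f n) (f m - f n) < e"
    have "\<forall>n. \<exists>m. m \<in> M \<and> f n = Pp m" using fV unfolding V_def by blast
    then obtain g where g: "\<And>n. g n \<in> M" "\<And>n. f n = Pp (g n)" by metis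
    have gD: "g n \<in> D" for n using g nn(2) by blast
    have gM: "g m - g n \<in> M" for m n using g sub subspace_diff by blast
    define k where "k = (1 + s) / a"
    have k: "k > 0" using s1 a_pos by (simp add: k_def)
    have Qg: "Q (g m - g n) (g m - g n) \<le> k * t (f m - f n) (f m - f n)" for m n
      using Q_sum_le(1)[OF F.mem(2)[OF gD gD] Pz0 nn(3)[OF gM]] by (simp add: k_def g(2) Ppl)
    have "\<exists>y\<in>D. (\<lambda>n. nQ (g n - y)) \<longlonglongrightarrow> 0"
    proof (rule form_complete[OF gD])
      fix e :: real assume e: "e > 0"
      then obtain N where N: "\<forall>m\<ge>N. \<forall>n\<ge>N. t (f m - f n) (f m - f n) < e\<^sup>2 / k" using cau[of "e\<^sup>2 / k"] k by auto
      have "nQ (g m - g n) < e" if "m \<ge> N" "n \<ge> N" for m n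
      proof -
        have "k * t (f m - f n) (f m - f n) < e\<^sup>2" using N that k by (simp add: field_simps)
        then have "Q (g m - g n) (g m - g n) < e\<^sup>2" using Qg[of m n] by linarith
        then show ?thesis using e by (intro real_less_lsqrt) auto
      qed
      then show "\<exists>M. \<forall>m\<ge>M. \<forall>n\<ge>M. nQ (g m - g n) < e" by blast
    qed
    then obtain y where y: "y \<in> D" "(\<lambda>n. nQ (g n - y)) \<longlonglongrightarrow> 0" by blast
    have yM: "y \<in> M" by (rule form_closure_nonneg[OF M g(1) y(2,1)])
    have "(\<lambda>n. t (f n - Pp y) (f n - Pp y)) \<longlonglongrightarrow> 0"
    proof (rule tendsto_sandwich[OF _ _ tendsto_const])
      have "(\<lambda>n. (nQ (g n - y))\<^sup>2) \<longlonglongrightarrow> 0" using tendsto_power[OF y(2), of 2] by simp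
      then show "(\<lambda>n. Q (g n - y) (g n - y)) \<longlonglongrightarrow> 0" using Q_nn[OF F.mem(2)[OF gD y(1)]] by simp
      have mem: "g n - y \<in> M" for n using g yM sub subspace_diff by blast
      have "t (f n - Pp y) (f n - Pp y) \<le> Q (g n - y) (g n - y)" for n
        using Q_sum_le(2,3)[OF F.mem(2)[OF gD y(1)] Pz0 nn(3)[OF mem], of n] by (simp add: g(2) Ppl)
      then show "\<forall>\<^sub>F n in sequentially. t (f n - Pp y) (f n - Pp y) \<le> Q (g n - y) (g n - y)" by simp
      show "\<forall>\<^sub>F n in sequentially. 0 \<le> t (f n - Pp y) (f n - Pp y)"
        using t_pos_nn[OF F.mem(2)[OF gD y(1)]] by (simp add: g(2) Ppl)
    qed
    then show "\<exists>v\<in>V. (\<lambda>n. t (f n - v) (f n - v)) \<longlonglongrightarrow> 0" using yM unfolding V_def by blast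
  qed
  then obtain m where m: "m \<in> M" and orth: "\<And>m'. m' \<in> M \<Longrightarrow> t (Pp x - Pp m) (Pp m') = 0" unfolding V_def by blast
  define w where "w = Pp x - Pp m"
  have w: "w \<in> D" "Pp w = w" unfolding w_def using x m nn(2) PpD F.mem by (auto simp: Ppl P_idem)
  have wo: "t w m' = 0" if "m' \<in> M" for m'
    using t_Pp[OF w(1), of m'] that nn(2) orth w(2) unfolding w_def by auto
  \<comment> \<open>A complex line is a real plane: adding the real multiples of \<open>w\<close>
    alone would break invariance under \<open>J\<close>.\<close>
  define L where "L = {c *\<^sub>R w + d *\<^sub>R J w | c d. True}"
  have Llin: "linear J" using J by (simp add: cplx_struct_def)
  have L: "csubspace J L"
    unfolding csubspace_def
  proof
    show "subspace L"
    proof (rule subspaceI)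
      show "0 \<in> L" unfolding L_def by (intro CollectI exI[of _ 0]) simp
    next
      fix u v assume "u \<in> L" "v \<in> L"
      then obtain c d c' d' where "u = c *\<^sub>R w + d *\<^sub>R J w" "v = c' *\<^sub>R w + d' *\<^sub>R J w" unfolding L_def by blast
      then show "u + v \<in> L" unfolding L_def
        by (intro CollectI exI[of _ "c + c'"] exI[of _ "d + d'"]) (simp add: algebra_simps)
    next
      fix k u assume "u \<in> L"
      then obtain c d where "u = c *\<^sub>R w + d *\<^sub>R J w" unfolding L_def by blast
      then show "k *\<^sub>R u \<in> L" unfolding L_def
        by (intro CollectI exI[of _ "k * c"] exI[of _ "k * d"]) (simp add: algebra_simps)
    qed
    show "\<forall>u\<in>L. J u \<in> L"
    proof
      fix u assume "u \<in> L"
      then obtain c d where "u = c *\<^sub>R w + d *\<^sub>R J w" unfolding L_def by blast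
      then show "J u \<in> L" unfolding L_def
        by (intro CollectI exI[of _ "- d"] exI[of _ c]) (simp add: J_lin JJ)
    qed
  qed
  define M' where "M' = {u + v | u v. u \<in> M \<and> v \<in> L}"
  have "nonneg_sub J A D M'"
    unfolding nonneg_sub_def
  proof (intro conjI ballI)
    show "csubspace J M'" unfolding M'_def by (rule csubspace_sum[OF nn(1) L Llin])
    have JwD: "J w \<in> D" using w D_J by blast
    have LD: "v \<in> D" if "v \<in> L" for v using that w JwD F.mem unfolding L_def by blast
    then show "M' \<subseteq> D" unfolding M'_def using nn(2) F.mem(1) by blast
    fix u assume "u \<in> M'"
    then obtain m' v where u: "u = m' + v" "m' \<in> M" "v \<in> L" unfolding M'_def by blast
    then obtain c d where v: "v = c *\<^sub>R w + d *\<^sub>R J w" unfolding L_def by blast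
    have m'D: "m' \<in> D" using u nn(2) by blast
    have "t (J w) m' = 0" using t_J_skew[OF w(1) m'D] wo[OF MJ[OF u(2)]] by simp
    then have "t v m' = 0" using wo[OF u(2)] w JwD m'D by (simp add: v F.add_l F.scale_l F.mem)
    then have c0: "t m' v = 0" using F.sym[OF LD[OF u(3)] m'D] by simp
    have "Pp v = v" using w(2) P_J(3)[of w] by (simp add: v Ppl)
    then have "0 \<le> t v v" using t_pos_nn[OF LD[OF u(3)]] by simp
    then have "0 \<le> t u u" using F.sq_add[OF m'D LD[OF u(3)]] c0 nn(3)[OF u(2)] by (simp add: u(1))
    moreover have "u \<in> D" using u F.mem(1)[OF m'D LD[OF u(3)]] by simp
    ultimately show "0 \<le> form_val A u" using fb_self by simp
  qed
  moreover have "M \<subseteq> M'"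
  proof
    fix u assume "u \<in> M"
    moreover have "0 \<in> L" using L subspace_0 unfolding csubspace_def by blast
    ultimately show "u \<in> M'" unfolding M'_def by (intro CollectI exI[of _ u] exI[of _ 0]) simp
  qed
  ultimately have "M' = M" using max by blast
  moreover have "w \<in> M'"
  proof -
    have "w \<in> L" unfolding L_def by (intro CollectI exI[of _ 1] exI[of _ 0]) simp
    moreover have "0 \<in> M" using sub subspace_0 by blast
    ultimately show ?thesis unfolding M'_def by (intro CollectI exI[of _ 0] exI[of _ w]) simp
  qed
  ultimately have "t w w = 0" using wo by blast
  then have "a * Q w w \<le> 0" using t_pos[OF w(1)] w(2) by simp
  then have "Q w w \<le> 0" using a_pos by (simp add: mult_le_0_iff)
  then have "w = 0" using Q_ge[OF w(1)] by (smt (verit) norm_le_zero_iff power2_less_eq_zero_iff)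
  then have "Pp (x - m) = 0" by (simp add: w_def Ppl)
  then have "Pm (x - m) = x - m" using P_sum[of "x - m"] Pz0 by simp
  then show ?thesis using m by blast
qed

text \<open>Let H be the range of \<open>Pm\<close>. The vectors \<open>nf h\<close> = h + kap h of
  \<open>N\<close> lie over h in H, with kap h in the non-negative part, and \<open>mf\<close>
  projects \<open>D\<close> onto \<open>M\<close> along H. The difference of \<open>x\<close> and
  the vector of \<open>N\<close> over u lies in \<open>M\<close> as soon as u = h0 + phi u, where
  \<open>phi\<close> maps H to itself. Non-negativity of \<open>M\<close> and negativity of
  \<open>N\<close> make \<open>phi\<close> contractive for minus the form on H; the hypothesis
  \<open>unif\<close> supplies the ratio q < 1.\<close>

lemma complement_transfer:
  assumes M: "subspace M" "M \<subseteq> D" "\<And>x. x \<in> M \<Longrightarrow> 0 \<le> t x x"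
    and MH: "\<And>x. x \<in> D \<Longrightarrow> \<exists>m\<in>M. Pm (x - m) = x - m"
    and N: "subspace N" "N \<subseteq> D" "\<And>x. x \<in> N \<Longrightarrow> x \<noteq> 0 \<Longrightarrow> t x x < 0"
    and NH: "\<And>x. x \<in> D \<Longrightarrow> \<exists>n\<in>N. Pm (x - n) = 0"
    and unif: "(\<exists>c>0. \<forall>x\<in>N. t x x \<le> - c * (norm x)\<^sup>2) \<or> (\<forall>x\<in>D. t x x \<le> 0)"
    and x: "x \<in> D"
  shows "\<exists>n\<in>N. x - n \<in> M"
proof -
  note Pml = sadj_lin[OF Pm_sadj]
  obtain nf where nf: "\<And>x. x \<in> D \<Longrightarrow> nf x \<in> N" "\<And>x. x \<in> D \<Longrightarrow> Pm (x - nf x) = 0" using NH by metis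
  obtain mf where mf: "\<And>x. x \<in> D \<Longrightarrow> mf x \<in> M" "\<And>x. x \<in> D \<Longrightarrow> Pm (x - mf x) = x - mf x" using MH by metis
  have nfD: "nf y \<in> D" and mfD: "mf y \<in> D" if "y \<in> D" for y using nf(1)[OF that] mf(1)[OF that] M(2) N(2) by auto
  have nf_diff: "nf y - nf z = nf (y - z)" if yz: "y \<in> D" "z \<in> D" for y z
  proof -
    define u where "u = nf y - nf z - nf (y - z)"
    have uN: "u \<in> N" unfolding u_def using nf(1) yz F.mem(2)[OF yz] N(1) by (simp add: subspace_diff)
    have "Pm u = 0" unfolding u_def using nf(2)[OF yz(1)] nf(2)[OF yz(2)] nf(2)[OF F.mem(2)[OF yz]]
      by (simp add: Pml)
    then have "0 \<le> t u u" using t_nonneg uN N(2) by blast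
    then have "u = 0" using N(3)[OF uN] by force
    then show ?thesis by (simp add: u_def)
  qed
  have mf_diff: "mf y - mf z = mf (y - z)" if yz: "y \<in> D" "z \<in> D" for y z
  proof -
    define u where "u = mf y - mf z - mf (y - z)"
    have uM: "u \<in> M" unfolding u_def using mf(1) yz F.mem(2)[OF yz] M(1) by (simp add: subspace_diff)
    have "u = (y - z - mf (y - z)) - (y - mf y) + (z - mf z)" by (simp add: u_def)
    then have "Pm u = u" using mf(2)[OF yz(1)] mf(2)[OF yz(2)] mf(2)[OF F.mem(2)[OF yz]]
      by (metis Pml(1,2))
    then have "u = 0" using t_neg_zero M(3)[OF uM] by blast
    then show ?thesis by (simp add: u_def)
  qed
  define V where "V = {h. Pm h = h}"
  have V: "subspace V" "closed V"
    unfolding V_def subspace_def using sadjD(1)[OF Pm_sadj]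
    by (auto simp: Pml intro!: closed_Collect_eq continuous_intros intro: bounded_linear.continuous_on)
  have VD: "h \<in> D" if "h \<in> V" for h using that PmD[of h] by (simp add: V_def)
  define kap where "kap h = nf h - h" for h
  define phi where "phi h = mf (kap h) - kap h" for h
  have kD: "kap h \<in> D" if "h \<in> V" for h unfolding kap_def using VD[OF that] nfD F.mem(2) by blast
  have kP: "Pm (kap h) = 0" if "h \<in> V" for h
    using nf(2)[OF VD[OF that]] unfolding kap_def by (simp add: Pml)
  have phiV: "phi h \<in> V" if "h \<in> V" for h
  proof -
    have "Pm (- (kap h - mf (kap h))) = - (kap h - mf (kap h))" using mf(2)[OF kD[OF that]] by (simp only: Pml)
    then show ?thesis unfolding phi_def V_def by simp
  qed
  have cross: "t h y = 0" if "h \<in> V" "y \<in> D" "Pm y = 0" for h y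
    using t_Pm[OF that(2), of h] that F.zero_r[OF VD[OF that(1)]] by (simp add: V_def)
  have b1: "- t (phi h) (phi h) \<le> t (kap h) (kap h)" if h: "h \<in> V" for h
  proof -
    \<comment> \<open>The form is non-negative at this vector of \<open>M\<close>, and its two
      components are orthogonal in the form; so the negative component weighs at most as much as
      \<open>kap h\<close>.\<close>
    have e: "mf (kap h) = phi h + kap h" by (simp add: phi_def)
    have "0 \<le> t (mf (kap h)) (mf (kap h))" using M(3) mf(1) kD[OF h] by blast
    also have "\<dots> = t (phi h) (phi h) + t (kap h) (kap h)"
      unfolding e using F.sq_add[OF VD[OF phiV[OF h]] kD[OF h]] cross[OF phiV[OF h] kD[OF h] kP[OF h]] by simp
    finally show ?thesis by simp
  qed
  have "\<exists>q. 0 \<le> q \<and> q < 1 \<and> (\<forall>h\<in>V. - t (phi h) (phi h) \<le> q * (- t h h))"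
  proof (cases "\<forall>x\<in>D. t x x \<le> 0")
    case True
    then show ?thesis using b1 kD by (intro exI[of _ 0]) force
  next
    case False
    then obtain c where c: "c > 0" "\<And>x. x \<in> N \<Longrightarrow> t x x \<le> - c * (norm x)\<^sup>2" using unif by blast
    \<comment> \<open>Uniform negativity of \<open>N\<close> gives t(kap h) <= - t(h) - c norm(h)^2,
      and - t(h) <= s norm(h)^2 turns the last term into at least the fraction c/s of - t(h). The
      maximum with 0 covers c > s.\<close>
    define q where "q = max 0 (1 - c / s)"
    have "- t (phi h) (phi h) \<le> q * (- t h h)" if h: "h \<in> V" for h
    proof -
      have e: "nf h = h + kap h" by (simp add: kap_def)
      have Pmh: "Pm (nf h) = h" using kP[OF h] h by (simp add: e Pml V_def)
      have "t (nf h) (nf h) = t h h + t (kap h) (kap h)"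
        unfolding e using F.sq_add[OF VD[OF h] kD[OF h]] cross[OF h kD[OF h] kP[OF h]] by simp
      moreover have "t (nf h) (nf h) \<le> - c * (norm (nf h))\<^sup>2" using c(2) nf(1)[OF VD[OF h]] by blast
      moreover have "(norm h)\<^sup>2 \<le> (norm (nf h))\<^sup>2" using norm_split[of "nf h"] Pmh by simp
      then have "c * (norm h)\<^sup>2 \<le> c * (norm (nf h))\<^sup>2" using c(1) by simp
      ultimately have "t (kap h) (kap h) \<le> - t h h - c * (norm h)\<^sup>2" by simp
      moreover have "(c / s) * (- t h h) \<le> c * (norm h)\<^sup>2"
      proof -
        have "- t h h \<le> s * (norm h)\<^sup>2" using t_low[OF VD[OF h]] by (simp add: algebra_simps) (smt (verit) zero_le_power2)
        then have "(c / s) * (- t h h) \<le> (c / s) * (s * (norm h)\<^sup>2)" using c(1) s1 by (intro mult_left_mono) auto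
        then show ?thesis using s1 by simp
      qed
      ultimately have "t (kap h) (kap h) \<le> (1 - c / s) * (- t h h)" by (simp add: algebra_simps)
      also have "\<dots> \<le> q * (- t h h)"
        using t_neg_nn[of h] h unfolding q_def by (intro mult_right_mono) (auto simp: V_def)
      finally show ?thesis using b1[OF h] by linarith
    qed
    moreover have "0 \<le> q" "q < 1" using c(1) s1 by (auto simp: q_def)
    ultimately show ?thesis by blast
  qed
  then obtain q where q: "0 \<le> q" "q < 1" "\<And>h. h \<in> V \<Longrightarrow> - t (phi h) (phi h) \<le> q * (- t h h)" by blast
  define h0 where "h0 = x - mf x"
  have h0: "h0 \<in> V" using mf(2)[OF x] by (simp add: h0_def V_def)
  have "\<exists>u\<in>V. u = h0 + phi u"
  proof (rule neumann[OF V, where b = "\<lambda>h. - t h h" and c = a and C = s and q = q])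
    show "phi y \<in> V" if "y \<in> V" for y using phiV[OF that] .
    show "phi y - phi z = phi (y - z)" if "y \<in> V" "z \<in> V" for y z
    proof -
      have k: "kap y - kap z = kap (y - z)" unfolding kap_def using nf_diff[OF VD[OF that(1)] VD[OF that(2)]] by (simp add: algebra_simps)
      show ?thesis unfolding phi_def using mf_diff[OF kD[OF that(1)] kD[OF that(2)]] k by (simp add: algebra_simps)
    qed
    show "a * (norm h)\<^sup>2 \<le> - t h h" if "h \<in> V" for h using t_neg[of h] that by (simp add: V_def)
    show "- t h h \<le> s * (norm h)\<^sup>2" if "h \<in> V" for h
      using t_low[OF VD[OF that]] by (simp add: algebra_simps) (smt (verit) zero_le_power2)
  qed (use a_pos q h0 in auto)
  then obtain u where u: "u \<in> V" "u = h0 + phi u" by blast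
  have "x - nf u = mf x - mf (kap u)"
    using u(2) unfolding h0_def phi_def kap_def by (simp add: algebra_simps)
  moreover have "mf x - mf (kap u) \<in> M" using mf(1)[OF x] mf(1)[OF kD[OF u(1)]] M(1) subspace_diff by blast
  ultimately have "x - nf u \<in> M" by (simp only:)
  then show ?thesis using nf(1)[OF VD[OF u(1)]] by blast
qed

end

section \<open>Uniform negativity\<close>

text \<open>\<open>k\<close> is replaced by its component \<open>k'\<close> orthogonal to
  \<open>W\<close> in the form; this exists because -b is equivalent to the squared norm on
  \<open>W\<close>. The form then has no mixed term, and the lower bound -C controls the coefficient
  of \<open>k'\<close> by the norm, which gives closedness.\<close>

lemma uniform_negative_extend:
  fixes D :: "'h::{real_inner,complete_space} set"
  assumes bf: "bform D b" and low: "\<And>x. x \<in> D \<Longrightarrow> - C * (norm x)\<^sup>2 \<le> b x x" "C \<ge> 0"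
    and W: "subspace W" "closed W" "c > 0" "\<And>w. w \<in> W \<Longrightarrow> b w w \<le> - c * (norm w)\<^sup>2"
    and sp: "span (insert k W) \<subseteq> D" "\<And>x. x \<in> span (insert k W) \<Longrightarrow> x \<noteq> 0 \<Longrightarrow> b x x < 0"
  shows "closed (span (insert k W)) \<and> (\<exists>c'>0. \<forall>w\<in>span (insert k W). b w w \<le> - c' * (norm w)\<^sup>2)"
proof (cases "k \<in> W")
  case True
  then have eq: "span (insert k W) = W" using W(1) span_eq_iff[of W] by (simp only: insert_absorb)
  show ?thesis unfolding eq using W(2-4) by blast
next
  case False
  let ?W = "span (insert k W)"
  interpret b: bform D b by (rule bf)
  have WW: "W \<subseteq> ?W" by (meson span_superset subset_insertI subset_trans)
  have kW: "k \<in> ?W" by (simp add: span_base)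
  interpret n: bform ?W "\<lambda>x y. - b x y"
    by (rule bform_uminus[OF bform_subset[OF bf subspace_span sp(1)]])
  have WD: "W \<subseteq> D" using WW sp(1) by blast
  have "\<exists>v\<in>W. \<forall>w\<in>W. - b (k - v) w = 0"
  proof (rule n.projection[OF _ W(1) WW _ kW])
    show "0 \<le> - b v v" if "v \<in> ?W" for v
      using sp(2)[OF that] b.zero_l[OF b.zero_mem] by (cases "v = 0") auto
    fix f :: "nat \<Rightarrow> 'h" assume fW: "\<And>n. f n \<in> W"
      and cau: "\<And>e. e > 0 \<Longrightarrow> \<exists>N::nat. \<forall>m\<ge>N. \<forall>n\<ge>N. - b (f m - f n) (f m - f n) < e"
    have d: "f m - f n \<in> W" for m n using fW W(1) subspace_diff by blast
    have "Cauchy f"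
    proof (rule metric_CauchyI)
      fix e :: real assume e: "e > 0"
      then obtain N where N: "\<forall>m\<ge>N. \<forall>n\<ge>N. - b (f m - f n) (f m - f n) < c * e\<^sup>2" using cau[of "c * e\<^sup>2"] W(3) by auto
      have "dist (f m) (f n) < e" if "m \<ge> N" "n \<ge> N" for m n
      proof -
        have "c * (norm (f m - f n))\<^sup>2 < c * e\<^sup>2" using N that W(4)[OF d[of m n]] by (smt (verit) mult_minus_left)
        then show ?thesis using W(3) e by (auto simp: dist_norm intro: power2_less_imp_less)
      qed
      then show "\<exists>M. \<forall>m\<ge>M. \<forall>n\<ge>M. dist (f m) (f n) < e" by blast
    qed
    then obtain v where v: "f \<longlonglongrightarrow> v" using Cauchy_convergent convergent_def by blast
    have vW: "v \<in> W" using closed_sequentially[OF W(2)] fW v by blast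
    have dv: "f n - v \<in> W" for n using fW vW W(1) subspace_diff by blast
    have "(\<lambda>n. - b (f n - v) (f n - v)) \<longlonglongrightarrow> 0"
    proof (rule tendsto_sandwich[OF _ _ tendsto_const])
      have "(\<lambda>n. C * (norm (f n - v))\<^sup>2) \<longlonglongrightarrow> C * (norm (v - v))\<^sup>2" by (intro tendsto_intros v)
      then show "(\<lambda>n. C * (norm (f n - v))\<^sup>2) \<longlonglongrightarrow> 0" by simp
      show "\<forall>\<^sub>F n in sequentially. - b (f n - v) (f n - v) \<le> C * (norm (f n - v))\<^sup>2"
      proof (rule always_eventually, rule allI)
        fix n show "- b (f n - v) (f n - v) \<le> C * (norm (f n - v))\<^sup>2"
          using low(1)[OF subsetD[OF WD dv[of n]]] by simp
      qed
      show "\<forall>\<^sub>F n in sequentially. 0 \<le> - b (f n - v) (f n - v)"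
      proof (rule always_eventually, rule allI)
        fix n
        have "0 \<le> c * (norm (f n - v))\<^sup>2" using W(3) by simp
        then show "0 \<le> - b (f n - v) (f n - v)" using W(4)[OF dv[of n]] by simp
      qed
    qed
    then show "\<exists>v\<in>W. (\<lambda>n. - b (f n - v) (f n - v)) \<longlonglongrightarrow> 0" using vW by blast
  qed
  then obtain v where v: "v \<in> W" "\<And>w. w \<in> W \<Longrightarrow> b (k - v) w = 0" by auto
  define k' where "k' = k - v"
  have k'W: "k' \<in> ?W" unfolding k'_def using kW WW v(1) span_diff by blast
  have k'D: "k' \<in> D" using k'W sp(1) by blast
  have k'0: "k' \<noteq> 0" using False v(1) by (auto simp: k'_def)
  define \<beta> where "\<beta> = - b k' k'"
  have \<beta>: "\<beta> > 0" using sp(2)[OF k'W k'0] by (simp add: \<beta>_def)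
  have dec: "\<exists>\<alpha> w. w \<in> W \<and> x = \<alpha> *\<^sub>R k' + w" if xW: "x \<in> ?W" for x
  proof -
    obtain \<alpha> where "x - \<alpha> *\<^sub>R k \<in> span W" using xW by (auto simp: span_breakdown_eq)
    then have "x - \<alpha> *\<^sub>R k \<in> W" using W(1) by (metis span_eq_iff)
    then have "x - \<alpha> *\<^sub>R k + \<alpha> *\<^sub>R v \<in> W" using v(1) W(1) by (simp add: subspace_add subspace_scale)
    then show ?thesis by (intro exI[of _ \<alpha>] exI[of _ "x - \<alpha> *\<^sub>R k'"]) (simp add: k'_def algebra_simps)
  qed
  have val: "b (\<alpha> *\<^sub>R k' + w) (\<alpha> *\<^sub>R k' + w) = - \<alpha>\<^sup>2 * \<beta> + b w w" if "w \<in> W" for \<alpha> w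
  proof -
    have wD: "w \<in> D" using that WD by blast
    have "b (w + \<alpha> *\<^sub>R k') (w + \<alpha> *\<^sub>R k') = b w w + 2 * \<alpha> * b w k' + \<alpha>\<^sup>2 * b k' k'" by (rule b.sq_add_scale[OF wD k'D])
    moreover have "b w k' = 0" using v(2)[OF that] b.sym[OF wD k'D] by (simp add: k'_def)
    ultimately show ?thesis by (simp add: \<beta>_def add.commute)
  qed
  \<comment> \<open>The factors 2 come from norm(x)^2 <= 2 \<alpha>^2 norm(k')^2 + 2
    norm(w)^2.\<close>
  define c' where "c' = min (\<beta> / (2 * (norm k')\<^sup>2)) (c / 2)"
  have c': "c' > 0" using \<beta> W(3) k'0 by (simp add: c'_def)
  have un: "b x x \<le> - c' * (norm x)\<^sup>2" if x: "x \<in> ?W" for x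
  proof -
    obtain \<alpha> w where w: "w \<in> W" "x = \<alpha> *\<^sub>R k' + w" using dec[OF x] by blast
    have "norm x \<le> \<bar>\<alpha>\<bar> * norm k' + norm w" using norm_triangle_ineq[of "\<alpha> *\<^sub>R k'" w] by (simp add: w(2))
    then have "(norm x)\<^sup>2 \<le> (\<bar>\<alpha>\<bar> * norm k' + norm w)\<^sup>2" by (intro power_mono) auto
    also have "\<dots> \<le> 2 * (\<bar>\<alpha>\<bar> * norm k')\<^sup>2 + 2 * (norm w)\<^sup>2"
      using sum_squares_bound[of "\<bar>\<alpha>\<bar> * norm k'" "norm w"] by (simp add: power2_sum)
    finally have n: "(norm x)\<^sup>2 \<le> 2 * \<alpha>\<^sup>2 * (norm k')\<^sup>2 + 2 * (norm w)\<^sup>2" by (simp add: power_mult_distrib)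
    have "c' * (norm x)\<^sup>2 \<le> c' * (2 * \<alpha>\<^sup>2 * (norm k')\<^sup>2) + c' * (2 * (norm w)\<^sup>2)"
      using mult_left_mono[OF n, of c'] c' by (simp add: distrib_left)
    moreover have "c' * (2 * (norm w)\<^sup>2) \<le> (c/2) * (2 * (norm w)\<^sup>2)" by (intro mult_right_mono) (auto simp: c'_def)
    moreover have "c' * (2 * \<alpha>\<^sup>2 * (norm k')\<^sup>2) \<le> (\<beta> / (2 * (norm k')\<^sup>2)) * (2 * \<alpha>\<^sup>2 * (norm k')\<^sup>2)"
      by (intro mult_right_mono) (auto simp: c'_def)
    ultimately have "c' * (norm x)\<^sup>2 \<le> \<alpha>\<^sup>2 * \<beta> + c * (norm w)\<^sup>2" using k'0 by (simp add: mult.commute)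
    then show ?thesis using val[OF w(1), of \<alpha>] W(4)[OF w(1)] by (simp add: w(2))
  qed
  have "closed ?W" unfolding closed_sequential_limits
  proof (intro allI impI, elim conjE)
    fix f x assume f: "\<forall>n. f n \<in> ?W" and fx: "f \<longlonglongrightarrow> x"
    have "\<forall>n. \<exists>\<alpha> w. w \<in> W \<and> f n = \<alpha> *\<^sub>R k' + w" using dec f by simp
    then obtain al wf where aw: "\<And>n. wf n \<in> W" "\<And>n. f n = al n *\<^sub>R k' + wf n" by metis
    have d: "\<beta> * (al m - al n)\<^sup>2 \<le> C * (norm (f m - f n))\<^sup>2" for m n
    proof -
      have w: "wf m - wf n \<in> W" using aw W(1) subspace_diff by blast
      have e: "f m - f n = (al m - al n) *\<^sub>R k' + (wf m - wf n)" by (simp add: aw(2) algebra_simps)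
      have fD: "f m - f n \<in> D" using f sp(1) span_diff by blast
      have "b (f m - f n) (f m - f n) = - (al m - al n)\<^sup>2 * \<beta> + b (wf m - wf n) (wf m - wf n)"
        unfolding e by (rule val[OF w])
      moreover have "b (wf m - wf n) (wf m - wf n) \<le> 0"
        using W(3,4) w by (smt (verit) mult_minus_left mult_nonneg_nonneg zero_le_power2)
      ultimately show ?thesis using low(1)[OF fD] by (simp add: mult.commute)
    qed
    have cf: "Cauchy f" using fx convergent_Cauchy convergentI by blast
    have "Cauchy al"
    proof (rule metric_CauchyI)
      fix e :: real assume e: "e > 0"
      have "e * sqrt (\<beta> / (C + 1)) > 0" using e \<beta> low(2) by simp
      then obtain M where M: "\<forall>m\<ge>M. \<forall>n\<ge>M. dist (f m) (f n) < e * sqrt (\<beta> / (C + 1))"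
        using metric_CauchyD[OF cf] by blast
      have "dist (al m) (al n) < e" if "m \<ge> M" "n \<ge> M" for m n
      proof -
        have "norm (f m - f n) < e * sqrt (\<beta> / (C + 1))" using M that by (simp add: dist_norm)
        then have "(norm (f m - f n))\<^sup>2 < (e * sqrt (\<beta> / (C + 1)))\<^sup>2" by (intro power_strict_mono) auto
        also have "\<dots> = e\<^sup>2 * (\<beta> / (C + 1))" using \<beta> low(2) by (simp add: power_mult_distrib)
        finally have "(C + 1) * (norm (f m - f n))\<^sup>2 < (C + 1) * (e\<^sup>2 * (\<beta> / (C + 1)))"
          using low(2) by (intro mult_strict_left_mono) auto
        also have "\<dots> = \<beta> * e\<^sup>2" using low(2) by simp
        finally have "(C + 1) * (norm (f m - f n))\<^sup>2 < \<beta> * e\<^sup>2" .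
        moreover have "C * (norm (f m - f n))\<^sup>2 \<le> (C + 1) * (norm (f m - f n))\<^sup>2" by (intro mult_right_mono) auto
        ultimately have "\<beta> * (al m - al n)\<^sup>2 < \<beta> * e\<^sup>2" using d[of m n] by linarith
        then have "(al m - al n)\<^sup>2 < e\<^sup>2" using \<beta> by simp
        then have "\<bar>al m - al n\<bar> < e" using e by (metis power2_abs power2_less_imp_less less_imp_le)
        then show ?thesis by (simp add: dist_real_def)
      qed
      then show "\<exists>M. \<forall>m\<ge>M. \<forall>n\<ge>M. dist (al m) (al n) < e" by blast
    qed
    then obtain \<alpha> where \<alpha>: "al \<longlonglongrightarrow> \<alpha>" using Cauchy_convergent convergent_def by blast
    have "(\<lambda>n. f n - al n *\<^sub>R k') \<longlonglongrightarrow> x - \<alpha> *\<^sub>R k'" by (intro tendsto_intros fx \<alpha>)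
    then have "wf \<longlonglongrightarrow> x - \<alpha> *\<^sub>R k'" by (simp add: aw(2))
    then have "x - \<alpha> *\<^sub>R k' \<in> W" using closed_sequentially[OF W(2)] aw(1) by blast
    then have "(x - \<alpha> *\<^sub>R k') + \<alpha> *\<^sub>R k' \<in> ?W" using WW k'W span_add span_scale by blast
    then show "x \<in> ?W" by simp
  qed
  then show ?thesis using un c' by blast
qed

lemma uniform_negative_finite_extend:
  fixes D :: "'h::{real_inner,complete_space} set"
  assumes bf: "bform D b" and low: "\<And>x. x \<in> D \<Longrightarrow> - C * (norm x)\<^sup>2 \<le> b x x" "C \<ge> 0"
    and W: "subspace W" "closed W" "c > 0" "\<And>w. w \<in> W \<Longrightarrow> b w w \<le> - c * (norm w)\<^sup>2"
    and S: "finite S" "span (S \<union> W) \<subseteq> D" "\<And>x. x \<in> span (S \<union> W) \<Longrightarrow> x \<noteq> 0 \<Longrightarrow> b x x < 0"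
  shows "closed (span (S \<union> W)) \<and> (\<exists>c'>0. \<forall>w\<in>span (S \<union> W). b w w \<le> - c' * (norm w)\<^sup>2)"
  using S
proof (induction S rule: finite_induct)
  case empty
  have eq: "span W = W" using W(1) span_eq_iff by blast
  show ?case unfolding Un_empty_left eq using W(2-4) by blast
next
  case (insert k S)
  let ?V = "span (S \<union> W)"
  have sub: "?V \<subseteq> span (insert k S \<union> W)" by (rule span_mono) auto
  have eq: "span (insert k ?V) = span (insert k S \<union> W)"
    unfolding Un_insert_left span_insert span_span ..
  have "closed ?V \<and> (\<exists>c'>0. \<forall>w\<in>?V. b w w \<le> - c' * (norm w)\<^sup>2)"
  proof (rule insert.IH)
    show "?V \<subseteq> D" using sub insert.prems(1) by (rule subset_trans)
    show "b x x < 0" if "x \<in> ?V" "x \<noteq> 0" for x using insert.prems(2)[OF subsetD[OF sub that(1)] that(2)] .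
  qed
  then obtain c' where c': "closed ?V" "c' > 0" "\<And>w. w \<in> ?V \<Longrightarrow> b w w \<le> - c' * (norm w)\<^sup>2" by blast
  show ?case unfolding eq[symmetric]
  proof (rule uniform_negative_extend[OF bf low subspace_span c'])
    show "span (insert k ?V) \<subseteq> D" unfolding eq by (rule insert.prems(1))
    show "b x x < 0" if "x \<in> span (insert k ?V)" "x \<noteq> 0" for x
      using that unfolding eq by (rule insert.prems(2))
  qed
qed

section \<open>Operator functions\<close>

text \<open>The resolvent at -s is reached from that at the imaginary unit through x = B y and w =
  (T - J) x = y - s x - J x. One factor s + 2 bounds the norm of w by that of y, the other bounds
  the difference of the resolvents at -s by the difference of those at the unit.\<close>

lemma resolvent_transfer:
  assumes "sb_op J A s" "sb_op J A' s" and close: "\<And>w. norm (res_i J A w - res_i J A' w) \<le> \<eta> * norm w"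
  shows "norm (sb_op.B A s y - sb_op.B A' s y) \<le> (s + 2)\<^sup>2 * \<eta> * norm y"
proof -
  interpret A: sb_op J A s by fact
  interpret A': sb_op J A' s by fact
  define x where "x = A.B y"
  define w where "w = y - s *\<^sub>R x - J x"
  define z where "z = A'.R w"
  define v where "v = z - x"
  have x: "x \<in> fst A" unfolding x_def by (rule A.B)
  have "snd A x - J x = w" unfolding w_def x_def A.T_B ..
  then have Rw: "A.R w = x" using A.res_i_eq[OF x] by simp
  have nv: "norm v \<le> \<eta> * norm w" using close[of w] unfolding Rw v_def z_def by (simp add: norm_minus_commute)
  have z: "z \<in> fst A'" "snd A' z - J z = w" unfolding z_def by (rule A'.res_i)+
  have "snd A' z + s *\<^sub>R z = y + (s *\<^sub>R v + J v)"
    using z(2) unfolding w_def v_def by (simp add: A.J_lin algebra_simps)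
  then have "A'.B (y + (s *\<^sub>R v + J v)) = z" using A'.B_eq[OF z(1)] by simp
  then have e: "z = A'.B y + A'.B (s *\<^sub>R v + J v)" by (simp add: sadj_lin[OF A'.B_sadj])
  have "norm (A'.B (s *\<^sub>R v + J v)) \<le> norm (s *\<^sub>R v + J v)" by (rule A'.B_norm)
  also have "\<dots> \<le> s * norm v + norm v"
    using norm_triangle_ineq[of "s *\<^sub>R v" "J v"] A.s1 by (simp add: A.J_norm)
  finally have 1: "norm (A'.B (s *\<^sub>R v + J v)) \<le> s * norm v + norm v" .
  have "x - A'.B y = A'.B (s *\<^sub>R v + J v) - v" using e by (simp add: v_def algebra_simps)
  then have "norm (x - A'.B y) \<le> norm (A'.B (s *\<^sub>R v + J v)) + norm v" using norm_triangle_ineq4 by metis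
  then have 2: "norm (x - A'.B y) \<le> (s + 2) * norm v" using 1 by (simp add: algebra_simps)
  have "norm w \<le> norm y + norm (s *\<^sub>R x) + norm (J x)"
    unfolding w_def using norm_triangle_ineq4[of "y - s *\<^sub>R x" "J x"] norm_triangle_ineq4[of y "s *\<^sub>R x"] by linarith
  also have "\<dots> = norm y + (s + 1) * norm x" using A.s1 by (simp add: A.J_norm algebra_simps)
  also have "\<dots> \<le> norm y + (s + 1) * norm y" using A.B_norm[of y] A.s1 by (simp add: x_def mult_left_mono)
  finally have nw: "norm w \<le> (s + 2) * norm y" by (simp add: algebra_simps)
  show ?thesis
  proof (cases "w = 0")
    case True
    then have "norm v \<le> 0" using nv by simp
    then have "x = A'.B y" using 2 by simp
    moreover have "0 \<le> \<eta> * norm y"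
      using order_trans[OF norm_ge_zero close[of y]] .
    ultimately show ?thesis using A.s1 by (simp add: x_def mult.assoc)
  next
    case False
    have "0 \<le> \<eta> * norm w" using order_trans[OF norm_ge_zero close[of w]] .
    then have \<eta>: "0 \<le> \<eta>" using False by (simp add: zero_le_mult_iff)
    have "norm (x - A'.B y) \<le> (s + 2) * (\<eta> * norm w)" using 2 nv A.s1 by (smt (verit) mult_left_mono)
    also have "\<dots> \<le> (s + 2) * (\<eta> * ((s + 2) * norm y))" using nw \<eta> A.s1 by (intro mult_left_mono) auto
    finally show ?thesis by (simp add: x_def power2_eq_square mult_ac)
  qed
qed

text \<open>Cauchy-Schwarz for minus the form, with - t <= s norm^2, bounds T x . y for y in the
  dense domain. This serves parameters without positive vectors, where the S-lemma has nothing to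
  compare with.\<close>

lemma nonpos_bounded:
  assumes "sb_op J A s" and np: "\<And>x. x \<in> form_dom A \<Longrightarrow> fb A x x \<le> 0" and x: "x \<in> fst A"
  shows "norm (snd A x) \<le> s * norm x"
proof -
  interpret A: sb_op J A s by fact
  interpret n: bform A.D "\<lambda>x y. - A.t x y" by (rule bform_uminus[OF A.bform_t])
  have sq: "- A.t y y \<le> s * (norm y)\<^sup>2" if "y \<in> A.D" for y
    using A.t_low[OF that] by (simp add: algebra_simps) (smt (verit) zero_le_power2)
  have le: "A.T x \<bullet> y \<le> s * norm x * norm y" if y: "y \<in> fst A" for y
  proof -
    have xy: "x \<in> A.D" "y \<in> A.D" using x y A.dom_D by auto
    have "(- A.t x y)\<^sup>2 \<le> (- A.t x x) * (- A.t y y)"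
      by (rule n.cauchy_schwarz[OF A.F.subD order_refl _ xy]) (use np in simp)
    also have "\<dots> \<le> (s * (norm x)\<^sup>2) * (s * (norm y)\<^sup>2)"
      using sq[OF xy(1)] sq[OF xy(2)] np[OF xy(2)] A.s1 by (intro mult_mono) auto
    finally have "(A.T x \<bullet> y)\<^sup>2 \<le> (s * norm x * norm y)\<^sup>2"
      by (simp add: A.t_dom[OF x xy(2)] power2_eq_square mult_ac)
    moreover have "0 \<le> s * norm x * norm y" using A.s1 by simp
    ultimately show ?thesis by (rule power2_le_imp_le)
  qed
  have "A.T x \<in> closure (fst A)" using A.sa by (simp add: self_adjoint_def)
  then obtain f where f: "\<And>n. f n \<in> fst A" "f \<longlonglongrightarrow> A.T x" unfolding closure_sequential by blast
  have "A.T x \<bullet> A.T x \<le> s * norm x * norm (A.T x)"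
  proof (rule LIMSEQ_le)
    show "(\<lambda>n. A.T x \<bullet> f n) \<longlonglongrightarrow> A.T x \<bullet> A.T x" by (intro tendsto_intros f)
    show "(\<lambda>n. s * norm x * norm (f n)) \<longlonglongrightarrow> s * norm x * norm (A.T x)" by (intro tendsto_intros f)
  qed (use le f in auto)
  then have "norm (A.T x) * norm (A.T x) \<le> (s * norm x) * norm (A.T x)" by (simp add: dot_square_norm power2_eq_square)
  then show ?thesis using A.s1 by (cases "A.T x = 0") auto
qed

locale fam =
  fixes J :: "'h::{real_inner,complete_space} \<Rightarrow> 'h" and \<Delta> :: "real set" and T :: "real \<Rightarrow> 'h lop" and D :: "'h set"
  assumes J: "cplx_struct J" and interval: "is_interval \<Delta>" and A: "cond_A J \<Delta> T D"
    and nrc: "norm_resolvent_continuous_on J \<Delta> T" and bb: "\<forall>l\<in>\<Delta>. bounded_below (T l)"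
begin

abbreviation "t \<nu> \<equiv> fb (T \<nu>)"

definition ES :: "real set \<Rightarrow> 'h set" where "ES C = span (\<Union>c\<in>C. ker (T c))"

lemma sa_op: "\<nu> \<in> \<Delta> \<Longrightarrow> sa_op J (T \<nu>)"
  using A J by (simp add: cond_A_def sa_op_def)

lemma sb_opI:
  assumes "\<nu> \<in> \<Delta>" "\<And>x. x \<in> fst (T \<nu>) \<Longrightarrow> - C * (norm x)\<^sup>2 \<le> snd (T \<nu>) x \<bullet> x" "s \<ge> 1" "s \<ge> 1 + C"
  shows "sb_op J (T \<nu>) s"
proof -
  interpret sa_op J "T \<nu>" by (rule sa_op) fact
  show ?thesis
  proof
    show "(1 - s) * (norm x)\<^sup>2 \<le> snd (T \<nu>) x \<bullet> x" if "x \<in> fst (T \<nu>)" for x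
      using assms(2)[OF that] mult_right_mono[of "1 - s" "- C" "(norm x)\<^sup>2"] assms(4) by simp
  qed (rule assms)
qed

lemma ex_sb: "\<nu> \<in> \<Delta> \<Longrightarrow> \<exists>s. sb_op J (T \<nu>) s"
proof -
  assume nu: "\<nu> \<in> \<Delta>"
  then obtain c where "\<forall>x\<in>fst (T \<nu>). snd (T \<nu>) x \<bullet> x \<ge> c * (norm x)\<^sup>2" using bb unfolding bounded_below_def by blast
  then have "sb_op J (T \<nu>) (max 1 (1 - c))" by (intro sb_opI[OF nu, where C = "- c"]) auto
  then show ?thesis by blast
qed

lemma form_dom: "\<nu> \<in> \<Delta> \<Longrightarrow> form_dom (T \<nu>) = D"
  using A by (simp add: cond_A_def)

lemma bf: "\<nu> \<in> \<Delta> \<Longrightarrow> bform D (t \<nu>)"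
  using ex_sb[of \<nu>] sb_op.bform_t[of J "T \<nu>"] form_dom[of \<nu>] by auto

lemma t_val: "\<nu> \<in> \<Delta> \<Longrightarrow> x \<in> D \<Longrightarrow> t \<nu> x x = form_val (T \<nu>) x"
  using ex_sb[of \<nu>] sb_op.fb_self[of J "T \<nu>"] form_dom[of \<nu>] by auto

lemma t_zero: "\<nu> \<in> \<Delta> \<Longrightarrow> t \<nu> 0 0 = 0"
  using bform.zero_l[OF bf, of \<nu> 0] bform.zero_mem[OF bf, of \<nu>] by simp

lemma t_cont: "x \<in> D \<Longrightarrow> continuous_on \<Delta> (\<lambda>\<nu>. t \<nu> x x)"
proof (cases "x = 0")
  case True
  then show ?thesis using continuous_on_cong[OF refl, of \<Delta> "\<lambda>\<nu>. t \<nu> x x" "\<lambda>_. 0"] t_zero by simp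
next
  case False
  assume x: "x \<in> D"
  then have "continuous_on \<Delta> (\<lambda>\<nu>. form_val (T \<nu>) x)" using A False by (simp add: cond_A_def)
  then show ?thesis using continuous_on_cong[OF refl, of \<Delta> "\<lambda>\<nu>. t \<nu> x x" "\<lambda>\<nu>. form_val (T \<nu>) x"] t_val[OF _ x] by simp
qed

section \<open>Sign changes along the parameter and the Rayleigh functional\<close>

lemma interval_sub: "a \<in> \<Delta> \<Longrightarrow> b \<in> \<Delta> \<Longrightarrow> {a..b} \<subseteq> \<Delta>"
  using interval unfolding is_interval_1 by (meson atLeastAtMost_iff subsetI)

lemma zero_sign:
  assumes "x \<in> D" "x \<noteq> 0" "\<nu>0 \<in> \<Delta>" "t \<nu>0 x x = 0" "\<nu> \<in> \<Delta>"
  shows "\<nu> < \<nu>0 \<Longrightarrow> 0 < t \<nu> x x" "\<nu> > \<nu>0 \<Longrightarrow> t \<nu> x x < 0"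
  using A assms t_val[of \<nu>0 x] t_val[of \<nu> x] unfolding cond_A_def by auto

text \<open>Otherwise the intermediate value theorem gives a zero in [\<nu>, \<nu>'], and the sign
  condition at that zero contradicts the sign at one of the two ends.\<close>

lemma mono_neg:
  assumes "\<nu> \<in> \<Delta>" "\<nu>' \<in> \<Delta>" "\<nu> < \<nu>'" and x: "x \<in> D" "x \<noteq> 0" "t \<nu> x x \<le> 0"
  shows "t \<nu>' x x < 0"
proof (rule ccontr)
  assume n: "\<not> t \<nu>' x x < 0"
  have "continuous_on {\<nu>..\<nu>'} (\<lambda>\<nu>. t \<nu> x x)"
    using t_cont[OF x(1)] interval_sub[OF assms(1,2)] continuous_on_subset by blast
  then obtain \<xi> where \<xi>: "\<nu> \<le> \<xi>" "\<xi> \<le> \<nu>'" "t \<xi> x x = 0"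
    using IVT'[of "\<lambda>\<nu>. t \<nu> x x" \<nu> 0 \<nu>'] n x(3) assms(3) by auto
  have "\<xi> \<in> \<Delta>" using interval_sub[OF assms(1,2)] \<xi> by auto
  then show False
    using zero_sign[OF x(1,2) _ \<xi>(3) assms(1)] zero_sign[OF x(1,2) _ \<xi>(3) assms(2)] \<xi> x(3) n assms(3)
    by fastforce
qed

lemma mono_neg_le:
  assumes "\<nu> \<in> \<Delta>" "\<nu>' \<in> \<Delta>" "\<nu> \<le> \<nu>'" and x: "x \<in> D" "t \<nu> x x \<le> 0"
  shows "t \<nu>' x x \<le> 0"
proof (cases "x = 0 \<or> \<nu> = \<nu>'")
  case True then show ?thesis using t_zero assms by auto
next
  case False then show ?thesis using mono_neg[of \<nu> \<nu>' x] assms by auto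
qed

lemma mono_pos:
  assumes "\<nu> \<in> \<Delta>" "\<nu>' \<in> \<Delta>" "\<nu> < \<nu>'" and x: "x \<in> D" "x \<noteq> 0" "t \<nu>' x x \<ge> 0"
  shows "0 < t \<nu> x x"
  using mono_neg[OF assms(1-5)] x(3) by force

lemma mono_pos_le:
  assumes "\<nu> \<in> \<Delta>" "\<nu>' \<in> \<Delta>" "\<nu> \<le> \<nu>'" and x: "x \<in> D" "t \<nu>' x x \<ge> 0"
  shows "0 \<le> t \<nu> x x"
proof (cases "x = 0 \<or> \<nu> = \<nu>'")
  case True then show ?thesis using t_zero assms by auto
next
  case False then show ?thesis using mono_pos[of \<nu> \<nu>' x] assms by auto
qed

text \<open>With its counterpart below, this is the only access to \<open>p\<close>: a sign of the
  form at \<open>l\<close> locates \<open>p x\<close> relative to \<open>l\<close>. If the form has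
  no zero on \<Delta>, it is positive throughout, which is the case where \<open>p x\<close> is only
  known to exceed every parameter.\<close>

lemma rayleigh_ge:
  assumes p: "gen_rayleigh \<Delta> T D p" and x: "x \<in> D" "x \<noteq> 0" and l: "l \<in> \<Delta>" "t l x x \<ge> 0"
  shows "ereal l \<le> p x"
proof (cases "\<exists>l0\<in>\<Delta>. t l0 x x = 0")
  case True
  then obtain l0 where l0: "l0 \<in> \<Delta>" "t l0 x x = 0" by blast
  then have "p x = ereal l0" using p x t_val[OF l0(1) x(1)] unfolding gen_rayleigh_def by auto
  moreover have "l \<le> l0" using zero_sign(2)[OF x l0 l(1)] l(2) by force
  ultimately show ?thesis by simp
next
  case False
  have "0 < t \<mu> x x" if \<mu>: "\<mu> \<in> \<Delta>" for \<mu>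
  proof (rule ccontr)
    assume "\<not> 0 < t \<mu> x x"
    then have n: "t \<mu> x x \<le> 0" by simp
    then have lm: "l \<le> \<mu>" using mono_neg[OF \<mu> l(1) _ x] l(2) by force
    have "continuous_on {l..\<mu>} (\<lambda>\<nu>. t \<nu> x x)"
      using t_cont[OF x(1)] interval_sub[OF l(1) \<mu>] continuous_on_subset by blast
    then obtain \<xi> where "l \<le> \<xi>" "\<xi> \<le> \<mu>" "t \<xi> x x = 0"
      using IVT2'[of "\<lambda>\<nu>. t \<nu> x x" \<mu> 0 l] n l(2) lm by auto
    then show False using False interval_sub[OF l(1) \<mu>] by auto
  qed
  then have "\<forall>\<mu>\<in>\<Delta>. form_val (T \<mu>) x > 0" using t_val[OF _ x(1)] by auto
  then have "p x > ereal l" using p x l(1) unfolding gen_rayleigh_def by auto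
  then show ?thesis by simp
qed

lemma rayleigh_le:
  assumes p: "gen_rayleigh \<Delta> T D p" and x: "x \<in> D" "x \<noteq> 0" and l: "l \<in> \<Delta>" "t l x x \<le> 0"
  shows "p x \<le> ereal l"
proof (cases "\<exists>l0\<in>\<Delta>. t l0 x x = 0")
  case True
  then obtain l0 where l0: "l0 \<in> \<Delta>" "t l0 x x = 0" by blast
  then have "p x = ereal l0" using p x t_val[OF l0(1) x(1)] unfolding gen_rayleigh_def by auto
  moreover have "l0 \<le> l" using zero_sign(1)[OF x l0 l(1)] l(2) by force
  ultimately show ?thesis by simp
next
  case False
  have "t \<mu> x x < 0" if \<mu>: "\<mu> \<in> \<Delta>" for \<mu>
  proof (rule ccontr)
    assume "\<not> t \<mu> x x < 0"
    then have n: "t \<mu> x x \<ge> 0" by simp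
    then have lm: "\<mu> \<le> l" using mono_pos[OF l(1) \<mu> _ x] l(2) by force
    have "continuous_on {\<mu>..l} (\<lambda>\<nu>. t \<nu> x x)"
      using t_cont[OF x(1)] interval_sub[OF \<mu> l(1)] continuous_on_subset by blast
    then obtain \<xi> where "\<mu> \<le> \<xi>" "\<xi> \<le> l" "t \<xi> x x = 0"
      using IVT2'[of "\<lambda>\<nu>. t \<nu> x x" l 0 \<mu>] n l(2) lm by auto
    then show False using False interval_sub[OF \<mu> l(1)] by auto
  qed
  then have "\<forall>\<mu>\<in>\<Delta>. form_val (T \<mu>) x < 0" using t_val[OF _ x(1)] by auto
  then have "p x < ereal l" using p x l(1) unfolding gen_rayleigh_def by auto
  then show ?thesis by simp
qed

section \<open>Order of the forms and semiboundedness uniform on compact parameter intervals\<close>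

lemma form_order:
  assumes nu: "\<nu> \<in> \<Delta>" "\<nu>' \<in> \<Delta>" "\<nu> \<le> \<nu>'" and u: "u \<in> D" "t \<nu> u u < 0" and v: "v \<in> D" "t \<nu>' v v > 0"
  shows "\<exists>c>0. c \<ge> t \<nu>' v v / t \<nu> v v \<and> t \<nu> v v > 0 \<and> (\<forall>x\<in>D. t \<nu>' x x \<le> c * t \<nu> x x)"
  using S_lemma[OF bf[OF nu(1)] bf[OF nu(2)] _ u v] mono_neg_le[OF nu] by blast

lemma resolvent_close:
  assumes nu: "\<nu>0 \<in> \<Delta>" and e: "\<eta> > 0"
  shows "\<exists>\<epsilon>>0. \<forall>\<nu>\<in>\<Delta>. \<bar>\<nu> - \<nu>0\<bar> < \<epsilon> \<longrightarrow> (\<forall>w. norm (res_i J (T \<nu>) w - res_i J (T \<nu>0) w) \<le> \<eta> * norm w)"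
proof -
  let ?f = "\<lambda>\<nu> y. res_i J (T \<nu>) y - res_i J (T \<nu>0) y"
  have "((\<lambda>l. onorm (?f l)) \<longlongrightarrow> 0) (at \<nu>0 within \<Delta>)"
    using nrc nu unfolding norm_resolvent_continuous_on_def by blast
  then have "eventually (\<lambda>l. onorm (?f l) < \<eta>) (at \<nu>0 within \<Delta>)" using e by (rule order_tendstoD(2))
  then obtain \<epsilon> where \<epsilon>: "\<epsilon> > 0" "\<And>\<nu>. \<nu> \<in> \<Delta> \<Longrightarrow> \<nu> \<noteq> \<nu>0 \<Longrightarrow> dist \<nu> \<nu>0 < \<epsilon> \<Longrightarrow> onorm (?f \<nu>) < \<eta>"
    unfolding eventually_at by blast
  have "norm (?f \<nu> w) \<le> \<eta> * norm w" if h: "\<nu> \<in> \<Delta>" "\<bar>\<nu> - \<nu>0\<bar> < \<epsilon>" for \<nu> w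
  proof (cases "\<nu> = \<nu>0")
    case True then show ?thesis using e by simp
  next
    case False
    have "bounded_linear (?f \<nu>)"
      by (intro bounded_linear_sub sa_op.res_i_bounded_linear sa_op h nu)
    then have "norm (?f \<nu> w) \<le> onorm (?f \<nu>) * norm w" by (rule onorm)
    also have "\<dots> \<le> \<eta> * norm w" using \<epsilon>(2)[OF h(1) False] h(2) by (intro mult_right_mono) (auto simp: dist_real_def)
    finally show ?thesis .
  qed
  then show ?thesis using \<epsilon>(1) by blast
qed

text \<open>At a negative vector the form at \<nu> is bounded from below through a later parameter:
  t(\<nu>1) <= c t(\<nu>), with \<open>c\<close> kept away from 0 by one positive vector. Where no
  positive vector exists, \<open>T \<nu>0\<close> is a bounded operator, and norm resolvent
  continuity takes over.\<close>

lemma local_lower_bound: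
  assumes gl: "\<gamma> \<in> \<Delta>" "l \<in> \<Delta>" and nu: "\<nu>0 \<in> {\<gamma>..l}"
  shows "\<exists>\<epsilon>>0. \<exists>C. \<forall>\<nu>\<in>{\<gamma>..l}. \<bar>\<nu> - \<nu>0\<bar> < \<epsilon> \<longrightarrow> (\<forall>x\<in>fst (T \<nu>). - C * (norm x)\<^sup>2 \<le> snd (T \<nu>) x \<bullet> x)"
proof (cases "\<exists>v\<in>D. t \<nu>0 v v > 0")
  case True
  have sub: "{\<gamma>..l} \<subseteq> \<Delta>" by (rule interval_sub[OF gl])
  obtain v where v: "v \<in> D" "t \<nu>0 v v > 0" using True by blast
  define \<tau> where "\<tau> = t \<nu>0 v v"
  have "continuous_on \<Delta> (\<lambda>\<nu>. t \<nu> v v)" by (rule t_cont[OF v(1)])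
  moreover have "\<nu>0 \<in> \<Delta>" using nu sub by blast
  moreover have "\<tau> / 2 > 0" using v by (simp add: \<tau>_def)
  ultimately obtain \<epsilon> where \<epsilon>: "\<epsilon> > 0" "\<And>\<nu>. \<nu> \<in> \<Delta> \<Longrightarrow> dist \<nu> \<nu>0 < \<epsilon> \<Longrightarrow> dist (t \<nu> v v) \<tau> < \<tau> / 2"
    unfolding continuous_on_iff \<tau>_def by meson
  \<comment> \<open>A parameter to the right of all nearby ones, cut off at \<open>l\<close>; the
    lower bound of its operator serves them all.\<close>
  define \<nu>1 where "\<nu>1 = min (\<nu>0 + \<epsilon> / 2) l"
  have n1: "\<nu>1 \<in> {\<gamma>..l}" "\<nu>1 \<in> \<Delta>" "dist \<nu>1 \<nu>0 < \<epsilon>"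
    using nu \<epsilon>(1) sub by (auto simp: \<nu>1_def dist_real_def)
  have b1: "\<tau> / 2 < t \<nu>1 v v" using \<epsilon>(2)[OF n1(2,3)] unfolding dist_real_def abs_diff_less_iff by linarith
  obtain s where s: "sb_op J (T \<nu>1) s" using ex_sb[OF n1(2)] by blast
  interpret N: sb_op J "T \<nu>1" s by (rule s)
  have low1: "- s * (norm x)\<^sup>2 \<le> t \<nu>1 x x" if "x \<in> D" for x
    using N.t_low[of x] that form_dom[OF n1(2)] by (simp add: algebra_simps) (smt (verit) zero_le_power2)
  have "- (3 * s) * (norm x)\<^sup>2 \<le> snd (T \<nu>) x \<bullet> x"
    if h: "\<nu> \<in> {\<gamma>..l}" "\<bar>\<nu> - \<nu>0\<bar> < \<epsilon> / 2" "x \<in> fst (T \<nu>)" for \<nu> x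
  proof -
    have nD: "\<nu> \<in> \<Delta>" using h sub by blast
    have le: "\<nu> \<le> \<nu>1" using h unfolding \<nu>1_def abs_diff_less_iff by auto
    obtain s' where s': "sb_op J (T \<nu>) s'" using ex_sb[OF nD] by blast
    interpret N': sb_op J "T \<nu>" s' by (rule s')
    have xD: "x \<in> D" using N'.dom_D[OF h(3)] form_dom[OF nD] by simp
    have tx: "t \<nu> x x = snd (T \<nu>) x \<bullet> x" using N'.t_dom[OF h(3) N'.dom_D[OF h(3)]] .
    have nn: "0 \<le> s * (norm x)\<^sup>2" using N.s1 by simp
    show ?thesis
    proof (cases "t \<nu> x x < 0")
      case False then show ?thesis using nn tx by simp
    next
      case True
      obtain c where c: "c > 0" "c \<ge> t \<nu>1 v v / t \<nu> v v" "t \<nu> v v > 0" "\<forall>x\<in>D. t \<nu>1 x x \<le> c * t \<nu> x x"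
        using form_order[OF nD n1(2) le xD True v(1)] b1 v(2) by (auto simp: \<tau>_def)
      have "dist \<nu> \<nu>0 < \<epsilon>" using h(2) \<epsilon>(1) by (simp add: dist_real_def)
      then have "t \<nu> v v < 3 * \<tau> / 2" using \<epsilon>(2)[OF nD] unfolding dist_real_def abs_diff_less_iff by linarith
      \<comment> \<open>The form at \<open>v\<close> exceeds \<tau>/2 at \<nu>1 and stays below
        3\<tau>/2 at \<nu>, so the S-lemma constant is at least 1/3.\<close>
      then have "1/3 \<le> t \<nu>1 v v / t \<nu> v v" using b1 c(3) by (simp add: field_simps)
      then have c3: "1/3 \<le> c" using c(2) by linarith
      have "- s * (norm x)\<^sup>2 \<le> c * t \<nu> x x" using low1[OF xD] c(4) xD by force
      also have "\<dots> \<le> (1/3) * t \<nu> x x" using c3 True by (intro mult_right_mono_neg) auto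
      finally show ?thesis using tx by simp
    qed
  qed
  moreover have "\<epsilon> / 2 > 0" using \<epsilon>(1) by simp
  ultimately show ?thesis by blast
next
  case False
  have sub: "{\<gamma>..l} \<subseteq> \<Delta>" by (rule interval_sub[OF gl])
  have n0: "\<nu>0 \<in> \<Delta>" using nu sub by blast
  obtain s where s: "sb_op J (T \<nu>0) s" using ex_sb[OF n0] by blast
  interpret N: sb_op J "T \<nu>0" s by (rule s)
  have np: "fb (T \<nu>0) x x \<le> 0" if "x \<in> form_dom (T \<nu>0)" for x using False that form_dom[OF n0] by force
  \<comment> \<open>With this tolerance the error term in norm(w) <= (s + 1) (norm(x) + norm(x - z))
    is at most norm(w)/2 and can be absorbed. As \<open>J x\<close> is orthogonal to
    \<open>x\<close>, a bound on \<open>w\<close> then bounds the form value at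
    \<open>x\<close>.\<close>
  obtain \<epsilon> where \<epsilon>: "\<epsilon> > 0" "\<And>\<nu> w. \<nu> \<in> \<Delta> \<Longrightarrow> \<bar>\<nu> - \<nu>0\<bar> < \<epsilon> \<Longrightarrow>
      norm (res_i J (T \<nu>) w - res_i J (T \<nu>0) w) \<le> (1 / (2 * (s + 1))) * norm w"
    using resolvent_close[OF n0, of "1 / (2 * (s + 1))"] N.s1 by auto
  have "- (2 * (s + 1)) * (norm x)\<^sup>2 \<le> snd (T \<nu>) x \<bullet> x"
    if h: "\<nu> \<in> {\<gamma>..l}" "\<bar>\<nu> - \<nu>0\<bar> < \<epsilon>" "x \<in> fst (T \<nu>)" for \<nu> x
  proof -
    have nD: "\<nu> \<in> \<Delta>" using h sub by blast
    interpret N': sa_op J "T \<nu>" by (rule sa_op[OF nD])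
    define w where "w = snd (T \<nu>) x - J x"
    define z where "z = N.R w"
    have xw: "N'.R w = x" unfolding w_def by (rule N'.res_i_eq[OF h(3)])
    have d: "norm (x - z) \<le> (1 / (2 * (s + 1))) * norm w" using \<epsilon>(2)[OF nD h(2), of w] unfolding xw z_def .
    have z: "z \<in> fst (T \<nu>0)" "snd (T \<nu>0) z - J z = w" unfolding z_def by (rule N.res_i)+
    have "norm w \<le> norm (snd (T \<nu>0) z) + norm (J z)" using z(2) norm_triangle_ineq4 by metis
    also have "\<dots> \<le> (s + 1) * norm z" using nonpos_bounded[OF s np z(1)] by (simp add: N.J_norm algebra_simps)
    also have "\<dots> \<le> (s + 1) * (norm x + norm (x - z))"
      using norm_triangle_ineq4[of x "x - z"] N.s1 by (intro mult_left_mono) auto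
    also have "\<dots> \<le> (s + 1) * (norm x + (1 / (2 * (s + 1))) * norm w)"
      using d N.s1 by (intro mult_left_mono) auto
    also have "\<dots> = (s + 1) * norm x + norm w / 2" using N.s1 by (simp add: field_simps)
    finally have nw: "norm w \<le> 2 * (s + 1) * norm x" by (simp add: algebra_simps)
    have "snd (T \<nu>) x \<bullet> x = w \<bullet> x" unfolding w_def using N'.J_self[of x] by (simp add: inner_diff_left)
    moreover have "\<bar>w \<bullet> x\<bar> \<le> norm w * norm x" by (rule Cauchy_Schwarz_ineq2)
    moreover have "norm w * norm x \<le> 2 * (s + 1) * norm x * norm x" using nw by (intro mult_right_mono) auto
    ultimately have "- (2 * (s + 1) * norm x * norm x) \<le> snd (T \<nu>) x \<bullet> x" by linarith
    then show ?thesis by (simp add: power2_eq_square algebra_simps)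
  qed
  then show ?thesis using \<epsilon>(1) by blast
qed

text \<open>Bolzano's interval principle plays the part of compactness. A common \<open>s\<close>
  allows the bounded transforms at different parameters to be compared.\<close>

lemma uniform_sb:
  assumes gl: "\<gamma> \<in> \<Delta>" "l \<in> \<Delta>" "\<gamma> \<le> l"
  shows "\<exists>s. \<forall>\<nu>\<in>{\<gamma>..l}. sb_op J (T \<nu>) s"
proof -
  define P where "P a b \<longleftrightarrow> (\<exists>C. \<forall>\<nu>\<in>{a..b} \<inter> {\<gamma>..l}. \<forall>x\<in>fst (T \<nu>). - C * (norm x)\<^sup>2 \<le> snd (T \<nu>) x \<bullet> x)" for a b
  have "P \<gamma> l"
  proof (rule Bolzano[OF gl(3)])
    fix a b c assume "P a b" "P b c"
    then obtain C1 C2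
      where 1: "\<And>\<nu> x. \<nu> \<in> {a..b} \<inter> {\<gamma>..l} \<Longrightarrow> x \<in> fst (T \<nu>) \<Longrightarrow> - C1 * (norm x)\<^sup>2 \<le> snd (T \<nu>) x \<bullet> x"
        and 2: "\<And>\<nu> x. \<nu> \<in> {b..c} \<inter> {\<gamma>..l} \<Longrightarrow> x \<in> fst (T \<nu>) \<Longrightarrow> - C2 * (norm x)\<^sup>2 \<le> snd (T \<nu>) x \<bullet> x"
      unfolding P_def by blast
    show "P a c" unfolding P_def
    proof (intro exI[of _ "max C1 C2"] ballI)
      fix \<nu> x assume h: "\<nu> \<in> {a..c} \<inter> {\<gamma>..l}" "x \<in> fst (T \<nu>)"
      have le: "- max C1 C2 * (norm x)\<^sup>2 \<le> - C1 * (norm x)\<^sup>2" "- max C1 C2 * (norm x)\<^sup>2 \<le> - C2 * (norm x)\<^sup>2"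
        by (rule mult_right_mono; simp)+
      show "- max C1 C2 * (norm x)\<^sup>2 \<le> snd (T \<nu>) x \<bullet> x"
      proof (cases "\<nu> \<le> b")
        case True then show ?thesis using order_trans[OF le(1) 1[of \<nu> x]] h by simp
      next
        case False then show ?thesis using order_trans[OF le(2) 2[of \<nu> x]] h by simp
      qed
    qed
  next
    fix \<nu>0 assume "\<gamma> \<le> \<nu>0" "\<nu>0 \<le> l"
    then have "\<nu>0 \<in> {\<gamma>..l}" by simp
    then obtain \<epsilon> C where e: "\<epsilon> > 0"
      "\<forall>\<nu>\<in>{\<gamma>..l}. \<bar>\<nu> - \<nu>0\<bar> < \<epsilon> \<longrightarrow> (\<forall>x\<in>fst (T \<nu>). - C * (norm x)\<^sup>2 \<le> snd (T \<nu>) x \<bullet> x)"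
      using local_lower_bound[OF gl(1,2)] by blast
    have "P a b" if "a \<le> \<nu>0 \<and> \<nu>0 \<le> b \<and> b - a < \<epsilon>" for a b
    proof -
      have "\<bar>\<nu> - \<nu>0\<bar> < \<epsilon>" if "\<nu> \<in> {a..b}" for \<nu> using that \<open>a \<le> \<nu>0 \<and> \<nu>0 \<le> b \<and> b - a < \<epsilon>\<close> by auto
      then show ?thesis unfolding P_def using e(2) by (intro exI[of _ C]) blast
    qed
    then show "\<exists>d>0. \<forall>a b. a \<le> \<nu>0 \<and> \<nu>0 \<le> b \<and> b - a < d \<longrightarrow> P a b" using e(1) by blast
  qed
  then obtain C where "\<forall>\<nu>\<in>{\<gamma>..l}. \<forall>x\<in>fst (T \<nu>). - C * (norm x)\<^sup>2 \<le> snd (T \<nu>) x \<bullet> x" unfolding P_def by auto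
  then have "sb_op J (T \<nu>) (max 1 (1 + C))" if "\<nu> \<in> {\<gamma>..l}" for \<nu>
    using that interval_sub[OF gl(1,2)] by (intro sb_opI[where C = C]) auto
  then show ?thesis by blast
qed

end

lemma fin_dim_basis:
  assumes "fin_dim S" "subspace S"
  obtains B where "finite B" "B \<subseteq> S" "independent B" "span B = S" "card B = dim S"
proof -
  obtain F where F: "finite F" "S \<subseteq> span F" using assms(1) by (auto simp: fin_dim_def)
  obtain B where B: "B \<subseteq> S" "independent B" "S \<subseteq> span B" "card B = dim S" using basis_exists[of S] by blast
  have "finite B" using independent_span_bound[OF F(1) B(2)] B(1) F(2) by blast
  moreover have "span B = S" using B assms(2) by (metis span_subspace)
  ultimately show thesis using that B by blast
qed

section \<open>Transport of complements along the parameter\<close>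

locale fam_split = fam J \<Delta> T D for J :: "'h::{real_inner,complete_space} \<Rightarrow> 'h" and \<Delta> T D +
  fixes \<gamma> l s :: real and Pm Pz Pp :: "real \<Rightarrow> 'h \<Rightarrow> 'h" and a :: "real \<Rightarrow> real"
  assumes gl: "\<gamma> \<in> \<Delta>" "l \<in> \<Delta>" "\<gamma> \<le> l"
    and split: "\<nu> \<in> {\<gamma>..l} \<Longrightarrow> ssplit J (T \<nu>) s (Pm \<nu>) (Pz \<nu>) (Pp \<nu>) (a \<nu>)"
    and fin_ker: "\<nu> \<in> {\<gamma>..l} \<Longrightarrow> fin_dim (ker (T \<nu>))"
begin

lemma seg: "\<nu> \<in> {\<gamma>..l} \<Longrightarrow> \<nu> \<in> \<Delta>"
  using interval_sub[OF gl(1,2)] by blast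

text \<open>The kernel of \<open>Pp\<close> is the non-positive part, the kernel of
  \<open>Pm\<close> the non-negative one; both contain the null space at their parameter, so kernels
  that appear or vanish do no harm. Only the gap at \<nu>0 enters, as the gap at \<nu> may be
  arbitrarily small. Both arrangements are stated because steps end at \<nu>0 and start from
  it.\<close>

lemma sum_close:
  assumes nu: "\<nu>0 \<in> {\<gamma>..l}"
  shows "\<exists>\<epsilon>>0. \<forall>\<nu>\<in>{\<gamma>..l}. \<bar>\<nu> - \<nu>0\<bar> < \<epsilon> \<longrightarrow>
     (\<forall>h. \<exists>u v. Pp \<nu> u = 0 \<and> Pm \<nu>0 v = 0 \<and> h = u + v) \<and> (\<forall>h. \<exists>u v. Pp \<nu>0 u = 0 \<and> Pm \<nu> v = 0 \<and> h = u + v)"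
proof -
  interpret N: ssplit J "T \<nu>0" s "Pm \<nu>0" "Pz \<nu>0" "Pp \<nu>0" "a \<nu>0" by (rule split[OF nu])
  \<comment> \<open>After the factor (s + 2)^2 from the change of resolvent and the factor s in
    \<open>A0\<close>, the two transforms differ by at most half the gap at \<nu>0.\<close>
  define \<eta> where "\<eta> = a \<nu>0 / (2 * s * (s + 2)\<^sup>2)"
  have "\<eta> > 0" using N.a_pos N.s1 by (simp add: \<eta>_def)
  then obtain \<epsilon> where \<epsilon>: "\<epsilon> > 0" "\<And>\<nu> w. \<nu> \<in> \<Delta> \<Longrightarrow> \<bar>\<nu> - \<nu>0\<bar> < \<epsilon> \<Longrightarrow>
      norm (res_i J (T \<nu>) w - res_i J (T \<nu>0) w) \<le> \<eta> * norm w"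
    using resolvent_close[OF seg[OF nu], of \<eta>] by auto
  have "(\<forall>h. \<exists>u v. Pp \<nu> u = 0 \<and> Pm \<nu>0 v = 0 \<and> h = u + v) \<and> (\<forall>h. \<exists>u v. Pp \<nu>0 u = 0 \<and> Pm \<nu> v = 0 \<and> h = u + v)"
    if h: "\<nu> \<in> {\<gamma>..l}" "\<bar>\<nu> - \<nu>0\<bar> < \<epsilon>" for \<nu>
  proof -
    interpret N': ssplit J "T \<nu>" s "Pm \<nu>" "Pz \<nu>" "Pp \<nu>" "a \<nu>" by (rule split[OF h(1)])
    have "norm (N'.B y - N.B y) \<le> (s + 2)\<^sup>2 * \<eta> * norm y" for y
      by (rule resolvent_transfer[OF N'.sb_op_axioms N.sb_op_axioms \<epsilon>(2)[OF seg[OF h(1)] h(2)]])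
    then have BB: "norm (N'.B y - N.B y) \<le> (a \<nu>0 / (2 * s)) * norm y" for y
      using N.s1 by (simp add: \<eta>_def)
    have AA: "norm (N.A0 y - N'.A0 y) \<le> (a \<nu>0 / 2) * norm y" for y
    proof -
      have "N.A0 y - N'.A0 y = s *\<^sub>R (N'.B y - N.B y)" by (simp add: N.A0_def N'.A0_def algebra_simps)
      then have "norm (N.A0 y - N'.A0 y) = s * norm (N'.B y - N.B y)" using N.s1 by simp
      also have "\<dots> \<le> s * ((a \<nu>0 / (2 * s)) * norm y)" using BB N.s1 by (intro mult_left_mono) auto
      finally show ?thesis using N.s1 by simp
    qed
    have AAi: "\<bar>(N.A0 y - N'.A0 y) \<bullet> y\<bar> \<le> (a \<nu>0 / 2) * (norm y)\<^sup>2" for y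
    proof -
      have "\<bar>(N.A0 y - N'.A0 y) \<bullet> y\<bar> \<le> norm (N.A0 y - N'.A0 y) * norm y" by (rule Cauchy_Schwarz_ineq2)
      also have "\<dots> \<le> (a \<nu>0 / 2) * norm y * norm y" by (intro mult_right_mono AA) auto
      finally show ?thesis by (simp add: power2_eq_square mult.assoc)
    qed
    have nA: "norm (N.A0 x) \<le> (1 + s) * norm x" for x by (rule N.A0_norm)
    have half: "a \<nu>0 / 2 < a \<nu>0" using N.a_pos by simp
    have "\<exists>u v. Pp \<nu> u = 0 \<and> Pm \<nu>0 v = 0 \<and> g = u + v" for g
    proof (rule sum_of_kernels[OF N'.Pp_sadj N'.P_idem(3) N.Pm_sadj N.P_idem(1), where A = "\<lambda>x. (-1) *\<^sub>R N.A0 x" and K = "1 + s" and a = "a \<nu>0" and e = "a \<nu>0 / 2"])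
      show "sadj (\<lambda>x. (-1) *\<^sub>R N.A0 x)" by (rule sadj_scale[OF N.A0_sadj])
      show "(-1) *\<^sub>R N.A0 (Pm \<nu>0 x) = Pm \<nu>0 ((-1) *\<^sub>R N.A0 x)" for x
        by (simp add: N.A0_com sadj_lin[OF N.Pm_sadj])
      show "norm ((-1) *\<^sub>R N.A0 x) \<le> (1 + s) * norm x" for x using nA[of x] by simp
      show "a \<nu>0 * (norm (Pm \<nu>0 x))\<^sup>2 \<le> ((-1) *\<^sub>R N.A0 (Pm \<nu>0 x)) \<bullet> Pm \<nu>0 x" for x
        using N.A0_neg[of x] by simp
      show "((-1) *\<^sub>R N.A0 (Pp \<nu> x)) \<bullet> Pp \<nu> x \<le> (a \<nu>0 / 2) * (norm (Pp \<nu> x))\<^sup>2" for x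
      proof -
        have "0 \<le> a \<nu> * (norm (Pp \<nu> x))\<^sup>2" using N'.a_pos by simp
        then have "0 \<le> N'.A0 (Pp \<nu> x) \<bullet> Pp \<nu> x" using N'.A0_pos[of x] by linarith
        then show ?thesis using AAi[of "Pp \<nu> x"] unfolding abs_le_iff inner_diff_left by simp
      qed
    qed (use half N.a_pos in auto)
    moreover have "\<exists>v u. Pm \<nu> v = 0 \<and> Pp \<nu>0 u = 0 \<and> g = v + u" for g
    proof (rule sum_of_kernels[OF N'.Pm_sadj N'.P_idem(1) N.Pp_sadj N.P_idem(3), where A = N.A0 and K = "1 + s" and a = "a \<nu>0" and e = "a \<nu>0 / 2"])
      show "N.A0 (Pm \<nu> x) \<bullet> Pm \<nu> x \<le> (a \<nu>0 / 2) * (norm (Pm \<nu> x))\<^sup>2" for x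
      proof -
        have "0 \<le> a \<nu> * (norm (Pm \<nu> x))\<^sup>2" using N'.a_pos by simp
        then have "N'.A0 (Pm \<nu> x) \<bullet> Pm \<nu> x \<le> 0" using N'.A0_neg[of x] by linarith
        then show ?thesis using AAi[of "Pm \<nu> x"] unfolding abs_le_iff inner_diff_left by simp
      qed
    qed (use half N.a_pos nA N.A0_sadj N.A0_com N.A0_pos in auto)
    ultimately show ?thesis by (metis add.commute)
  qed
  then show ?thesis using \<epsilon>(1) by blast
qed

text \<open>This pair of properties is carried along the parameter in place of maximality, which it
  implies at \<gamma>.\<close>

definition good :: "real \<Rightarrow> 'h set \<Rightarrow> bool" where
  "good \<nu> M \<longleftrightarrow> csubspace J M \<and> M \<subseteq> D \<and> (\<forall>x\<in>M. 0 \<le> t \<nu> x x) \<and> (\<forall>x\<in>D. \<exists>m\<in>M. Pm \<nu> (x - m) = x - m)"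

text \<open>On the negative part at \<nu>1 the S-lemma carries the gap over: t(\<nu>2) <= c
  t(\<nu>1) <= - c a norm^2. Null vectors at \<nu>1 are negative at \<nu>2, but the form order gives
  them no margin; they form a finite-dimensional space, so the finite extension lemma restores
  uniformity. The vector \<open>v\<close> makes the S-lemma constant positive.\<close>

lemma nonpos_uniform:
  assumes nu: "\<nu>1 \<in> {\<gamma>..l}" "\<nu>2 \<in> {\<gamma>..l}" "\<nu>1 < \<nu>2" and pos: "v \<in> D" "t \<nu>2 v v > 0"
  shows "\<exists>c>0. \<forall>x\<in>{x. Pp \<nu>1 x = 0}. t \<nu>2 x x \<le> - c * (norm x)\<^sup>2"
proof -
  interpret N: ssplit J "T \<nu>1" s "Pm \<nu>1" "Pz \<nu>1" "Pp \<nu>1" "a \<nu>1" by (rule split[OF nu(1)])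
  interpret N2: ssplit J "T \<nu>2" s "Pm \<nu>2" "Pz \<nu>2" "Pp \<nu>2" "a \<nu>2" by (rule split[OF nu(2)])
  have D1: "N.D = D" and D2: "N2.D = D" using form_dom seg nu by auto
  define W where "W = {x. Pm \<nu>1 x = x}"
  have W: "subspace W" "closed W"
    unfolding W_def subspace_def using sadjD(1)[OF N.Pm_sadj]
    by (auto simp: sadj_lin[OF N.Pm_sadj] intro!: closed_Collect_eq continuous_intros intro: bounded_linear.continuous_on)
  have "\<exists>c>0. \<forall>w\<in>W. t \<nu>2 w w \<le> - c * (norm w)\<^sup>2"
  proof (cases "\<exists>u\<in>D. t \<nu>1 u u < 0")
    case True
    then obtain u where u: "u \<in> D" "t \<nu>1 u u < 0" by blast
    obtain c where c: "c > 0" "\<forall>x\<in>D. t \<nu>2 x x \<le> c * t \<nu>1 x x"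
      using form_order[OF seg[OF nu(1)] seg[OF nu(2)] _ u pos] nu(3) by force
    have "t \<nu>2 w w \<le> - (c * a \<nu>1) * (norm w)\<^sup>2" if w: "w \<in> W" for w
    proof -
      have "w \<in> D" using w N.PmD[of w] D1 by (simp add: W_def)
      then have "t \<nu>2 w w \<le> c * t \<nu>1 w w" using c by blast
      also have "\<dots> \<le> c * (- a \<nu>1 * (norm w)\<^sup>2)" using mult_left_mono[OF N.t_neg[of w], of c] w c(1) by (simp add: W_def)
      finally show ?thesis by simp
    qed
    then show ?thesis using c(1) N.a_pos by (intro exI[of _ "c * a \<nu>1"]) auto
  next
    case False
    have "w = 0" if w: "w \<in> W" for w
    proof (rule N.t_neg_zero)
      show "Pm \<nu>1 w = w" using w by (simp add: W_def)
      have "w \<in> D" using w N.PmD[of w] D1 by (simp add: W_def)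
      then show "0 \<le> t \<nu>1 w w" using False by force
    qed
    then have "t \<nu>2 w w \<le> - 1 * (norm w)\<^sup>2" if "w \<in> W" for w using t_zero[OF seg[OF nu(2)]] that by fastforce
    then show ?thesis using zero_less_one by blast
  qed
  then obtain c where c: "c > 0" "\<And>w. w \<in> W \<Longrightarrow> t \<nu>2 w w \<le> - c * (norm w)\<^sup>2" by blast
  obtain S where S: "finite S" "S \<subseteq> ker (T \<nu>1)" "span S = ker (T \<nu>1)"
    using fin_dim_basis[OF fin_ker[OF nu(1)] N.ker_subspace] by metis
  have sub0: "subspace {x. Pp \<nu>1 x = 0}"
    unfolding subspace_def by (auto simp: sadj_lin[OF N.Pp_sadj])
  have kz: "Pp \<nu>1 k = 0" if "k \<in> ker (T \<nu>1)" for k using N.P_orth(6)[of k] N.Pz_ker(2)[OF that] by simp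
  have sp: "span (S \<union> W) = {x. Pp \<nu>1 x = 0}"
  proof
    have "Pp \<nu>1 w = 0" if "w \<in> W" for w using N.P_orth(5)[of w] that by (simp add: W_def)
    then have "S \<union> W \<subseteq> {x. Pp \<nu>1 x = 0}" using S(2) kz by auto
    then show "span (S \<union> W) \<subseteq> {x. Pp \<nu>1 x = 0}" using sub0 by (rule span_minimal)
    show "{x. Pp \<nu>1 x = 0} \<subseteq> span (S \<union> W)"
    proof
      fix x assume "x \<in> {x. Pp \<nu>1 x = 0}"
      then have x: "x = Pz \<nu>1 x + Pm \<nu>1 x" using N.P_sum[of x] by (simp add: add.commute)
      have "Pz \<nu>1 x \<in> span S" using S(3) N.Pz_ker(1) by blast
      then have "Pz \<nu>1 x \<in> span (S \<union> W)" using span_mono[of S "S \<union> W"] by blast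
      moreover have "Pm \<nu>1 x \<in> span (S \<union> W)" by (rule span_base) (simp add: W_def N.P_idem)
      ultimately show "x \<in> span (S \<union> W)" by (subst x) (rule span_add)
    qed
  qed
  have "closed (span (S \<union> W)) \<and> (\<exists>c'>0. \<forall>w\<in>span (S \<union> W). t \<nu>2 w w \<le> - c' * (norm w)\<^sup>2)"
  proof (rule uniform_negative_finite_extend[OF bf[OF seg[OF nu(2)]] _ _ W c S(1), where C = s])
    show "- s * (norm x)\<^sup>2 \<le> t \<nu>2 x x" if "x \<in> D" for x
      using N2.t_low[of x] that D2 by (simp add: algebra_simps) (smt (verit) zero_le_power2)
    show "0 \<le> s" using N.s1 by simp
    show "span (S \<union> W) \<subseteq> D" unfolding sp using N.nonpos_dom N.dom_D D1 by auto
    show "t \<nu>2 x x < 0" if "x \<in> span (S \<union> W)" "x \<noteq> 0" for x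
    proof -
      have x: "x \<in> D" "Pp \<nu>1 x = 0" using that(1) N.nonpos_dom N.dom_D D1 unfolding sp by auto
      then have "t \<nu>1 x x \<le> 0" using N.t_nonpos D1 by simp
      then show ?thesis using mono_neg[OF seg[OF nu(1)] seg[OF nu(2)] nu(3) x(1) that(2)] by simp
    qed
  qed
  then show ?thesis unfolding sp by blast
qed

text \<open>The non-positive part at \<nu>1 is strictly negative at \<nu>2, so it is a complement of
  \<open>M\<close>. It consists of the negative part and the kernel at \<nu>1; handing the kernel
  over to \<open>M\<close> leaves the negative part as complement, and null vectors do not change
  form values at \<nu>1.\<close>

lemma good_step:
  assumes nu: "\<nu>1 \<in> {\<gamma>..l}" "\<nu>2 \<in> {\<gamma>..l}" "\<nu>1 < \<nu>2"
    and sum: "\<And>h. \<exists>u v. Pp \<nu>1 u = 0 \<and> Pm \<nu>2 v = 0 \<and> h = u + v"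
    and M: "good \<nu>2 M"
  shows "good \<nu>1 {u + v | u v. u \<in> M \<and> v \<in> ker (T \<nu>1)}" (is "good \<nu>1 ?M")
proof -
  interpret N: ssplit J "T \<nu>1" s "Pm \<nu>1" "Pz \<nu>1" "Pp \<nu>1" "a \<nu>1" by (rule split[OF nu(1)])
  interpret N2: ssplit J "T \<nu>2" s "Pm \<nu>2" "Pz \<nu>2" "Pp \<nu>2" "a \<nu>2" by (rule split[OF nu(2)])
  have D1: "N.D = D" and D2: "N2.D = D" using form_dom seg nu by auto
  have M': "csubspace J M" "subspace M" "M \<subseteq> D" "\<And>x. x \<in> M \<Longrightarrow> 0 \<le> t \<nu>2 x x"
    "\<And>x. x \<in> D \<Longrightarrow> \<exists>m\<in>M. Pm \<nu>2 (x - m) = x - m"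
    using M by (auto simp: good_def csubspace_def)
  let ?N = "{x. Pp \<nu>1 x = 0}"
  have ND: "?N \<subseteq> D" using N.nonpos_dom N.dom_D D1 by auto
  have tr: "\<exists>n\<in>?N. x - n \<in> M" if x: "x \<in> D" for x
  proof (rule N2.complement_transfer)
    show "subspace M" "M \<subseteq> N2.D" "\<And>x. x \<in> M \<Longrightarrow> 0 \<le> t \<nu>2 x x"
      "\<And>x. x \<in> N2.D \<Longrightarrow> \<exists>m\<in>M. Pm \<nu>2 (x - m) = x - m" "x \<in> N2.D" using M' D2 x by auto
    show "subspace ?N" unfolding subspace_def by (auto simp: sadj_lin[OF N.Pp_sadj])
    show "?N \<subseteq> N2.D" using ND D2 by simp
    show "t \<nu>2 x x < 0" if "x \<in> ?N" "x \<noteq> 0" for x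
    proof -
      have x: "x \<in> D" "Pp \<nu>1 x = 0" using that ND by auto
      then have "t \<nu>1 x x \<le> 0" using N.t_nonpos D1 by simp
      then show ?thesis using mono_neg[OF seg[OF nu(1)] seg[OF nu(2)] nu(3) x(1) that(2)] by simp
    qed
    show "\<exists>n\<in>?N. Pm \<nu>2 (x - n) = 0" for x
    proof -
      obtain u v where "Pp \<nu>1 u = 0" "Pm \<nu>2 v = 0" "x = u + v" using sum by blast
      then show ?thesis by (intro bexI[of _ u]) auto
    qed
    show "(\<exists>c>0. \<forall>x\<in>?N. t \<nu>2 x x \<le> - c * (norm x)\<^sup>2) \<or> (\<forall>x\<in>N2.D. t \<nu>2 x x \<le> 0)"
    proof (cases "\<exists>v\<in>D. t \<nu>2 v v > 0")
      case True then show ?thesis using nonpos_uniform[OF nu] by blast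
    next
      case False then show ?thesis using D2 by force
    qed
  qed
  show ?thesis unfolding good_def
  proof (intro conjI ballI)
    have "linear J" using J by (simp add: cplx_struct_def)
    moreover have "csubspace J (ker (T \<nu>1))" unfolding csubspace_def using N.ker_subspace N.ker_J by blast
    ultimately show "csubspace J ?M" by (intro csubspace_sum M')
    have kD: "k \<in> D" if "k \<in> ker (T \<nu>1)" for k using N.dom_D[OF N.kerD(1)[OF that]] D1 by simp
    then show "?M \<subseteq> D" using M'(3) N.F.mem(1) D1 by blast
    fix x assume "x \<in> ?M"
    then obtain m k where x: "x = m + k" "m \<in> M" "k \<in> ker (T \<nu>1)" by blast
    have mD: "m \<in> N.D" and kD': "k \<in> N.D" using x M'(3) kD D1 by auto
    have "t \<nu>1 x x = t \<nu>1 m m"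
      unfolding x(1) N.F.sq_add[OF mD kD'] using N.t_ker[OF x(3) mD] N.t_ker[OF x(3) kD'] N.F.sym[OF mD kD'] by simp
    moreover have "0 \<le> t \<nu>1 m m"
      using mono_pos_le[OF seg[OF nu(1)] seg[OF nu(2)], of m] nu(3) M'(4)[OF x(2)] mD D1 by simp
    ultimately show "0 \<le> t \<nu>1 x x" by simp
  next
    fix x assume x: "x \<in> D"
    obtain n where n: "Pp \<nu>1 n = 0" "x - n \<in> M" using tr[OF x] by auto
    have n': "n = Pm \<nu>1 n + Pz \<nu>1 n" using N.P_sum[of n] n(1) by simp
    have "x - n + Pz \<nu>1 n \<in> ?M" using n(2) N.Pz_ker(1) by blast
    moreover have "x - (x - n + Pz \<nu>1 n) = Pm \<nu>1 n" using n' by (metis add_diff_cancel_right' diff_diff_eq diff_diff_eq2 add_diff_cancel_left')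
    then have "Pm \<nu>1 (x - (x - n + Pz \<nu>1 n)) = x - (x - n + Pz \<nu>1 n)" by (simp only: N.P_idem)
    ultimately show "\<exists>m\<in>?M. Pm \<nu>1 (x - m) = x - m" by blast
  qed
qed

lemma ES_empty: "ES {} = {0}" by (simp add: ES_def)

lemma ES_single: "\<nu> \<in> {\<gamma>..l} \<Longrightarrow> ES {\<nu>} = ker (T \<nu>)"
proof -
  assume nu: "\<nu> \<in> {\<gamma>..l}"
  interpret N: ssplit J "T \<nu>" s "Pm \<nu>" "Pz \<nu>" "Pp \<nu>" "a \<nu>" by (rule split[OF nu])
  show ?thesis using N.ker_subspace span_eq_iff[of "ker (T \<nu>)"] by (simp add: ES_def)
qed

lemma ES_Un: "ES (C \<union> C') = {u + v | u v. u \<in> ES C \<and> v \<in> ES C'}"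
  unfolding ES_def UN_Un by (rule span_Un)

text \<open>The guards at \<gamma> and \<open>l\<close> are there because Bolzano's principle also
  tests intervals that stick out of [\<gamma>, l]. The range is half-open because each step adds the
  kernel at its left end; the eigenspace at the right end is not added.\<close>

definition Link :: "real \<Rightarrow> real \<Rightarrow> bool" where
  "Link u v \<longleftrightarrow> (\<gamma> \<le> u \<longrightarrow> v \<le> l \<longrightarrow> (\<forall>M. good v M \<longrightarrow>
     (\<exists>C. finite C \<and> C \<subseteq> {u..<v} \<and> good u {x + k | x k. x \<in> M \<and> k \<in> ES C})))"

lemma Link_refl: "Link u u"
  unfolding Link_def
proof (intro impI allI)
  fix M assume M: "good u M"
  have "{x + k | x k. x \<in> M \<and> k \<in> ES {}} = M" by (auto simp: ES_empty)
  then show "\<exists>C. finite C \<and> C \<subseteq> {u..<u} \<and> good u {x + k | x k. x \<in> M \<and> k \<in> ES C}"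
    using M by (intro exI[of _ "{}"]) simp
qed

lemma Link_trans:
  assumes 1: "Link u v" and 2: "Link v w" and le: "u \<le> v" "v \<le> w"
  shows "Link u w"
  unfolding Link_def
proof (intro impI allI)
  fix M assume u: "\<gamma> \<le> u" and w: "w \<le> l" and M: "good w M"
  have v: "\<gamma> \<le> v" "v \<le> l" using u w le by auto
  obtain C where C: "finite C" "C \<subseteq> {v..<w}" "good v {x + k | x k. x \<in> M \<and> k \<in> ES C}"
    using 2 v(1) w M unfolding Link_def by blast
  let ?M = "{x + k | x k. x \<in> M \<and> k \<in> ES C}"
  obtain C' where C': "finite C'" "C' \<subseteq> {u..<v}" "good u {x + k | x k. x \<in> ?M \<and> k \<in> ES C'}"
    using 1 u v(2) C(3) unfolding Link_def by blast
  have "{x + k | x k. x \<in> ?M \<and> k \<in> ES C'} = {x + k | x k. x \<in> M \<and> k \<in> ES (C \<union> C')}"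
    unfolding ES_Un by (auto simp: add.assoc) (metis add.assoc)+
  then have "good u {x + k | x k. x \<in> M \<and> k \<in> ES (C \<union> C')}" using C'(3) by simp
  moreover have "C \<union> C' \<subseteq> {u..<w}" using C(2) C'(2) le by fastforce
  ultimately show "\<exists>C. finite C \<and> C \<subseteq> {u..<w} \<and> good u {x + k | x k. x \<in> M \<and> k \<in> ES C}"
    using C(1) C'(1) by (intro exI[of _ "C \<union> C'"]) auto
qed

lemma Link_step:
  assumes nu: "\<nu>1 \<in> {\<gamma>..l}" "\<nu>2 \<in> {\<gamma>..l}" "\<nu>1 \<le> \<nu>2"
    and sum: "\<And>h. \<exists>u v. Pp \<nu>1 u = 0 \<and> Pm \<nu>2 v = 0 \<and> h = u + v"
  shows "Link \<nu>1 \<nu>2"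
proof (cases "\<nu>1 = \<nu>2")
  case True then show ?thesis using Link_refl by simp
next
  case False
  then have lt: "\<nu>1 < \<nu>2" using nu(3) by simp
  show ?thesis unfolding Link_def
  proof (intro impI allI)
    fix M assume "good \<nu>2 M"
    then have "good \<nu>1 {u + v | u v. u \<in> M \<and> v \<in> ES {\<nu>1}}"
      unfolding ES_single[OF nu(1)] by (rule good_step[OF nu(1,2) lt sum])
    then show "\<exists>C. finite C \<and> C \<subseteq> {\<nu>1..<\<nu>2} \<and> good \<nu>1 {x + k | x k. x \<in> M \<and> k \<in> ES C}"
      using lt by (intro exI[of _ "{\<nu>1}"]) simp
  qed
qed

lemma Link_all: "Link \<gamma> l"
proof (rule Bolzano[OF gl(3), where P = Link])
  show "Link x z" if "Link x y" "Link y z" "x \<le> y" "y \<le> z" for x y z using Link_trans that by blast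
  fix \<nu>0 assume "\<gamma> \<le> \<nu>0" "\<nu>0 \<le> l"
  then have n0: "\<nu>0 \<in> {\<gamma>..l}" by simp
  obtain \<epsilon> where \<epsilon>: "\<epsilon> > 0" "\<And>\<nu>. \<nu> \<in> {\<gamma>..l} \<Longrightarrow> \<bar>\<nu> - \<nu>0\<bar> < \<epsilon> \<Longrightarrow>
     (\<forall>h. \<exists>u v. Pp \<nu> u = 0 \<and> Pm \<nu>0 v = 0 \<and> h = u + v) \<and> (\<forall>h. \<exists>u v. Pp \<nu>0 u = 0 \<and> Pm \<nu> v = 0 \<and> h = u + v)"
    using sum_close[OF n0] by blast
  have "Link x y" if ab: "x \<le> \<nu>0 \<and> \<nu>0 \<le> y \<and> y - x < \<epsilon>" for x y
  proof (cases "\<gamma> \<le> x \<and> y \<le> l")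
    case False then show ?thesis unfolding Link_def by blast
  next
    case True
    then have m: "x \<in> {\<gamma>..l}" "y \<in> {\<gamma>..l}" "\<bar>x - \<nu>0\<bar> < \<epsilon>" "\<bar>y - \<nu>0\<bar> < \<epsilon>" using ab by auto
    have "Link x \<nu>0" using ab \<epsilon>(2)[OF m(1,3)] by (intro Link_step m n0) auto
    moreover have "Link \<nu>0 y" using ab \<epsilon>(2)[OF m(2,4)] by (intro Link_step m n0) auto
    ultimately show ?thesis using Link_trans ab by blast
  qed
  then show "\<exists>d>0. \<forall>x y. x \<le> \<nu>0 \<and> \<nu>0 \<le> y \<and> y - x < d \<longrightarrow> Link x y" using \<epsilon>(1) by blast
qed

text \<open>A larger non-negative subspace would contain a nonzero vector of the negative part,
  where the form is strictly negative.\<close>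

lemma good_Mplus:
  assumes M: "good \<gamma> M"
  shows "M \<in> Mplus J (T \<gamma>) D"
proof -
  have g: "\<gamma> \<in> {\<gamma>..l}" using gl by simp
  interpret N: ssplit J "T \<gamma>" s "Pm \<gamma>" "Pz \<gamma>" "Pp \<gamma>" "a \<gamma>" by (rule split[OF g])
  have D1: "N.D = D" using form_dom seg g by auto
  have M': "csubspace J M" "M \<subseteq> D" "\<And>x. x \<in> M \<Longrightarrow> 0 \<le> t \<gamma> x x"
    "\<And>x. x \<in> D \<Longrightarrow> \<exists>m\<in>M. Pm \<gamma> (x - m) = x - m"
    using M by (auto simp: good_def)
  have "nonneg_sub J (T \<gamma>) D M" unfolding nonneg_sub_def using M'(1-3) t_val[OF gl(1) subsetD[OF M'(2)]] by force
  moreover have "M' = M" if h: "nonneg_sub J (T \<gamma>) D M'" "M \<subseteq> M'" for M'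
  proof
    show "M' \<subseteq> M"
    proof
      fix x assume x: "x \<in> M'"
      then have xD: "x \<in> D" using h unfolding nonneg_sub_def by blast
      obtain m where m: "m \<in> M" "Pm \<gamma> (x - m) = x - m" using M'(4)[OF xD] by blast
      have "x - m \<in> M'" using x m(1) h unfolding nonneg_sub_def csubspace_def by (meson subsetD subspace_diff)
      then have "0 \<le> t \<gamma> (x - m) (x - m)" using h(1) t_val[OF gl(1), of "x - m"] unfolding nonneg_sub_def by auto
      then have "x - m = 0" using N.t_neg_zero[OF m(2)] by simp
      then show "x \<in> M" using m(1) by simp
    qed
  qed (rule h(2))
  ultimately show ?thesis unfolding Mplus_def by blast
qed

lemma chain_result:
  "\<exists>C. finite C \<and> C \<subseteq> {\<gamma>..<l} \<and> {u + v | u v. u \<in> {x \<in> D. Pm l x = 0} \<and> v \<in> ES C} \<in> Mplus J (T \<gamma>) D"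
proof -
  have ll: "l \<in> {\<gamma>..l}" using gl by simp
  interpret N: ssplit J "T l" s "Pm l" "Pz l" "Pp l" "a l" by (rule split[OF ll])
  have D1: "N.D = D" using form_dom seg ll by auto
  have "good l {x \<in> D. Pm l x = 0}"
    unfolding good_def csubspace_def
  proof (intro conjI ballI)
    show "subspace {x \<in> D. Pm l x = 0}"
      using N.F.subD D1 unfolding subspace_def by (auto simp: sadj_lin[OF N.Pm_sadj])
    show "0 \<le> t l x x" if "x \<in> {x \<in> D. Pm l x = 0}" for x using N.t_nonneg that D1 by auto
    show "\<exists>m\<in>{x \<in> D. Pm l x = 0}. Pm l (x - m) = x - m" if "x \<in> D" for x
      using N.F.mem(2)[of x "Pm l x"] N.PmD[of x] that D1
      by (intro bexI[of _ "x - Pm l x"]) (auto simp: N.P_idem sadj_lin[OF N.Pm_sadj])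
  qed (use N.D_J D1 N.P_J(1) N.J_lin(4) in auto)
  then show ?thesis using Link_all good_Mplus unfolding Link_def by blast
qed

end

section \<open>Dimension counting\<close>

lemma independent_image_card:
  assumes "linear g" "independent B" "\<And>x. x \<in> span B \<Longrightarrow> g x = 0 \<Longrightarrow> x = 0"
  shows "independent (g ` B)" "card (g ` B) = card B"
proof -
  have inj: "inj_on g (span B)"
  proof (rule inj_onI)
    fix x y assume "x \<in> span B" "y \<in> span B" "g x = g y"
    then show "x = y" using assms(3)[of "x - y"] linear_diff[OF assms(1), of x y] span_diff[of x B y] by simp
  qed
  show "independent (g ` B)" by (rule linear_independent_injective_image[OF assms(1,2) inj])
  show "card (g ` B) = card B" using inj_on_subset[OF inj span_superset] by (rule card_image)
qed

text \<open>The sum of (x . y) y over \<open>S\<close> maps the span of \<open>B\<close> into the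
  smaller span of \<open>S\<close>, so it has a nontrivial kernel; there its inner product with x
  vanishes and is a sum of squares.\<close>

lemma exists_orthogonal_vector:
  fixes B :: "'a::real_inner set"
  assumes B: "finite B" "independent B" and S: "finite S" "card S < card B"
  obtains x where "x \<in> span B" "x \<noteq> 0" "\<And>y. y \<in> span S \<Longrightarrow> x \<bullet> y = 0"
proof -
  define g where "g x = (\<Sum>y\<in>S. (x \<bullet> y) *\<^sub>R y)" for x
  have g: "linear g" unfolding g_def
    by (rule linearI) (simp_all add: inner_add_left scaleR_add_left sum.distrib scaleR_sum_right)
  have "\<exists>x\<in>span B. g x = 0 \<and> x \<noteq> 0"
  proof (rule ccontr)
    assume "\<not> (\<exists>x\<in>span B. g x = 0 \<and> x \<noteq> 0)"
    then have i: "independent (g ` B)" "card (g ` B) = card B" using independent_image_card[OF g B(2)] by blast+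
    have "g ` B \<subseteq> span S" unfolding g_def by (auto intro!: span_sum intro: span_scale span_base)
    then have "card (g ` B) \<le> card S" using independent_span_bound[OF S(1) i(1)] by simp
    then show False using i(2) S(2) by simp
  qed
  then obtain x where x: "x \<in> span B" "g x = 0" "x \<noteq> 0" by blast
  have "(\<Sum>y\<in>S. (x \<bullet> y)\<^sup>2) = x \<bullet> g x"
    unfolding g_def by (simp add: inner_sum_right power2_eq_square)
  then have "(\<Sum>y\<in>S. (x \<bullet> y)\<^sup>2) = 0" using x(2) by simp
  then have "x \<bullet> y = 0" if "y \<in> S" for y using S(1) that by (simp add: sum_nonneg_eq_0_iff)
  then have "x \<bullet> y = 0" if "y \<in> span S" for y using orthogonal_to_span[of y S x] that by (auto simp: orthogonal_def)
  then show thesis using that x by blast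
qed

lemma independent_Un:
  assumes "finite B" "independent A" "independent B" "span A \<inter> span B \<subseteq> {0}"
  shows "independent (A \<union> B) \<and> A \<inter> B = {}"
  using assms
proof (induction B rule: finite_induct)
  case (insert b B)
  have bB: "b \<notin> span B" "independent B" using insert.prems(2) insert.hyps(2) by (auto simp: independent_insert)
  have sm: "span B \<subseteq> span (insert b B)" by (rule span_mono) auto
  have IH: "independent (A \<union> B)" "A \<inter> B = {}" using insert.IH[OF insert.prems(1) bB(2)] insert.prems(3) sm by auto
  have nb: "b \<notin> span (A \<union> B)"
  proof
    assume "b \<in> span (A \<union> B)"
    then obtain u v where uv: "b = u + v" "u \<in> span A" "v \<in> span B" unfolding span_Un by blast
    have "b \<in> span (insert b B)" by (simp add: span_base)
    then have "b - v \<in> span (insert b B)" using uv(3) sm span_diff by blast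
    then have "u = 0" using insert.prems(3) uv by auto
    then show False using bB(1) uv by simp
  qed
  then have "b \<notin> A \<union> B" using span_base[of b "A \<union> B"] by blast
  then show ?case using IH nb by (simp add: independent_insert)
qed simp

text \<open>If J x - c x lay in \<open>L\<close>, applying \<open>J\<close> and adding c times the
  vector would put -(1 + c^2) x into \<open>L\<close>. So a vector outside \<open>L\<close> always
  brings two real dimensions.\<close>

lemma csubspace_extend1:
  fixes J :: "'h::real_inner \<Rightarrow> 'h"
  assumes J: "cplx_struct J" and L: "csubspace J L" "fin_dim L" and x: "x \<notin> L"
    and M: "csubspace J M" "L \<subseteq> M" "x \<in> M"
  shows "\<exists>L'. csubspace J L' \<and> L \<subseteq> L' \<and> L' \<subseteq> M \<and> fin_dim L' \<and> dim L' = dim L + 2"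
proof -
  have Jl: "linear J" and JJ: "\<And>x. J (J x) = - x" using J by (auto simp: cplx_struct_def)
  have Ls: "subspace L" "\<And>x. x \<in> L \<Longrightarrow> J x \<in> L" and Ms: "subspace M" "\<And>x. x \<in> M \<Longrightarrow> J x \<in> M"
    using L M by (auto simp: csubspace_def)
  obtain B where B: "finite B" "independent B" "span B = L" "card B = dim L"
    using fin_dim_basis[OF L(2) Ls(1)] by metis
  define B' where "B' = insert (J x) (insert x B)"
  have xB: "x \<notin> span B" using x B(3) by simp
  have JxB: "J x \<notin> span (insert x B)"
  proof
    have inv: "(- 1 / k) * (- k) = 1" if "k \<noteq> 0" for k :: real using that by simp
    assume "J x \<in> span (insert x B)"
    then obtain c where c: "J x - c *\<^sub>R x \<in> L" unfolding span_breakdown_eq B(3) by blast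
    then have "J (J x - c *\<^sub>R x) + c *\<^sub>R (J x - c *\<^sub>R x) \<in> L" using Ls by (simp add: subspace_add subspace_scale)
    also have "J (J x - c *\<^sub>R x) + c *\<^sub>R (J x - c *\<^sub>R x) = - (1 + c * c) *\<^sub>R x"
      by (simp add: linear_diff[OF Jl] linear_scale[OF Jl] JJ algebra_simps)
    finally have "(- 1 / (1 + c * c)) *\<^sub>R (- (1 + c * c) *\<^sub>R x) \<in> L" using Ls(1) subspace_scale by blast
    moreover have "1 + c * c \<noteq> 0" by (smt (verit) zero_le_square)
    then have "(- 1 / (1 + c * c)) *\<^sub>R (- (1 + c * c) *\<^sub>R x) = x" unfolding scaleR_scaleR by (simp only: inv[OF \<open>1 + c * c \<noteq> 0\<close>] scaleR_one)
    ultimately show False using x by metis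
  qed
  have i1: "independent (insert x B)" using xB B(2) by (simp add: independent_insert)
  have ind: "independent B'" unfolding B'_def using JxB i1 by (simp add: independent_insert)
  have "x \<notin> B" "J x \<notin> insert x B" using xB JxB span_base by blast+
  then have card: "card B' = dim L + 2" unfolding B'_def using B(1,4) by simp
  have "csubspace J (span B')" unfolding csubspace_def
  proof (intro conjI ballI)
    fix y assume "y \<in> span B'"
    then have "J y \<in> span (J ` B')" using linear_span_image[OF Jl] by blast
    moreover have "J ` B' \<subseteq> span B'"
    proof -
      have "J b \<in> span B'" if "b \<in> B" for b
      proof -
        have "J b \<in> L" using Ls(2) B(3) that span_base by blast
        then show ?thesis using B(3) span_mono[of B B'] unfolding B'_def by blast
      qed
      moreover have "x \<in> span B'" "J x \<in> span B'" unfolding B'_def by (auto intro: span_base)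
      ultimately show ?thesis unfolding B'_def by (auto simp: JJ span_neg)
    qed
    ultimately show "J y \<in> span B'" by (meson span_minimal subsetD subspace_span)
  qed (rule subspace_span)
  moreover have "L \<subseteq> span B'" using B(3) span_mono[of B B'] unfolding B'_def by blast
  moreover have "span B' \<subseteq> M"
    using M Ms B(3) span_superset[of B] unfolding B'_def by (intro span_minimal) auto
  moreover have "fin_dim (span B')" unfolding fin_dim_def using B(1) by (intro exI[of _ B']) (simp add: B'_def)
  moreover have "dim (span B') = dim L + 2" using dim_span_eq_card_independent[OF ind] card by simp
  ultimately show ?thesis by blast
qed

text \<open>Complex lines are added until the real dimension is 2 n; the independent set
  \<open>B\<close> guarantees a vector outside as long as the dimension is smaller. \<open>M\<close>
  itself may be infinite-dimensional.\<close>

lemma csubspace_extend: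
  fixes J :: "'h::real_inner \<Rightarrow> 'h"
  assumes J: "cplx_struct J" and M: "csubspace J M" and B: "finite B" "independent B" "B \<subseteq> M" "2 * n \<le> card B"
    and L: "csubspace J L" "fin_dim L" "L \<subseteq> M" "dim L = 2 * k" "k \<le> n"
  shows "\<exists>L'. csubspace J L' \<and> L \<subseteq> L' \<and> L' \<subseteq> M \<and> fin_dim L' \<and> dim L' = 2 * n"
  using L
proof (induction "n - k" arbitrary: L k)
  case 0
  then show ?case by (intro exI[of _ L]) auto
next
  case (Suc d)
  have "\<not> B \<subseteq> L"
  proof
    assume BL: "B \<subseteq> L"
    obtain F where F: "finite F" "independent F" "span F = L" "card F = dim L"
      using fin_dim_basis[OF Suc.prems(2)] Suc.prems(1) unfolding csubspace_def by metis
    have "card B \<le> card F" using independent_span_bound[OF F(1) B(2)] BL F(3) by simp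
    then show False using F(4) Suc B(4) by simp
  qed
  then obtain x where x: "x \<in> B" "x \<notin> L" by blast
  then obtain L1 where L1: "csubspace J L1" "L \<subseteq> L1" "L1 \<subseteq> M" "fin_dim L1" "dim L1 = dim L + 2"
    using csubspace_extend1[OF J Suc.prems(1,2) x(2) M Suc.prems(3)] B(3) by blast
  moreover have "n - Suc k = d" "dim L1 = 2 * Suc k" "Suc k \<le> n" using Suc.hyps(2) Suc.prems(4,5) L1(5) by auto
  ultimately obtain L' where "csubspace J L'" "L1 \<subseteq> L'" "L' \<subseteq> M" "fin_dim L'" "dim L' = 2 * n"
    using Suc.hyps(1)[of "Suc k" L1] by blast
  then show ?case using L1(2) by blast
qed

text \<open>Otherwise complex lines fill \<open>L\<close> up to one dimension short, and the next
  line overshoots. The point matters because \<open>cdim\<close> halves by integer division.\<close>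

lemma csubspace_even_dim:
  fixes J :: "'h::real_inner \<Rightarrow> 'h"
  assumes J: "cplx_struct J" and L: "csubspace J L" "fin_dim L"
  shows "dim L = 2 * (dim L div 2)"
proof (rule ccontr)
  assume odd: "dim L \<noteq> 2 * (dim L div 2)"
  have Ls: "subspace L" using L by (simp add: csubspace_def)
  obtain B where B: "finite B" "independent B" "B \<subseteq> L" "span B = L" "card B = dim L"
    using fin_dim_basis[OF L(2) Ls] by metis
  have "linear J" using J by (simp add: cplx_struct_def)
  then have z: "csubspace J {0}" by (simp add: csubspace_def linear_0)
  have fz: "fin_dim {0}" unfolding fin_dim_def by (intro exI[of _ "{}"]) simp
  obtain L0 where L0: "csubspace J L0" "L0 \<subseteq> L" "fin_dim L0" "dim L0 = 2 * (dim L div 2)"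
  proof -
    have d0: "dim {0::'h} = 2 * 0" using dim_le_card[of "{0::'h}" "{}"] by simp
    have "{0} \<subseteq> L" using subspace_0[OF Ls] by simp
    then show ?thesis using csubspace_extend[OF J L(1) B(1-3) _ z fz _ d0, of "dim L div 2"] B(5) that by auto
  qed
  have "L0 \<noteq> L" using L0(4) odd by metis
  then obtain x where x: "x \<in> L" "x \<notin> L0" using L0(2) by blast
  obtain L1 where L1: "csubspace J L1" "L1 \<subseteq> L" "fin_dim L1" "dim L1 = dim L0 + 2"
    using csubspace_extend1[OF J L0(1,3) x(2) L(1) L0(2) x(1)] by blast
  have "dim L1 \<le> card B" using L1(2) B(1,4) by (intro dim_le_card) auto
  then show False using L1(4) L0(4) B(5) by presburger
qed

context ssplit
begin

text \<open>As the negative part is a complement of \<open>M\<close>, each vector of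
  \<open>E\<close> can be moved into \<open>M\<close> by a negative vector; the move is injective
  because the span of \<open>E\<close> meets the negative part only in 0. \<open>P\<close> is
  abstract since it will stand for non-positivity of the form at another parameter.\<close>

lemma Mplus_transfer:
  assumes inj: "\<And>x. x \<in> ker A \<Longrightarrow> x = 0" and M: "M \<in> Mplus J A D"
    and E: "finite E" "independent E" "E \<subseteq> D"
    and np: "\<And>h e. Pm h = h \<Longrightarrow> e \<in> span E \<Longrightarrow> P (h + e)"
    and tr: "\<And>e. e \<in> span E \<Longrightarrow> Pm e = e \<Longrightarrow> e = 0"
  shows "\<exists>E'. finite E' \<and> independent E' \<and> E' \<subseteq> M \<and> card E' = card E \<and> (\<forall>x\<in>span E'. P x)"
proof -
  have Ms: "subspace M" using M unfolding Mplus_def nonneg_sub_def csubspace_def by blast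
  have "\<forall>x\<in>E. \<exists>m. m \<in> M \<and> Pm (x - m) = x - m" using Mplus_complement[OF inj M] E(3) by blast
  then obtain mf where mf: "\<And>x. x \<in> E \<Longrightarrow> mf x \<in> M" "\<And>x. x \<in> E \<Longrightarrow> Pm (x - mf x) = x - mf x" by metis
  obtain g where g: "linear g" "\<And>x. x \<in> E \<Longrightarrow> g x = mf x" using linear_independent_extend[OF E(2), of mf] by blast
  have gM: "g x \<in> M \<and> Pm (x - g x) = x - g x" if "x \<in> span E" for x
    using that
  proof (induction rule: span_induct)
    show "subspace {x. g x \<in> M \<and> Pm (x - g x) = x - g x}"
      unfolding subspace_def
    proof (intro conjI ballI allI)
      show "0 \<in> {x. g x \<in> M \<and> Pm (x - g x) = x - g x}"
        using Ms by (simp add: linear_0[OF g(1)] subspace_0 sadj_lin[OF Pm_sadj])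
      fix x c assume x: "x \<in> {x. g x \<in> M \<and> Pm (x - g x) = x - g x}"
      have "Pm (c *\<^sub>R (x - g x)) = c *\<^sub>R (x - g x)" using x by (simp only: sadj_lin[OF Pm_sadj]) simp
      then show "c *\<^sub>R x \<in> {x. g x \<in> M \<and> Pm (x - g x) = x - g x}"
        using Ms x by (simp add: linear_scale[OF g(1)] subspace_scale scaleR_diff_right)
      fix y assume y: "y \<in> {x. g x \<in> M \<and> Pm (x - g x) = x - g x}"
      have "Pm ((x - g x) + (y - g y)) = (x - g x) + (y - g y)" using x y by (simp only: sadj_lin[OF Pm_sadj]) simp
      then show "x + y \<in> {x. g x \<in> M \<and> Pm (x - g x) = x - g x}"
        using Ms x y by (simp add: linear_add[OF g(1)] subspace_add add_diff_add)
    qed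
    show "g x \<in> M \<and> Pm (x - g x) = x - g x" if "x \<in> E" for x using mf that g(2) by simp
  qed
  have inj: "x = 0" if "x \<in> span E" "g x = 0" for x using gM[OF that(1)] that tr by simp
  note ic = independent_image_card[OF g(1) E(2) inj]
  have "P y" if y: "y \<in> span (g ` E)" for y
  proof -
    have "y \<in> g ` span E" using y by (simp only: linear_span_image[OF g(1)])
    then obtain x where x: "x \<in> span E" "y = g x" by blast
    have "Pm (- (x - g x)) = - (x - g x)" using gM[OF x(1)] by (simp only: sadj_lin[OF Pm_sadj])
    then have "P (- (x - g x) + x)" using np x(1) by blast
    then show ?thesis using x(2) by simp
  qed
  moreover have "g ` E \<subseteq> M" using mf(1) g(2) by auto
  ultimately show ?thesis using ic E(1) by (intro exI[of _ "g ` E"]) auto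
qed

end

section \<open>Sums of eigenspaces\<close>

context fam
begin

lemma kerT:
  assumes "c \<in> \<Delta>"
  shows "subspace (ker (T c))" "ker (T c) \<subseteq> D" "\<And>k x. k \<in> ker (T c) \<Longrightarrow> x \<in> D \<Longrightarrow> t c k x = 0"
    "csubspace J (ker (T c))"
proof -
  obtain s where "sb_op J (T c) s" using ex_sb[OF assms] by blast
  then interpret N: sb_op J "T c" s .
  show "subspace (ker (T c))" by (rule N.ker_subspace)
  show "ker (T c) \<subseteq> D" using N.kerD(1) N.dom_D form_dom[OF assms] by auto
  show "fb (T c) k x = 0" if "k \<in> ker (T c)" "x \<in> D" for k x using N.t_ker that form_dom[OF assms] by blast
  show "csubspace J (ker (T c))" unfolding csubspace_def using N.ker_subspace N.ker_J by blast
qed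

lemma ES_insert:
  assumes "b \<in> \<Delta>"
  shows "ES (insert b C) = {u + v | u v. u \<in> ker (T b) \<and> v \<in> ES C}"
proof -
  have "span (ker (T b)) = ker (T b)" using kerT(1)[OF assms] span_eq_iff by blast
  then show ?thesis unfolding ES_def UN_insert span_Un by (simp only:)
qed

lemma ES_D: "C \<subseteq> \<Delta> \<Longrightarrow> \<gamma> \<in> \<Delta> \<Longrightarrow> ES C \<subseteq> D"
  unfolding ES_def using kerT(2) bform.subD[OF bf] by (intro span_minimal) auto

lemma t_add_ker:
  assumes b: "b \<in> \<Delta>" and k: "k \<in> ker (T b)" and x: "x \<in> D"
  shows "t b (k + x) (k + x) = t b x x"
proof -
  interpret F: bform D "t b" by (rule bf[OF b])
  have kD: "k \<in> D" using kerT(2)[OF b] k by blast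
  show ?thesis using F.sq_add[OF kD x] kerT(3)[OF b k x] kerT(3)[OF b k kD] by simp
qed

text \<open>Induction on the largest parameter \<open>b\<close>: its null vectors leave the form at
  \<open>b\<close> unchanged, and monotonicity moves the sign on to \<open>l\<close>.\<close>

lemma ES_nonpos:
  assumes g: "\<gamma> \<in> \<Delta>" and h: "h \<in> D" "t \<gamma> h h \<le> 0"
    and C: "finite C" "C \<subseteq> \<Delta>" "\<And>c. c \<in> C \<Longrightarrow> \<gamma> \<le> c"
    and e: "e \<in> ES C" and l: "l \<in> \<Delta>" "\<gamma> \<le> l" "\<And>c. c \<in> C \<Longrightarrow> c \<le> l"
  shows "t l (h + e) (h + e) \<le> 0"
  using C e l
proof (induction C arbitrary: e l rule: finite_linorder_max_induct)
  case empty
  then have "e = 0" by (simp add: ES_def)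
  then show ?case using mono_neg_le[OF g _ _ h] empty by simp
next
  case (insert b C)
  have b: "b \<in> \<Delta>" "\<gamma> \<le> b" using insert.prems by auto
  obtain k e' where ke: "e = k + e'" "k \<in> ker (T b)" "e' \<in> ES C"
    using insert.prems(3) unfolding ES_insert[OF b(1)] by blast
  have e'D: "e' \<in> D" using ES_D[OF _ g, of C] ke(3) insert.prems(1) by blast
  have heD: "h + e' \<in> D" using bform.mem(1)[OF bf[OF g] h(1) e'D] .
  have "t b (h + e') (h + e') \<le> 0"
  proof (rule insert.IH[OF _ _ ke(3) b])
    show "c \<le> b" if "c \<in> C" for c using insert.hyps(2) that by (simp add: less_imp_le)
  qed (use insert.prems in auto)
  moreover have eq: "h + e = k + (h + e')" by (simp add: ke(1) algebra_simps)
  ultimately have "t b (h + e) (h + e) \<le> 0" unfolding eq t_add_ker[OF b(1) ke(2) heD] by simp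
  moreover have "h + e \<in> D" unfolding eq using bform.mem(1)[OF bf[OF g] _ heD] kerT(2)[OF b(1)] ke(2) by blast
  ultimately show ?case using mono_neg_le[OF b(1) insert.prems(4)] insert.prems(6) by simp
qed

text \<open>The mirror image: induction on the smallest parameter, with the sign travelling to the
  left.\<close>

lemma ES_nonneg:
  assumes g: "\<gamma> \<in> \<Delta>"
    and C: "finite C" "C \<subseteq> \<Delta>" and e: "e \<in> ES C" and l: "l \<in> \<Delta>" "\<And>c. c \<in> C \<Longrightarrow> l \<le> c"
  shows "0 \<le> t l e e"
  using C e l
proof (induction C arbitrary: e l rule: finite_linorder_min_induct)
  case empty
  then have "e = 0" by (simp add: ES_def)
  then show ?case using t_zero empty by simp
next
  case (insert b C)
  have b: "b \<in> \<Delta>" using insert.prems by auto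
  obtain k e' where ke: "e = k + e'" "k \<in> ker (T b)" "e' \<in> ES C"
    using insert.prems(2) unfolding ES_insert[OF b] by blast
  have e'D: "e' \<in> D" using ES_D[OF _ g, of C] ke(3) insert.prems(1) by blast
  have "0 \<le> t b e' e'" using insert.IH[OF _ ke(3) b] insert.prems insert.hyps by (auto intro: less_imp_le)
  then have "0 \<le> t b e e" unfolding ke(1) t_add_ker[OF b ke(2) e'D] .
  moreover have "e \<in> D" unfolding ke(1) using bform.mem(1)[OF bf[OF g] _ e'D] kerT(2)[OF b] ke(2) by blast
  ultimately show ?case using mono_pos_le[OF insert.prems(3) b] insert.prems(4) by simp
qed

lemma ES_pos:
  assumes g: "\<gamma> \<in> \<Delta>" and C: "finite C" "C \<subseteq> \<Delta>" "\<And>c. c \<in> C \<Longrightarrow> \<gamma> < c" and e: "e \<in> ES C" "e \<noteq> 0"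
  shows "0 < t \<gamma> e e"
proof -
  have "C \<noteq> {}" using e by (auto simp: ES_def)
  then have m: "Min C \<in> C" using C(1) by simp
  then have mD: "Min C \<in> \<Delta>" using C(2) by blast
  have "0 \<le> t (Min C) e e" using C(1) by (intro ES_nonneg[OF g C(1,2) e(1) mD]) auto
  moreover have "e \<in> D" using ES_D[OF C(2) g] e(1) by blast
  ultimately show ?thesis using mono_pos[OF g mD C(3)[OF m] _ e(2)] by blast
qed

text \<open>Null vectors at different parameters belong to different operators, so independence has
  to come from the forms: a common nonzero vector would be non-positive at a parameter before
  \<open>b\<close>, hence negative at \<open>b\<close>, where it is neutral.\<close>

lemma ES_basis:
  assumes g: "\<gamma> \<in> \<Delta>" and C: "finite C" "C \<subseteq> \<Delta>" "\<And>c. c \<in> C \<Longrightarrow> \<gamma> < c" "\<And>c. c \<in> C \<Longrightarrow> fin_dim (ker (T c))"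
  shows "\<exists>B. finite B \<and> independent B \<and> span B = ES C \<and> card B = (\<Sum>c\<in>C. dim (ker (T c)))"
  using C
proof (induction C rule: finite_linorder_max_induct)
  case empty
  show ?case by (intro exI[of _ "{}"]) (simp add: ES_def independent_empty)
next
  case (insert b C)
  have b: "b \<in> \<Delta>" "\<gamma> < b" "fin_dim (ker (T b))" using insert.prems by auto
  obtain B where B: "finite B" "independent B" "span B = ES C" "card B = (\<Sum>c\<in>C. dim (ker (T c)))"
    using insert by auto
  obtain K where K: "finite K" "independent K" "span K = ker (T b)" "card K = dim (ker (T b))"
    using fin_dim_basis[OF b(3) kerT(1)[OF b(1)]] by metis
  have "span B \<inter> span K \<subseteq> {0}"
  proof
    fix x assume "x \<in> span B \<inter> span K"
    then have x: "x \<in> ES C" "x \<in> ker (T b)" using B(3) K(3) by auto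
    have xD: "x \<in> D" using x(2) kerT(2)[OF b(1)] by blast
    have 0: "t b x x = 0" by (rule kerT(3)[OF b(1) x(2) xD])
    show "x \<in> {0}"
    proof (rule ccontr)
      assume "x \<notin> {0}"
      then have x0: "x \<noteq> 0" by simp
      \<comment> \<open>Including \<gamma> makes the maximum meaningful for empty
        \<open>C\<close>.\<close>
      define m where "m = Max (insert \<gamma> C)"
      have "m \<in> insert \<gamma> C" unfolding m_def using insert.hyps(1) by (intro Max_in) auto
      then have m: "m \<in> \<Delta>" "m < b" using g insert.prems(1) insert.hyps(2) b(2) by auto
      have "t m (0 + x) (0 + x) \<le> 0"
      proof (rule ES_nonpos[OF g _ _ insert.hyps(1) _ _ x(1) m(1)])
        show "0 \<in> D" "t \<gamma> 0 0 \<le> 0" using bform.zero_mem[OF bf[OF g]] t_zero[OF g] by auto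
        show "\<gamma> \<le> m" "\<And>c. c \<in> C \<Longrightarrow> c \<le> m" unfolding m_def using insert.hyps(1) by (auto intro: Max_ge)
      qed (use insert.prems(1,2) in \<open>auto intro: less_imp_le\<close>)
      then show False using mono_neg[OF m(1) b(1) m(2) xD x0] 0 by simp
    qed
  qed
  then have i: "independent (B \<union> K)" "B \<inter> K = {}" using independent_Un[OF K(1) B(2) K(2)] by auto
  have "span (B \<union> K) = ES (insert b C)"
    unfolding span_Un B(3) K(3) ES_insert[OF b(1)] by (auto; metis add.commute)
  moreover have "card (B \<union> K) = (\<Sum>c\<in>insert b C. dim (ker (T c)))"
    using card_Un_disjoint[OF B(1) K(1) i(2)] B(4) K(4) insert.hyps by (subst sum.insert) auto
  ultimately show ?case using i B(1) K(1) by (intro exI[of _ "B \<union> K"]) auto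
qed

end

section \<open>Points of the essential spectrum\<close>

text \<open>\<open>V\<close> will be the operator domain, which need not be closed, so an orthogonal
  projection could leave it. The finitely many conditions are met one at a time by correctors taken
  inside \<open>V\<close>.\<close>

lemma finite_codim_complement:
  fixes V :: "'a::real_inner set"
  assumes "subspace V" "finite S"
  shows "\<exists>G. finite G \<and> G \<subseteq> V \<and> (\<forall>x\<in>V. \<exists>g\<in>span G. \<forall>y\<in>S. (x - g) \<bullet> y = 0)"
  using assms(2)
proof (induction S rule: finite_induct)
  case empty
  then show ?case using assms(1) by (intro exI[of _ "{}"]) auto
next
  case (insert y S)
  then obtain G where G: "finite G" "G \<subseteq> V" "\<And>x. x \<in> V \<Longrightarrow> \<exists>g\<in>span G. \<forall>y\<in>S. (x - g) \<bullet> y = 0" by blast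
  have GV: "span G \<subseteq> V" using G(2) assms(1) by (rule span_minimal)
  show ?case
  proof (cases "\<exists>z\<in>V. (\<forall>w\<in>S. z \<bullet> w = 0) \<and> z \<bullet> y \<noteq> 0")
    case False
    have "\<exists>g\<in>span G. \<forall>w\<in>insert y S. (x - g) \<bullet> w = 0" if x: "x \<in> V" for x
    proof -
      obtain g where g: "g \<in> span G" "\<forall>w\<in>S. (x - g) \<bullet> w = 0" using G(3)[OF x] by blast
      have "x - g \<in> V" using x g(1) GV assms(1) subspace_diff by blast
      then have "(x - g) \<bullet> y = 0" using False g(2) by blast
      then show ?thesis using g by (intro bexI[of _ g]) auto
    qed
    then show ?thesis using G by (intro exI[of _ G]) blast
  next
    case True
    then obtain z where z: "z \<in> V" "\<forall>w\<in>S. z \<bullet> w = 0" "z \<bullet> y \<noteq> 0" by blast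
    have "\<exists>g\<in>span (insert z G). \<forall>w\<in>insert y S. (x - g) \<bullet> w = 0" if x: "x \<in> V" for x
    proof -
      obtain g where g: "g \<in> span G" "\<forall>w\<in>S. (x - g) \<bullet> w = 0" using G(3)[OF x] by blast
      define c where "c = ((x - g) \<bullet> y) / (z \<bullet> y)"
      have "g + c *\<^sub>R z \<in> span (insert z G)"
        using g(1) span_mono[of G "insert z G"] by (intro span_add span_scale) (auto intro: span_base)
      moreover have "(x - (g + c *\<^sub>R z)) \<bullet> y = 0"
        using z(3) by (simp add: c_def inner_diff_left inner_add_left)
      moreover have "(x - (g + c *\<^sub>R z)) \<bullet> w = 0" if "w \<in> S" for w
        using g(2) z(2) that by (simp add: inner_diff_left inner_add_left)
      ultimately show ?thesis by (intro bexI[of _ "g + c *\<^sub>R z"]) auto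
    qed
    then show ?thesis using G(1,2) z(1) by (intro exI[of _ "insert z G"]) auto
  qed
qed

text \<open>The uniform extension lemma, applied to the negative of the inner product.\<close>

lemma closed_finite_extension:
  fixes W :: "'h::{real_inner,complete_space} set"
  assumes "subspace W" "closed W" "finite S"
  shows "closed (span (S \<union> W))"
proof -
  have "closed (span (S \<union> W)) \<and> (\<exists>c'>0. \<forall>w\<in>span (S \<union> W). - (w \<bullet> w) \<le> - c' * (norm w)\<^sup>2)"
    by (rule uniform_negative_finite_extend[OF bform_uminus[OF bform_inner] _ _ assms(1,2) _ _ assms(3), where C = 1 and c = 1])
      (auto simp: dot_square_norm)
  then show ?thesis by (rule conjunct1)
qed

context sa_op
begin

text \<open>If \<open>T\<close> were bounded below on the domain vectors orthogonal to
  \<open>S\<close>, its kernel would be finite-dimensional and the image of that part closed. The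
  whole range adds only finitely many dimensions, and its orthogonal complement lies in the kernel,
  so \<open>A\<close> would be Fredholm.\<close>

lemma approximate_kernel_vector:
  assumes nf: "\<not> fredholm A" and S: "finite S" and e: "e > 0"
  shows "\<exists>x\<in>dm. norm x = 1 \<and> (\<forall>y\<in>S. x \<bullet> y = 0) \<and> norm (T x) \<le> e"
proof (rule ccontr)
  assume H: "\<not> (\<exists>x\<in>dm. norm x = 1 \<and> (\<forall>y\<in>S. x \<bullet> y = 0) \<and> norm (T x) \<le> e)"
  define V where "V = {x. \<forall>y\<in>S. x \<bullet> y = 0}"
  have V: "subspace V" unfolding V_def subspace_def by (auto simp: inner_add_left)
  have Veq: "V = (\<Inter>y\<in>S. {x. x \<bullet> y = 0})" by (auto simp: V_def)
  have Vc: "closed V" unfolding Veq by (intro closed_INT ballI closed_Collect_eq continuous_intros)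
  have low: "e * norm x \<le> norm (T x + 0)" if x: "x \<in> dm" "x \<in> V" for x
  proof (cases "x = 0")
    case False
    let ?u = "(1 / norm x) *\<^sub>R x"
    have "?u \<in> dm" "norm ?u = 1" "\<forall>y\<in>S. ?u \<bullet> y = 0" using x False dom_closed(3) by (auto simp: V_def)
    then have "e < norm (T ?u)" using H by force
    then show ?thesis using False by (simp add: T_scale x(1) field_simps)
  qed simp
  have fk: "fin_dim (ker A)"
  proof -
    obtain B where B: "B \<subseteq> ker A" "independent B" "ker A \<subseteq> span B" by (rule basis_exists[of "ker A"])
    have "finite B"
    proof (rule ccontr)
      assume "infinite B"
      then obtain B' where B': "finite B'" "card B' = Suc (card S)" "B' \<subseteq> B" using infinite_arbitrarily_large by blast
      have "independent B'" using B(2) B'(3) independent_mono by blast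
      then obtain x where x: "x \<in> span B'" "x \<noteq> 0" "\<And>y. y \<in> span S \<Longrightarrow> x \<bullet> y = 0"
        using exists_orthogonal_vector[OF B'(1) _ S] B'(2) by auto
      have "B' \<subseteq> ker A" using B'(3) B(1) by blast
      then have "span B' \<subseteq> ker A" using ker_subspace by (rule span_minimal)
      then have "x \<in> ker A" using x(1) by blast
      moreover have "x \<in> V" using x(3) span_base[of _ S] by (simp add: V_def)
      ultimately show False using low[of x] e x(2) by (simp add: ker_def mult_le_0_iff)
    qed
    then show ?thesis unfolding fin_dim_def using B(3) by blast
  qed
  have "{y. \<forall>z\<in>ran A. z \<bullet> y = 0} \<subseteq> ker A"
  proof
    fix y assume "y \<in> {y. \<forall>z\<in>ran A. z \<bullet> y = 0}"
    then have "T x \<bullet> y = x \<bullet> 0" if "x \<in> dm" for x using that by (simp add: ran_def)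
    then show "y \<in> ker A" using adjointI[of y 0] by (simp add: ker_def)
  qed
  then have fc: "fin_dim {y. \<forall>z\<in>ran A. z \<bullet> y = 0}" using fk unfolding fin_dim_def by (meson subset_trans)
  let ?R = "(\<lambda>x. T x + 0) ` (dm \<inter> V)"
  have R: "subspace ?R" "closed ?R"
    using perturbed_range_subspace[OF bounded_linear_zero V] perturbed_range_closed[OF bounded_linear_zero e V Vc low] by auto
  obtain G where G: "finite G" "G \<subseteq> dm" "\<And>x. x \<in> dm \<Longrightarrow> \<exists>g\<in>span G. \<forall>y\<in>S. (x - g) \<bullet> y = 0"
    using finite_codim_complement[OF dom_subspace S] by blast
  have Gd: "span G \<subseteq> dm" using G(2) dom_subspace by (rule span_minimal)
  have TG: "T g \<in> span (T ` G)" if "g \<in> span G" for g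
  proof -
    have "subspace {g \<in> dm. T g \<in> span (T ` G)}"
      by (rule subspaceI) (auto simp: dom_closed T_zero T_add T_scale span_add span_scale span_zero)
    moreover have "G \<subseteq> {g \<in> dm. T g \<in> span (T ` G)}" using G(2) by (auto intro: span_base)
    ultimately have "g \<in> {g \<in> dm. T g \<in> span (T ` G)}" using that span_minimal by blast
    then show ?thesis by simp
  qed
  have "ran A = span (T ` G \<union> ?R)"
  proof
    show "ran A \<subseteq> span (T ` G \<union> ?R)"
    proof
      fix z assume "z \<in> ran A"
      then obtain x where x: "x \<in> dm" "z = T x" by (auto simp: ran_def)
      obtain g where g: "g \<in> span G" "\<forall>y\<in>S. (x - g) \<bullet> y = 0" using G(3)[OF x(1)] by blast
      have gd: "g \<in> dm" using g(1) Gd by blast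
      have "T (x - g) + 0 \<in> ?R" using g(2) dom_closed(2)[OF x(1) gd] by (intro imageI) (simp add: V_def)
      then have "T (x - g) \<in> span (T ` G \<union> ?R)" by (intro span_base) simp
      moreover have "T g \<in> span (T ` G \<union> ?R)" using TG[OF g(1)] span_mono[of "T ` G" "T ` G \<union> ?R"] by blast
      ultimately have "T (x - g) + T g \<in> span (T ` G \<union> ?R)" by (rule span_add)
      then show "z \<in> span (T ` G \<union> ?R)" using x gd by (simp add: T_diff)
    qed
    have "subspace (ran A)" using perturbed_range_subspace[OF bounded_linear_zero subspace_UNIV] by (simp add: ran_def)
    moreover have "T ` G \<union> ?R \<subseteq> ran A" using G(2) by (auto simp: ran_def)
    ultimately show "span (T ` G \<union> ?R) \<subseteq> ran A" by (intro span_minimal)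
  qed
  moreover have "closed (span (T ` G \<union> ?R))" by (rule closed_finite_extension[OF R finite_imageI[OF G(1)]])
  ultimately have "closed (ran A)" by simp
  then show False using nf fk fc by (simp add: fredholm_def)
qed

text \<open>Each new vector is a unit vector orthogonal to the previous span, so components are
  bounded by the norm of the sum, and the error grows by at most \<open>d\<close> per
  vector.\<close>

lemma approximate_kernel:
  assumes nf: "\<not> fredholm A" and d: "d > 0"
  shows "\<exists>B. finite B \<and> independent B \<and> card B = k \<and> B \<subseteq> dm \<and> (\<forall>x\<in>span B. norm (T x) \<le> real k * d * norm x)"
proof (induction k)
  case 0
  show ?case by (intro exI[of _ "{}"]) (auto simp: independent_empty T_zero)
next
  case (Suc k)
  then obtain B where B: "finite B" "independent B" "card B = k" "B \<subseteq> dm" "\<And>x. x \<in> span B \<Longrightarrow> norm (T x) \<le> real k * d * norm x" by blast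
  obtain x where x: "x \<in> dm" "norm x = 1" "\<forall>y\<in>B. x \<bullet> y = 0" "norm (T x) \<le> d"
    using approximate_kernel_vector[OF nf B(1) d] by blast
  have xs: "x \<bullet> y = 0" if "y \<in> span B" for y using orthogonal_to_span[of y B x] that x(3) by (auto simp: orthogonal_def)
  have xB: "x \<notin> span B" using xs[of x] x(2) by force
  have Bd: "span B \<subseteq> dm" using B(4) dom_subspace by (rule span_minimal)
  have "norm (T y) \<le> real (Suc k) * d * norm y" if y: "y \<in> span (insert x B)" for y
  proof -
    obtain c where c: "y - c *\<^sub>R x \<in> span B" using y unfolding span_breakdown_eq by blast
    define u where "u = y - c *\<^sub>R x"
    have u: "u \<in> span B" "u \<in> dm" "y = u + c *\<^sub>R x" using c Bd by (auto simp: u_def)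
    have n: "(norm y)\<^sup>2 = (norm u)\<^sup>2 + c\<^sup>2"
    proof -
      have "x \<bullet> x = 1" using x(2) by (simp add: norm_eq_1)
      then show ?thesis unfolding u(3) power2_norm_eq_inner using xs[OF u(1)]
        by (simp add: inner_add_left inner_add_right inner_commute[of u x] power2_eq_square)
    qed
    have "norm u \<le> norm y" "\<bar>c\<bar> \<le> norm y"
      using n power2_le_imp_le[of "norm u" "norm y"] power2_le_imp_le[of "\<bar>c\<bar>" "norm y"] by simp_all
    have "T y = T u + c *\<^sub>R T x" unfolding u(3) using u(2) x(1) dom_closed(3)[OF x(1)] by (simp add: T_add T_scale)
    then have "norm (T y) \<le> norm (T u) + \<bar>c\<bar> * norm (T x)" using norm_triangle_ineq[of "T u" "c *\<^sub>R T x"] by simp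
    also have "\<dots> \<le> real k * d * norm y + norm y * d"
    proof (rule add_mono)
      show "norm (T u) \<le> real k * d * norm y"
        using B(5)[OF u(1)] mult_left_mono[OF \<open>norm u \<le> norm y\<close>, of "real k * d"] d by simp
      show "\<bar>c\<bar> * norm (T x) \<le> norm y * d" using \<open>\<bar>c\<bar> \<le> norm y\<close> x(4) by (intro mult_mono) auto
    qed
    finally show ?thesis by (simp add: algebra_simps)
  qed
  moreover have "independent (insert x B)" using xB B(2) by (simp add: independent_insert)
  moreover have "card (insert x B) = Suc k" using B(1,3) xB span_base[of x B] by (subst card_insert_disjoint) auto
  ultimately show ?case using B(1,4) x(1) by (intro exI[of _ "insert x B"]) auto
qed

end

section \<open>Consequences of the derivative condition\<close>

text \<open>At the last point before \<open>b\<close> with f <= v the value is v, and f decreases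
  just to the right of it, a contradiction. The monotonicity hypothesis concerns the level v only,
  which suits (VM): it gives information only where the form is small.\<close>

lemma stays_below:
  fixes f :: "real \<Rightarrow> real"
  assumes ab: "a \<le> b" and cont: "continuous_on {a..b} f" and start: "f a \<le> v"
    and dec: "\<And>s. a \<le> s \<Longrightarrow> s < b \<Longrightarrow> f s = v \<Longrightarrow> \<exists>d>0. \<forall>h>0. h < d \<longrightarrow> s + h \<le> b \<longrightarrow> f (s + h) < f s"
  shows "f b \<le> v"
proof (rule ccontr)
  assume n: "\<not> f b \<le> v"
  define S where "S = {x \<in> {a..b}. f x \<le> v}"
  have "S = {a..b} \<inter> f -` {..v}" by (auto simp: S_def)
  then have "closed S" using continuous_closed_preimage[OF cont closed_atLeastAtMost closed_atMost, of v] by simp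
  moreover have aS: "a \<in> S" using ab start by (simp add: S_def)
  moreover have bdd: "bdd_above S" by (auto simp: S_def intro: bdd_aboveI[of _ b])
  ultimately have sS: "Sup S \<in> S" by (intro closed_contains_Sup) auto
  define s where "s = Sup S"
  have s: "a \<le> s" "s \<le> b" "f s \<le> v" using sS by (auto simp: S_def s_def)
  have sb: "s < b" using s n by (metis order_le_less)
  have up: "v < f x" if "s < x" "x \<le> b" for x
  proof (rule ccontr)
    assume "\<not> v < f x"
    then have "x \<in> S" using that s by (simp add: S_def)
    then have "x \<le> s" unfolding s_def using bdd by (rule cSup_upper)
    then show False using that by simp
  qed
  have "continuous_on {s..b} f" using cont s by (auto intro: continuous_on_subset)
  then obtain x where x: "s \<le> x" "x \<le> b" "f x = v" using IVT'[of f s v b] s n by auto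
  then have fs: "f s = v" using up[of x] by (metis less_irrefl order_le_less)
  obtain d where d: "d > 0" "\<forall>h>0. h < d \<longrightarrow> s + h \<le> b \<longrightarrow> f (s + h) < f s" using dec[OF s(1) sb fs] by blast
  define h where "h = min (d / 2) (b - s)"
  have "h > 0" "h < d" "s + h \<le> b" using d(1) sb by (auto simp: h_def)
  then show False using d(2) up[of "s + h"] fs by force
qed

context fam
begin

lemma VM_unit:
  assumes VM: "cond_VM \<Delta> T D" and ab: "a \<in> \<Delta>" "b \<in> \<Delta>" "a \<le> b"
  obtains \<epsilon> \<delta> where "\<epsilon> > 0" "\<delta> > 0"
    "\<And>x l. x \<in> D \<Longrightarrow> norm x = 1 \<Longrightarrow> l \<in> {a..b} \<Longrightarrow> \<bar>t l x x\<bar> \<le> \<epsilon> \<Longrightarrow>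
       \<exists>d\<le>- \<delta>. ((\<lambda>\<nu>. t \<nu> x x) has_real_derivative d) (at l within \<Delta>)"
proof -
  have sub: "{a..b} \<subseteq> \<Delta>" by (rule interval_sub[OF ab(1,2)])
  obtain \<epsilon> \<delta> where ed: "\<epsilon> > 0" "\<delta> > 0" "\<forall>x\<in>D. \<forall>l\<in>{a..b}. \<forall>d. norm x = 1 \<and> \<bar>form_val (T l) x\<bar> \<le> \<epsilon> \<and>
            ((\<lambda>\<mu>. form_val (T \<mu>) x) has_real_derivative d) (at l within \<Delta>) \<longrightarrow> d \<le> - \<delta>"
    using VM ab(3) sub unfolding cond_VM_def by meson
  have "\<exists>d\<le>- \<delta>. ((\<lambda>\<nu>. t \<nu> x x) has_real_derivative d) (at l within \<Delta>)"
    if x: "x \<in> D" "norm x = 1" "l \<in> {a..b}" "\<bar>t l x x\<bar> \<le> \<epsilon>" for x l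
  proof -
    have l: "l \<in> \<Delta>" using x(3) sub by blast
    have "(\<lambda>\<mu>. form_val (T \<mu>) x) differentiable (at l within \<Delta>)" using VM x(1) l unfolding cond_VM_def by blast
    then obtain d where d: "((\<lambda>\<mu>. form_val (T \<mu>) x) has_real_derivative d) (at l within \<Delta>)"
      unfolding real_differentiable_def by blast
    have "d \<le> - \<delta>" using ed(3) x d t_val[OF l x(1)] by auto
    moreover have "((\<lambda>\<nu>. t \<nu> x x) has_real_derivative d) (at l within \<Delta>)"
      by (rule has_field_derivative_transform_within[OF d zero_less_one l]) (simp add: t_val x(1))
    ultimately show ?thesis by blast
  qed
  then show thesis using that ed by blast
qed

lemma t_unit: "\<nu> \<in> \<Delta> \<Longrightarrow> x \<in> D \<Longrightarrow> x \<noteq> 0 \<Longrightarrow> t \<nu> x x = (norm x)\<^sup>2 * t \<nu> ((1 / norm x) *\<^sub>R x) ((1 / norm x) *\<^sub>R x)"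
  using bform.sq_scale[OF bf, of \<nu> x "1 / norm x"] by (simp add: power_divide)

lemma unit_D: "\<nu> \<in> \<Delta> \<Longrightarrow> x \<in> D \<Longrightarrow> (1 / norm x) *\<^sub>R x \<in> D"
  using bform.mem(3)[OF bf] by blast

lemma VM_stays_below:
  assumes ed: "\<epsilon> > 0" "\<delta> > 0"
    "\<And>x l. x \<in> D \<Longrightarrow> norm x = 1 \<Longrightarrow> l \<in> {a..b} \<Longrightarrow> \<bar>t l x x\<bar> \<le> \<epsilon> \<Longrightarrow>
       \<exists>d\<le>- \<delta>. ((\<lambda>\<nu>. t \<nu> x x) has_real_derivative d) (at l within \<Delta>)"
    and ab: "a \<in> \<Delta>" "b \<in> \<Delta>" "a \<le> b" and x: "x \<in> D" "norm x = 1" and v: "\<bar>v\<bar> \<le> \<epsilon>" "t a x x \<le> v"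
  shows "t b x x \<le> v"
proof (rule stays_below[OF ab(3), where f = "\<lambda>\<nu>. t \<nu> x x"])
  show "continuous_on {a..b} (\<lambda>\<nu>. t \<nu> x x)"
    using t_cont[OF x(1)] interval_sub[OF ab(1,2)] continuous_on_subset by blast
  show "t a x x \<le> v" by (rule v(2))
  fix s assume s: "a \<le> s" "s < b" "t s x x = v"
  then obtain d where d: "d \<le> - \<delta>" "((\<lambda>\<nu>. t \<nu> x x) has_real_derivative d) (at s within \<Delta>)"
    using ed(3)[OF x, of s] v(1) by auto
  obtain e where e: "e > 0" "\<forall>h>0. s + h \<in> \<Delta> \<longrightarrow> h < e \<longrightarrow> t (s + h) x x < t s x x"
    using has_real_derivative_neg_dec_right[OF d(2)] d(1) ed(2) by auto
  have "s + h \<in> \<Delta>" if "h > 0" "s + h \<le> b" for h using interval_sub[OF ab(1,2)] that s by auto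
  then show "\<exists>d>0. \<forall>h>0. h < d \<longrightarrow> s + h \<le> b \<longrightarrow> t (s + h) x x < t s x x" using e by blast
qed

text \<open>With m = min c \<epsilon> the level -m lies in the band where the derivative is
  negative, so a unit vector starting below this level stays below.\<close>

lemma VM_negative:
  assumes VM: "cond_VM \<Delta> T D" and ab: "a \<in> \<Delta>" "b \<in> \<Delta>" "a \<le> b" and c: "c > 0"
  shows "\<exists>m>0. \<forall>x\<in>D. t a x x \<le> - c * (norm x)\<^sup>2 \<longrightarrow> t b x x \<le> - m * (norm x)\<^sup>2"
proof -
  obtain \<epsilon> \<delta> where ed: "\<epsilon> > 0" "\<delta> > 0"
    "\<And>x l. x \<in> D \<Longrightarrow> norm x = 1 \<Longrightarrow> l \<in> {a..b} \<Longrightarrow> \<bar>t l x x\<bar> \<le> \<epsilon> \<Longrightarrow>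
       \<exists>d\<le>- \<delta>. ((\<lambda>\<nu>. t \<nu> x x) has_real_derivative d) (at l within \<Delta>)"
    using VM_unit[OF VM ab] by blast
  define m where "m = min c \<epsilon>"
  have "t b x x \<le> - m * (norm x)\<^sup>2" if x: "x \<in> D" "t a x x \<le> - c * (norm x)\<^sup>2" for x
  proof (cases "x = 0")
    case True then show ?thesis using t_zero[OF ab(2)] by simp
  next
    case False
    let ?u = "(1 / norm x) *\<^sub>R x"
    have n2: "(norm x)\<^sup>2 > 0" using False by simp
    have u: "?u \<in> D" "norm ?u = 1" using unit_D[OF ab(1) x(1)] False by auto
    have "(norm x)\<^sup>2 * t a ?u ?u \<le> (norm x)\<^sup>2 * (- c)" using x(2) t_unit[OF ab(1) x(1) False] by (simp add: mult.commute)
    then have "t a ?u ?u \<le> - c" using n2 by (simp only: mult_le_cancel_left_pos)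
    then have "t a ?u ?u \<le> - m" by (simp add: m_def)
    then have "t b ?u ?u \<le> - m"
      using ed(1) c by (intro VM_stays_below[OF ed ab u]) (auto simp: m_def)
    then have "(norm x)\<^sup>2 * t b ?u ?u \<le> (norm x)\<^sup>2 * (- m)" using n2 by (intro mult_left_mono) auto
    then show ?thesis using t_unit[OF ab(2) x(1) False] by (simp add: mult.commute)
  qed
  then show ?thesis using c ed(1) by (intro exI[of _ m]) (auto simp: m_def)
qed

text \<open>If a unit vector were still positive at \<open>b\<close>, its form values on [a, b]
  would lie between 0 and m <= \<epsilon>, so the derivative would be at most -\<delta> in between
  and the total drop at least \<delta> (b - a) >= m.\<close>

lemma VM_crossing:
  assumes VM: "cond_VM \<Delta> T D" and ab: "a \<in> \<Delta>" "b \<in> \<Delta>" "a < b"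
  shows "\<exists>m>0. \<forall>x\<in>D. t a x x \<le> m * (norm x)\<^sup>2 \<longrightarrow> t b x x \<le> 0"
proof -
  have ab': "a \<le> b" using ab by simp
  obtain \<epsilon> \<delta> where ed: "\<epsilon> > 0" "\<delta> > 0"
    "\<And>x l. x \<in> D \<Longrightarrow> norm x = 1 \<Longrightarrow> l \<in> {a..b} \<Longrightarrow> \<bar>t l x x\<bar> \<le> \<epsilon> \<Longrightarrow>
       \<exists>d\<le>- \<delta>. ((\<lambda>\<nu>. t \<nu> x x) has_real_derivative d) (at l within \<Delta>)"
    using VM_unit[OF VM ab(1,2) ab'] by blast
  have sub: "{a..b} \<subseteq> \<Delta>" by (rule interval_sub[OF ab(1,2)])
  define m where "m = min \<epsilon> (\<delta> * (b - a))"
  have m: "m > 0" "m \<le> \<epsilon>" "m \<le> \<delta> * (b - a)" using ed ab(3) by (auto simp: m_def)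
  have unit: "t b x x \<le> 0" if x: "x \<in> D" "norm x = 1" "t a x x \<le> m" for x
  proof (rule ccontr)
    assume "\<not> t b x x \<le> 0"
    then have pos: "t b x x > 0" by simp
    have x0: "x \<noteq> 0" using x(2) by auto
    have small: "\<bar>t l x x\<bar> \<le> \<epsilon>" if l: "l \<in> {a..b}" for l
    proof -
      have lD: "l \<in> \<Delta>" using l sub by blast
      have "0 \<le> t l x x" using mono_pos_le[OF lD ab(2) _ x(1)] l pos by simp
      moreover have "t l x x \<le> m"
      proof (rule VM_stays_below[OF ed(1,2) _ ab(1) lD _ x(1,2) _ x(3)])
        show "\<exists>d\<le>- \<delta>. ((\<lambda>\<nu>. t \<nu> y y) has_real_derivative d) (at k within \<Delta>)"
          if "y \<in> D" "norm y = 1" "k \<in> {a..l}" "\<bar>t k y y\<bar> \<le> \<epsilon>" for y k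
          using ed(3)[OF that(1,2) _ that(4)] that(3) l by auto
      qed (use m l in auto)
      ultimately show ?thesis using m(2) by simp
    qed
    have "\<exists>f'. \<forall>l. a < l \<and> l < b \<longrightarrow> f' l \<le> - \<delta> \<and> ((\<lambda>\<nu>. t \<nu> x x) has_real_derivative f' l) (at l)"
    proof -
      have "\<exists>d. d \<le> - \<delta> \<and> ((\<lambda>\<nu>. t \<nu> x x) has_real_derivative d) (at l)" if l: "a < l" "l < b" for l
      proof -
        have li: "l \<in> {a..b}" using l by simp
        obtain d where d: "d \<le> - \<delta>" "((\<lambda>\<nu>. t \<nu> x x) has_real_derivative d) (at l within \<Delta>)"
          using ed(3)[OF x(1,2) li small[OF li]] by blast
        \<comment> \<open>Inner points lie in the interior of \<Delta>, where the derivative within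
          \<Delta> is the two-sided one of the mean value theorem.\<close>
        have "{a<..<b} \<subseteq> \<Delta>" using sub by (auto simp: subset_iff)
        moreover have "l \<in> {a<..<b}" using l by simp
        ultimately have "l \<in> interior \<Delta>" using interiorI[OF open_greaterThanLessThan] by blast
        then have "at l within \<Delta> = at l" by (rule at_within_interior)
        then show ?thesis using d by metis
      qed
      then show ?thesis by metis
    qed
    then obtain f' where f': "\<And>l. a < l \<Longrightarrow> l < b \<Longrightarrow> f' l \<le> - \<delta>"
      "\<And>l. a < l \<Longrightarrow> l < b \<Longrightarrow> ((\<lambda>\<nu>. t \<nu> x x) has_real_derivative f' l) (at l)" by blast
    have cont: "continuous_on {a..b} (\<lambda>\<nu>. t \<nu> x x)" using t_cont[OF x(1)] sub continuous_on_subset by blast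
    obtain \<xi> where \<xi>: "a < \<xi>" "\<xi> < b" "t b x x - t a x x = f' \<xi> * (b - a)"
      using mvt[OF ab(3) cont f'(2)[unfolded has_field_derivative_def]] by blast
    have "f' \<xi> * (b - a) \<le> - \<delta> * (b - a)" using f'(1)[OF \<xi>(1,2)] ab(3) by (intro mult_right_mono) auto
    then show False using \<xi>(3) pos x(3) m(3) by simp
  qed
  have "t b x x \<le> 0" if x: "x \<in> D" "t a x x \<le> m * (norm x)\<^sup>2" for x
  proof (cases "x = 0")
    case True then show ?thesis using t_zero[OF ab(2)] by simp
  next
    case False
    let ?u = "(1 / norm x) *\<^sub>R x"
    have n2: "(norm x)\<^sup>2 > 0" using False by simp
    have u: "?u \<in> D" "norm ?u = 1" using unit_D[OF ab(1) x(1)] False by auto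
    have "(norm x)\<^sup>2 * t a ?u ?u \<le> (norm x)\<^sup>2 * m" using x(2) t_unit[OF ab(1) x(1) False] by (simp add: mult.commute)
    then have "t a ?u ?u \<le> m" using n2 by (simp only: mult_le_cancel_left_pos)
    then have "t b ?u ?u \<le> 0" by (rule unit[OF u])
    then show ?thesis using t_unit[OF ab(2) x(1) False] n2 by (simp add: mult_nonneg_nonpos)
  qed
  then show ?thesis using m(1) by blast
qed

end

section \<open>The triple variational principle\<close>

lemma in_rho_fredholm:
  assumes "sa_op J A" "in_rho A"
  shows "ker A = {0}" "fredholm A"
proof -
  interpret sa_op J A by fact
  show k: "ker A = {0}"
  proof
    show "ker A \<subseteq> {0}" using assms(2) dom_closed(5) T_zero unfolding in_rho_def ker_def by blast
    show "{0} \<subseteq> ker A" using dom_closed(5) T_zero by (simp add: ker_def)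
  qed
  have ran: "ran A = UNIV"
  proof -
    have "y \<in> ran A" for y
    proof -
      obtain x where "x \<in> dm" "T x = y" using assms(2) unfolding in_rho_def by blast
      then show ?thesis by (auto simp: ran_def)
    qed
    then show ?thesis by blast
  qed
  have "y = 0" if "\<forall>z\<in>ran A. z \<bullet> y = 0" for y
    using that[unfolded ran, rule_format, of y] by simp
  then have "{y. \<forall>z\<in>ran A. z \<bullet> y = 0} = {0}" by auto
  moreover have "fin_dim {0::'a}" unfolding fin_dim_def by (intro exI[of _ "{}"]) simp
  ultimately show "fredholm A" unfolding fredholm_def k ran by simp
qed

context fam
begin

text \<open>A non-positive subspace of \<open>M\<close> of real dimension at least 2 n contains a
  nonzero vector orthogonal to any competing \<open>L\<close>, and \<open>p\<close> is at most
  \<open>l\<close> there.\<close>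

lemma triple_var_le:
  assumes p: "gen_rayleigh \<Delta> T D p" and n: "n \<ge> 1" and l: "l \<in> \<Delta>"
    and B: "\<And>M. M \<in> Mplus J (T \<gamma>) D \<Longrightarrow>
        \<exists>B. finite B \<and> independent B \<and> B \<subseteq> M \<and> 2 * n \<le> card B \<and> (\<forall>x\<in>span B. t l x x \<le> 0)"
  shows "triple_var J (T \<gamma>) D p n \<le> ereal l"
  unfolding triple_var_def
proof (intro SUP_least)
  fix M L assume M: "M \<in> Mplus J (T \<gamma>) D" and "L \<in> {L. csubspace J L \<and> L \<subseteq> M \<and> cdim L = enat (n - 1)}"
  then have L: "csubspace J L" "L \<subseteq> M" "cdim L = enat (n - 1)" by auto
  have Ms: "subspace M" "M \<subseteq> D" using M unfolding Mplus_def nonneg_sub_def csubspace_def by auto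
  have fL: "fin_dim L" "dim L div 2 = n - 1" using L(3) by (auto simp: cdim_def split: if_splits)
  obtain S where S: "finite S" "span S = L" "card S = dim L"
    using fin_dim_basis[OF fL(1)] L(1) unfolding csubspace_def by metis
  obtain B where B: "finite B" "independent B" "B \<subseteq> M" "2 * n \<le> card B" "\<forall>x\<in>span B. t l x x \<le> 0" using B[OF M] by blast
  \<comment> \<open>\<open>dim L div 2 = n - 1\<close> bounds the real dimension of \<open>L\<close>
    by 2 n - 1.\<close>
  have "card S < card B" using S(3) fL(2) B(4) n by linarith
  then obtain x where x: "x \<in> span B" "x \<noteq> 0" "\<And>y. y \<in> span S \<Longrightarrow> x \<bullet> y = 0"
    using exists_orthogonal_vector[OF B(1,2) S(1)] by blast
  have xM: "x \<in> M" using x(1) B(3) Ms(1) span_minimal by blast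
  have "p x \<le> ereal l" using rayleigh_le[OF p _ x(2) l] xM Ms(2) B(5) x(1) by blast
  then show "(INF x\<in>{x \<in> M. x \<noteq> 0 \<and> (\<forall>y\<in>L. x \<bullet> y = 0)}. p x) \<le> ereal l"
    using xM x S(2) by (intro INF_lower2[of x]) auto
qed

text \<open>\<open>L\<close> may be too small; it is enlarged inside \<open>M\<close> to complex
  dimension n - 1, which only shrinks the set over which the infimum is taken. \<open>B\<close>
  provides the room.\<close>

lemma triple_var_ge:
  assumes p: "gen_rayleigh \<Delta> T D p" and l: "l \<in> \<Delta>" and M: "M \<in> Mplus J (T \<gamma>) D"
    and L: "csubspace J L" "L \<subseteq> M" "fin_dim L" "dim L \<le> 2 * (n - 1)"
    and B: "finite B" "independent B" "B \<subseteq> M" "2 * (n - 1) \<le> card B"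
    and nn: "\<And>x. x \<in> M \<Longrightarrow> (\<And>y. y \<in> L \<Longrightarrow> x \<bullet> y = 0) \<Longrightarrow> 0 \<le> t l x x"
  shows "ereal l \<le> triple_var J (T \<gamma>) D p n"
proof -
  have Mc: "csubspace J M" "M \<subseteq> D" using M unfolding Mplus_def nonneg_sub_def by auto
  have "dim L = 2 * (dim L div 2)" by (rule csubspace_even_dim[OF J L(1,3)])
  then obtain L' where L': "csubspace J L'" "L \<subseteq> L'" "L' \<subseteq> M" "fin_dim L'" "dim L' = 2 * (n - 1)"
    using csubspace_extend[OF J Mc(1) B L(1,3,2), of "dim L div 2"] L(4) by auto
  have cd: "cdim L' = enat (n - 1)" using L'(4,5) by (simp add: cdim_def)
  have "ereal l \<le> (INF x\<in>{x \<in> M. x \<noteq> 0 \<and> (\<forall>y\<in>L'. x \<bullet> y = 0)}. p x)"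
  proof (rule INF_greatest)
    fix x assume "x \<in> {x \<in> M. x \<noteq> 0 \<and> (\<forall>y\<in>L'. x \<bullet> y = 0)}"
    then have x: "x \<in> M" "x \<noteq> 0" "\<And>y. y \<in> L \<Longrightarrow> x \<bullet> y = 0" using L'(2) by auto
    then show "ereal l \<le> p x" using rayleigh_ge[OF p _ x(2) l nn[OF x(1) x(3)]] Mc(2) by blast
  qed
  also have "\<dots> \<le> (SUP L\<in>{L. csubspace J L \<and> L \<subseteq> M \<and> cdim L = enat (n - 1)}.
          INF x\<in>{x\<in>M. x \<noteq> 0 \<and> (\<forall>y\<in>L. x \<bullet> y = 0)}. p x)"
    using L' cd by (intro SUP_upper) simp
  also have "\<dots> \<le> triple_var J (T \<gamma>) D p n"
    unfolding triple_var_def using M by (rule SUP_upper)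
  finally show ?thesis .
qed

text \<open>The dimension of \<open>L\<close> is bounded because each of its vectors is the image
  under \<open>Pm l\<close> of a component in the sum of eigenspaces. \<open>dims\<close> counts
  parameters strictly below \<open>l\<close>, matching the half-open range of the transport.\<close>

lemma lower_bound:
  assumes p: "gen_rayleigh \<Delta> T D p" and gl: "\<gamma> \<in> \<Delta>" "l \<in> \<Delta>" "\<gamma> \<le> l"
    and fred: "\<And>\<nu>. \<nu> \<in> {\<gamma>..l} \<Longrightarrow> fredholm (T \<nu>)"
    and dims: "\<And>C. finite C \<Longrightarrow> C \<subseteq> {\<gamma>..<l} \<Longrightarrow> (\<Sum>c\<in>C. dim (ker (T c))) \<le> 2 * (n - 1)"
    and B: "\<And>M. M \<in> Mplus J (T \<gamma>) D \<Longrightarrow> \<exists>B. finite B \<and> independent B \<and> B \<subseteq> M \<and> 2 * (n - 1) \<le> card B"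
  shows "ereal l \<le> triple_var J (T \<gamma>) D p n"
proof -
  obtain s where s: "\<And>\<nu>. \<nu> \<in> {\<gamma>..l} \<Longrightarrow> sb_op J (T \<nu>) s" using uniform_sb[OF gl] by blast
  have "\<forall>\<nu>\<in>{\<gamma>..l}. \<exists>Q. ssplit J (T \<nu>) s (fst Q) (fst (snd Q)) (fst (snd (snd Q))) (snd (snd (snd Q)))"
  proof
    fix \<nu> assume nu: "\<nu> \<in> {\<gamma>..l}"
    obtain P1 P2 P3 a where "ssplit J (T \<nu>) s P1 P2 P3 a" using sb_op.ex_ssplit[OF s[OF nu] fred[OF nu]] by blast
    then show "\<exists>Q. ssplit J (T \<nu>) s (fst Q) (fst (snd Q)) (fst (snd (snd Q))) (snd (snd (snd Q)))"
      by (intro exI[of _ "(P1, P2, P3, a)"]) simp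
  qed
  then obtain Q where Q: "\<And>\<nu>. \<nu> \<in> {\<gamma>..l} \<Longrightarrow>
      ssplit J (T \<nu>) s (fst (Q \<nu>)) (fst (snd (Q \<nu>))) (fst (snd (snd (Q \<nu>)))) (snd (snd (snd (Q \<nu>))))" by metis
  define Pm Pz Pp a where "Pm \<nu> = fst (Q \<nu>)" and "Pz \<nu> = fst (snd (Q \<nu>))" and "Pp \<nu> = fst (snd (snd (Q \<nu>)))"
    and "a \<nu> = snd (snd (snd (Q \<nu>)))" for \<nu>
  have split: "ssplit J (T \<nu>) s (Pm \<nu>) (Pz \<nu>) (Pp \<nu>) (a \<nu>)" if "\<nu> \<in> {\<gamma>..l}" for \<nu>
    unfolding Pm_def Pz_def Pp_def a_def by (rule Q[OF that])
  have fk: "fin_dim (ker (T \<nu>))" if "\<nu> \<in> {\<gamma>..l}" for \<nu> using fred[OF that] by (simp add: fredholm_def)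
  interpret S: fam_split J \<Delta> T D \<gamma> l s Pm Pz Pp a
    by (rule fam_split.intro[OF fam_axioms], rule fam_split_axioms.intro) (fact gl split fk)+
  have ll: "l \<in> {\<gamma>..l}" using gl by simp
  interpret N: ssplit J "T l" s "Pm l" "Pz l" "Pp l" "a l" by (rule split[OF ll])
  have ND: "N.D = D" by (rule form_dom[OF gl(2)])
  note Pml = sadj_lin[OF N.Pm_sadj]
  obtain C where C: "finite C" "C \<subseteq> {\<gamma>..<l}"
    and G0: "{u + v | u v. u \<in> {x \<in> D. Pm l x = 0} \<and> v \<in> ES C} \<in> Mplus J (T \<gamma>) D"
    using S.chain_result by blast
  define G where "G = {u + v | u v. u \<in> {x \<in> D. Pm l x = 0} \<and> v \<in> ES C}"
  have G: "G \<in> Mplus J (T \<gamma>) D" using G0 unfolding G_def .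
  then have Gc: "csubspace J G" "subspace G" "G \<subseteq> D" unfolding Mplus_def nonneg_sub_def csubspace_def by auto
  define L where "L = {x \<in> G. Pm l x = x}"
  have "\<forall>c\<in>C. \<exists>K. finite K \<and> span K = ker (T c) \<and> card K = dim (ker (T c))"
  proof
    fix c assume "c \<in> C"
    then have c: "c \<in> {\<gamma>..l}" using C(2) by auto
    then have cD: "c \<in> \<Delta>" using S.seg by blast
    show "\<exists>K. finite K \<and> span K = ker (T c) \<and> card K = dim (ker (T c))"
      using fin_dim_basis[OF fk[OF c] kerT(1)[OF cD]] by metis
  qed
  then obtain K where K: "\<And>c. c \<in> C \<Longrightarrow> finite (K c)" "\<And>c. c \<in> C \<Longrightarrow> span (K c) = ker (T c)"
    "\<And>c. c \<in> C \<Longrightarrow> card (K c) = dim (ker (T c))" by metis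
  define R where "R = (\<Union>c\<in>C. K c)"
  have R: "finite R" unfolding R_def using C(1) K(1) by blast
  have "card R \<le> (\<Sum>c\<in>C. card (K c))" unfolding R_def by (rule card_UN_le[OF C(1)])
  also have "\<dots> = (\<Sum>c\<in>C. dim (ker (T c)))" using K(3) by (intro sum.cong) auto
  also have "\<dots> \<le> 2 * (n - 1)" by (rule dims[OF C])
  finally have cR: "card R \<le> 2 * (n - 1)" .
  have KR: "ES C \<subseteq> span R" unfolding ES_def
  proof (rule span_minimal)
    show "(\<Union>c\<in>C. ker (T c)) \<subseteq> span R"
    proof
      fix x assume "x \<in> (\<Union>c\<in>C. ker (T c))"
      then obtain c where c: "c \<in> C" "x \<in> ker (T c)" by blast
      then have "x \<in> span (K c)" using K(2) by simp
      moreover have "K c \<subseteq> R" using c(1) by (auto simp: R_def)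
      ultimately show "x \<in> span R" using span_mono by blast
    qed
  qed (rule subspace_span)
  have lin: "linear (Pm l)" using sadjD(1)[OF N.Pm_sadj] bounded_linear.linear by blast
  have LR: "L \<subseteq> span (Pm l ` R)"
  proof
    fix x assume x: "x \<in> L"
    then obtain u v where uv: "x = u + v" "Pm l u = 0" "v \<in> ES C" "Pm l x = x" unfolding L_def G_def by blast
    then have "x = Pm l v" by (simp add: Pml)
    moreover have "v \<in> span R" using uv(3) KR by blast
    ultimately show "x \<in> span (Pm l ` R)" unfolding linear_span_image[OF lin] by blast
  qed
  have "csubspace J L" unfolding csubspace_def
  proof
    show "subspace L" unfolding L_def using Gc(2) unfolding subspace_def by (auto simp: Pml)
    show "\<forall>x\<in>L. J x \<in> L" unfolding L_def using Gc(1) by (auto simp: csubspace_def N.P_J)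
  qed
  moreover have "L \<subseteq> G" by (auto simp: L_def)
  moreover have "fin_dim L" unfolding fin_dim_def using LR R by blast
  moreover have "dim L \<le> 2 * (n - 1)"
    using dim_le_card[OF LR] card_image_le[OF R, of "Pm l"] R cR by force
  moreover obtain E where E: "finite E" "independent E" "E \<subseteq> G" "2 * (n - 1) \<le> card E" using B[OF G] by blast
  moreover have "0 \<le> t l x x" if x: "x \<in> G" "\<And>y. y \<in> L \<Longrightarrow> x \<bullet> y = 0" for x
  proof -
    have xD: "x \<in> D" using x(1) Gc(3) by blast
    \<comment> \<open>This component is in the non-negative part, hence in \<open>G\<close>; so
      \<open>Pm l x\<close> is in \<open>G\<close> as well and therefore in \<open>L\<close>, and
      orthogonality to \<open>L\<close> makes it vanish.\<close>
    have "x - Pm l x \<in> D" using N.F.mem(2)[of x "Pm l x"] N.PmD[of x] xD ND by simp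
    moreover have "Pm l (x - Pm l x) = 0" by (simp add: Pml N.P_idem)
    moreover have "0 \<in> ES C" unfolding ES_def by (rule span_zero)
    ultimately have "(x - Pm l x) + 0 \<in> G" unfolding G_def by blast
    then have "x - (x - Pm l x) \<in> G" using x(1) Gc(2) subspace_diff by force
    then have "Pm l x \<in> L" by (simp add: L_def N.P_idem)
    then have "x \<bullet> Pm l x = 0" by (rule x(2))
    then have "Pm l x \<bullet> Pm l x = 0" using N.P_inner(1)[of x x] by (simp add: inner_commute)
    then show ?thesis using N.t_nonneg[of x] xD ND by simp
  qed
  ultimately show ?thesis by (rule triple_var_ge[OF p gl(2) G])
qed

section \<open>Non-positive subspaces of prescribed dimension inside maximal non-negative
  ones\<close>

lemma negative_extension_in_Mplus:
  assumes g: "\<gamma> \<in> \<Delta>" "in_rho (T \<gamma>)" and M: "M \<in> Mplus J (T \<gamma>) D"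
    and split: "ssplit J (T \<gamma>) s Pm Pz Pp a"
    and B: "finite B" "independent B" "B \<subseteq> D"
    and np: "\<And>h e. Pm h = h \<Longrightarrow> e \<in> span B \<Longrightarrow> t l (h + e) (h + e) \<le> 0"
    and tr: "\<And>e. e \<in> span B \<Longrightarrow> Pm e = e \<Longrightarrow> e = 0"
  shows "\<exists>B'. finite B' \<and> independent B' \<and> B' \<subseteq> M \<and> card B' = card B \<and> (\<forall>x\<in>span B'. t l x x \<le> 0)"
proof -
  interpret N: ssplit J "T \<gamma>" s Pm Pz Pp a by (rule split)
  have k: "x = 0" if "x \<in> ker (T \<gamma>)" for x using in_rho_fredholm(1)[OF sa_op[OF g(1)] g(2)] that by simp
  show ?thesis
    by (rule N.Mplus_transfer[where P = "\<lambda>x. t l x x \<le> 0", OF k]) (use M B np tr form_dom[OF g(1)] in auto)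
qed

lemma ex_split:
  assumes g: "\<gamma> \<in> \<Delta>" "in_rho (T \<gamma>)"
  obtains s Pm Pz Pp a where "ssplit J (T \<gamma>) s Pm Pz Pp a"
proof -
  obtain s where s: "sb_op J (T \<gamma>) s" using ex_sb[OF g(1)] by blast
  show thesis using sb_op.ex_ssplit[OF s in_rho_fredholm(2)[OF sa_op[OF g(1)] g(2)]] that by blast
qed

text \<open>The sum of the eigenspaces is positive at \<gamma>, so it meets the negative part there
  only in 0 and moves into \<open>M\<close> without loss of dimension.\<close>

lemma eigen_upper:
  assumes g: "\<gamma> \<in> \<Delta>" "in_rho (T \<gamma>)" and M: "M \<in> Mplus J (T \<gamma>) D"
    and C: "finite C" "C \<subseteq> \<Delta>" "\<And>c. c \<in> C \<Longrightarrow> \<gamma> < c" "\<And>c. c \<in> C \<Longrightarrow> fin_dim (ker (T c))"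
    and l: "l \<in> \<Delta>" "\<gamma> \<le> l" "\<And>c. c \<in> C \<Longrightarrow> c \<le> l"
  shows "\<exists>B. finite B \<and> independent B \<and> B \<subseteq> M \<and> card B = (\<Sum>c\<in>C. dim (ker (T c))) \<and> (\<forall>x\<in>span B. t l x x \<le> 0)"
proof -
  obtain s Pm Pz Pp a where split: "ssplit J (T \<gamma>) s Pm Pz Pp a" by (rule ex_split[OF g])
  interpret N: ssplit J "T \<gamma>" s Pm Pz Pp a by (rule split)
  obtain B where B: "finite B" "independent B" "span B = ES C" "card B = (\<Sum>c\<in>C. dim (ker (T c)))"
    using ES_basis[OF g(1) C] by blast
  have BD: "B \<subseteq> D" using ES_D[OF C(2) g(1)] B(3) span_superset[of B] by blast
  have neg: "h \<in> D \<and> t \<gamma> h h \<le> 0" if "Pm h = h" for h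
    using N.PmD[of h] N.t_neg_nn[of h] that form_dom[OF g(1)] by simp
  have "\<exists>B'. finite B' \<and> independent B' \<and> B' \<subseteq> M \<and> card B' = card B \<and> (\<forall>x\<in>span B'. t l x x \<le> 0)"
  proof (rule negative_extension_in_Mplus[OF g M split B(1,2) BD])
    show "t l (h + e) (h + e) \<le> 0" if "Pm h = h" "e \<in> span B" for h e
      using neg[OF that(1)] that(2) B(3) C(3) l by (intro ES_nonpos[OF g(1) _ _ C(1,2)]) (auto intro: less_imp_le)
    show "e = 0" if "e \<in> span B" "Pm e = e" for e
    proof (rule ccontr)
      assume "e \<noteq> 0"
      then have "0 < t \<gamma> e e" using that(1) B(3) by (intro ES_pos[OF g(1) C(1-3)]) auto
      then show False using neg[OF that(2)] by simp
    qed
  qed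
  then show ?thesis using B(4) by simp
qed

text \<open>\<open>VM_negative\<close> carries the gap of the negative part from \<gamma> to \<mu>,
  where approximate null vectors disturb it little; \<open>VM_crossing\<close> turns the remaining
  small positive values at \<mu> into non-positive ones at \<open>l\<close>. This is why
  \<open>l\<close> lies strictly beyond \<mu>.\<close>

lemma essential_upper:
  assumes VM: "cond_VM \<Delta> T D" and g: "\<gamma> \<in> \<Delta>" "in_rho (T \<gamma>)" and M: "M \<in> Mplus J (T \<gamma>) D"
    and mu: "\<mu> \<in> \<Delta>" "\<not> fredholm (T \<mu>)" "\<gamma> \<le> \<mu>" and l: "l \<in> \<Delta>" "\<mu> < l"
  shows "\<exists>B. finite B \<and> independent B \<and> B \<subseteq> M \<and> card B = k \<and> (\<forall>x\<in>span B. t l x x \<le> 0)"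
proof -
  obtain s Pm Pz Pp a where split: "ssplit J (T \<gamma>) s Pm Pz Pp a" by (rule ex_split[OF g])
  interpret N: ssplit J "T \<gamma>" s Pm Pz Pp a by (rule split)
  obtain s' where "sb_op J (T \<mu>) s'" using ex_sb[OF mu(1)] by blast
  then interpret U: sb_op J "T \<mu>" s' .
  have UD: "U.D = D" by (rule form_dom[OF mu(1)])
  obtain m where m: "m > 0" "\<And>x. x \<in> D \<Longrightarrow> t \<gamma> x x \<le> - a * (norm x)\<^sup>2 \<Longrightarrow> t \<mu> x x \<le> - m * (norm x)\<^sup>2"
    using VM_negative[OF VM g(1) mu(1,3) N.a_pos] by blast
  obtain r where r: "r > 0" "\<And>x. x \<in> D \<Longrightarrow> t \<mu> x x \<le> r * (norm x)\<^sup>2 \<Longrightarrow> t l x x \<le> 0"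
    using VM_crossing[OF VM mu(1) l] by blast
  \<comment> \<open>The estimate below uses 2 norm(x) norm(h) <= norm(x)^2 + norm(h)^2 and norm(x)^2
    <= 2 norm(h + x)^2 + 2 norm(h)^2. It collects 5 e0 in front of norm(h)^2, absorbed by
    \<open>m\<close>, and 4 e0 in front of norm(h + x)^2, absorbed by \<open>r\<close>.\<close>
  define e0 where "e0 = min (m / 5) (r / 4)"
  have e0: "e0 > 0" "5 * e0 \<le> m" "4 * e0 \<le> r" using m(1) r(1) by (auto simp: e0_def)
  \<comment> \<open>The error on a span of dimension k is at most k d, here at most
    \<open>e0\<close>; the + 1 covers k = 0.\<close>
  define d where "d = e0 / (real k + 1)"
  have d: "d > 0" "real k * d \<le> e0" using e0(1) by (auto simp: d_def field_simps)
  obtain B where B: "finite B" "independent B" "card B = k" "B \<subseteq> fst (T \<mu>)"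
    "\<And>x. x \<in> span B \<Longrightarrow> norm (snd (T \<mu>) x) \<le> real k * d * norm x"
    using U.approximate_kernel[OF mu(2) d(1), of k] by blast
  have Bdm: "x \<in> fst (T \<mu>)" if "x \<in> span B" for x using B(4) U.dom_subspace span_minimal that by blast
  have BD: "B \<subseteq> D" using B(4) U.dom_D UD by auto
  have Tx: "norm (snd (T \<mu>) x) \<le> e0 * norm x" if "x \<in> span B" for x
    using B(5)[OF that] mult_right_mono[OF d(2), of "norm x"] by simp
  have neg: "h \<in> D \<and> t \<mu> h h \<le> - m * (norm h)\<^sup>2" if "Pm h = h" for h
    using N.PmD[of h] N.t_neg[of h] that form_dom[OF g(1)] m(2)[of h] by simp
  have Ti: "\<bar>snd (T \<mu>) x \<bullet> y\<bar> \<le> e0 * norm x * norm y" if "x \<in> span B" for x y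
  proof -
    have "\<bar>snd (T \<mu>) x \<bullet> y\<bar> \<le> norm (snd (T \<mu>) x) * norm y" by (rule Cauchy_Schwarz_ineq2)
    also have "\<dots> \<le> e0 * norm x * norm y" by (intro mult_right_mono Tx[OF that]) auto
    finally show ?thesis .
  qed
  have "\<exists>B'. finite B' \<and> independent B' \<and> B' \<subseteq> M \<and> card B' = card B \<and> (\<forall>x\<in>span B'. t l x x \<le> 0)"
  proof (rule negative_extension_in_Mplus[OF g M split B(1,2) BD])
    fix h x assume h: "Pm h = h" and x: "x \<in> span B"
    have hD: "h \<in> U.D" and xD: "x \<in> U.D" using neg[OF h] U.dom_D[OF Bdm[OF x]] UD by auto
    have "t \<mu> (h + x) (h + x) = t \<mu> h h + 2 * (snd (T \<mu>) x \<bullet> h) + snd (T \<mu>) x \<bullet> x"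
      using U.F.sq_add[OF hD xD] U.F.sym[OF hD xD] U.t_dom[OF Bdm[OF x] hD] U.t_dom[OF Bdm[OF x] xD] by simp
    also have "\<dots> \<le> - m * (norm h)\<^sup>2 + 2 * (e0 * norm x * norm h) + e0 * norm x * norm x"
      using neg[OF h] Ti[OF x, of h] Ti[OF x, of x] by linarith
    also have "\<dots> \<le> 4 * e0 * (norm (h + x))\<^sup>2"
    proof -
      have "norm x \<le> norm (h + x) + norm h" using norm_triangle_ineq4[of "h + x" h] by simp
      then have "(norm x)\<^sup>2 \<le> (norm (h + x) + norm h)\<^sup>2" by (intro power_mono) auto
      also have "\<dots> \<le> 2 * (norm (h + x))\<^sup>2 + 2 * (norm h)\<^sup>2"
        using sum_squares_bound[of "norm (h + x)" "norm h"] by (simp add: power2_sum)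
      finally have 1: "e0 * (norm x)\<^sup>2 \<le> e0 * (2 * (norm (h + x))\<^sup>2 + 2 * (norm h)\<^sup>2)" using e0(1) by simp
      have "2 * norm x * norm h \<le> (norm x)\<^sup>2 + (norm h)\<^sup>2" by (rule sum_squares_bound)
      then have 2: "e0 * (2 * norm x * norm h) \<le> e0 * ((norm x)\<^sup>2 + (norm h)\<^sup>2)" using e0(1) by simp
      have 3: "5 * e0 * (norm h)\<^sup>2 \<le> m * (norm h)\<^sup>2" using e0(2) by (intro mult_right_mono) auto
      show ?thesis using 1 2 3 by (simp add: algebra_simps power2_eq_square)
    qed
    also have "\<dots> \<le> r * (norm (h + x))\<^sup>2" using e0(3) by (intro mult_right_mono) auto
    finally show "t l (h + x) (h + x) \<le> 0" using r(2)[of "h + x"] U.F.mem(1)[OF hD xD] UD by simp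
  next
    fix x assume x: "x \<in> span B" and h: "Pm x = x"
    have xD: "x \<in> U.D" using U.dom_D[OF Bdm[OF x]] .
    have "- (e0 * norm x * norm x) \<le> - m * (norm x)\<^sup>2"
      using neg[OF h] Ti[OF x, of x] U.t_dom[OF Bdm[OF x] xD] by linarith
    then have "m * (norm x)\<^sup>2 \<le> e0 * (norm x)\<^sup>2" by (simp add: power2_eq_square mult.assoc)
    moreover have "e0 < m" using e0 by linarith
    ultimately show "x = 0" by (metis linorder_not_le mult_less_cancel_right_pos zero_less_norm_iff zero_less_power)
  qed
  then show ?thesis using B(3) by simp
qed

end

theorem theorem5p1:
  fixes J :: "'h::{real_inner,complete_space} \<Rightarrow> 'h"
    and \<Delta> :: "real set" and \<beta> :: ereal
    and T :: "real \<Rightarrow> 'h lop" and D :: "'h set"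
    and p :: "'h \<Rightarrow> ereal" and \<gamma> :: real
    and lamE :: ereal and N :: enat and lam :: "nat \<Rightarrow> real"
  assumes J: "cplx_struct J"
    and interval: "is_interval \<Delta>"
    and beta: "\<beta> = (SUP l\<in>\<Delta>. ereal l)"
    and A: "cond_A J \<Delta> T D"
    and nrc: "norm_resolvent_continuous_on J \<Delta> T"
    and bb: "\<forall>l\<in>\<Delta>. bounded_below (T l)"
    and p: "gen_rayleigh \<Delta> T D p"
    and gamma: "\<gamma> \<in> \<Delta>" "in_rho (T \<gamma>)" "ereal \<gamma> < \<beta>"
    and lame: "lamE = (if spec_ess \<Delta> T \<inter> {l. \<gamma> < l \<and> ereal l < \<beta>} \<noteq> {}
                     then (INF l\<in>spec_ess \<Delta> T \<inter> {l. \<gamma> < l \<and> ereal l < \<beta>}. ereal l)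
                     else \<beta>)"
    and noacc: "\<forall>\<mu>. \<gamma> \<le> \<mu> \<and> ereal \<mu> < lamE \<longrightarrow>
                  \<not> \<mu> islimpt (spec \<Delta> T \<inter> {l. \<gamma> \<le> l \<and> ereal l < lamE})"
    and seq_mono: "\<forall>m n. 1 \<le> m \<and> m \<le> n \<and> enat n \<le> N \<longrightarrow> lam m \<le> lam n"
    and seq_range: "{lam n | n. 1 \<le> n \<and> enat n \<le> N} = spec \<Delta> T \<inter> {l. \<gamma> \<le> l \<and> ereal l < lamE}"
    and seq_mult: "\<forall>\<mu>\<in>spec \<Delta> T \<inter> {l. \<gamma> \<le> l \<and> ereal l < lamE}.
                     finite {n. 1 \<le> n \<and> enat n \<le> N \<and> lam n = \<mu>} \<and>
                     enat (card {n. 1 \<le> n \<and> enat n \<le> N \<and> lam n = \<mu>}) = cdim (ker (T \<mu>))"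
    and nonempty: "spec \<Delta> T \<inter> {l. \<gamma> < l \<and> ereal l < lamE} \<noteq> {}"
  shows "(\<forall>n. 1 \<le> n \<and> enat n \<le> N \<longrightarrow> ereal (lam n) = triple_var J (T \<gamma>) D p n) \<and>
         (cond_VM \<Delta> T D \<and> N \<noteq> \<infinity> \<and> spec_ess \<Delta> T \<inter> {l. \<gamma> < l \<and> ereal l < \<beta>} \<noteq> {}
            \<longrightarrow> (\<forall>n. enat n > N \<longrightarrow> triple_var J (T \<gamma>) D p n = lamE))"
proof -
  interpret fam J \<Delta> T D by unfold_locales (fact J interval A nrc bb)+
  let ?E = "spec_ess \<Delta> T \<inter> {l. \<gamma> < l \<and> ereal l < \<beta>}"
  have lamE_le: "lamE \<le> \<beta>"
  proof (cases "?E = {}")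
    case False
    then obtain \<mu> where "\<mu> \<in> ?E" by blast
    then have "lamE \<le> ereal \<mu>" "ereal \<mu> < \<beta>" using lame False by (auto intro: INF_lower)
    then show ?thesis by simp
  qed (use lame in simp)
  have below_beta: "\<nu> \<in> \<Delta>" if nu: "\<gamma> \<le> \<nu>" "ereal \<nu> < \<beta>" for \<nu>
  proof -
    obtain l where "l \<in> \<Delta>" "ereal \<nu> < ereal l" using nu(2) unfolding beta less_SUP_iff by blast
    then show ?thesis using interval_sub[OF gamma(1), of l] nu(1) by (auto simp: subset_iff)
  qed
  have inD: "\<nu> \<in> \<Delta>" if "\<gamma> \<le> \<nu>" "ereal \<nu> < lamE" for \<nu>
    using below_beta[OF that(1)] that(2) lamE_le by auto
  have fred: "fredholm (T \<nu>)" if nu: "\<gamma> \<le> \<nu>" "ereal \<nu> < lamE" for \<nu>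
  proof (rule ccontr)
    assume nf: "\<not> fredholm (T \<nu>)"
    \<comment> \<open>\<open>lamE\<close> concerns parameters strictly above \<gamma>; at \<gamma>
      itself Fredholmness comes from the resolvent set.\<close>
    have "\<nu> \<noteq> \<gamma>" using in_rho_fredholm(2)[OF sa_op[OF gamma(1)] gamma(2)] nf by blast
    then have "\<nu> \<in> ?E" using nu inD[OF nu] nf lamE_le by (auto simp: spec_ess_def)
    then have "lamE \<le> ereal \<nu>" using lame by (auto intro: INF_lower)
    then show False using nu(2) by simp
  qed
  \<comment> \<open>The positions at which \<open>c\<close> is listed. Their number is the complex
    dimension of the kernel, so sums of real kernel dimensions become twice a count of
    indices.\<close>
  define idx where "idx c = {n. 1 \<le> n \<and> enat n \<le> N \<and> lam n = c}" for c
  have dimker: "finite (idx c) \<and> fin_dim (ker (T c)) \<and> dim (ker (T c)) = 2 * card (idx c)"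
    if c: "\<gamma> \<le> c" "ereal c < lamE" for c
  proof -
    have cD: "c \<in> \<Delta>" by (rule inD[OF c])
    have fk: "fin_dim (ker (T c))" using fred[OF c] by (simp add: fredholm_def)
    show ?thesis
    proof (cases "in_rho (T c)")
      case True
      have "dim (ker (T c)) = 0" using dim_le_card[of "ker (T c)" "{}"] in_rho_fredholm(1)[OF sa_op[OF cD] True] by simp
      moreover have "idx c = {}" using seq_range True unfolding idx_def spec_def by blast
      ultimately show ?thesis using fk by simp
    next
      case False
      then have "c \<in> spec \<Delta> T \<inter> {l. \<gamma> \<le> l \<and> ereal l < lamE}" using c cD by (simp add: spec_def)
      then have 1: "finite (idx c)" "enat (card (idx c)) = cdim (ker (T c))" using seq_mult unfolding idx_def by auto
      then have "dim (ker (T c)) div 2 = card (idx c)" using fk by (simp add: cdim_def)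
      then show ?thesis using 1(1) fk csubspace_even_dim[OF J kerT(4)[OF cD] fk] by simp
    qed
  qed
  have sumdim: "finite (\<Union>c\<in>C. idx c) \<and> (\<Sum>c\<in>C. dim (ker (T c))) = 2 * card (\<Union>c\<in>C. idx c)"
    if C: "finite C" "\<And>c. c \<in> C \<Longrightarrow> \<gamma> \<le> c \<and> ereal c < lamE" for C
  proof -
    have f: "finite (idx c)" if "c \<in> C" for c using dimker C(2)[OF that] by blast
    have "card (\<Union>c\<in>C. idx c) = (\<Sum>c\<in>C. card (idx c))"
      using C(1) f by (intro card_UN_disjoint) (auto simp: idx_def)
    moreover have "(\<Sum>c\<in>C. dim (ker (T c))) = (\<Sum>c\<in>C. 2 * card (idx c))"
      using dimker C(2) by (intro sum.cong) auto
    ultimately show ?thesis using f C(1) by (simp add: sum_distrib_left)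
  qed
  have lamD: "\<gamma> < lam n \<and> ereal (lam n) < lamE \<and> lam n \<in> \<Delta>" if n: "1 \<le> n" "enat n \<le> N" for n
  proof -
    have "lam n \<in> {lam n | n. 1 \<le> n \<and> enat n \<le> N}" using n by blast
    then have s: "lam n \<in> spec \<Delta> T" "\<gamma> \<le> lam n" "ereal (lam n) < lamE" unfolding seq_range by auto
    moreover have "lam n \<noteq> \<gamma>" using s(1) gamma(2) by (auto simp: spec_def)
    ultimately show ?thesis using inD by auto
  qed
  show ?thesis
  proof (intro conjI allI impI)
    fix n assume "1 \<le> n \<and> enat n \<le> N"
    then have n: "1 \<le> n" "enat n \<le> N" by auto
    note ln = lamD[OF n]
    have mN: "enat m \<le> N" if "m \<le> n" for m using that n(2) by (meson enat_ord_simps(1) order_trans)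
    \<comment> \<open>The distinct values among the first n. If \<open>lam n\<close> recurs after
      position n, the count of indices exceeds n, which is why only an inequality is kept.\<close>
    define C where "C = lam ` {1..n}"
    have C: "finite C" "\<And>c. c \<in> C \<Longrightarrow> \<gamma> < c \<and> ereal c < lamE \<and> c \<in> \<Delta> \<and> c \<le> lam n"
      unfolding C_def using lamD mN seq_mono n by auto
    have "{1..n} \<subseteq> (\<Union>c\<in>C. idx c)" unfolding C_def idx_def using mN by auto
    moreover have sd: "finite (\<Union>c\<in>C. idx c)" "(\<Sum>c\<in>C. dim (ker (T c))) = 2 * card (\<Union>c\<in>C. idx c)"
      using sumdim[OF C(1)] C(2) by (auto simp: less_imp_le)
    ultimately have "n \<le> card (\<Union>c\<in>C. idx c)" using card_mono[of "\<Union>c\<in>C. idx c" "{1..n}"] by simp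
    then have cn: "2 * n \<le> (\<Sum>c\<in>C. dim (ker (T c)))" using sd(2) by simp
    have up: "\<exists>B. finite B \<and> independent B \<and> B \<subseteq> M \<and> 2 * n \<le> card B \<and> (\<forall>x\<in>span B. t (lam n) x x \<le> 0)"
      if M: "M \<in> Mplus J (T \<gamma>) D" for M
    proof -
      have "\<exists>B. finite B \<and> independent B \<and> B \<subseteq> M \<and> card B = (\<Sum>c\<in>C. dim (ker (T c))) \<and> (\<forall>x\<in>span B. t (lam n) x x \<le> 0)"
        by (rule eigen_upper[OF gamma(1,2) M C(1)]) (use C(2) dimker ln in \<open>auto simp: less_imp_le\<close>)
      then show ?thesis using cn by metis
    qed
    have "triple_var J (T \<gamma>) D p n \<le> ereal (lam n)"
      by (rule triple_var_le[OF p n(1) _ up]) (use ln in auto)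
    moreover have "ereal (lam n) \<le> triple_var J (T \<gamma>) D p n"
    proof (rule lower_bound[OF p gamma(1)])
      show "lam n \<in> \<Delta>" "\<gamma> \<le> lam n" using ln by auto
      show "fredholm (T \<nu>)" if "\<nu> \<in> {\<gamma>..lam n}" for \<nu>
      proof (rule fred)
        show "\<gamma> \<le> \<nu>" using that by simp
        have "ereal \<nu> \<le> ereal (lam n)" using that by simp
        then show "ereal \<nu> < lamE" using ln by (meson le_less_trans)
      qed
      show "(\<Sum>c\<in>C. dim (ker (T c))) \<le> 2 * (n - 1)" if C: "finite C" "C \<subseteq> {\<gamma>..<lam n}" for C
      proof -
        have cl: "\<gamma> \<le> c \<and> ereal c < lamE" if "c \<in> C" for c
        proof -
          have "\<gamma> \<le> c" "ereal c < ereal (lam n)" using that C(2) by auto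
          then show ?thesis using ln by (meson less_trans)
        qed
        \<comment> \<open>Values strictly below \<open>lam n\<close> occur only at positions before
          n, however often \<open>lam n\<close> is repeated.\<close>
        have "(\<Union>c\<in>C. idx c) \<subseteq> {1..<n}"
        proof
          fix m assume "m \<in> (\<Union>c\<in>C. idx c)"
          then have m: "1 \<le> m" "enat m \<le> N" "lam m < lam n" using C(2) unfolding idx_def by auto
          then have "\<not> n \<le> m" using seq_mono n(1) by (metis linorder_not_le)
          then show "m \<in> {1..<n}" using m(1) by simp
        qed
        then have "card (\<Union>c\<in>C. idx c) \<le> card {1..<n}" by (intro card_mono) auto
        then show ?thesis using sumdim[OF C(1) cl] by simp
      qed
      \<comment> \<open>The subspaces found for the upper bound already show that every
        \<open>M\<close> is large enough.\<close>
      show "\<exists>B. finite B \<and> independent B \<and> B \<subseteq> M \<and> 2 * (n - 1) \<le> card B" if "M \<in> Mplus J (T \<gamma>) D" for M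
        using up[OF that] by (meson diff_le_self le_trans mult_le_mono2)
    qed
    ultimately show "ereal (lam n) = triple_var J (T \<gamma>) D p n" by (rule antisym[rotated])
  next
    fix n assume h: "cond_VM \<Delta> T D \<and> N \<noteq> \<infinity> \<and> ?E \<noteq> {}" and nN: "N < enat n"
    have n1: "n \<ge> 1" using nN by (cases n) (auto simp: zero_enat_def[symmetric])
    obtain k where k: "N = enat k" using h by (cases N) auto
    have kn: "k < n" using nN k by simp
    have up: "\<exists>B. finite B \<and> independent B \<and> B \<subseteq> M \<and> card B = 2 * n \<and> (\<forall>x\<in>span B. t l x x \<le> 0)"
      if "M \<in> Mplus J (T \<gamma>) D" "\<mu> \<in> ?E" "\<mu> < l" "l \<in> \<Delta>" for M \<mu> l
      using h that by (intro essential_upper[OF _ gamma(1,2) that(1), of \<mu>]) (auto simp: spec_ess_def)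
    \<comment> \<open>Points of \<open>?E\<close> lie strictly below \<beta>, so \<Delta> extends
      beyond them.\<close>
    have between: "\<exists>l\<in>\<Delta>. \<mu> < l \<and> ereal l < z" if mz: "\<mu> \<in> ?E" "ereal \<mu> < z" for \<mu> z
    proof -
      have "ereal \<mu> < min z \<beta>" using mz by auto
      then obtain l where l: "ereal \<mu> < ereal l" "ereal l < min z \<beta>" using ereal_dense2 by blast
      then have "l \<in> \<Delta>" using mz(1) by (intro below_beta) auto
      then show ?thesis using l by auto
    qed
    have "triple_var J (T \<gamma>) D p n \<le> ereal \<mu>" if mu: "\<mu> \<in> ?E" for \<mu>
    \<comment> \<open>Non-positive subspaces are available only at parameters beyond \<mu>, so the
      bound \<mu> is reached as a limit from the right.\<close>
    proof (rule dense_ge)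
      fix z assume "ereal \<mu> < z"
      then obtain l where l: "l \<in> \<Delta>" "\<mu> < l" "ereal l < z" using between[OF mu] by blast
      have "triple_var J (T \<gamma>) D p n \<le> ereal l"
        by (rule triple_var_le[OF p n1 l(1)]) (metis up[OF _ mu l(2,1)] order_refl)
      then show "triple_var J (T \<gamma>) D p n \<le> z" using l(3) by simp
    qed
    then have "triple_var J (T \<gamma>) D p n \<le> lamE" using h lame by (auto intro: INF_greatest)
    moreover have "lamE \<le> triple_var J (T \<gamma>) D p n"
    \<comment> \<open>The lower bound asks for Fredholm operators up to and including its parameter,
      so it is applied below \<open>lamE\<close> and passed to the limit.\<close>
    proof (rule dense_le)
      fix z assume z: "z < lamE"
      obtain \<mu>0 where "\<gamma> < \<mu>0" "ereal \<mu>0 < lamE" using nonempty by blast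
      then have "ereal \<gamma> < lamE" by (metis ereal_less(1) less_ereal.simps(1) less_trans)
      then have "max z (ereal \<gamma>) < lamE" using z by simp
      then obtain l where l: "max z (ereal \<gamma>) < ereal l" "ereal l < lamE" using ereal_dense2 by blast
      then have gl: "\<gamma> < l" "z < ereal l" by auto
      have "ereal l \<le> triple_var J (T \<gamma>) D p n"
      proof (rule lower_bound[OF p gamma(1)])
        show "l \<in> \<Delta>" "\<gamma> \<le> l" using inD[of l] gl l(2) by auto
        have below: "\<gamma> \<le> \<nu> \<and> ereal \<nu> < lamE" if "\<nu> \<in> {\<gamma>..l}" for \<nu>
        proof -
          have "ereal \<nu> \<le> ereal l" using that by simp
          then show ?thesis using l(2) that by (meson atLeastAtMost_iff le_less_trans)
        qed
        show "fredholm (T \<nu>)" if "\<nu> \<in> {\<gamma>..l}" for \<nu> using fred below[OF that] by blast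
        show "(\<Sum>c\<in>C. dim (ker (T c))) \<le> 2 * (n - 1)" if C: "finite C" "C \<subseteq> {\<gamma>..<l}" for C
        proof -
          have cl: "\<gamma> \<le> c \<and> ereal c < lamE" if "c \<in> C" for c using below[of c] that C(2) by auto
          have "(\<Union>c\<in>C. idx c) \<subseteq> {1..k}" unfolding idx_def k by auto
          then have "card (\<Union>c\<in>C. idx c) \<le> card {1..k}" by (intro card_mono) auto
          then show ?thesis using sumdim[OF C(1) cl] kn by simp
        qed
        \<comment> \<open>Room for enlarging the test space: only k eigenvalues are listed below
          \<open>lamE\<close>, but a point of the essential spectrum yields subspaces of the
          required dimension in every \<open>M\<close>.\<close>
        obtain \<mu> where mu: "\<mu> \<in> ?E" using h by blast
        then obtain l' where l': "l' \<in> \<Delta>" "\<mu> < l'" using between[of \<mu> \<beta>] by auto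
        show "\<exists>B. finite B \<and> independent B \<and> B \<subseteq> M \<and> 2 * (n - 1) \<le> card B" if "M \<in> Mplus J (T \<gamma>) D" for M
          using up[OF that mu l'(2,1)] by (metis diff_le_self mult_le_mono2)
      qed
      then show "z \<le> triple_var J (T \<gamma>) D p n" using gl(2) by simp
    qed
    ultimately show "triple_var J (T \<gamma>) D p n = lamE" by (rule antisym)
  qed
qed

end
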